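(* Let $r,d\in\mathbb{N}$, let $B\in\mathbb{R}^{d\times d}$ be a Frolov matrix, let $\psi:\mathbb{R}\to\mathbb{R}$ be an infinitely differentiable function such that $\psi|_{(-\infty,0)}=0$, $\psi|_{(1,\infty)}=1$ and $\psi|_{(0,1)}:(0,1)\to(0,1)$ is a diffeomorphism, and let $U$ and $V$ be independent random vectors uniformly distributed in $[1,2^{1/d}]^d$ and $[0,1]^d$, respectively. There is some $c>0$ (which may depend on $r$, $d$, $B$ and $\psi$) such that for every natural number $n\geq 2$ and every $f\in H^{r,\mathrm{mix}}([0,1]^d)$ \[ \left(\mathbb{E}\left|\widetilde{Q}_{n^{1/d}\hat{U}B}^V(f)-I_d(f)\right|^2\right)^{1/2} \leq c\, n^{-r-1/2}\, \Vert f\Vert_{H^{r,\mathrm{mix}}([0,1]^d)} \] and \[ \sup_{(u,v)\in[1,2^{1/d}]^d\times[0,1]^d}\left|\widetilde{Q}_{n^{1/d}\hat{u}B}^v(f)-I_d(f)\right| \leq c\, n^{-r}\, (\log n)^{\frac{d-1}{2}}\, \Vert f\Vert_{H^{r,\mathrm{mix}}([0,1]^d)}. \]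
   Context: Notation: $\mathbb{N}=\{1,2,\dots\}$; for $f:[0,1]^d\to\mathbb{R}$ integrable, $I_d(f)=\int_{[0,1]^d} f(x)\,dx$. For $u\in\mathbb{R}^d$, $\hat{u}=\mathrm{diag}(u_1,\dots,u_d)$. Put $\Psi:\mathbb{R}^d\to\mathbb{R}^d$, $\Psi(x)=(\psi(x_1),\dots,\psi(x_d))^\top$, and $|D\Psi(x)|=\det D\Psi(x)=\prod_{i=1}^d\psi'(x_i)$. For an invertible matrix $S\in\mathbb{R}^{d\times d}$, $v\in\mathbb{R}^d$ and $f:[0,1]^d\to\mathbb{R}$, the transformed quadrature rule is \[\widetilde{Q}_S^v(f)=\frac{1}{|\det S|}\sum_{m\in\mathbb{Z}^d} f\left(\Psi\left(S^{-\top}(m+v)\right)\right)\cdot\left|D\Psi\left(S^{-\top}(m+v)\right)\right|,\] where $S^{-\top}$ is the transpose of the inverse of $S$ (terms with $S^{-\top}(m+v)\notin[0,1]^d$ vanish). The expectation is with respect to $(U,V)$. A matrix $B\in\mathbb{R}^{d\times d}$ is a Frolov matrix if: (a) $B$ is invertible; (b) $\left|\prod_{j=1}^d (Bm)_j\right|\geq 1$ for every $m\in\mathbb{Z}^d\setminus\{0\}$; (c) for all $x,y\in\mathbb{R}^d$ the box $[x,y]=\{z\in\mathbb{R}^d : z_j \text{ lies between } x_j \text{ and } y_j \text{ (inclusive) for } j=1,\dots,d\}$ with volume $V_0=\prod_{j=1}^d|x_j-y_j|$ contains at most $V_0+1$ lattice points $Bm$, $m\in\mathbb{Z}^d$. $H^{r,\mathrm{mix}}([0,1]^d)$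 is the space of real-valued $f\in L^2([0,1]^d)$ whose weak derivatives $D^\alpha f$ exist and lie in $L^2([0,1]^d)$ for all $\alpha\in\{0,\dots,r\}^d$, with norm $\Vert f\Vert_{H^{r,\mathrm{mix}}([0,1]^d)}=\left(\sum_{\alpha\in\{0,\dots,r\}^d}\Vert D^\alpha f\Vert_{L^2([0,1]^d)}^2\right)^{1/2}$; its elements are identified with their continuous representatives. *)

theory Defs
  imports "HOL-Probability.Probability"
begin

definition unit_cube :: "(real ^ 'n) set" where
  "unit_cube = cbox 0 1"

definition int_points :: "(real ^ 'n) set" where
  "int_points = {m. \<forall>i. m $ i \<in> \<int>}"

definition diag_matrix :: "real ^ 'n \<Rightarrow> real ^ 'n ^ 'n" where
  "diag_matrix u = (\<chi> i j. if i = j then u $ i else 0)"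

(* The corners x and y need not be ordered, hence closed segments rather than cbox x y. *)
definition coord_box :: "real ^ 'n \<Rightarrow> real ^ 'n \<Rightarrow> (real ^ 'n) set" where
  "coord_box x y = {z. \<forall>j. z $ j \<in> closed_segment (x $ j) (y $ j)}"

(* Finiteness is stated because card is 0 on infinite sets. *)
definition frolov_matrix :: "real ^ 'n ^ 'n \<Rightarrow> bool" where
  "frolov_matrix B \<longleftrightarrow>
     invertible B \<and>
     (\<forall>m \<in> int_points - {0}. \<bar>\<Prod>j\<in>UNIV. (B *v m) $ j\<bar> \<ge> 1) \<and>
     (\<forall>x y. finite ((*v) B ` int_points \<inter> coord_box x y) \<and>
            real (card ((*v) B ` int_points \<inter> coord_box x y))
              \<le> (\<Prod>j\<in>UNIV. \<bar>x $ j - y $ j\<bar>) + 1)"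

(* S is meant to be open, so the iterated derivatives at points of S depend only on f on S. *)
definition smooth_fun_on :: "real set \<Rightarrow> (real \<Rightarrow> real) \<Rightarrow> bool" where
  "smooth_fun_on S f \<longleftrightarrow> (\<forall>k. \<forall>x\<in>S. (deriv ^^ k) f differentiable (at x))"

definition diffeomorphism_between :: "real set \<Rightarrow> real set \<Rightarrow> (real \<Rightarrow> real) \<Rightarrow> bool" where
  "diffeomorphism_between S T f \<longleftrightarrow>
     bij_betw f S T \<and> smooth_fun_on S f \<and> smooth_fun_on T (inv_into S f)"

definition transform_fun :: "(real \<Rightarrow> real) \<Rightarrow> bool" where
  "transform_fun \<psi> \<longleftrightarrow>
     smooth_fun_on UNIV \<psi> \<and> (\<forall>x<0. \<psi> x = 0) \<and> (\<forall>x>1. \<psi> x = 1) \<and>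
     diffeomorphism_between {0<..<1} {0<..<1} \<psi>"

definition Psi :: "(real \<Rightarrow> real) \<Rightarrow> real ^ 'n \<Rightarrow> real ^ 'n" where
  "Psi \<psi> x = (\<chi> i. \<psi> (x $ i))"

definition DPsi :: "(real \<Rightarrow> real) \<Rightarrow> real ^ 'n \<Rightarrow> real" where
  "DPsi \<psi> x = det (jacobian (Psi \<psi>) (at x))"

lemma DPsi_eq_prod:
  fixes x :: "real ^ 'n"
  assumes "transform_fun \<psi>"
  shows "DPsi \<psi> x = (\<Prod>i\<in>UNIV. deriv \<psi> (x $ i))"
proof -
  have d: "(\<psi> has_derivative (\<lambda>h. deriv \<psi> t * h)) (at t)" for t
  proof -
    have "(deriv ^^ 0) \<psi> differentiable (at t)"
      using assms unfolding transform_fun_def smooth_fun_on_def by blast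
    then have "\<psi> field_differentiable (at t)"
      by (simp add: field_differentiable_def real_differentiable_def)
    then show ?thesis
      by (simp add: DERIV_deriv_iff_field_differentiable has_field_derivative_def[symmetric])
  qed
  have "((\<lambda>x. Psi \<psi> x :: real ^ 'n) has_derivative (\<lambda>h. \<chi> i. deriv \<psi> (x $ i) * h $ i)) (at x)"
  proof (subst has_derivative_componentwise_within, rule ballI)
    fix b :: "real ^ 'n" assume "b \<in> Basis"
    then obtain i where b: "b = axis i 1" by (auto simp: Basis_vec_def)
    have "((\<lambda>x :: real ^ 'n. \<psi> (x $ i)) has_derivative (\<lambda>h. deriv \<psi> (x $ i) * h $ i)) (at x)"
      by (rule has_derivative_compose[OF bounded_linear_imp_has_derivative[OF bounded_linear_vec_nth] d])
    then show "((\<lambda>x. Psi \<psi> x \<bullet> b) has_derivative (\<lambda>h. (\<chi> i. deriv \<psi> (x $ i) * h $ i) \<bullet> b)) (at x)"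
      by (simp add: b Psi_def inner_axis)
  qed
  then have "frechet_derivative (Psi \<psi>) (at x) = (\<lambda>h. \<chi> i. deriv \<psi> (x $ i) * h $ i)"
    by (simp add: frechet_derivative_at[symmetric])
  then have *: "jacobian (Psi \<psi>) (at x) = (\<chi> i j. deriv \<psi> (x $ i) * axis j 1 $ i)"
    by (simp add: jacobian_def matrix_def)
  show ?thesis
    unfolding DPsi_def by (subst det_diagonal) (auto simp: * axis_def)
qed

(* For invertible S only finitely many terms are nonzero: the determinant vanishes outside the
   unit cube. Moreover Psi takes values in the unit cube, so only f on the cube matters. *)
definition Q_tilde ::
  "(real \<Rightarrow> real) \<Rightarrow> real ^ 'n ^ 'n \<Rightarrow> real ^ 'n \<Rightarrow> (real ^ 'n \<Rightarrow> real) \<Rightarrow> real" where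
  "Q_tilde \<psi> S v f = 1 / \<bar>det S\<bar> *
     (\<Sum>\<^sub>\<infinity>m\<in>int_points. f (Psi \<psi> (transpose (matrix_inv S) *v (m + v)))
        * DPsi \<psi> (transpose (matrix_inv S) *v (m + v)))"

definition I_cube :: "(real ^ 'n \<Rightarrow> real) \<Rightarrow> real" where
  "I_cube f = integral\<^sup>L (lebesgue_on unit_cube) f"

definition L2_cube :: "(real ^ 'n \<Rightarrow> real) set" where
  "L2_cube = {f. f \<in> borel_measurable (lebesgue_on unit_cube) \<and>
                 integrable (lebesgue_on unit_cube) (\<lambda>x. (f x)\<^sup>2)}"

definition L2_norm_cube :: "(real ^ 'n \<Rightarrow> real) \<Rightarrow> real" where
  "L2_norm_cube f = sqrt (integral\<^sup>L (lebesgue_on unit_cube) (\<lambda>x. (f x)\<^sup>2))"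

definition partial :: "'n \<Rightarrow> (real ^ 'n \<Rightarrow> real) \<Rightarrow> real ^ 'n \<Rightarrow> real" where
  "partial i \<phi> x = deriv (\<lambda>t. \<phi> (x + t *\<^sub>R axis i 1)) 0"

definition partials :: "'n list \<Rightarrow> (real ^ 'n \<Rightarrow> real) \<Rightarrow> real ^ 'n \<Rightarrow> real" where
  "partials is \<phi> = foldr partial is \<phi>"

(* Infinitely differentiable functions with compact support in the open unit cube. *)
definition test_function :: "(real ^ 'n \<Rightarrow> real) \<Rightarrow> bool" where
  "test_function \<phi> \<longleftrightarrow>
     (\<forall>is x. partials is \<phi> differentiable (at x)) \<and>
     closure {x. \<phi> x \<noteq> 0} \<subseteq> box 0 1"

(* A multi-index is a function 'n => nat. The classical derivative of a test function along it is
   computed along any list of coordinates in which i occurs a i times; the order of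
   differentiation does not matter for smooth functions. *)
definition has_weak_deriv ::
  "(real ^ 'n \<Rightarrow> real) \<Rightarrow> ('n \<Rightarrow> nat) \<Rightarrow> (real ^ 'n \<Rightarrow> real) \<Rightarrow> bool" where
  "has_weak_deriv f \<alpha> g \<longleftrightarrow>
     f \<in> L2_cube \<and> g \<in> L2_cube \<and>
     (\<forall>\<phi>. test_function \<phi> \<longrightarrow>
       (\<forall>is. (\<forall>i. count_list is i = \<alpha> i) \<longrightarrow>
         integral\<^sup>L (lebesgue_on unit_cube) (\<lambda>x. f x * partials is \<phi> x)
           = (-1) ^ (\<Sum>i\<in>UNIV. \<alpha> i)
             * integral\<^sup>L (lebesgue_on unit_cube) (\<lambda>x. g x * \<phi> x)))"

(* Unique up to null sets whenever it exists. *)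
definition weak_deriv :: "('n \<Rightarrow> nat) \<Rightarrow> (real ^ 'n \<Rightarrow> real) \<Rightarrow> real ^ 'n \<Rightarrow> real" where
  "weak_deriv \<alpha> f = (SOME g. has_weak_deriv f \<alpha> g)"

(* Elements are the continuous representatives. *)
definition H_mix :: "nat \<Rightarrow> (real ^ 'n \<Rightarrow> real) set" where
  "H_mix r = {f. continuous_on unit_cube f \<and> f \<in> L2_cube \<and>
                 (\<forall>\<alpha>. (\<forall>i. \<alpha> i \<le> r) \<longrightarrow> (\<exists>g. has_weak_deriv f \<alpha> g))}"

definition mix_norm :: "nat \<Rightarrow> (real ^ 'n \<Rightarrow> real) \<Rightarrow> real" where
  "mix_norm r f = sqrt (\<Sum>\<alpha> | \<forall>i. \<alpha> i \<le> r. (L2_norm_cube (weak_deriv \<alpha> f))\<^sup>2)"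

definition uniformly_distributed_in ::
  "'a measure \<Rightarrow> ('a \<Rightarrow> real ^ 'n) \<Rightarrow> (real ^ 'n) set \<Rightarrow> bool" where
  "uniformly_distributed_in M X A \<longleftrightarrow>
     X \<in> borel_measurable M \<and> distr M borel X = uniform_measure lborel A"

(* The cube [1, 2^(1/d)]^d. *)
definition dilation_cube :: "(real ^ 'n) set" where
  "dilation_cube = cbox 1 (\<chi> i. 2 powr (1 / real CARD('n)))"

definition scaled_matrix :: "nat \<Rightarrow> real ^ 'n \<Rightarrow> real ^ 'n ^ 'n \<Rightarrow> real ^ 'n ^ 'n" where
  "scaled_matrix n u B = (real n powr (1 / real CARD('n))) *\<^sub>R (diag_matrix u ** B)"

end

theory Submission
  imports Defs "HOL-Real_Asymp.Real_Asymp"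
begin

text \<open>
  The rule applied to f is the lattice rule applied to the function g = (f \<circ> Psi) |DPsi|, which
  is supported in the cube and has the same integral as f; its mixed derivatives up to order r are bounded
  in L2 by those of f. By Poisson summation the error, as a function of the shift v, has the Fourier
  coefficients \<open>F g(S m)\<close> for \<open>m \<noteq> 0\<close>.

  For the supremum, insert the weights \<open>\<Prod>j. max 1 \<bar>(S m)_j\<bar> ^ (2 r)\<close> and apply the Cauchy-Schwarz
  inequality: by the Frolov property the reciprocal weights have a sum of order
  \<open>n ^ (-2 r) (log n) ^ (d - 1)\<close>, and by Bessel's inequality for the periodized derivatives of g the
  weighted squares of the coefficients have a bounded sum.

  For the expectation, averaging over v turns the squared error into the sum of \<open>|F g(S m)|\<^sup>2\<close>, and
  averaging over u turns this sum into an integral of \<open>|F g(\<xi>)|\<^sup>2\<close> over \<open>\<Prod>j. \<bar>\<xi> j\<bar> \<ge> n\<close>, with a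
  density of order 1 / n. There the mixed derivative of order (r, ..., r) gains another factor \<open>n ^ (-2 r)\<close>.

  As f has weak derivatives only, all this is done for mollifications of f; the two bounds
  follow by pointwise convergence and by Fatou's lemma.
\<close>

subsection \<open>Integration over the unit cube\<close>

text \<open>Multidimensional calculus is done one coordinate at a time: \<open>upd x i t\<close>
  moves along a line, Fubini's theorem is used for a single resampled coordinate, and
  \<open>Psi\<close> is composed of d one-dimensional changes of variables. The obstacle there is
  that the derivatives of f of top order are controlled only in L2: the chain rule has to hand each
  of them a factor \<open>deriv \<psi>\<close> that serves as the Jacobian of the substitution.

  The constants may depend neither on n nor on the dilation. For S =
  \<open>scaled_matrix n u B\<close>, Bessel's inequality for a periodized function h bounds (det
  S)^2 times the sum of the \<bar>F h (S m)\<bar>^2 by \<bar>det S\<bar> times the number of integer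
  translates that meet the cube, times the squared L2 norm of h. This number is of order n, and so
  is \<bar>det S\<bar>, hence everything but the squared norm cancels.

  The weighted estimate behind the supremum bound also makes the Fourier series absolutely summable.
  Then two inequalities suffice, a pointwise bound by the sum of the absolute coefficients and one
  half of Parseval's identity, and the former yields the latter.\<close>

abbreviation cube_measure :: "(real ^ 'n) measure" where
  "cube_measure \<equiv> uniform_measure lborel unit_cube"

definition upd :: "real ^ 'n \<Rightarrow> 'n \<Rightarrow> real \<Rightarrow> real ^ 'n" where
  "upd x i t = (\<chi> j. if j = i then t else x $ j)"

lemma upd_nth [simp]: "upd x i t $ j = (if j = i then t else x $ j)"
  by (simp add: upd_def)

lemma upd_upd [simp]: "upd (upd x i s) i t = upd x i t"
  by (simp add: vec_eq_iff)

lemma upd_commute: "i \<noteq> j \<Longrightarrow> upd (upd x i s) j t = upd (upd x j t) i s"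
  by (auto simp: vec_eq_iff)

lemma continuous_on_upd [continuous_intros]:
  assumes "continuous_on S f" "continuous_on S g"
  shows "continuous_on S (\<lambda>z. upd (f z) i (g z))"
proof -
  have "continuous_on S (\<lambda>z. if j = i then g z else f z $ j)" for j
    using assms by (cases "j = i") (auto intro!: continuous_intros)
  then show ?thesis
    unfolding upd_def by (rule continuous_on_vec_lambda)
qed

lemma measurable_vec_nth [measurable (raw)]:
  fixes f :: "'a \<Rightarrow> real ^ 'n"
  assumes "f \<in> borel_measurable M"
  shows "(\<lambda>x. f x $ i) \<in> borel_measurable M"
  using assms by (rule borel_measurable_continuous_on[rotated]) (intro continuous_intros)

lemma measurable_vec_iff:
  "f \<in> borel_measurable M \<longleftrightarrow> (\<forall>i. (\<lambda>x. f x $ i) \<in> borel_measurable M)"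
  for f :: "'a \<Rightarrow> real ^ 'n"
proof
  assume *: "\<forall>i. (\<lambda>x. f x $ i) \<in> borel_measurable M"
  show "f \<in> borel_measurable M"
    by (subst borel_measurable_euclidean_space) (auto simp: Basis_vec_def inner_axis *)
qed auto

lemma measurable_upd [measurable]:
  assumes [measurable]: "f \<in> borel_measurable M" "g \<in> borel_measurable M"
  shows "(\<lambda>z. upd (f z) i (g z)) \<in> borel_measurable M"
  unfolding measurable_vec_iff
proof
  show "(\<lambda>x. upd (f x) i (g x) $ j) \<in> borel_measurable M" for j
    by (cases "j = i") auto
qed

lemma mem_unit_cube: "x \<in> unit_cube \<longleftrightarrow> (\<forall>i. 0 \<le> x $ i \<and> x $ i \<le> 1)"
  by (auto simp: unit_cube_def mem_box_cart)

lemma unit_cube_measurable [measurable]: "unit_cube \<in> sets borel"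
  by (simp add: unit_cube_def)

text \<open>The \<open>max 0\<close> covers an empty intersection. Closed boxes form an
  intersection-stable generator of the Borel sets, so this formula is what identifies
  \<open>cube_measure\<close>.\<close>

lemma emeasure_cube_Int_cbox:
  fixes a b :: "real ^ 'n"
  shows "emeasure lborel (unit_cube \<inter> cbox a b)
    = ennreal (\<Prod>i\<in>UNIV. max 0 (min 1 (b $ i) - max 0 (a $ i)))"
proof -
  define a' b' :: "real ^ 'n" where "a' = (\<chi> i. max 0 (a $ i))" and "b' = (\<chi> i. min 1 (b $ i))"
  have eq: "unit_cube \<inter> cbox a b = cbox a' b'"
    by (auto simp: mem_unit_cube mem_box_cart a'_def b'_def)
  show ?thesis
  proof (cases "cbox a' b' = {}")
    case True
    then obtain i where "b' $ i < a' $ i"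
      by (auto simp: interval_eq_empty_cart)
    then have "max 0 (min 1 (b $ i) - max 0 (a $ i)) = 0"
      by (auto simp: a'_def b'_def)
    then have "(\<Prod>i\<in>UNIV. max 0 (min 1 (b $ i) - max 0 (a $ i))) = 0"
      by (meson UNIV_I finite_class.finite_UNIV prod_zero)
    then show ?thesis using True by (simp only: eq) simp
  next
    case False
    then have le: "a' $ i \<le> b' $ i" for i
      by (auto simp: interval_ne_empty_cart)
    have "emeasure lborel (cbox a' b') = ennreal (measure lborel (cbox a' b'))"
      by (rule emeasure_eq_ennreal_measure) (use emeasure_lborel_cbox_finite[of a' b'] in auto)
    also have "measure lborel (cbox a' b') = (\<Prod>i\<in>UNIV. b' $ i - a' $ i)"
      using False by (rule content_cbox_cart)
    also have "\<dots> = (\<Prod>i\<in>UNIV. max 0 (min 1 (b $ i) - max 0 (a $ i)))"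
      using le by (intro prod.cong) (auto simp: a'_def b'_def)
    finally show ?thesis by (simp add: eq)
  qed
qed

lemma emeasure_unit_cube [simp]: "emeasure lborel (unit_cube :: (real ^ 'n) set) = 1"
  using emeasure_cube_Int_cbox[of 0 "1 :: real ^ 'n"] by (simp add: unit_cube_def)

lemma measure_unit_cube [simp]: "measure lborel (unit_cube :: (real ^ 'n) set) = 1"
  by (simp add: measure_def)

lemma prob_space_cube: "prob_space (cube_measure :: (real ^ 'n) measure)"
  by (rule prob_space_uniform_measure) auto

lemma ennreal_divide_1 [simp]: "x / 1 = (x :: ennreal)"
  by (simp add: divide_ennreal_def)

lemma nn_integral_cube:
  assumes [measurable]: "f \<in> borel_measurable borel"
  shows "(\<integral>\<^sup>+x. f x \<partial>cube_measure) = (\<integral>\<^sup>+x. f x * indicator unit_cube x \<partial>lborel)"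
  by (subst nn_integral_uniform_measure) auto

lemma cube_measure_eq_density:
  "cube_measure = density lborel (\<lambda>x :: real ^ 'n. ennreal (indicator unit_cube x))"
  by (simp add: uniform_measure_def ennreal_indicator)

lemma integral_cube:
  fixes f :: "real ^ 'n \<Rightarrow> 'b :: {banach, second_countable_topology}"
  assumes [measurable]: "f \<in> borel_measurable borel"
  shows "(\<integral>x. f x \<partial>cube_measure) = (\<integral>x. indicator unit_cube x *\<^sub>R f x \<partial>lborel)"
  unfolding cube_measure_eq_density
  by (subst integral_density) auto

lemma AE_cube: "AE x in cube_measure. x \<in> (unit_cube :: (real ^ 'n) set)"
  by (rule AE_uniform_measureI) auto

lemma AE_cube_box: "AE x in cube_measure. x \<in> box (0 :: real ^ 'n) 1"
proof (rule AE_uniform_measureI)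
  have "emeasure lborel (cbox (0::real^'n) 1 - box 0 1)
      = emeasure lborel (cbox (0::real^'n) 1) - emeasure lborel (box (0::real^'n) 1)"
    by (rule emeasure_Diff) (auto simp: emeasure_lborel_box_eq box_subset_cbox)
  also have "emeasure lborel (box (0::real^'n) 1) = emeasure lborel (cbox (0::real^'n) 1)"
    by (simp add: emeasure_lborel_box_eq emeasure_lborel_cbox_eq)
  also have "emeasure lborel (cbox (0::real^'n) 1) - emeasure lborel (cbox (0::real^'n) 1) = 0"
    by (rule ennreal_diff_self) (simp add: emeasure_lborel_cbox_eq)
  finally have "cbox (0::real^'n) 1 - box 0 1 \<in> null_sets lborel"
    by (auto simp: null_sets_def)
  from AE_not_in[OF this] show "AE x in lborel. x \<in> unit_cube \<longrightarrow> x \<in> box (0::real^'n) 1"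
    by eventually_elim (auto simp: unit_cube_def)
qed simp

lemma integrable_cube_bounded:
  fixes f :: "real ^ 'n \<Rightarrow> 'b :: {banach, second_countable_topology}"
  assumes "f \<in> borel_measurable borel" "\<And>x. x \<in> unit_cube \<Longrightarrow> norm (f x) \<le> B"
  shows "integrable cube_measure f"
proof -
  interpret prob_space "cube_measure :: (real ^ 'n) measure" by (rule prob_space_cube)
  show ?thesis
    using assms by (intro integrable_const_bound[where B = B]) (auto intro: eventually_mono[OF AE_cube])
qed

lemma integrable_cube_continuous:
  fixes f :: "real ^ 'n \<Rightarrow> 'b :: {banach, second_countable_topology}"
  assumes "continuous_on UNIV f"
  shows "integrable cube_measure f"
proof -
  have "compact (f ` unit_cube)"
    using assms by (intro compact_continuous_image) (auto simp: unit_cube_def intro: continuous_on_subset)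
  then obtain B where "\<forall>y \<in> f ` unit_cube. norm y \<le> B"
    by (meson compact_imp_bounded bounded_iff)
  then show ?thesis
    using assms by (intro integrable_cube_bounded[where B = B] borel_measurable_continuous_onI) auto
qed

abbreviation unit_measure :: "real measure" where
  "unit_measure \<equiv> uniform_measure lborel {0..1}"

lemma prob_space_unit: "prob_space unit_measure"
  by (rule prob_space_uniform_measure) auto

lemma integral_unit_measure:
  fixes f :: "real \<Rightarrow> 'b :: euclidean_space"
  assumes "continuous_on UNIV f"
  shows "(\<integral>x. f x \<partial>unit_measure) = integral {0..1} f"
proof -
  have [measurable]: "f \<in> borel_measurable borel"
    using assms by (rule borel_measurable_continuous_onI)
  have "unit_measure = density lborel (\<lambda>x. ennreal (indicator {0..1} x))"
    by (simp add: uniform_measure_def ennreal_indicator)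
  then have "(\<integral>x. f x \<partial>unit_measure) = (\<integral>x. indicator {0..1} x *\<^sub>R f x \<partial>lborel)"
    by (simp add: integral_density)
  also have "\<dots> = integral {0..1} f"
    using set_borel_integral_eq_integral(2)[of "{0..1}" f]
      borel_integrable_atLeastAtMost'[of 0 1 f] assms
    by (auto simp: set_lebesgue_integral_def intro: continuous_on_subset)
  finally show ?thesis .
qed

text \<open>Resampling one coordinate uniformly preserves the uniform distribution. This replaces
  the decomposition of the cube as a product, since \<open>real ^ 'n\<close> is not a product
  type.\<close>

lemma cube_measure_coordinate:
  "cube_measure = distr (cube_measure \<Otimes>\<^sub>M unit_measure) borel (\<lambda>(x :: real ^ 'n, t). upd x i t)"
  (is "?M = ?N")
proof (rule measure_eqI_generator_eq[where E = "range (\<lambda>(a, b). cbox a b)" and \<Omega> = UNIV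
        and A = "\<lambda>n. cbox (- (\<chi> i. real n)) (\<chi> i. real n)"])
  interpret P: prob_space "cube_measure :: (real ^ 'n) measure" by (rule prob_space_cube)
  interpret U: prob_space unit_measure by (rule prob_space_unit)
  interpret PU: pair_prob_space "cube_measure :: (real ^ 'n) measure" unit_measure ..
  have borel: "(borel :: (real ^ 'n) measure) = sigma UNIV (range (\<lambda>(a, b). cbox a b))"
    using borel_eq_atLeastAtMost by (simp only: interval_cbox)
  show "sets ?M = sigma_sets UNIV (range (\<lambda>(a, b). cbox a b))"
    by (simp add: borel)
  show "sets ?N = sigma_sets UNIV (range (\<lambda>(a, b). cbox a b))"
    by (simp add: borel)
  show "Int_stable (range (\<lambda>(a :: real ^ 'n, b). cbox a b))"
    by (auto simp: Int_stable_def Int_interval)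
  show "emeasure ?M X = emeasure ?N X" if X: "X \<in> range (\<lambda>(a, b). cbox a b)" for X
  proof -
    obtain a b where X: "X = cbox a b" using X by auto
    define l where "l j = max 0 (min 1 (b $ j) - max 0 (a $ j))" for j
    \<comment> \<open>The preimage does not constrain coordinate i. Inside the cube this coordinate
      lies in [0,1] anyway, so the cylinder may be replaced by the box \<open>Y\<close>.\<close>
    define Y where "Y = cbox (upd a i 0) (upd b i 1)"
    have "emeasure ?N X = emeasure (cube_measure \<Otimes>\<^sub>M unit_measure) ((\<lambda>(x, t). upd x i t) -` X \<inter> space (cube_measure \<Otimes>\<^sub>M unit_measure))"
      by (subst emeasure_distr) (auto simp: X)
    also have "(\<lambda>(x, t). upd x i t) -` X \<inter> space (cube_measure \<Otimes>\<^sub>M unit_measure) =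
        {x. \<forall>j. j \<noteq> i \<longrightarrow> a $ j \<le> x $ j \<and> x $ j \<le> b $ j} \<times> {a $ i..b $ i}" (is "_ = ?Y \<times> _")
      by (auto simp: X mem_box_cart space_pair_measure split: if_splits)
    also have "emeasure (cube_measure \<Otimes>\<^sub>M unit_measure) \<dots> = emeasure cube_measure ?Y * emeasure unit_measure {a $ i..b $ i}"
      by (rule U.emeasure_pair_measure_Times) measurable
    also have "emeasure cube_measure ?Y = emeasure lborel (unit_cube \<inter> ?Y)"
      by (subst emeasure_uniform_measure) measurable
    also have "unit_cube \<inter> ?Y = unit_cube \<inter> Y"
      by (force simp: Y_def mem_box_cart mem_unit_cube split: if_splits)
    also have "emeasure lborel (unit_cube \<inter> Y) = ennreal (\<Prod>j\<in>UNIV. max 0 (min 1 (upd b i 1 $ j) - max 0 (upd a i 0 $ j)))"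
      unfolding Y_def by (rule emeasure_cube_Int_cbox)
    also have "(\<Prod>j\<in>UNIV. max 0 (min 1 (upd b i 1 $ j) - max 0 (upd a i 0 $ j))) = (\<Prod>j\<in>UNIV-{i}. l j)"
      by (subst prod.remove[of _ i]) (auto simp: l_def intro!: prod.cong)
    also have "emeasure unit_measure {a $ i..b $ i} = emeasure lborel ({0..1} \<inter> {a $ i..b $ i})"
      by (subst emeasure_uniform_measure) auto
    also have "{0..1} \<inter> {a $ i..b $ i} = {max 0 (a $ i)..min 1 (b $ i)}"
      by auto
    also have "emeasure lborel \<dots> = ennreal (l i)"
      by (auto simp: l_def emeasure_lborel_Icc_eq ennreal_neg)
    also have "ennreal (\<Prod>j\<in>UNIV-{i}. l j) * ennreal (l i) = ennreal (\<Prod>j\<in>UNIV. l j)"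
      by (subst prod.remove[of _ i]) (auto simp: l_def ennreal_mult' mult.commute prod_nonneg)
    also have "\<dots> = emeasure lborel (unit_cube \<inter> cbox a b)"
      by (simp add: emeasure_cube_Int_cbox l_def)
    also have "\<dots> = emeasure ?M X"
      by (subst emeasure_uniform_measure) (auto simp: X)
    finally show ?thesis by simp
  qed
  show "(\<Union>n. cbox (- (\<chi> i. real n)) (\<chi> i. real n)) = (UNIV :: (real ^ 'n) set)"
  proof -
    have "\<exists>n. x \<in> cbox (- (\<chi> i. real n)) (\<chi> i. real n)" for x :: "real ^ 'n"
    proof -
      obtain n where "norm x \<le> real n" using real_arch_simple by blast
      then have "\<bar>x $ j\<bar> \<le> real n" for j
        using component_le_norm_cart[of x j] by linarith
      then show ?thesis by (auto simp: mem_box_cart abs_le_iff minus_le_iff)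
    qed
    then show ?thesis by auto
  qed
qed (auto simp: emeasure_cube_Int_cbox)

lemma integral_cube_coordinate:
  fixes h :: "real ^ 'n \<Rightarrow> 'b :: euclidean_space"
  assumes h: "continuous_on UNIV h"
  shows "(\<integral>x. h x \<partial>cube_measure) = (\<integral>x. integral {0..1} (\<lambda>t. h (upd x i t)) \<partial>cube_measure)"
proof -
  interpret P: prob_space "cube_measure :: (real ^ 'n) measure" by (rule prob_space_cube)
  interpret U: prob_space unit_measure by (rule prob_space_unit)
  interpret PU: pair_prob_space "cube_measure :: (real ^ 'n) measure" unit_measure ..
  have hm [measurable]: "h \<in> borel_measurable borel"
    using h by (rule borel_measurable_continuous_onI)
  have int: "integrable (cube_measure \<Otimes>\<^sub>M unit_measure) (\<lambda>p. h (upd (fst p) i (snd p)))"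
    using integrable_cube_continuous[OF h]
    by (subst (asm) cube_measure_coordinate[of i], subst (asm) integrable_distr_eq) (auto simp: case_prod_unfold)
  have "(\<integral>x. h x \<partial>cube_measure) = (\<integral>x. h x \<partial>distr (cube_measure \<Otimes>\<^sub>M unit_measure) borel (\<lambda>(x, t). upd x i t))"
    using cube_measure_coordinate[of i] by simp
  also have "\<dots> = (\<integral>p. h (upd (fst p) i (snd p)) \<partial>(cube_measure \<Otimes>\<^sub>M unit_measure))"
    by (subst integral_distr) (auto simp: case_prod_unfold)
  also have "\<dots> = (\<integral>x. \<integral>t. h (upd x i t) \<partial>unit_measure \<partial>cube_measure)"
    using PU.integral_fst'[OF int] by simp
  also have "\<dots> = (\<integral>x. integral {0..1} (\<lambda>t. h (upd x i t)) \<partial>cube_measure)"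
  proof (intro Bochner_Integration.integral_cong refl integral_unit_measure)
    show "continuous_on UNIV (\<lambda>t. h (upd x i t))" for x
      by (rule continuous_on_compose2[OF h]) (auto intro!: continuous_intros)
  qed
  finally show ?thesis .
qed

text \<open>The fundamental theorem of calculus along coordinate i, with boundary terms that cancel
  because h agrees on opposite faces. It gives both the orthogonality of the exponentials and
  integration by parts in Fourier coefficients.\<close>

lemma integral_cube_partial_eq_0:
  fixes h h' :: "real ^ 'n \<Rightarrow> 'b :: euclidean_space"
  assumes h': "continuous_on UNIV h'"
    and deriv: "\<And>x t. ((\<lambda>s. h (upd x i s)) has_vector_derivative h' (upd x i t)) (at t)"
    and faces: "\<And>x. h (upd x i 0) = h (upd x i 1)"
  shows "(\<integral>x. h' x \<partial>cube_measure) = 0"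
proof -
  have "((\<lambda>t. h' (upd x i t)) has_integral h (upd x i 1) - h (upd x i 0)) {0..1}" for x
    by (rule fundamental_theorem_of_calculus[OF _ has_vector_derivative_at_within[OF deriv]]) simp
  then have "integral {0..1} (\<lambda>t. h' (upd x i t)) = 0" for x
    using faces by (simp add: integral_unique)
  then show ?thesis by (subst integral_cube_coordinate[OF h', of i]) simp
qed

subsection \<open>Fourier coefficients\<close>

definition ce :: "real ^ 'n \<Rightarrow> real ^ 'n \<Rightarrow> complex" where
  "ce m x = cis (2 * pi * (m \<bullet> x))"

text \<open>The frequency is an arbitrary real vector. At integer points this is a Fourier
  coefficient of a periodic function; for h supported in the cube it is the Fourier transform of
  h.\<close>

definition fc :: "(real ^ 'n \<Rightarrow> complex) \<Rightarrow> real ^ 'n \<Rightarrow> complex" where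
  "fc h \<xi> = (\<integral>x. h x * ce (- \<xi>) x \<partial>cube_measure)"

lemma norm_ce [simp]: "norm (ce m x) = 1"
  by (simp add: ce_def)

lemma ce_0 [simp]: "ce 0 x = 1" "ce m 0 = 1"
  by (simp_all add: ce_def)

lemma ce_add: "ce (m + k) x = ce m x * ce k x"
  by (simp add: ce_def cis_mult inner_add_left ring_distribs)

lemma ce_add_right: "ce m (x + y) = ce m x * ce m y"
  by (simp add: ce_def cis_mult inner_add_right ring_distribs)

lemma ce_uminus: "ce (- m) x = cnj (ce m x)"
  by (simp add: ce_def cis_cnj)

lemma continuous_on_ce [continuous_intros]:
  assumes "continuous_on S f"  "continuous_on S g"
  shows "continuous_on S (\<lambda>x. ce (g x) (f x))"
  unfolding ce_def cis_conv_exp by (intro continuous_intros assms)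

lemma borel_measurable_ce [measurable]:
  assumes "f \<in> borel_measurable M" "g \<in> borel_measurable M"
  shows "(\<lambda>x. ce (g x) (f x)) \<in> borel_measurable M"
  unfolding ce_def cis_conv_exp
  by (intro borel_measurable_continuous_on[of "\<lambda>x. exp (\<i> * complex_of_real x)"] continuous_intros)
     (use assms in measurable)

lemma int_points_add: "m \<in> int_points \<Longrightarrow> k \<in> int_points \<Longrightarrow> m + k \<in> int_points"
  by (auto simp: int_points_def)

lemma int_points_uminus: "m \<in> int_points \<Longrightarrow> - m \<in> int_points"
  by (auto simp: int_points_def)

lemma int_points_diff: "m \<in> int_points \<Longrightarrow> k \<in> int_points \<Longrightarrow> m - k \<in> int_points"
  by (auto simp: int_points_def)

lemma zero_int_points [simp]: "0 \<in> int_points"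
  by (auto simp: int_points_def)

lemma ce_int:
  assumes "m \<in> int_points" "k \<in> int_points"
  shows "ce m k = 1"
proof -
  have "m \<bullet> k \<in> \<int>"
    using assms by (auto simp: int_points_def inner_vec_def intro!: Ints_sum)
  then obtain j where "m \<bullet> k = of_int j" by (auto elim: Ints_cases)
  then show ?thesis
    by (simp add: ce_def cis.ctr complex_eq_iff)
qed

lemma ce_upd_deriv:
  "((\<lambda>s. ce m (upd x i s)) has_vector_derivative (2 * pi * m $ i * \<i>) * ce m (upd x i t)) (at t)"
proof -
  have eq: "m \<bullet> upd x i s = m $ i * s + (\<Sum>j\<in>UNIV-{i}. m $ j * x $ j)" for s
    by (simp add: inner_vec_def sum.remove[of _ i])
  define r where "r = complex_of_real (\<Sum>j\<in>UNIV-{i}. m $ j * x $ j)"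
  have ce_eq: "ce m (upd x i s) = exp (\<i> * (2 * pi * (m $ i * complex_of_real s + r)))" for s
    unfolding ce_def cis_conv_exp eq r_def by simp
  have "((\<lambda>z. exp (\<i> * (2 * pi * (complex_of_real (m $ i) * z + r)))) has_field_derivative
      (2 * pi * m $ i * \<i>) * exp (\<i> * (2 * pi * (complex_of_real (m $ i) * of_real t + r)))) (at (of_real t))"
    by (auto intro!: derivative_eq_intros simp: algebra_simps)
  from has_vector_derivative_real_field[OF this] show ?thesis
    unfolding ce_eq .
qed

text \<open>Differentiation in a direction with \<open>m $ i \<noteq> 0\<close> multiplies
  \<open>ce m\<close> by a nonzero constant, and a derivative of a periodic function integrates to
  0.\<close>

lemma integral_ce:
  assumes m: "m \<in> int_points"
  shows "(\<integral>x. ce m x \<partial>cube_measure) = (if m = 0 then 1 else 0)"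
proof (cases "m = 0")
  case True
  then show ?thesis by simp
next
  case False
  then obtain i where i: "m $ i \<noteq> 0" by (auto simp: vec_eq_iff)
  have "ce m (upd x i 0) = ce m (upd x i 1)" for x
  proof -
    have "upd x i 1 = upd x i 0 + axis i 1" by (auto simp: vec_eq_iff axis_def)
    moreover have "axis i 1 \<in> int_points" by (auto simp: int_points_def axis_def)
    ultimately show ?thesis by (simp add: ce_add_right ce_int m)
  qed
  then have "(\<integral>x. (2 * pi * m $ i * \<i>) * ce m x \<partial>cube_measure) = 0"
    by (intro integral_cube_partial_eq_0[OF _ ce_upd_deriv]) (auto intro!: continuous_intros)
  then show ?thesis using i False by simp
qed

lemma integrable_cube_cont_mult_ce:
  assumes "continuous_on UNIV h"
  shows "integrable cube_measure (\<lambda>x. h x * ce m x)"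
  by (intro integrable_cube_continuous continuous_intros assms)

text \<open>Orthogonality of the exponentials. It is applied to partial sums of the Fourier series,
  to h = 0 in order to read off the coefficients of a trigonometric polynomial, and to a constant in
  order to remove a mean value.\<close>

lemma fc_diff_trig:
  assumes h: "continuous_on UNIV h" and F: "finite F" "F \<subseteq> int_points" and k: "k \<in> int_points"
  shows "fc (\<lambda>x. h x - (\<Sum>m\<in>F. c m * ce m x)) k = fc h k - (if k \<in> F then c k else 0)"
proof -
  have "fc (\<lambda>x. h x - (\<Sum>m\<in>F. c m * ce m x)) k
      = (\<integral>x. h x * ce (- k) x - (\<Sum>m\<in>F. c m * ce (m - k) x) \<partial>cube_measure)"
    unfolding fc_def
    by (rule Bochner_Integration.integral_cong) (auto simp: ring_distribs sum_distrib_right ce_add[symmetric] mult.assoc)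
  also have "\<dots> = fc h k - (\<Sum>m\<in>F. \<integral>x. c m * ce (m - k) x \<partial>cube_measure)"
    unfolding fc_def
    by (subst Bochner_Integration.integral_diff, rule integrable_cube_cont_mult_ce[OF h], rule integrable_cube_continuous)
       (intro continuous_intros, subst Bochner_Integration.integral_sum, auto intro!: integrable_cube_continuous continuous_intros)
  also have "(\<Sum>m\<in>F. \<integral>x. c m * ce (m - k) x \<partial>cube_measure) = (\<Sum>m\<in>F. if m = k then c m else 0)"
    using F k by (intro sum.cong refl) (auto simp: integral_ce int_points_diff)
  also have "\<dots> = (if k \<in> F then c k else 0)"
    using F by simp
  finally show ?thesis .
qed

text \<open>Pythagoras: the partial sum s is orthogonal to the remainder h - s, whose coefficients
  in F vanish.\<close>

lemma integral_cube_norm_diff_trig: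
  assumes h: "continuous_on UNIV h" and F: "finite F" "F \<subseteq> int_points"
  shows "(\<integral>x. (norm (h x - (\<Sum>m\<in>F. fc h m * ce m x)))\<^sup>2 \<partial>cube_measure)
    = (\<integral>x. (norm (h x))\<^sup>2 \<partial>cube_measure) - (\<Sum>m\<in>F. (norm (fc h m))\<^sup>2)"
proof -
  define s where "s x = (\<Sum>m\<in>F. fc h m * ce m x)" for x
  have cs: "continuous_on UNIV s"
    unfolding s_def by (intro continuous_intros)
  have cnj_s: "cnj (s x) = (\<Sum>m\<in>F. cnj (fc h m) * ce (-m) x)" for x
    by (simp add: s_def ce_uminus)
  have *: "(\<integral>x. (h x - s x) * cnj (s x) \<partial>cube_measure) = 0"
  proof -
    have "(\<integral>x. (h x - s x) * cnj (s x) \<partial>cube_measure) = (\<integral>x. (\<Sum>m\<in>F. cnj (fc h m) * ((h x - s x) * ce (-m) x)) \<partial>cube_measure)"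
      by (rule Bochner_Integration.integral_cong) (simp_all add: cnj_s sum_distrib_left mult_ac)
    also have "\<dots> = (\<Sum>m\<in>F. cnj (fc h m) * fc (\<lambda>x. h x - s x) m)"
      unfolding fc_def
      by (subst Bochner_Integration.integral_sum)
         (auto intro!: integrable_cube_continuous continuous_intros h cs)
    also have "\<dots> = 0"
      unfolding s_def using F by (intro sum.neutral) (auto simp: fc_diff_trig[OF h F])
    finally show ?thesis .
  qed
  have **: "(\<integral>x. h x * cnj (s x) \<partial>cube_measure) = (\<Sum>m\<in>F. of_real ((norm (fc h m))\<^sup>2))"
  proof -
    have "(\<integral>x. h x * cnj (s x) \<partial>cube_measure) = (\<integral>x. (\<Sum>m\<in>F. cnj (fc h m) * (h x * ce (-m) x)) \<partial>cube_measure)"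
      by (rule Bochner_Integration.integral_cong) (simp_all add: cnj_s sum_distrib_left mult_ac)
    also have "\<dots> = (\<Sum>m\<in>F. cnj (fc h m) * fc h m)"
      unfolding fc_def
      by (subst Bochner_Integration.integral_sum)
         (auto intro!: integrable_cube_continuous continuous_intros h)
    finally show ?thesis unfolding complex_norm_square by (simp add: mult.commute)
  qed
  \<comment> \<open>The integrand equals \<open>of_real ((norm (h x))\<^sup>2) - h x * cnj (s x) -
    cnj ((h x - s x) * cnj (s x))\<close>. It is padded by two terms that vanish identically and
    drop out in the next step.\<close>
  have "(\<integral>x. complex_of_real ((norm (h x - s x))\<^sup>2) \<partial>cube_measure)
      = (\<integral>x. of_real ((norm (h x))\<^sup>2) - h x * cnj (s x) + cnj (h x * cnj (s x) - h x * cnj (s x))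
          - cnj ((h x - s x) * cnj (s x)) + (cnj ((h x - s x) * cnj (s x)) - s x * cnj (h x - s x)) \<partial>cube_measure)"
    by (rule Bochner_Integration.integral_cong) (auto simp: complex_norm_square algebra_simps simp del: of_real_power)
  also have "\<dots> = (\<integral>x. of_real ((norm (h x))\<^sup>2) - h x * cnj (s x) - cnj ((h x - s x) * cnj (s x)) \<partial>cube_measure)"
    by (rule Bochner_Integration.integral_cong) (auto simp: algebra_simps)
  also have "\<dots> = (\<integral>x. of_real ((norm (h x))\<^sup>2) \<partial>cube_measure) - (\<integral>x. h x * cnj (s x) \<partial>cube_measure)
      - (\<integral>x. cnj ((h x - s x) * cnj (s x)) \<partial>cube_measure)"
    by (subst Bochner_Integration.integral_diff Bochner_Integration.integral_diff,
        (auto intro!: integrable_cube_continuous continuous_intros h cs)[2])+ simp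
  also have "(\<integral>x. cnj ((h x - s x) * cnj (s x)) \<partial>cube_measure) = 0"
    using Bochner_Integration.integral_cnj[of cube_measure "\<lambda>x. (h x - s x) * cnj (s x)"]
    by (simp only: * complex_cnj_zero)
  finally have "complex_of_real (\<integral>x. (norm (h x - s x))\<^sup>2 \<partial>cube_measure)
     = of_real ((\<integral>x. (norm (h x))\<^sup>2 \<partial>cube_measure) - (\<Sum>m\<in>F. (norm (fc h m))\<^sup>2))"
    by (simp only: integral_complex_of_real ** of_real_diff of_real_sum diff_zero)
  then show ?thesis
    by (simp only: of_real_eq_iff s_def)
qed

lemma bessel:
  assumes h: "continuous_on UNIV h" and F: "finite F" "F \<subseteq> int_points"
  shows "(\<Sum>m\<in>F. (norm (fc h m))\<^sup>2) \<le> (\<integral>x. (norm (h x))\<^sup>2 \<partial>cube_measure)"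
proof -
  have "0 \<le> (\<integral>x. (norm (h x - (\<Sum>m\<in>F. fc h m * ce m x)))\<^sup>2 \<partial>cube_measure)"
    by (rule Bochner_Integration.integral_nonneg) simp
  then show ?thesis using integral_cube_norm_diff_trig[OF assms] by simp
qed

section \<open>Trigonometric polynomials, the pointwise bound and half of Parseval's
  identity\<close>

inductive trig_poly :: "(real ^ 'n \<Rightarrow> complex) \<Rightarrow> bool" where
  zero: "trig_poly (\<lambda>x. 0)"
| add_ce: "trig_poly T \<Longrightarrow> m \<in> int_points \<Longrightarrow> trig_poly (\<lambda>x. T x + c * ce m x)"

lemma trig_poly_cmult_ce:
  assumes "m \<in> int_points"
  shows "trig_poly (\<lambda>x. c * ce m x)"
  using add_ce[OF zero assms, of c] by simp

lemma trig_poly_const: "trig_poly (\<lambda>x. c)"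
  using trig_poly_cmult_ce[of 0 c] by simp

lemma trig_poly_add:
  assumes "trig_poly T" "trig_poly U"
  shows "trig_poly (\<lambda>x. T x + U x)"
  using assms(2)
proof induction
  case (add_ce U m c)
  from trig_poly.add_ce[OF add_ce.IH add_ce.hyps(2), of c] show ?case by (simp add: add.assoc)
qed (use assms in simp)

lemma trig_poly_mult_ce:
  assumes "trig_poly T" "m \<in> int_points"
  shows "trig_poly (\<lambda>x. T x * (c * ce m x))"
  using assms(1)
proof induction
  case zero
  then show ?case by (simp add: trig_poly.zero)
next
  case (add_ce T k b)
  from trig_poly.add_ce[OF add_ce.IH int_points_add[OF add_ce.hyps(2) assms(2)], of "b * c"]
  show ?case by (simp add: ce_add algebra_simps)
qed

lemma trig_poly_mult:
  assumes "trig_poly T" "trig_poly U"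
  shows "trig_poly (\<lambda>x. T x * U x)"
  using assms(2)
proof induction
  case zero
  then show ?case by (simp add: trig_poly.zero)
next
  case (add_ce U k b)
  from trig_poly_add[OF add_ce.IH trig_poly_mult_ce[OF assms(1) add_ce.hyps(2), of b]]
  show ?case by (simp add: algebra_simps)
qed

lemma trig_poly_power: "trig_poly T \<Longrightarrow> trig_poly (\<lambda>x. T x ^ N)"
  by (induction N) (auto intro: trig_poly_const trig_poly_mult)

lemma trig_poly_sum:
  assumes "\<And>j. j \<in> J \<Longrightarrow> trig_poly (T j)"
  shows "trig_poly (\<lambda>x. \<Sum>j\<in>J. T j x)"
  using assms
  by (induction J rule: infinite_finite_induct) (auto intro: trig_poly_const trig_poly_add)

text \<open>The only frequencies are 0 and plus or minus the j-th unit vector. The function vanishes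
  exactly when \<open>x $ j - v\<close> is an integer and thus acts as a periodic distance from
  v.\<close>

lemma trig_poly_sin_squared:
  fixes j :: "'n :: finite"
  shows "trig_poly (\<lambda>x. complex_of_real ((sin (pi * (x $ j - v)))\<^sup>2))"
proof -
  have alg: "(1 - (a * x + b * y) / 2) / 2 = 1 / 2 + (- a / 4) * x + (- b / 4) * y" for a b x y :: complex
    by (simp add: field_simps)
  let ?a = "axis j 1 :: real ^ 'n"
  have a: "?a \<in> int_points" by (auto simp: int_points_def axis_def)
  have "complex_of_real ((sin (pi * (x $ j - v)))\<^sup>2)
      = 1 / 2 + (- cis (- (2 * pi * v)) / 4) * ce ?a x + (- cis (2 * pi * v) / 4) * ce (- ?a) x" for x
  proof -
    have "(sin (pi * (x $ j - v)))\<^sup>2 = (1 - cos (2 * (pi * (x $ j - v)))) / 2"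
      by (simp add: cos_double_sin)
    then have "complex_of_real ((sin (pi * (x $ j - v)))\<^sup>2) = (1 - of_real (cos (2 * (pi * (x $ j - v))))) / 2"
      by (simp only:) simp
    also have "complex_of_real (cos (2 * (pi * (x $ j - v)))) =
        (cis (2 * (pi * (x $ j - v))) + cis (- (2 * (pi * (x $ j - v))))) / 2"
      by (simp add: complex_eq_iff)
    also have "cis (2 * (pi * (x $ j - v))) = cis (- (2 * pi * v)) * ce ?a x"
      by (simp add: ce_def cis_mult inner_axis' algebra_simps)
    also have "cis (- (2 * (pi * (x $ j - v)))) = cis (2 * pi * v) * ce (- ?a) x"
      by (simp add: ce_def cis_mult inner_axis' algebra_simps)
    finally show ?thesis unfolding alg .
  qed
  then show ?thesis
    by (simp only:) (intro trig_poly_add trig_poly_const trig_poly_cmult_ce a int_points_uminus)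
qed

text \<open>The induction carries the invariant that t vanishes off F, so that a new summand can be
  merged whether or not its frequency already occurs in F.\<close>

lemma trig_poly_expand:
  assumes "trig_poly T"
  obtains F t where "finite F" "F \<subseteq> int_points" "\<And>x. T x = (\<Sum>m\<in>F. t m * ce m x)"
proof -
  have "\<exists>F t. finite F \<and> F \<subseteq> int_points \<and> (\<forall>x. T x = (\<Sum>m\<in>F. t m * ce m x)) \<and> (\<forall>m. m \<notin> F \<longrightarrow> t m = 0)"
    using assms
  proof induction
    case zero
    then show ?case by (intro exI[of _ "{}"] exI[of _ "\<lambda>_. 0"]) auto
  next
    case (add_ce T k c)
    then obtain F t where *: "finite F" "F \<subseteq> int_points" "\<forall>x. T x = (\<Sum>m\<in>F. t m * ce m x)"
      "\<forall>m. m \<notin> F \<longrightarrow> t m = 0" by blast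
    have "T x + c * ce k x = (\<Sum>m\<in>insert k F. (t(k := t k + c)) m * ce m x)" for x
    proof -
      have "T x = (\<Sum>m\<in>insert k F. t m * ce m x)"
        unfolding *(3)[rule_format] by (rule sum.mono_neutral_left) (use * in auto)
      also have "\<dots> = t k * ce k x + (\<Sum>m\<in>F-{k}. t m * ce m x)"
        using *(1) by (rule sum.insert_remove)
      also have "(\<Sum>m\<in>F-{k}. t m * ce m x) = (\<Sum>m\<in>F-{k}. (t(k := t k + c)) m * ce m x)"
        by (intro sum.cong) auto
      finally show ?thesis
        using *(1) by (simp add: sum.insert_remove algebra_simps)
    qed
    then show ?case
      using * add_ce.hyps by (intro exI[of _ "insert k F"] exI[of _ "t(k := t k + c)"]) auto
  qed
  then show ?thesis using that by blast
qed

lemma trig_poly_continuous: "trig_poly T \<Longrightarrow> continuous_on UNIV T"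
  by (induction rule: trig_poly.induct) (auto intro!: continuous_intros)

text \<open>Every coefficient of a nonnegative function is at most its mean in absolute value.
  Expanding t turns the integral into a finite sum of coefficients of \<phi>, each multiplied by
  such a number.\<close>

lemma norm_integral_mult_trig_poly_le:
  fixes \<phi> :: "real ^ 'n \<Rightarrow> complex" and t :: "real ^ 'n \<Rightarrow> real"
  assumes \<phi>: "continuous_on UNIV \<phi>"
    and B: "\<And>F. finite F \<Longrightarrow> F \<subseteq> int_points \<Longrightarrow> (\<Sum>m\<in>F. norm (fc \<phi> m)) \<le> B"
    and t: "trig_poly (\<lambda>x. complex_of_real (t x))" and nonneg: "\<And>x. x \<in> unit_cube \<Longrightarrow> 0 \<le> t x"
  shows "norm (\<integral>x. \<phi> x * t x \<partial>cube_measure) \<le> B * (\<integral>x. t x \<partial>cube_measure)"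
proof -
  have ct: "continuous_on UNIV (\<lambda>x. complex_of_real (t x))"
    using t by (rule trig_poly_continuous)
  have ctr: "continuous_on UNIV t"
    using continuous_on_Re[OF ct] by simp
  obtain F c where F: "finite F" "F \<subseteq> int_points" and eq: "\<And>x. complex_of_real (t x) = (\<Sum>m\<in>F. c m * ce m x)"
    using trig_poly_expand[OF t] by blast
  define A where "A = (\<integral>x. t x \<partial>cube_measure)"
  have A0: "0 \<le> A"
    unfolding A_def by (rule integral_nonneg_AE) (use AE_cube nonneg in \<open>auto elim: eventually_mono\<close>)
  have c: "norm (c k) \<le> A" if k: "k \<in> F" for k
  proof -
    \<comment> \<open>The coefficients of t are read off, up to sign, by subtracting t from the zero
      function.\<close>
    have "fc (\<lambda>x. 0 - (\<Sum>m\<in>F. c m * ce m x)) k = - c k"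
      using F k by (subst fc_diff_trig) (auto simp: fc_def)
    then have "norm (c k) = norm (fc (\<lambda>x. - of_real (t x)) k)"
      by (simp add: eq)
    also have "\<dots> \<le> (\<integral>x. norm (- of_real (t x) * ce (- k) x) \<partial>cube_measure)"
      unfolding fc_def by (rule integral_norm_bound)
    also have "\<dots> = A"
      unfolding A_def
    proof (rule Bochner_Integration.integral_cong_AE)
      show "AE x in cube_measure. norm (- complex_of_real (t x) * ce (- k) x) = t x"
        using AE_cube nonneg by (auto elim!: eventually_mono simp: norm_mult)
    qed (auto intro!: borel_measurable_integrable integrable_cube_continuous continuous_intros ctr)
    finally show ?thesis .
  qed
  have "(\<integral>x. \<phi> x * t x \<partial>cube_measure) = (\<integral>x. (\<Sum>m\<in>F. c m * (\<phi> x * ce m x)) \<partial>cube_measure)"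
    by (rule Bochner_Integration.integral_cong) (auto simp: eq sum_distrib_left mult_ac)
  also have "\<dots> = (\<Sum>m\<in>F. c m * fc \<phi> (- m))"
    unfolding fc_def by (subst Bochner_Integration.integral_sum)
      (auto intro!: integrable_cube_continuous continuous_intros \<phi>)
  finally have "norm (\<integral>x. \<phi> x * t x \<partial>cube_measure) \<le> (\<Sum>m\<in>F. norm (c m * fc \<phi> (- m)))"
    by (simp add: norm_sum)
  also have "\<dots> \<le> (\<Sum>m\<in>F. A * norm (fc \<phi> (- m)))"
    by (intro sum_mono) (auto simp: norm_mult intro!: mult_right_mono c)
  also have "\<dots> = A * (\<Sum>m\<in>uminus ` F. norm (fc \<phi> m))"
    by (subst sum.reindex) (auto simp: sum_distrib_left)
  also have "\<dots> \<le> A * B"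
    using F A0 by (intro mult_left_mono B) (auto intro: int_points_uminus)
  finally show ?thesis by (simp add: A_def mult.commute)
qed

text \<open>Without Fejer kernels: if the bound failed at v, then Re (c \<phi>) - B would be positive near the
  integer translates of v for a suitable unimodular c. The powers T_N of a trigonometric polynomial
  that peaks there satisfy \<open>\<integral> (Re (c \<phi>) - B) T_N \<le> 0\<close>, although these integrals tend to infinity.\<close>

lemma norm_le_sum_fc:
  fixes \<phi> :: "real ^ 'n \<Rightarrow> complex"
  assumes \<phi>: "continuous_on UNIV \<phi>" and periodic: "\<And>x k. k \<in> int_points \<Longrightarrow> \<phi> (x + k) = \<phi> x"
    and B: "\<And>F. finite F \<Longrightarrow> F \<subseteq> int_points \<Longrightarrow> (\<Sum>m\<in>F. norm (fc \<phi> m)) \<le> B"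
    and v: "v \<in> unit_cube"
  shows "norm (\<phi> v) \<le> B"
proof (rule ccontr)
  assume "\<not> ?thesis"
  interpret P: prob_space "cube_measure :: (real ^ 'n) measure" by (rule prob_space_cube)
  \<comment> \<open>Multiplication by c rotates \<open>\<phi> v\<close> onto the positive real axis,
    so that \<open>\<rho> v\<close> is the assumed excess of \<open>norm (\<phi> v)\<close> over
    B.\<close>
  define c where "c = cnj (sgn (\<phi> v))"
  define \<rho> where "\<rho> y = Re (c * \<phi> y) - B" for y
  define a where "a = \<rho> v / 2"
  have B0: "0 \<le> B" using B[of "{}"] by simp
  have v0: "\<phi> v \<noteq> 0" using \<open>\<not> norm (\<phi> v) \<le> B\<close> B0 by auto
  have "c * \<phi> v = of_real (norm (\<phi> v))"
    using v0 by (simp add: c_def sgn_eq mult.commute complex_norm_square[symmetric] power2_eq_square)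
  then have "0 < \<rho> v" using \<open>\<not> norm (\<phi> v) \<le> B\<close> by (simp add: \<rho>_def)
  then have a: "0 < a" "a < \<rho> v" by (auto simp: a_def)
  have nc: "norm c = 1" using v0 by (simp add: c_def norm_sgn)
  have c\<rho>: "continuous_on UNIV \<rho>" unfolding \<rho>_def by (intro continuous_intros \<phi>)
  define s :: "real ^ 'n \<Rightarrow> real" where "s y = (\<Sum>j\<in>UNIV. (sin (pi * (y $ j - v $ j)))\<^sup>2) / CARD('n)" for y
  have cs: "continuous_on UNIV s" unfolding s_def by (intro continuous_intros) auto
  have s0: "0 \<le> s y" for y unfolding s_def by (intro divide_nonneg_nonneg sum_nonneg) auto
  have s1: "s y \<le> 1" for y
  proof -
    have "(\<Sum>j\<in>UNIV. (sin (pi * (y $ j - v $ j)))\<^sup>2) \<le> (\<Sum>j\<in>(UNIV :: 'n set). 1)"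
      by (intro sum_mono) (simp add: abs_square_le_1)
    then show ?thesis by (simp add: s_def divide_le_eq)
  qed
  define K where "K = {y \<in> unit_cube. \<rho> y \<le> a}"
  have "K = unit_cube \<inter> \<rho> -` {..a}" by (auto simp: K_def)
  then have "compact K"
    using continuous_closed_vimage[of "{..a}" \<rho>] c\<rho>
    by (simp add: unit_cube_def compact_Int_closed continuous_on_eq_continuous_at)
  have spos: "s y > 0" if "y \<in> K" for y
  proof (rule ccontr)
    assume "\<not> s y > 0"
    then have "(\<Sum>j\<in>UNIV. (sin (pi * (y $ j - v $ j)))\<^sup>2) = 0"
      using s0[of y] by (simp add: s_def)
    then have "\<forall>j. sin ((y $ j - v $ j) * pi) = 0"
      by (subst (asm) sum_nonneg_eq_0_iff) (auto simp: mult.commute)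
    then have "y - v \<in> int_points"
      by (auto simp: int_points_def sin_times_pi_eq_0)
    then have "\<phi> y = \<phi> v" using periodic[of "y - v" v] by simp
    then show False using that a by (simp add: K_def \<rho>_def)
  qed
  \<comment> \<open>Compactness of K turns pointwise positivity of s into a gap. With this \<eta>
    the base \<open>1 + \<eta> - s y\<close> is at most \<open>1 - \<eta>\<close> on K and at least
    \<open>1 + \<eta> / 2\<close> where s is below \<open>\<eta> / 2\<close>.\<close>
  obtain \<eta> where \<eta>: "0 < \<eta>" "\<eta> \<le> 1 / 4" "\<And>y. y \<in> K \<Longrightarrow> 2 * \<eta> \<le> s y"
  proof (cases "K = {}")
    case True then show ?thesis using that[of "1 / 4"] by auto
  next
    case False
    obtain y0 where "y0 \<in> K" "\<And>y. y \<in> K \<Longrightarrow> s y0 \<le> s y"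
      using continuous_attains_inf[OF \<open>compact K\<close> False continuous_on_subset[OF cs]] by auto
    then show ?thesis using that[of "min (1 / 4) (s y0 / 2)"] spos[of y0] by fastforce
  qed
  define T where "T N y = (1 + \<eta> - s y) ^ N" for N y
  have T0: "0 \<le> T N y" for N y
    using \<eta>(1) s1[of y] by (simp add: T_def)
  have cT: "continuous_on UNIV (T N)" for N unfolding T_def by (intro continuous_intros cs)
  have tT: "trig_poly (\<lambda>y. complex_of_real (T N y))" for N
  proof -
    have "(\<lambda>y. complex_of_real (T N y)) =
      (\<lambda>y. ((1 + \<eta>) + (- 1 / CARD('n)) * (\<Sum>j\<in>UNIV. complex_of_real ((sin (pi * (y $ j - v $ j)))\<^sup>2))) ^ N)"
      by (simp add: T_def s_def fun_eq_iff)
    then show ?thesis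
      by (simp only:) (intro trig_poly_power trig_poly_add trig_poly_const trig_poly_mult
          trig_poly_sum trig_poly_sin_squared)
  qed
  have le0: "(\<integral>y. \<rho> y * T N y \<partial>cube_measure) \<le> 0" for N
  proof -
    have "(\<integral>y. \<rho> y * T N y \<partial>cube_measure) = (\<integral>y. Re (c * (\<phi> y * T N y)) - B * T N y \<partial>cube_measure)"
      by (rule Bochner_Integration.integral_cong) (auto simp: \<rho>_def algebra_simps)
    also have "\<dots> = Re (c * (\<integral>y. \<phi> y * T N y \<partial>cube_measure)) - B * (\<integral>y. T N y \<partial>cube_measure)"
    proof -
      have i: "integrable cube_measure (\<lambda>y. \<phi> y * complex_of_real (T N y))"
        by (intro integrable_cube_continuous continuous_intros \<phi> cT)
      have i2: "integrable cube_measure (\<lambda>y. c * (\<phi> y * complex_of_real (T N y)))"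
        using i by (rule integrable_mult_right)
      have "(\<integral>y. Re (c * (\<phi> y * T N y)) - B * T N y \<partial>cube_measure)
          = (\<integral>y. Re (c * (\<phi> y * T N y)) \<partial>cube_measure) - (\<integral>y. B * T N y \<partial>cube_measure)"
        by (rule Bochner_Integration.integral_diff[OF integrable_Re[OF i2]])
           (intro integrable_cube_continuous continuous_intros cT)
      then show ?thesis
        unfolding integral_Re[OF i2] by (simp only: integral_mult_right_zero)
    qed
    also have "Re (c * (\<integral>y. \<phi> y * T N y \<partial>cube_measure)) \<le> norm (\<integral>y. \<phi> y * T N y \<partial>cube_measure)"
      using complex_Re_le_cmod[of "c * (\<integral>y. \<phi> y * T N y \<partial>cube_measure)"] nc by (simp add: norm_mult)
    also have "\<dots> \<le> B * (\<integral>y. T N y \<partial>cube_measure)"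
      by (rule norm_integral_mult_trig_poly_le[OF \<phi> B tT T0])
    finally show ?thesis by simp
  qed
  have "compact (\<rho> ` unit_cube)"
    unfolding unit_cube_def
    by (rule compact_continuous_image[OF continuous_on_subset[OF c\<rho>]]) auto
  then have "bounded (\<rho> ` unit_cube)" by (rule compact_imp_bounded)
  then obtain M where M: "\<And>y. y \<in> unit_cube \<Longrightarrow> \<bar>\<rho> y\<bar> \<le> M"
    unfolding bounded_iff by auto
  \<comment> \<open>The point v may lie on the boundary of the cube. Intersecting with the open cube
    gives a nonempty open set, hence one of positive measure.\<close>
  define W where "W = {y. s y < \<eta> / 2} \<inter> box (0 :: real ^ 'n) 1"
  have os: "open {y. s y < \<eta> / 2}"
    using open_Collect_less[OF cs continuous_on_const] .
  then have oW: "open W" unfolding W_def by (intro open_Int open_box)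
  have "box (0 :: real ^ 'n) 1 \<noteq> {}" by (simp add: interval_eq_empty_cart)
  then have "v \<in> closure (box 0 1)"
    using v by (simp add: unit_cube_def closure_box)
  moreover have "v \<in> {y. s y < \<eta> / 2}" using \<eta> by (simp add: s_def)
  ultimately have "W \<noteq> {}"
    using open_Int_closure_eq_empty[OF os, of "box 0 1"] unfolding W_def by blast
  have W: "W \<subseteq> unit_cube" "W \<in> sets borel"
    using oW box_subset_cbox[of "0 :: real ^ 'n" 1] by (auto simp: W_def unit_cube_def)
  have iW: "integrable cube_measure (indicator W :: _ \<Rightarrow> real)"
    by (rule integrable_cube_bounded[where B = 1]) (use W in \<open>auto simp: indicator_def\<close>)
  have "W \<notin> null_sets lborel"
    using open_not_negligible[OF oW \<open>W \<noteq> {}\<close>] null_sets_completionI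
    by (auto simp: negligible_iff_null_sets)
  then have "emeasure lborel W \<noteq> 0"
    using W by (simp add: null_sets_def)
  moreover have "emeasure cube_measure W = emeasure lborel W"
    using W by (subst emeasure_uniform_measure) (auto simp: Int_absorb1)
  ultimately have "P.prob W \<noteq> 0"
    using P.emeasure_eq_measure[of W] by auto
  then have Wpos: "0 < P.prob W" using measure_nonneg[of cube_measure W] by linarith
  \<comment> \<open>The integrand is at least -M on K, where the kernel is at most 1, grows
    geometrically on W, and is nonnegative elsewhere.\<close>
  have lower: "a * (1 + \<eta> / 2) ^ N * P.prob W - M \<le> 0" for N
  proof -
    have "a * (1 + \<eta> / 2) ^ N * P.prob W - M = (\<integral>y. a * (1 + \<eta> / 2) ^ N * indicator W y - M \<partial>cube_measure)"
      using W iW by (subst Bochner_Integration.integral_diff) (auto simp: P.prob_space)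
    also have "\<dots> \<le> (\<integral>y. \<rho> y * T N y \<partial>cube_measure)"
    proof (rule integral_mono_AE)
      show "integrable cube_measure (\<lambda>y. a * (1 + \<eta> / 2) ^ N * indicator W y - M)"
        using W iW by (intro Bochner_Integration.integrable_diff) auto
      show "integrable cube_measure (\<lambda>y. \<rho> y * T N y)"
        by (intro integrable_cube_continuous continuous_intros c\<rho> cT)
      show "AE y in cube_measure. a * (1 + \<eta> / 2) ^ N * indicator W y - M \<le> \<rho> y * T N y"
        using AE_cube
      proof eventually_elim
        case (elim y)
        have M0: "0 \<le> M" using M[OF elim] by linarith
        show ?case
        proof (cases "y \<in> K")
          case True
          then have "y \<notin> W" using \<eta>(3)[OF True] \<eta>(1) by (auto simp: W_def)
          have "T N y \<le> 1" unfolding T_def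
            using \<eta>(3)[OF True] \<eta>(1) s1[of y] by (intro power_le_one) auto
          have "\<bar>\<rho> y * T N y\<bar> \<le> M * 1"
            unfolding abs_mult using M[OF elim] \<open>T N y \<le> 1\<close> T0[of N y] by (intro mult_mono) auto
          then show ?thesis using \<open>y \<notin> W\<close> by auto
        next
          case False
          then have ge: "a \<le> \<rho> y" using elim by (auto simp: K_def)
          show ?thesis
          proof (cases "y \<in> W")
            case True
            then have "(1 + \<eta> / 2) ^ N \<le> T N y"
              unfolding T_def using \<eta>(1) by (intro power_mono) (auto simp: W_def)
            then have "a * (1 + \<eta> / 2) ^ N \<le> \<rho> y * T N y"
              using ge a \<eta>(1) by (intro mult_mono) auto
            then show ?thesis using True M0 by auto
          next
            case False
            then show ?thesis using ge a T0[of N y] M0 by (auto intro: order_trans[of _ 0])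
          qed
        qed
      qed
    qed
    also have "\<dots> \<le> 0" by (rule le0)
    finally show ?thesis .
  qed
  obtain N where "M / (a * P.prob W) < (1 + \<eta> / 2) ^ N"
    using real_arch_pow[of "1 + \<eta> / 2"] \<eta> by auto
  then have "M < a * (1 + \<eta> / 2) ^ N * P.prob W"
    using a Wpos by (simp add: divide_less_eq mult_ac)
  then show False using lower[of N] by linarith
qed

text \<open>Choose F so that its absolute coefficient sum is within \<epsilon> of the supremum S.
  The remainder of the Fourier series after F then has absolute coefficient sums at most \<epsilon>,
  hence by \<open>norm_le_sum_fc\<close> it is at most \<epsilon> on the whole cube, and Pythagoras
  finishes.\<close>

lemma parseval_le:
  fixes \<phi> :: "real ^ 'n \<Rightarrow> complex"
  assumes \<phi>: "continuous_on UNIV \<phi>" and periodic: "\<And>x k. k \<in> int_points \<Longrightarrow> \<phi> (x + k) = \<phi> x"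
    and B: "\<And>F. finite F \<Longrightarrow> F \<subseteq> int_points \<Longrightarrow> (\<Sum>m\<in>F. norm (fc \<phi> m)) \<le> B"
    and \<epsilon>: "0 < \<epsilon>"
  shows "\<exists>F. finite F \<and> F \<subseteq> int_points \<and>
    (\<integral>x. (norm (\<phi> x))\<^sup>2 \<partial>cube_measure) \<le> \<epsilon>\<^sup>2 + (\<Sum>m\<in>F. (norm (fc \<phi> m))\<^sup>2)"
proof -
  interpret P: prob_space "cube_measure :: (real ^ 'n) measure" by (rule prob_space_cube)
  define \<F> where "\<F> = {F. finite F \<and> F \<subseteq> (int_points :: (real ^ 'n) set)}"
  define S where "S = (SUP F\<in>\<F>. \<Sum>m\<in>F. norm (fc \<phi> m))"
  have bdd: "bdd_above ((\<lambda>F. \<Sum>m\<in>F. norm (fc \<phi> m)) ` \<F>)"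
    using B by (auto simp: \<F>_def bdd_above_def)
  have "{} \<in> \<F>" by (simp add: \<F>_def)
  then have "\<exists>F\<in>\<F>. S - \<epsilon> < (\<Sum>m\<in>F. norm (fc \<phi> m))"
    using less_cSUP_iff[of \<F> "\<lambda>F. \<Sum>m\<in>F. norm (fc \<phi> m)" "S - \<epsilon>"] bdd \<epsilon> by (auto simp: S_def)
  then obtain F where F: "finite F" "F \<subseteq> int_points" "S - \<epsilon> < (\<Sum>m\<in>F. norm (fc \<phi> m))"
    by (auto simp: \<F>_def)
  define \<psi> where "\<psi> x = \<phi> x - (\<Sum>m\<in>F. fc \<phi> m * ce m x)" for x
  have c\<psi>: "continuous_on UNIV \<psi>" unfolding \<psi>_def by (intro continuous_intros \<phi>)
  have "norm (\<psi> x) \<le> \<epsilon>" if "x \<in> unit_cube" for x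
  proof (rule norm_le_sum_fc[OF c\<psi> _ _ that])
    show "\<psi> (x + k) = \<psi> x" if k: "k \<in> int_points" for x k
    proof -
      have "ce m (x + k) = ce m x" if "m \<in> F" for m
        using F(2) that k by (auto simp: ce_add_right ce_int)
      then show ?thesis by (simp add: \<psi>_def periodic k)
    qed
    show "(\<Sum>m\<in>G. norm (fc \<psi> m)) \<le> \<epsilon>" if G: "finite G" "G \<subseteq> int_points" for G
    proof -
      have "(\<Sum>m\<in>G. norm (fc \<psi> m)) = (\<Sum>m\<in>G. if m \<in> F then 0 else norm (fc \<phi> m))"
        unfolding \<psi>_def using G by (intro sum.cong refl) (auto simp: fc_diff_trig[OF \<phi> F(1,2)])
      also have "\<dots> = (\<Sum>m\<in>G-F. norm (fc \<phi> m))"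
        using G by (simp add: sum.If_cases Diff_eq)
      also have "\<dots> = (\<Sum>m\<in>F \<union> (G-F). norm (fc \<phi> m)) - (\<Sum>m\<in>F. norm (fc \<phi> m))"
        using F G by (subst sum.union_disjoint) auto
      also have "(\<Sum>m\<in>F \<union> (G-F). norm (fc \<phi> m)) \<le> S"
        unfolding S_def by (rule cSUP_upper[OF _ bdd]) (use F G in \<open>auto simp: \<F>_def\<close>)
      finally show ?thesis using F(3) by linarith
    qed
  qed
  then have *: "(norm (\<psi> x))\<^sup>2 \<le> \<epsilon>\<^sup>2" if "x \<in> unit_cube" for x
    using that by (intro power_mono) auto
  have "(\<integral>x. (norm (\<psi> x))\<^sup>2 \<partial>cube_measure) \<le> (\<integral>x. \<epsilon>\<^sup>2 \<partial>(cube_measure :: (real ^ 'n) measure))"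
    by (rule integral_mono_AE)
       (use AE_cube in \<open>auto intro!: integrable_cube_continuous continuous_intros c\<psi> elim!: eventually_mono simp: *\<close>)
  then have "(\<integral>x. (norm (\<psi> x))\<^sup>2 \<partial>cube_measure) \<le> \<epsilon>\<^sup>2"
    using P.prob_space by simp
  then show ?thesis
    using integral_cube_norm_diff_trig[OF \<phi> F(1,2)] F(1,2) unfolding \<psi>_def
    by (intro exI[of _ F]) auto
qed

subsection \<open>Lattice periodization\<close>

definition int_box :: "nat \<Rightarrow> (real ^ 'n) set" where
  "int_box R = {m \<in> int_points. \<forall>i. \<bar>m $ i\<bar> \<le> real R}"

lemma int_box_subset: "int_box R \<subseteq> int_points"
  by (auto simp: int_box_def)

lemma int_box_eq_image:
  "int_box R = (\<lambda>f. \<chi> i. real_of_int (f i)) ` PiE (UNIV :: 'n :: finite set) (\<lambda>_. {- int R..int R})"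
proof (intro equalityI subsetI)
  fix m :: "real ^ 'n" assume m: "m \<in> int_box R"
  have f: "real_of_int \<lfloor>m $ i\<rfloor> = m $ i" for i
  proof -
    have "m $ i \<in> \<int>" using m by (auto simp: int_box_def int_points_def)
    then show ?thesis by (auto elim: Ints_cases)
  qed
  have "\<lfloor>m $ i\<rfloor> \<in> {- int R..int R}" for i
  proof -
    have "\<bar>real_of_int \<lfloor>m $ i\<rfloor>\<bar> \<le> real R" using m unfolding f by (simp add: int_box_def)
    then show ?thesis by (simp add: abs_le_iff)
  qed
  moreover have "m = (\<chi> i. real_of_int \<lfloor>m $ i\<rfloor>)" by (simp add: vec_eq_iff f)
  ultimately show "m \<in> (\<lambda>f. \<chi> i. real_of_int (f i)) ` PiE (UNIV :: 'n set) (\<lambda>_. {- int R..int R})"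
    by (intro image_eqI[where x = "\<lambda>i. \<lfloor>m $ i\<rfloor>"]) auto
next
  fix m :: "real ^ 'n" assume "m \<in> (\<lambda>f. \<chi> i. real_of_int (f i)) ` PiE (UNIV :: 'n set) (\<lambda>_. {- int R..int R})"
  then obtain f where f: "m = (\<chi> i. real_of_int (f i))" and "f \<in> PiE (UNIV :: 'n set) (\<lambda>_. {- int R..int R})"
    by blast
  then have f_mem: "f i \<in> {- int R..int R}" for i by auto
  have "\<bar>real_of_int (f i)\<bar> \<le> real R" for i
    using f_mem[of i] by (auto simp: abs_le_iff)
  then show "m \<in> int_box R" by (auto simp: int_box_def int_points_def f)
qed

lemma finite_int_box [simp]: "finite (int_box R :: (real ^ 'n) set)"
  unfolding int_box_eq_image by (intro finite_imageI finite_PiE) auto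

lemma card_int_box: "card (int_box R :: (real ^ 'n) set) \<le> (2 * R + 1) ^ CARD('n)"
proof -
  have "card (int_box R :: (real ^ 'n) set) \<le> card (PiE (UNIV :: 'n set) (\<lambda>_. {- int R..int R}))"
    unfolding int_box_eq_image by (intro card_image_le finite_PiE) auto
  also have "\<dots> = (2 * R + 1) ^ CARD('n)"
    by (subst card_PiE) (auto simp: nat_add_distrib nat_mult_distrib)
  finally show ?thesis .
qed

lemma countable_int_points: "countable (int_points :: (real ^ 'n) set)"
proof -
  have "int_points = (\<Union>R. int_box R :: (real ^ 'n) set)"
  proof (intro equalityI subsetI)
    fix m :: "real ^ 'n" assume m: "m \<in> int_points"
    obtain R where R: "norm m \<le> real R" using real_arch_simple by blast
    have "\<bar>m $ i\<bar> \<le> real R" for i using component_le_norm_cart[of m i] R by linarith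
    then show "m \<in> (\<Union>R. int_box R)" using m by (auto simp: int_box_def)
  qed (use int_box_subset in auto)
  then show ?thesis by (metis countable_UN countable_finite finite_int_box countableI_type)
qed

text \<open>Half-open, so that its integer translates partition the space: x lies in exactly the
  translate by \<open>floor_vec x\<close>. It differs from \<open>unit_cube\<close> by a null
  set.\<close>

definition half_cube :: "(real ^ 'n) set" where
  "half_cube = {x. \<forall>i. 0 \<le> x $ i \<and> x $ i < 1}"

definition floor_vec :: "real ^ 'n \<Rightarrow> real ^ 'n" where
  "floor_vec x = (\<chi> i. of_int \<lfloor>x $ i\<rfloor>)"

lemma floor_vec_int [simp]: "floor_vec x \<in> int_points"
  by (simp add: floor_vec_def int_points_def)

lemma diff_mem_half_cube_iff:
  assumes "k \<in> int_points"
  shows "x - k \<in> half_cube \<longleftrightarrow> k = floor_vec x"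
proof -
  have "0 \<le> x $ i - k $ i \<and> x $ i - k $ i < 1 \<longleftrightarrow> k $ i = of_int \<lfloor>x $ i\<rfloor>" for i
  proof -
    obtain j where j: "k $ i = of_int j" using assms by (auto simp: int_points_def elim: Ints_cases)
    have "0 \<le> x $ i - of_int j \<and> x $ i - of_int j < 1 \<longleftrightarrow> \<lfloor>x $ i\<rfloor> = j"
      unfolding floor_eq_iff by linarith
    then show ?thesis unfolding j by auto
  qed
  then show ?thesis by (auto simp: half_cube_def floor_vec_def vec_eq_iff)
qed

lemma half_cube_measurable [measurable]: "half_cube \<in> sets borel"
proof -
  have "half_cube = (\<Inter>i. {x :: real ^ 'n. 0 \<le> x $ i} \<inter> {x. x $ i < 1})"
    by (auto simp: half_cube_def)
  also have "\<dots> \<in> sets borel"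
    by (intro sets.countable_INT'') auto
  finally show ?thesis .
qed

lemma AE_half_cube: "AE x in lborel. x \<in> half_cube \<longleftrightarrow> x \<in> (unit_cube :: (real ^ 'n) set)"
proof -
  have "AE x in lborel. x \<in> unit_cube \<longrightarrow> x \<in> box (0 :: real ^ 'n) 1"
    using AE_cube_box by (subst (asm) AE_uniform_measure) auto
  then show ?thesis
  proof eventually_elim
    case (elim x)
    have "x \<in> half_cube" if "x \<in> box (0 :: real ^ 'n) 1"
      using that by (auto simp: half_cube_def mem_box_cart less_imp_le)
    moreover have "x \<in> unit_cube" if "x \<in> half_cube"
      using that by (auto simp: half_cube_def mem_unit_cube less_imp_le)
    ultimately show ?case using elim by blast
  qed
qed

lemma nn_integral_lborel_translate:
  fixes f :: "'a :: euclidean_space \<Rightarrow> ennreal"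
  assumes [measurable]: "f \<in> borel_measurable borel"
  shows "(\<integral>\<^sup>+x. f x \<partial>lborel) = (\<integral>\<^sup>+x. f (k + x) \<partial>lborel)"
proof -
  have "(\<integral>\<^sup>+x. f x \<partial>lborel) = (\<integral>\<^sup>+x. f x \<partial>distr lborel borel ((+) k))"
    by (simp only: lborel_distr_plus)
  then show ?thesis by (simp add: nn_integral_distr)
qed

lemma integral_lborel_translate:
  fixes f :: "real ^ 'n \<Rightarrow> 'b :: {banach, second_countable_topology}"
  assumes [measurable]: "f \<in> borel_measurable borel"
  shows "(\<integral>x. f x \<partial>lborel) = (\<integral>x. f (k + x) \<partial>lborel)"
proof -
  have "(\<integral>x. f x \<partial>lborel) = (\<integral>x. f x \<partial>distr lborel borel ((+) k))"
    by (simp only: lborel_distr_plus)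
  then show ?thesis by (simp add: integral_distr)
qed

text \<open>Inserts the partition of unity formed by the translated indicators of
  \<open>half_cube\<close> and shifts every tile back to the cube.\<close>

lemma nn_integral_tiling:
  fixes f :: "real ^ 'n \<Rightarrow> ennreal"
  assumes [measurable]: "f \<in> borel_measurable borel"
  shows "(\<integral>\<^sup>+x. f x \<partial>lborel) = (\<integral>\<^sup>+k. (\<integral>\<^sup>+y. f (k + y) \<partial>cube_measure) \<partial>count_space int_points)"
proof -
  have one: "(\<integral>\<^sup>+k. indicator half_cube (x - k) * f x \<partial>count_space int_points) = f x" for x
  proof -
    have "(\<integral>\<^sup>+k. indicator half_cube (x - k) * f x \<partial>count_space int_points)
        = (\<integral>\<^sup>+k. f x * indicator {floor_vec x} k \<partial>count_space int_points)"
      by (rule nn_integral_cong) (auto simp: diff_mem_half_cube_iff indicator_def)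
    also have "\<dots> = f x"
      by (subst nn_integral_cmult_indicator) auto
    finally show ?thesis .
  qed
  have "(\<integral>\<^sup>+x. f x \<partial>lborel) = (\<integral>\<^sup>+x. (\<integral>\<^sup>+k. indicator half_cube (x - k) * f x \<partial>count_space int_points) \<partial>lborel)"
    by (simp add: one)
  also have "\<dots> = (\<integral>\<^sup>+k. (\<integral>\<^sup>+x. indicator half_cube (x - k) * f x \<partial>lborel) \<partial>count_space int_points)"
    by (rule nn_integral_count_space_nn_integral) (auto intro: countable_int_points)
  also have "\<dots> = (\<integral>\<^sup>+k. (\<integral>\<^sup>+y. f (k + y) \<partial>cube_measure) \<partial>count_space int_points)"
  proof (rule nn_integral_cong)
    fix k :: "real ^ 'n"
    have "(\<integral>\<^sup>+x. indicator half_cube (x - k) * f x \<partial>lborel) = (\<integral>\<^sup>+x. indicator half_cube (k + x - k) * f (k + x) \<partial>lborel)"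
      by (rule nn_integral_lborel_translate) auto
    also have "\<dots> = (\<integral>\<^sup>+x. f (k + x) * indicator unit_cube x \<partial>lborel)"
      by (rule nn_integral_cong_AE) (use AE_half_cube in \<open>auto elim!: eventually_mono simp: indicator_def\<close>)
    also have "\<dots> = (\<integral>\<^sup>+y. f (k + y) \<partial>cube_measure)"
      by (rule nn_integral_cube[symmetric]) auto
    finally show "(\<integral>\<^sup>+x. indicator half_cube (x - k) * f x \<partial>lborel) = (\<integral>\<^sup>+y. f (k + y) \<partial>cube_measure)" .
  qed
  finally show ?thesis .
qed

text \<open>Bounded support leaves finitely many tiles, so no exchange of limits arises for signed
  or complex f. The summand 1 in \<open>\<rho> + 1\<close> pays for rounding a coordinate
  down.\<close>

lemma integral_tiling:
  fixes f :: "real ^ 'n \<Rightarrow> 'b :: {banach, second_countable_topology}"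
  assumes f: "integrable lborel f"
    and supp: "\<And>z i. f z \<noteq> 0 \<Longrightarrow> \<bar>z $ i\<bar> \<le> \<rho>" and R: "\<rho> + 1 \<le> real R"
  shows "(\<integral>x. f x \<partial>lborel) = (\<Sum>k\<in>int_box R. \<integral>y. f (k + y) \<partial>cube_measure)"
proof -
  have [measurable]: "f \<in> borel_measurable borel"
    using f by auto
  have one: "(\<Sum>k\<in>int_box R. indicator half_cube (x - k) *\<^sub>R f x) = f x" for x
  proof (cases "f x = 0")
    case False
    have "floor_vec x \<in> int_box R"
    proof -
      have "\<bar>real_of_int \<lfloor>x $ i\<rfloor>\<bar> \<le> real R" for i
        using supp[OF False, of i] R by linarith
      then show ?thesis
        unfolding int_box_def using floor_vec_int[of x] by (simp add: floor_vec_def)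
    qed
    moreover have "(\<Sum>k\<in>int_box R. indicator half_cube (x - k) *\<^sub>R f x) = (\<Sum>k\<in>int_box R. if k = floor_vec x then f x else 0)"
      by (rule sum.cong) (auto simp: diff_mem_half_cube_iff[OF subsetD[OF int_box_subset]] indicator_def)
    ultimately show ?thesis by simp
  qed simp
  have "(\<integral>x. f x \<partial>lborel) = (\<integral>x. (\<Sum>k\<in>int_box R. indicator half_cube (x - k) *\<^sub>R f x) \<partial>lborel)"
    by (simp only: one)
  also have "\<dots> = (\<Sum>k\<in>int_box R. \<integral>x. indicator half_cube (x - k) *\<^sub>R f x \<partial>lborel)"
  proof (rule Bochner_Integration.integral_sum)
    show "integrable lborel (\<lambda>x. indicator half_cube (x - k) *\<^sub>R f x)" for k
      by (rule Bochner_Integration.integrable_bound[OF f]) (auto simp: indicator_def)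
  qed
  also have "\<dots> = (\<Sum>k\<in>int_box R. \<integral>y. f (k + y) \<partial>cube_measure)"
  proof (rule sum.cong[OF refl])
    fix k :: "real ^ 'n"
    have "(\<integral>x. indicator half_cube (x - k) *\<^sub>R f x \<partial>lborel) = (\<integral>x. indicator half_cube (k + x - k) *\<^sub>R f (k + x) \<partial>lborel)"
      by (rule integral_lborel_translate) measurable
    also have "\<dots> = (\<integral>x. indicator unit_cube x *\<^sub>R f (k + x) \<partial>lborel)"
    proof (rule Bochner_Integration.integral_cong_AE)
      show "AE x in lborel. indicator half_cube (k + x - k) *\<^sub>R f (k + x) = indicator unit_cube x *\<^sub>R f (k + x)"
        using AE_half_cube by (auto elim!: eventually_mono simp: indicator_def)
    qed measurable
    also have "\<dots> = (\<integral>y. f (k + y) \<partial>cube_measure)"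
      by (rule integral_cube[symmetric]) measurable
    finally show "(\<integral>x. indicator half_cube (x - k) *\<^sub>R f x \<partial>lborel) = (\<integral>y. f (k + y) \<partial>cube_measure)" .
  qed
  finally show ?thesis .
qed

section \<open>Linear change of variables in Lebesgue integrals\<close>

lemma continuous_on_matrix_vector [continuous_intros]:
  fixes A :: "real ^ 'n ^ 'm"
  assumes "continuous_on S f"
  shows "continuous_on S (\<lambda>x. A *v f x)"
  by (rule bounded_linear.continuous_on[OF matrix_vector_mul_bounded_linear assms])

lemma measurable_matrix_vector [measurable]:
  fixes A :: "real ^ 'n ^ 'm"
  shows "(\<lambda>x. A *v x) \<in> borel_measurable borel"
  by (intro borel_measurable_continuous_onI continuous_intros)

lemma matrix_inv_mult:
  fixes A :: "real ^ 'n ^ 'n"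
  assumes "invertible A"
  shows "A ** matrix_inv A = mat 1" "matrix_inv A ** A = mat 1"
proof -
  have "\<exists>A'. A ** A' = mat 1 \<and> A' ** A = mat 1"
    using assms by (simp add: invertible_def)
  then have "A ** matrix_inv A = mat 1 \<and> matrix_inv A ** A = mat 1"
    unfolding matrix_inv_def by (rule someI_ex)
  then show "A ** matrix_inv A = mat 1" "matrix_inv A ** A = mat 1" by auto
qed

lemma emeasure_slab:
  fixes l u :: "real ^ 'n"
  assumes "\<And>j. l $ j \<le> u $ j"
  shows "emeasure lborel ({x. x $ i \<in> {0..1}} \<inter> {x. \<forall>j. j \<noteq> i \<longrightarrow> l $ j < x $ j \<and> x $ j < u $ j})
    = ennreal (\<Prod>j\<in>UNIV-{i}. u $ j - l $ j)" (is "emeasure lborel ?X = _")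
proof -
  let ?l = "upd l i 0" and ?u = "upd u i 1"
  have le: "\<forall>b\<in>Basis. ?l \<bullet> b \<le> ?u \<bullet> b"
    using assms by (auto simp: Basis_vec_def inner_axis)
  have prod: "(\<Prod>b\<in>Basis. (?u - ?l) \<bullet> b) = (\<Prod>j\<in>UNIV-{i}. u $ j - l $ j)"
  proof -
    have "(\<Prod>b\<in>Basis. (?u - ?l) \<bullet> b) = (\<Prod>j\<in>UNIV. (?u - ?l) $ j)"
      by (simp add: Basis_vec_def prod.UNION_disjoint axis_eq_axis inner_axis)
    also have "\<dots> = (\<Prod>j\<in>UNIV-{i}. u $ j - l $ j)"
      by (subst prod.remove[of _ i]) (auto intro!: prod.cong)
    finally show ?thesis .
  qed
  have X: "?X \<in> sets borel"
  proof -
    have "?X = {x \<in> space borel. x $ i \<in> {0..1} \<and> (\<forall>j. j \<noteq> i \<longrightarrow> l $ j < x $ j \<and> x $ j < u $ j)}"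
      by auto
    also have "\<dots> \<in> sets borel" by measurable
    finally show ?thesis .
  qed
  have "emeasure lborel (box ?l ?u) \<le> emeasure lborel ?X"
    using X by (intro emeasure_mono) (auto simp: mem_box_cart less_imp_le split: if_splits)
  moreover have "emeasure lborel ?X \<le> emeasure lborel (cbox ?l ?u)"
    by (intro emeasure_mono) (auto simp: mem_box_cart less_imp_le)
  moreover have "emeasure lborel (box ?l ?u) = emeasure lborel (cbox ?l ?u)"
    by (simp add: emeasure_lborel_box_eq emeasure_lborel_cbox_eq)
  moreover have "emeasure lborel (cbox ?l ?u) = ennreal (\<Prod>j\<in>UNIV-{i}. u $ j - l $ j)"
    using le prod by (simp add: emeasure_lborel_cbox_eq)
  ultimately show ?thesis by simp
qed

text \<open>Fubini for a single coordinate over the whole space. The outer variable is still a full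
  vector; its i-th coordinate is a dummy confined to [0,1], which contributes mass 1 and is then
  overwritten by t.\<close>

lemma lborel_slice:
  "lborel = distr (density lborel (indicator {x :: real ^ 'n. x $ i \<in> {0..1}}) \<Otimes>\<^sub>M lborel) borel (\<lambda>(x, t). upd x i t)"
proof (rule lborel_eqI)
  let ?D = "density lborel (indicator {x :: real ^ 'n. x $ i \<in> {0..1}})"
  fix l u :: "real ^ 'n"
  assume "\<And>b. b \<in> Basis \<Longrightarrow> l \<bullet> b \<le> u \<bullet> b"
  then have lu: "l $ j \<le> u $ j" for j by (simp add: cart_eq_inner_axis)
  let ?Y = "{x :: real ^ 'n. \<forall>j. j \<noteq> i \<longrightarrow> l $ j < x $ j \<and> x $ j < u $ j}"
  have Y: "?Y \<in> sets borel"
  proof -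
    have "?Y = {x \<in> space borel. \<forall>j. j \<noteq> i \<longrightarrow> l $ j < x $ j \<and> x $ j < u $ j}" by auto
    also have "\<dots> \<in> sets borel" by measurable
    finally show ?thesis .
  qed
  have S: "{x :: real ^ 'n. x $ i \<in> {0..1}} \<in> sets borel"
  proof -
    have "{x :: real ^ 'n. x $ i \<in> {0..1}} = {x \<in> space borel. x $ i \<in> {0..1}}" by auto
    also have "\<dots> \<in> sets borel" by measurable
    finally show ?thesis .
  qed
  have "emeasure (distr (?D \<Otimes>\<^sub>M lborel) borel (\<lambda>(x, t). upd x i t)) (box l u)
      = emeasure (?D \<Otimes>\<^sub>M lborel) ((\<lambda>(x, t). upd x i t) -` box l u \<inter> space (?D \<Otimes>\<^sub>M lborel))"
    by (subst emeasure_distr) auto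
  also have "(\<lambda>(x, t). upd x i t) -` box l u \<inter> space (?D \<Otimes>\<^sub>M lborel) = ?Y \<times> {l $ i<..<u $ i}"
    by (auto simp: mem_box_cart space_pair_measure split: if_splits)
  also have "emeasure (?D \<Otimes>\<^sub>M lborel) \<dots> = emeasure ?D ?Y * emeasure lborel {l $ i<..<u $ i}"
    by (rule lborel.emeasure_pair_measure_Times) (use Y in auto)
  also have "emeasure ?D ?Y = emeasure lborel ({x. x $ i \<in> {0..1}} \<inter> ?Y)"
    using S Y by (subst emeasure_density) (auto simp: nn_integral_indicator[symmetric] indicator_inter_arith simp del: nn_integral_indicator)
  also have "\<dots> = ennreal (\<Prod>j\<in>UNIV-{i}. u $ j - l $ j)"
    by (rule emeasure_slab[OF lu])
  also have "emeasure lborel {l $ i<..<u $ i} = ennreal (u $ i - l $ i)"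
    using lu by simp
  also have "ennreal (\<Prod>j\<in>UNIV-{i}. u $ j - l $ j) * ennreal (u $ i - l $ i) = ennreal (\<Prod>j\<in>UNIV. u $ j - l $ j)"
    using lu by (subst prod.remove[of UNIV i]) (auto simp: ennreal_mult' mult.commute prod_nonneg)
  also have "(\<Prod>j\<in>UNIV. u $ j - l $ j) = (\<Prod>b\<in>Basis. (u - l) \<bullet> b)"
    by (simp add: Basis_vec_def prod.UNION_disjoint axis_eq_axis inner_axis)
  finally show "emeasure (distr (?D \<Otimes>\<^sub>M lborel) borel (\<lambda>(x, t). upd x i t)) (box l u)
      = ennreal (\<Prod>b\<in>Basis. (u - l) \<bullet> b)" .
qed simp

lemma nn_integral_slice:
  fixes f :: "real ^ 'n \<Rightarrow> ennreal"
  assumes [measurable]: "f \<in> borel_measurable borel"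
  shows "(\<integral>\<^sup>+x. f x \<partial>lborel)
    = (\<integral>\<^sup>+x. (\<integral>\<^sup>+t. f (upd x i t) \<partial>lborel) \<partial>density lborel (indicator {x. x $ i \<in> {0..1}}))"
proof -
  let ?D = "density lborel (indicator {x :: real ^ 'n. x $ i \<in> {0..1}})"
  have "(\<integral>\<^sup>+x. f x \<partial>lborel) = (\<integral>\<^sup>+p. f (upd (fst p) i (snd p)) \<partial>(?D \<Otimes>\<^sub>M lborel))"
  proof -
    have "(\<integral>\<^sup>+x. f x \<partial>lborel) = (\<integral>\<^sup>+x. f x \<partial>distr (?D \<Otimes>\<^sub>M lborel) borel (\<lambda>(x, t). upd x i t))"
      by (simp only: lborel_slice[of i, symmetric])
    then show ?thesis by (simp add: nn_integral_distr case_prod_unfold)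
  qed
  also have "\<dots> = (\<integral>\<^sup>+x. (\<integral>\<^sup>+t. f (upd x i t) \<partial>lborel) \<partial>?D)"
    by (subst lborel.nn_integral_fst[symmetric]) auto
  finally show ?thesis .
qed

text \<open>On a line in direction m the coordinate n is constant, so the shear acts there as a
  translation.\<close>

lemma nn_integral_shear:
  fixes f :: "real ^ 'n \<Rightarrow> ennreal"
  assumes [measurable]: "f \<in> borel_measurable borel" and "m \<noteq> n"
  shows "(\<integral>\<^sup>+x. f (upd x m (x $ m + c * x $ n)) \<partial>lborel) = (\<integral>\<^sup>+x. f x \<partial>lborel)"
proof -
  let ?D = "density lborel (indicator {x :: real ^ 'n. x $ m \<in> {0..1}})"
  have "(\<integral>\<^sup>+x. f (upd x m (x $ m + c * x $ n)) \<partial>lborel) = (\<integral>\<^sup>+x. (\<integral>\<^sup>+t. f (upd x m (t + c * x $ n)) \<partial>lborel) \<partial>?D)"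
    using \<open>m \<noteq> n\<close> by (subst nn_integral_slice[where i = m]) auto
  also have "\<dots> = (\<integral>\<^sup>+x. (\<integral>\<^sup>+t. f (upd x m t) \<partial>lborel) \<partial>?D)"
  proof (rule nn_integral_cong)
    fix x :: "real ^ 'n"
    show "(\<integral>\<^sup>+t. f (upd x m (t + c * x $ n)) \<partial>lborel) = (\<integral>\<^sup>+t. f (upd x m t) \<partial>lborel)"
      using nn_integral_lborel_translate[of "\<lambda>t. f (upd x m t)" "c * x $ n"] by (simp add: add.commute)
  qed
  also have "\<dots> = (\<integral>\<^sup>+x. f x \<partial>lborel)"
    by (rule nn_integral_slice[symmetric]) auto
  finally show ?thesis .
qed

lemma nn_integral_swap_coordinates:
  fixes f :: "real ^ 'n \<Rightarrow> ennreal" and \<pi> :: "'n \<Rightarrow> 'n"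
  assumes [measurable]: "f \<in> borel_measurable borel" and \<pi>: "bij \<pi>"
  shows "(\<integral>\<^sup>+x. f (\<chi> i. x $ \<pi> i) \<partial>lborel) = (\<integral>\<^sup>+x. f x \<partial>lborel)"
proof -
  have [measurable]: "(\<lambda>x :: real ^ 'n. \<chi> i. x $ \<pi> i) \<in> borel_measurable borel"
    unfolding measurable_vec_iff by simp
  have "lborel = distr lborel borel (\<lambda>x :: real ^ 'n. \<chi> i. x $ \<pi> i)"
  proof (rule lborel_eqI)
    fix l u :: "real ^ 'n"
    assume "\<And>b. b \<in> Basis \<Longrightarrow> l \<bullet> b \<le> u \<bullet> b"
    then have lu: "l $ j \<le> u $ j" for j by (simp add: cart_eq_inner_axis)
    let ?l = "\<chi> i. l $ inv \<pi> i" and ?u = "\<chi> i. u $ inv \<pi> i"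
    have basis: "(\<Prod>b\<in>Basis. (u - l) \<bullet> b) = (\<Prod>j\<in>UNIV. u $ j - l $ j)" for u l :: "real ^ 'n"
      by (simp add: Basis_vec_def prod.UNION_disjoint axis_eq_axis inner_axis)
    have "x \<in> box ?l ?u \<longleftrightarrow> (\<chi> i. x $ \<pi> i) \<in> box l u" for x
    proof -
      have "(\<forall>i. l $ inv \<pi> i < x $ i \<and> x $ i < u $ inv \<pi> i) \<longleftrightarrow> (\<forall>i. l $ i < x $ \<pi> i \<and> x $ \<pi> i < u $ i)"
        using \<pi> by (metis bij_inv_eq_iff)
      then show ?thesis by (simp add: mem_box_cart)
    qed
    then have "(\<lambda>x. \<chi> i. x $ \<pi> i) -` box l u = box ?l ?u" by auto
    then have "emeasure (distr lborel borel (\<lambda>x :: real ^ 'n. \<chi> i. x $ \<pi> i)) (box l u) = emeasure lborel (box ?l ?u)"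
      by (simp add: emeasure_distr)
    also have "\<dots> = ennreal (\<Prod>j\<in>UNIV. u $ inv \<pi> j - l $ inv \<pi> j)"
      using lu by (subst emeasure_lborel_box_eq, subst basis) (auto simp: Basis_vec_def inner_axis)
    also have "(\<Prod>j\<in>UNIV. u $ inv \<pi> j - l $ inv \<pi> j) = (\<Prod>j\<in>UNIV. u $ j - l $ j)"
      using bij_betw_inv_into[OF \<pi>] by (rule prod.reindex_bij_betw)
    finally show "emeasure (distr lborel borel (\<lambda>x :: real ^ 'n. \<chi> i. x $ \<pi> i)) (box l u)
        = ennreal (\<Prod>b\<in>Basis. (u - l) \<bullet> b)" by (simp only: basis)
  qed simp
  then have "(\<integral>\<^sup>+x. f x \<partial>lborel) = (\<integral>\<^sup>+x. f x \<partial>distr lborel borel (\<lambda>x :: real ^ 'n. \<chi> i. x $ \<pi> i))"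
    by simp
  also have "\<dots> = (\<integral>\<^sup>+x. f (\<chi> i. x $ \<pi> i) \<partial>lborel)"
    by (subst nn_integral_distr) auto
  finally show ?thesis by simp
qed

lemma nn_integral_scale_coordinates:
  fixes f :: "real ^ 'n \<Rightarrow> ennreal" and c :: "'n \<Rightarrow> real"
  assumes [measurable]: "f \<in> borel_measurable borel" and c: "\<And>i. c i \<noteq> 0"
  shows "(\<integral>\<^sup>+x. f x \<partial>lborel) = ennreal (\<Prod>i\<in>UNIV. \<bar>c i\<bar>) * (\<integral>\<^sup>+x. f (\<chi> i. c i * x $ i) \<partial>lborel)"
proof -
  define c' :: "real ^ 'n \<Rightarrow> real" where "c' b = b \<bullet> (\<chi> i. c i)" for b
  have c'0: "c' b \<noteq> 0" if "b \<in> Basis" for b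
    using that c by (auto simp: c'_def Basis_vec_def inner_axis')
  have T: "(0 :: real ^ 'n) + (\<Sum>j\<in>Basis. (c' j * (x \<bullet> j)) *\<^sub>R j) = (\<chi> i. c i * x $ i)" for x :: "real ^ 'n"
  proof -
    have "(\<Sum>j\<in>Basis. (c' j * (x \<bullet> j)) *\<^sub>R j) = (\<Sum>i\<in>UNIV. (c i * x $ i) *\<^sub>R axis i 1)"
      by (simp add: Basis_vec_def sum.UNION_disjoint axis_eq_axis inner_axis inner_axis' c'_def)
    also have "\<dots> = (\<chi> i. c i * x $ i)"
      by (simp add: vec_eq_iff axis_def if_distrib cong: if_cong)
    finally show ?thesis by simp
  qed
  have P: "(\<Prod>j\<in>Basis. \<bar>c' j\<bar>) = (\<Prod>i\<in>UNIV. \<bar>c i\<bar>)"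
    by (simp add: Basis_vec_def prod.UNION_disjoint axis_eq_axis inner_axis' c'_def)
  have [measurable]: "(\<lambda>x :: real ^ 'n. \<chi> i. c i * x $ i) \<in> borel_measurable borel"
    unfolding measurable_vec_iff by simp
  have "lborel = density (distr lborel borel (\<lambda>x. \<chi> i. c i * x $ i)) (\<lambda>_. ennreal (\<Prod>i\<in>UNIV. \<bar>c i\<bar>))"
    using lborel_affine_euclidean[of c' 0] c'0 unfolding T P by simp
  then have "(\<integral>\<^sup>+x. f x \<partial>lborel)
    = (\<integral>\<^sup>+x. f x \<partial>density (distr lborel borel (\<lambda>x. \<chi> i. c i * x $ i)) (\<lambda>_. ennreal (\<Prod>i\<in>UNIV. \<bar>c i\<bar>)))"
    by simp
  also have "\<dots> = ennreal (\<Prod>i\<in>UNIV. \<bar>c i\<bar>) * (\<integral>\<^sup>+x. f (\<chi> i. c i * x $ i) \<partial>lborel)"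
    by (subst nn_integral_density) (auto simp: nn_integral_distr nn_integral_cmult)
  finally show ?thesis .
qed

text \<open>Induction over elementary matrices: products, matrices with a zero row, diagonal
  matrices, coordinate transpositions and shears. The guard \<open>det A \<noteq> 0\<close> in
  \<open>P\<close> makes the zero-row case vacuous and passes from a product to its factors because
  the determinant is multiplicative.\<close>

lemma nn_integral_matrix:
  fixes A :: "real ^ 'n ^ 'n" and f :: "real ^ 'n \<Rightarrow> ennreal"
  assumes "det A \<noteq> 0" and "f \<in> borel_measurable borel"
  shows "(\<integral>\<^sup>+x. f x \<partial>lborel) = ennreal \<bar>det A\<bar> * (\<integral>\<^sup>+x. f (A *v x) \<partial>lborel)"
proof -
  define P where "P A \<longleftrightarrow> (det A \<noteq> 0 \<longrightarrow> (\<forall>f \<in> borel_measurable borel.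
    (\<integral>\<^sup>+x. f x \<partial>lborel) = ennreal \<bar>det A\<bar> * (\<integral>\<^sup>+x. f (A *v x) \<partial>lborel)))" for A :: "real ^ 'n ^ 'n"
  have P_D: "(\<integral>\<^sup>+x. f x \<partial>lborel) = ennreal \<bar>det A\<bar> * (\<integral>\<^sup>+x. f (A *v x) \<partial>lborel)"
    if "P A" "det A \<noteq> 0" "f \<in> borel_measurable borel" for A f
    using that unfolding P_def by blast
  have "P A"
  proof (rule induct_matrix_elementary)
    show "P (A ** B)" if "P A" "P B" for A B
      unfolding P_def
    proof (intro impI ballI)
      fix f :: "real ^ 'n \<Rightarrow> ennreal"
      assume d: "det (A ** B) \<noteq> 0" and [measurable]: "f \<in> borel_measurable borel"
      have "(\<integral>\<^sup>+x. f x \<partial>lborel) = ennreal \<bar>det A\<bar> * (\<integral>\<^sup>+x. f (A *v x) \<partial>lborel)"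
        by (rule P_D[OF that(1)]) (use d in \<open>auto simp: det_mul\<close>)
      also have "(\<integral>\<^sup>+x. f (A *v x) \<partial>lborel) = ennreal \<bar>det B\<bar> * (\<integral>\<^sup>+x. f (A *v (B *v x)) \<partial>lborel)"
      proof -
        have "(\<lambda>x. f (A *v x)) \<in> borel_measurable borel" by measurable
        then show ?thesis by (rule P_D[OF that(2), rotated]) (use d in \<open>auto simp: det_mul\<close>)
      qed
      finally show "(\<integral>\<^sup>+x. f x \<partial>lborel) = ennreal \<bar>det (A ** B)\<bar> * (\<integral>\<^sup>+x. f ((A ** B) *v x) \<partial>lborel)"
        by (simp add: det_mul abs_mult ennreal_mult mult.assoc matrix_vector_mul_assoc)
    qed
    show "P A" if "row i A = 0" for A i
      using det_zero_row(1)[of i A] that by (simp add: P_def)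
    show "P A" if "\<And>i j. i \<noteq> j \<Longrightarrow> A $ i $ j = 0" for A
      unfolding P_def
    proof (intro impI ballI)
      fix f :: "real ^ 'n \<Rightarrow> ennreal"
      assume d: "det A \<noteq> 0" and [measurable]: "f \<in> borel_measurable borel"
      have dd: "det A = (\<Prod>i\<in>UNIV. A $ i $ i)"
        by (rule det_diagonal) (use that in auto)
      then have nz: "A $ i $ i \<noteq> 0" for i using d by auto
      have "A *v x = (\<chi> i. A $ i $ i * x $ i)" for x
      proof -
        have "(\<Sum>j\<in>UNIV. A $ i $ j * x $ j) = A $ i $ i * x $ i" for i
          using that by (subst sum.remove[of _ i]) auto
        then show ?thesis by (simp add: matrix_vector_mult_def)
      qed
      then show "(\<integral>\<^sup>+x. f x \<partial>lborel) = ennreal \<bar>det A\<bar> * (\<integral>\<^sup>+x. f (A *v x) \<partial>lborel)"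
        using nn_integral_scale_coordinates[of f "\<lambda>i. A $ i $ i"] nz by (simp add: dd abs_prod)
    qed
    show "P (\<chi> i j. mat 1 $ i $ Transposition.transpose m n j)" if "m \<noteq> n" for m n
    proof -
      let ?A = "(\<chi> i j. mat 1 $ i $ Transposition.transpose m n j) :: real ^ 'n ^ 'n"
      let ?p = "Transposition.transpose m n"
      have "?p permutes UNIV" by (rule permutes_swap_id) auto
      then have "\<bar>det ?A\<bar> = 1"
        by (subst det_permute_columns) (auto simp: sign_def)
      moreover have "?A *v x = (\<chi> i. x $ ?p i)" for x
      proof -
        have "(\<Sum>j\<in>UNIV. (if i = ?p j then 1 else 0) * x $ j) = x $ ?p i" for i
        proof -
          have "i = ?p j \<longleftrightarrow> j = ?p i" for j
            by (metis transpose_involutory)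
          then have "(\<Sum>j\<in>UNIV. (if i = ?p j then 1 else 0) * x $ j) = (\<Sum>j\<in>UNIV. if j = ?p i then x $ j else 0)"
            by (intro sum.cong) simp_all
          then show ?thesis by simp
        qed
        then show ?thesis by (simp add: matrix_vector_mult_def mat_def)
      qed
      ultimately show ?thesis
        unfolding P_def by (auto simp: nn_integral_swap_coordinates[OF _ bij_transpose])
    qed
    show "P (\<chi> i j. if i = m \<and> j = n then c else of_bool (i = j))" if mn: "m \<noteq> n" for m n c
    proof -
      let ?A = "(\<chi> i j. if i = m \<and> j = n then c else of_bool (i = j)) :: real ^ 'n ^ 'n"
      have "?A = (\<chi> k. if k = m then row m (mat 1) + c *s row n (mat 1) else row k (mat 1))"
        using mn by (auto simp: vec_eq_iff row_def mat_def)
      then have "det ?A = det (mat 1 :: real ^ 'n ^ 'n)"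
        by (simp only: det_row_operation[OF mn])
      then have "det ?A = 1" by (simp only: det_I)
      moreover have "?A *v x = upd x m (x $ m + c * x $ n)" for x
      proof -
        have "(\<Sum>j\<in>UNIV. (if i = m \<and> j = n then c else of_bool (i = j)) * x $ j)
            = (if i = m then x $ m + c * x $ n else x $ i)" for i
        proof -
          have "(\<Sum>j\<in>UNIV. (if i = m \<and> j = n then c else of_bool (i = j)) * x $ j)
            = (\<Sum>j\<in>UNIV. (if j = n then (if i = m then c * x $ n else 0) else 0) + (if j = i then x $ i else 0))"
            using mn by (intro sum.cong) auto
          then show ?thesis by (simp add: sum.distrib)
        qed
        then show ?thesis by (simp add: matrix_vector_mult_def vec_eq_iff)
      qed
      ultimately show ?thesis
        unfolding P_def by (auto simp: nn_integral_shear[OF _ mn])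
    qed
  qed
  then show ?thesis using assms by (rule P_D)
qed

text \<open>Restates the formula as an identity of measures, from which integrability and the
  formula for vector-valued integrals follow.\<close>

lemma lborel_matrix_eq:
  fixes A :: "real ^ 'n ^ 'n"
  assumes A: "invertible A"
  shows "lborel = density (distr lborel borel ((*v) A)) (\<lambda>_. ennreal \<bar>det A\<bar>)"
proof (rule measure_eqI)
  fix X :: "(real ^ 'n) set" assume "X \<in> sets lborel"
  then have X: "X \<in> sets borel" by simp
  have d: "det A \<noteq> 0" using A invertible_det_nz by blast
  have m: "(*v) A \<in> measurable lborel borel"
    using measurable_matrix_vector[of A] by simp
  have "emeasure lborel X = (\<integral>\<^sup>+x. indicator X x \<partial>lborel)"
    using X by (simp only: nn_integral_indicator sets_lborel)
  also have "\<dots> = ennreal \<bar>det A\<bar> * (\<integral>\<^sup>+x. indicator X (A *v x) \<partial>lborel)"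
    by (rule nn_integral_matrix[OF d]) (rule borel_measurable_indicator[OF X])
  also have "(\<integral>\<^sup>+x. indicator X (A *v x) \<partial>lborel) = (\<integral>\<^sup>+x. indicator X x \<partial>distr lborel borel ((*v) A))"
    by (rule nn_integral_distr[OF m, symmetric]) (simp add: borel_measurable_indicator X)
  also have "\<dots> = emeasure (distr lborel borel ((*v) A)) X"
    using X by (simp only: nn_integral_indicator sets_distr)
  also have "ennreal \<bar>det A\<bar> * \<dots> = emeasure (density (distr lborel borel ((*v) A)) (\<lambda>_. ennreal \<bar>det A\<bar>)) X"
    by (rule emeasure_density_const[symmetric]) (simp add: X)
  finally show "emeasure lborel X = emeasure (density (distr lborel borel ((*v) A)) (\<lambda>_. ennreal \<bar>det A\<bar>)) X" .
qed simp

lemma integral_matrix: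
  fixes A :: "real ^ 'n ^ 'n" and f :: "real ^ 'n \<Rightarrow> 'b :: {banach, second_countable_topology}"
  assumes A: "invertible A" and [measurable]: "f \<in> borel_measurable borel"
  shows "(\<integral>x. f x \<partial>lborel) = \<bar>det A\<bar> *\<^sub>R (\<integral>x. f (A *v x) \<partial>lborel)"
proof -
  have m: "(*v) A \<in> measurable lborel borel"
    using measurable_matrix_vector[of A] by simp
  have "(\<integral>x. f x \<partial>lborel) = (\<integral>x. f x \<partial>density (distr lborel borel ((*v) A)) (\<lambda>_. ennreal \<bar>det A\<bar>))"
    by (simp only: lborel_matrix_eq[OF A, symmetric])
  also have "\<dots> = (\<integral>x. \<bar>det A\<bar> *\<^sub>R f x \<partial>distr lborel borel ((*v) A))"
    by (rule integral_density) auto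
  also have "\<dots> = (\<integral>x. \<bar>det A\<bar> *\<^sub>R f (A *v x) \<partial>lborel)"
    by (rule integral_distr[OF m]) auto
  finally show ?thesis by simp
qed

lemma integrable_matrix:
  fixes A :: "real ^ 'n ^ 'n" and f :: "real ^ 'n \<Rightarrow> 'b :: {banach, second_countable_topology}"
  assumes A: "invertible A" and f: "integrable lborel f"
  shows "integrable lborel (\<lambda>x. f (A *v x))"
proof -
  have [measurable]: "f \<in> borel_measurable borel" using f by auto
  have "det A \<noteq> 0" using A by (simp add: invertible_det_nz)
  moreover have "integrable lborel (\<lambda>x. \<bar>det A\<bar> *\<^sub>R f (A *v x))"
  proof -
    have m: "(*v) A \<in> measurable lborel borel"
      using measurable_matrix_vector[of A] by simp
    have "integrable (density (distr lborel borel ((*v) A)) (\<lambda>_. ennreal \<bar>det A\<bar>)) f"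
      using f by (simp only: lborel_matrix_eq[OF A, symmetric])
    then have "integrable (distr lborel borel ((*v) A)) (\<lambda>x. \<bar>det A\<bar> *\<^sub>R f x)"
      by (subst (asm) integrable_density) auto
    then show ?thesis
      by (subst (asm) integrable_distr_eq[OF m]) auto
  qed
  ultimately show ?thesis
    using integrable_scaleR_right[of "1 / \<bar>det A\<bar>" lborel "\<lambda>x. \<bar>det A\<bar> *\<^sub>R f (A *v x)"] by simp
qed

section \<open>Periodization along a lattice and its Fourier coefficients\<close>

definition periodization :: "real ^ 'n ^ 'n \<Rightarrow> (real ^ 'n \<Rightarrow> real) \<Rightarrow> real ^ 'n \<Rightarrow> real" where
  "periodization A h y = (\<Sum>\<^sub>\<infinity>k\<in>int_points. h (A *v (k + y)))"

text \<open>The point \<open>A *v (k + y)\<close> can meet the cube only if k + y is bounded by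
  \<rho>. One box of integer points therefore serves all y bounded by Y at once, which is what
  continuity in y and integration over y need.\<close>

lemma periodization_eq_sum:
  fixes h :: "real ^ 'n \<Rightarrow> real"
  assumes h: "\<And>x. x \<notin> unit_cube \<Longrightarrow> h x = 0"
    and \<rho>: "\<And>z i. A *v z \<in> unit_cube \<Longrightarrow> \<bar>z $ i\<bar> \<le> \<rho>"
    and y: "\<And>i. \<bar>y $ i\<bar> \<le> Y" and R: "\<rho> + Y \<le> real R"
  shows "periodization A h y = (\<Sum>k\<in>int_box R. h (A *v (k + y)))"
proof -
  have "periodization A h y = infsum (\<lambda>k. h (A *v (k + y))) (int_box R)"
    unfolding periodization_def
  proof (rule infsum_cong_neutral)
    show "h (A *v (k + y)) = 0" if k: "k \<in> int_points - int_box R" for k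
    proof (rule h, rule notI)
      assume "A *v (k + y) \<in> unit_cube"
      then have "\<bar>k $ i\<bar> \<le> real R" for i
        using \<rho>[of "k + y" i] y[of i] R by (simp add: abs_le_iff)
      then show False using k by (auto simp: int_box_def)
    qed
  qed (use int_box_subset in auto)
  then show ?thesis by simp
qed

lemma periodization_periodic:
  assumes "k \<in> int_points"
  shows "periodization A h (y + k) = periodization A h y"
proof -
  have "bij_betw (\<lambda>m. m + k) int_points int_points"
    by (rule bij_betw_byWitness[where f' = "\<lambda>m. m - k"])
       (use assms in \<open>auto intro: int_points_add int_points_diff\<close>)
  from infsum_reindex_bij_betw[OF this, of "\<lambda>m. h (A *v (m + y))"] show ?thesis
    unfolding periodization_def by (simp add: add_ac)
qed

lemma continuous_periodization:
  fixes h :: "real ^ 'n \<Rightarrow> real"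
  assumes c: "continuous_on UNIV h" and h: "\<And>x. x \<notin> unit_cube \<Longrightarrow> h x = 0"
    and \<rho>: "\<And>z i. A *v z \<in> unit_cube \<Longrightarrow> \<bar>z $ i\<bar> \<le> \<rho>"
  shows "continuous_on UNIV (periodization A h)"
proof -
  have "isCont (periodization A h) y" for y
  proof -
    obtain R where R: "\<rho> + (norm y + 1) \<le> real R" using real_arch_simple by blast
    have c': "continuous_on (ball 0 (norm y + 1)) (\<lambda>y. \<Sum>k\<in>int_box R. h (A *v (k + y)))"
      by (intro continuous_intros continuous_on_compose2[OF c]) auto
    have "continuous_on (ball 0 (norm y + 1)) (periodization A h)"
    proof (rule continuous_on_eq[OF c'])
      fix x :: "real ^ 'n" assume x: "x \<in> ball 0 (norm y + 1)"
      have "\<bar>x $ i\<bar> \<le> norm y + 1" for i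
        using component_le_norm_cart[of x i] x by simp
      then show "(\<Sum>k\<in>int_box R. h (A *v (k + x))) = periodization A h x"
        using periodization_eq_sum[OF h \<rho> _ R] by simp
    qed
    then show ?thesis
      by (simp add: continuous_on_eq_continuous_at)
  qed
  then show ?thesis by (simp add: continuous_on_eq_continuous_at)
qed

lemma integrable_lborel_cube_support:
  fixes f :: "real ^ 'n \<Rightarrow> 'b :: {banach, second_countable_topology}"
  assumes f: "continuous_on UNIV f" and supp: "\<And>x. x \<notin> unit_cube \<Longrightarrow> f x = 0"
  shows "integrable lborel f" "(\<integral>x. f x \<partial>lborel) = (\<integral>x. f x \<partial>cube_measure)"
proof -
  have [measurable]: "f \<in> borel_measurable borel" using f by (rule borel_measurable_continuous_onI)
  have eq: "(\<lambda>x. indicator unit_cube x *\<^sub>R f x) = f"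
    using supp by (auto simp: indicator_def)
  have "integrable lborel (\<lambda>x. indicator unit_cube x *\<^sub>R f x)"
    unfolding unit_cube_def by (rule borel_integrable_compact) (auto intro: continuous_on_subset[OF f])
  then show "integrable lborel f" by (simp add: eq)
  show "(\<integral>x. f x \<partial>lborel) = (\<integral>x. f x \<partial>cube_measure)"
    by (subst integral_cube) (auto simp: eq)
qed

text \<open>Poisson summation by unfolding. The exponential does not see integer translations, so
  tiling merges the sum and the integral over the cube into an integral over the space. The
  substitution \<open>x = A *v z\<close> then produces the factor \<bar>det S\<bar> and moves the
  frequency to \<open>S *v m\<close>, because
  \<open>(S *v m) \<bullet> (A *v z) = m \<bullet> z\<close>.\<close>

lemma fc_periodization:
  fixes h :: "real ^ 'n \<Rightarrow> real" and S :: "real ^ 'n ^ 'n"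
  assumes S: "invertible S" and A: "A = transpose (matrix_inv S)"
    and c: "continuous_on UNIV h" and h: "\<And>x. x \<notin> unit_cube \<Longrightarrow> h x = 0"
    and \<rho>: "\<And>z i. A *v z \<in> unit_cube \<Longrightarrow> \<bar>z $ i\<bar> \<le> \<rho>"
    and m: "m \<in> int_points"
  shows "fc (\<lambda>y. of_real (periodization A h y)) m = \<bar>det S\<bar> *\<^sub>R fc (\<lambda>x. of_real (h x)) (S *v m)"
proof -
  define H where "H z = complex_of_real (h (A *v z)) * ce (- m) z" for z
  obtain R where R: "\<rho> + 1 \<le> real R" using real_arch_simple by blast
  have cH: "continuous_on UNIV H"
    unfolding H_def by (intro continuous_intros continuous_on_compose2[OF c]) auto
  have TA: "transpose S ** A = mat 1" "A ** transpose S = mat 1"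
    unfolding A by (simp_all add: matrix_transpose_mul[symmetric] matrix_inv_mult S)
  have invA: "invertible A" using TA by (auto simp: invertible_def)
  have "det (transpose S) * det A = 1" by (metis TA(1) det_I det_mul)
  then have detA: "\<bar>det S\<bar> * \<bar>det A\<bar> = 1" by (simp add: abs_mult[symmetric])
  define H' where "H' x = complex_of_real (h x) * ce (- (S *v m)) x" for x
  have HH': "H z = H' (A *v z)" for z
  proof -
    have "(S *v m) \<bullet> (A *v z) = m \<bullet> ((transpose S ** A) *v z)"
      by (metis adjoint_matrix adjoint_works matrix_vector_mul_assoc matrix_vector_mul_linear)
    then have "(S *v m) \<bullet> (A *v z) = m \<bullet> z" by (simp add: TA)
    then show ?thesis by (simp add: H_def H'_def ce_def)
  qed
  have cH': "continuous_on UNIV H'"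
    unfolding H'_def by (intro continuous_intros c)
  have iH': "integrable lborel H'" "(\<integral>x. H' x \<partial>lborel) = (\<integral>x. H' x \<partial>cube_measure)"
    by (rule integrable_lborel_cube_support[OF cH']; simp add: H'_def h)+
  have iH: "integrable lborel H"
    using integrable_matrix[OF invA iH'(1)] by (simp only: HH'[abs_def])
  have "fc (\<lambda>y. of_real (periodization A h y)) m
      = (\<integral>y. (\<Sum>k\<in>int_box R. H (k + y)) \<partial>cube_measure)"
    unfolding fc_def
  proof (rule integral_cong_AE)
    show "AE y in cube_measure. complex_of_real (periodization A h y) * ce (- m) y = (\<Sum>k\<in>int_box R. H (k + y))"
      using AE_cube
    proof eventually_elim
      case (elim y)
      have "\<bar>y $ i\<bar> \<le> 1" for i using elim by (auto simp: mem_unit_cube)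
      then have "periodization A h y = (\<Sum>k\<in>int_box R. h (A *v (k + y)))"
        using periodization_eq_sum[OF h \<rho> _ R] by simp
      moreover have "ce (- m) (k + y) = ce (- m) y" if "k \<in> int_box R" for k
        using ce_int[OF int_points_uminus[OF m] subsetD[OF int_box_subset that]] by (simp add: ce_add_right)
      ultimately show ?case by (simp add: H_def sum_distrib_right)
    qed
  qed (auto intro!: borel_measurable_integrable integrable_cube_continuous continuous_intros
        continuous_periodization[OF c h \<rho>] continuous_on_compose2[OF cH])
  also have "\<dots> = (\<Sum>k\<in>int_box R. \<integral>y. H (k + y) \<partial>cube_measure)"
    by (rule Bochner_Integration.integral_sum)
       (auto intro!: integrable_cube_continuous continuous_intros continuous_on_compose2[OF cH])
  also have "\<dots> = (\<integral>z. H z \<partial>lborel)"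
  proof (rule integral_tiling[OF iH _ R, symmetric])
    fix z i assume "H z \<noteq> 0"
    then show "\<bar>z $ i\<bar> \<le> \<rho>" using h \<rho> by (force simp: H_def)
  qed
  also have "\<dots> = (\<bar>det S\<bar> * \<bar>det A\<bar>) *\<^sub>R (\<integral>z. H' (A *v z) \<partial>lborel)"
    by (simp add: detA HH')
  also have "\<dots> = \<bar>det S\<bar> *\<^sub>R (\<integral>x. H' x \<partial>lborel)"
    using integral_matrix[OF invA, of H'] iH' by simp
  also have "(\<integral>x. H' x \<partial>lborel) = fc (\<lambda>x. of_real (h x)) (S *v m)"
    unfolding iH'(2) by (simp add: fc_def H'_def[abs_def])
  finally show ?thesis .
qed

text \<open>Cauchy-Schwarz over the integer points of the box costs their number; unfolding the sum
  of the squares costs \<bar>det S\<bar>. For scaled Frolov matrices R can be taken of order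
  \<open>n powr (1 / d)\<close>, so that the first factor is of order n.\<close>

lemma integral_periodization_squared_le:
  fixes h :: "real ^ 'n \<Rightarrow> real" and S :: "real ^ 'n ^ 'n"
  assumes S: "invertible S" and A: "A = transpose (matrix_inv S)"
    and c: "continuous_on UNIV h" and h: "\<And>x. x \<notin> unit_cube \<Longrightarrow> h x = 0"
    and \<rho>: "\<And>z i. A *v z \<in> unit_cube \<Longrightarrow> \<bar>z $ i\<bar> \<le> \<rho>" and R: "\<rho> + 1 \<le> real R"
  shows "(\<integral>y. (periodization A h y)\<^sup>2 \<partial>cube_measure)
    \<le> real ((2 * R + 1) ^ CARD('n)) * \<bar>det S\<bar> * (\<integral>x. (h x)\<^sup>2 \<partial>cube_measure)"
proof -
  define H where "H z = (h (A *v z))\<^sup>2" for z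
  define N where "N = real (card (int_box R :: (real ^ 'n) set))"
  have N: "N \<le> real ((2 * R + 1) ^ CARD('n))" unfolding N_def using card_int_box[where 'n = 'n] of_nat_le_iff by blast
  have cH: "continuous_on UNIV H"
    unfolding H_def by (intro continuous_intros continuous_on_compose2[OF c]) auto
  have TA: "transpose S ** A = mat 1" "A ** transpose S = mat 1"
    unfolding A by (simp_all add: matrix_transpose_mul[symmetric] matrix_inv_mult S)
  have invA: "invertible A" using TA by (auto simp: invertible_def)
  have "det (transpose S) * det A = 1" by (metis TA(1) det_I det_mul)
  then have detA: "\<bar>det S\<bar> * \<bar>det A\<bar> = 1" by (simp add: abs_mult[symmetric])
  have ch2: "continuous_on UNIV (\<lambda>x. (h x)\<^sup>2)" by (intro continuous_intros c)
  have i2: "integrable lborel (\<lambda>x. (h x)\<^sup>2)" "(\<integral>x. (h x)\<^sup>2 \<partial>lborel) = (\<integral>x. (h x)\<^sup>2 \<partial>cube_measure)"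
    by (rule integrable_lborel_cube_support[OF ch2]; simp add: h)+
  have iH: "integrable lborel H"
    unfolding H_def by (rule integrable_matrix[OF invA i2(1)])
  have "(\<integral>y. (periodization A h y)\<^sup>2 \<partial>cube_measure) \<le> (\<integral>y. N * (\<Sum>k\<in>int_box R. H (k + y)) \<partial>cube_measure)"
  proof (rule integral_mono_AE)
    show "AE y in cube_measure. (periodization A h y)\<^sup>2 \<le> N * (\<Sum>k\<in>int_box R. H (k + y))"
      using AE_cube
    proof eventually_elim
      case (elim y)
      have "\<bar>y $ i\<bar> \<le> 1" for i using elim by (auto simp: mem_unit_cube)
      then have "periodization A h y = (\<Sum>k\<in>int_box R. 1 * h (A *v (k + y)))"
        using periodization_eq_sum[OF h \<rho> _ R] by simp
      also have "\<dots>\<^sup>2 \<le> N * (\<Sum>k\<in>int_box R. (h (A *v (k + y)))\<^sup>2)"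
        using Cauchy_Schwarz_ineq_sum[of "\<lambda>_. 1" "\<lambda>k. h (A *v (k + y))" "int_box R"] by (simp add: N_def)
      finally show ?case by (simp add: H_def)
    qed
  qed (auto intro!: integrable_cube_continuous continuous_intros
        continuous_periodization[OF c h \<rho>] continuous_on_compose2[OF cH])
  also have "\<dots> = N * (\<Sum>k\<in>int_box R. \<integral>y. H (k + y) \<partial>cube_measure)"
    by (subst integral_mult_right_zero, subst Bochner_Integration.integral_sum)
       (auto intro!: integrable_cube_continuous continuous_intros continuous_on_compose2[OF cH])
  also have "(\<Sum>k\<in>int_box R. \<integral>y. H (k + y) \<partial>cube_measure) = (\<integral>z. H z \<partial>lborel)"
  proof (rule integral_tiling[OF iH _ R, symmetric])
    fix z i assume "H z \<noteq> 0"
    then show "\<bar>z $ i\<bar> \<le> \<rho>" using h \<rho> by (force simp: H_def)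
  qed
  also have "(\<integral>z. H z \<partial>lborel) = (\<bar>det S\<bar> * \<bar>det A\<bar>) *\<^sub>R (\<integral>z. (h (A *v z))\<^sup>2 \<partial>lborel)"
    by (simp add: detA H_def)
  also have "\<dots> = \<bar>det S\<bar> * (\<integral>x. (h x)\<^sup>2 \<partial>lborel)"
    using integral_matrix[OF invA, of "\<lambda>x. (h x)\<^sup>2"] i2 by simp
  also have "N * (\<bar>det S\<bar> * (\<integral>x. (h x)\<^sup>2 \<partial>lborel))
      \<le> real ((2 * R + 1) ^ CARD('n)) * (\<bar>det S\<bar> * (\<integral>x. (h x)\<^sup>2 \<partial>lborel))"
    by (rule mult_right_mono[OF N]) simp
  finally show ?thesis by (simp add: i2(2) mult.assoc)
qed

subsection \<open>Sums over Frolov lattices\<close>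

text \<open>All coordinates but one determine the last, and each of them lies between 0 and
  s.\<close>

lemma card_sum_eq_le:
  fixes K :: "('n :: finite \<Rightarrow> nat) set"
  assumes "\<And>k. k \<in> K \<Longrightarrow> (\<Sum>i\<in>UNIV. k i) = s"
  shows "finite K" "card K \<le> (s + 1) ^ (CARD('n) - 1)"
proof -
  obtain i0 :: 'n where True by simp
  define g where "g k = restrict k (UNIV - {i0})" for k :: "'n \<Rightarrow> nat"
  have inj: "inj_on g K"
  proof (rule inj_onI)
    fix k l assume kl: "k \<in> K" "l \<in> K" "g k = g l"
    have eq: "k i = l i" if "i \<noteq> i0" for i
      using fun_cong[OF kl(3), of i] that by (simp add: g_def)
    have "k i0 + (\<Sum>i\<in>UNIV-{i0}. k i) = l i0 + (\<Sum>i\<in>UNIV-{i0}. l i)"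
      using assms[OF kl(1)] assms[OF kl(2)] by (simp add: sum.remove[of UNIV i0])
    moreover have "(\<Sum>i\<in>UNIV-{i0}. k i) = (\<Sum>i\<in>UNIV-{i0}. l i)"
      by (rule sum.cong) (auto simp: eq)
    ultimately have "k i0 = l i0" by simp
    then show "k = l" using eq by (metis ext)
  qed
  have sub: "g ` K \<subseteq> PiE (UNIV - {i0}) (\<lambda>_. {0..s})"
  proof -
    have "k i \<le> s" if "k \<in> K" for k i
      using member_le_sum[of i UNIV k] assms[OF that] by simp
    then show ?thesis unfolding g_def by (intro image_subsetI) (simp add: PiE_iff extensional_def)
  qed
  have fin: "finite (PiE (UNIV - {i0}) (\<lambda>_. {0..s}))" by (intro finite_PiE) auto
  show "finite K" using inj finite_subset[OF sub fin] by (simp add: finite_image_iff)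
  have "card K = card (g ` K)" using inj by (simp add: card_image)
  also have "\<dots> \<le> card (PiE (UNIV - {i0}) (\<lambda>_. {0..s}))" by (rule card_mono[OF fin sub])
  also have "\<dots> = (s + 1) ^ (CARD('n) - 1)" by (subst card_PiE) (auto simp: card_Diff_singleton)
  finally show "card K \<le> (s + 1) ^ (CARD('n) - 1)" .
qed

text \<open>The Frolov property counts images B m; injectivity of B transfers the count to the
  integer points m themselves.\<close>

lemma frolov_card_le:
  fixes B :: "real ^ 'n ^ 'n" and M :: "(real ^ 'n) set"
  assumes B: "frolov_matrix B" and M: "M \<subseteq> int_points"
    and box: "\<And>m. m \<in> M \<Longrightarrow> B *v m \<in> coord_box x y"
  shows "finite M" "real (card M) \<le> (\<Prod>j\<in>UNIV. \<bar>x $ j - y $ j\<bar>) + 1"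
proof -
  have inj: "inj_on ((*v) B) M"
    by (rule inj_onI) (use B in \<open>auto simp: frolov_matrix_def dest!: inj_matrix_vector_mult injD\<close>)
  have sub: "(*v) B ` M \<subseteq> (*v) B ` int_points \<inter> coord_box x y"
    using M box by auto
  have fin: "finite ((*v) B ` int_points \<inter> coord_box x y)"
    and card: "real (card ((*v) B ` int_points \<inter> coord_box x y)) \<le> (\<Prod>j\<in>UNIV. \<bar>x $ j - y $ j\<bar>) + 1"
    using B by (auto simp: frolov_matrix_def)
  show "finite M" using inj finite_subset[OF sub fin] by (simp add: finite_image_iff)
  have "card M = card ((*v) B ` M)" using inj by (simp add: card_image)
  also have "\<dots> \<le> card ((*v) B ` int_points \<inter> coord_box x y)" by (rule card_mono[OF fin sub])
  finally show "real (card M) \<le> (\<Prod>j\<in>UNIV. \<bar>x $ j - y $ j\<bar>) + 1" using card by linarith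
qed

text \<open>Writing s = L + t, the bounds \<open>s + 1 \<le> (L + 1) * (t + 1)\<close> and
  \<open>2 ^ t \<le> 2 ^ (q * t)\<close> factor the tail into its first term and a convergent series
  that depends on p alone.\<close>

lemma sum_power_geometric_tail:
  fixes p q L :: nat
  assumes q: "1 \<le> q" and S: "finite S" "\<And>s. s \<in> S \<Longrightarrow> L \<le> s"
  shows "(\<Sum>s\<in>S. real (s + 1) ^ p / 2 ^ (q * s))
    \<le> real (L + 1) ^ p / 2 ^ (q * L) * (\<Sum>t. real (t + 1) ^ p / 2 ^ t)"
proof -
  have summ: "summable (\<lambda>t. real (t + 1) ^ p / 2 ^ t)"
  proof -
    have "(\<lambda>t. (real (t + 2) / real (t + 1)) ^ p) \<longlonglongrightarrow> 1 ^ p"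
      by (rule tendsto_power) real_asymp
    then have "\<forall>\<^sub>F t in sequentially. (real (t + 2) / real (t + 1)) ^ p < 3 / 2"
      by (rule order_tendstoD) simp
    then obtain t0 where t0: "\<And>t. t0 \<le> t \<Longrightarrow> (real (t + 2) / real (t + 1)) ^ p < 3 / 2"
      unfolding eventually_sequentially by blast
    show ?thesis
    proof (rule summable_ratio_test[where c = "3 / 4" and N = t0])
      fix t assume "t0 \<le> t"
      then have "real (t + 2) ^ p \<le> 3 / 2 * real (t + 1) ^ p"
        using t0[of t] by (simp add: power_divide divide_less_eq)
      then show "norm (real (Suc t + 1) ^ p / 2 ^ Suc t) \<le> 3 / 4 * norm (real (t + 1) ^ p / 2 ^ t)"
        by (simp add: field_simps)
    qed simp
  qed
  have "(\<Sum>s\<in>S. real (s + 1) ^ p / 2 ^ (q * s))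
      \<le> (\<Sum>s\<in>S. real (L + 1) ^ p / 2 ^ (q * L) * (real (s - L + 1) ^ p / 2 ^ (s - L)))"
  proof (rule sum_mono)
    fix s assume "s \<in> S"
    then obtain t where t: "s = L + t" using S(2) le_Suc_ex by blast
    have "real (s + 1) \<le> real (L + 1) * real (t + 1)"
      unfolding of_nat_mult[symmetric] of_nat_le_iff t by (simp add: algebra_simps)
    then have 1: "real (s + 1) ^ p \<le> real (L + 1) ^ p * real (t + 1) ^ p"
      unfolding power_mult_distrib[symmetric] by (intro power_mono) auto
    have "(2 :: real) ^ t \<le> 2 ^ (q * t)" using q by (intro power_increasing) auto
    then have 2: "(2 :: real) ^ (q * L) * 2 ^ t \<le> 2 ^ (q * s)"
      unfolding t distrib_left power_add by simp
    have "real (s + 1) ^ p / 2 ^ (q * s) \<le> (real (L + 1) ^ p * real (t + 1) ^ p) / (2 ^ (q * L) * 2 ^ t)"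
      using 1 2 by (intro frac_le) auto
    then show "real (s + 1) ^ p / 2 ^ (q * s)
      \<le> real (L + 1) ^ p / 2 ^ (q * L) * (real (s - L + 1) ^ p / 2 ^ (s - L))"
      by (simp add: t)
  qed
  also have "\<dots> = real (L + 1) ^ p / 2 ^ (q * L) * (\<Sum>s\<in>S. real (s - L + 1) ^ p / 2 ^ (s - L))"
    by (simp add: sum_distrib_left)
  also have "\<dots> \<le> real (L + 1) ^ p / 2 ^ (q * L) * (\<Sum>t. real (t + 1) ^ p / 2 ^ t)"
  proof (rule mult_left_mono)
    have "(\<Sum>s\<in>S. real (s - L + 1) ^ p / 2 ^ (s - L)) = (\<Sum>t\<in>(\<lambda>s. s - L) ` S. real (t + 1) ^ p / 2 ^ t)"
      by (subst sum.reindex) (auto intro!: inj_on_diff_nat S(2))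
    also have "\<dots> \<le> (\<Sum>t. real (t + 1) ^ p / 2 ^ t)"
      using S(1) by (intro sum_le_suminf summ) auto
    finally show "(\<Sum>s\<in>S. real (s - L + 1) ^ p / 2 ^ (s - L)) \<le> (\<Sum>t. real (t + 1) ^ p / 2 ^ t)" .
  qed simp
  finally show ?thesis .
qed

lemma dyadic_exponent:
  obtains \<kappa> :: nat where "2 ^ \<kappa> \<le> max 1 (x :: real)" "max 1 x \<le> 2 ^ (\<kappa> + 1)"
proof -
  let ?y = "max 1 x"
  have l: "0 \<le> log 2 ?y" by (simp add: zero_le_log_cancel_iff)
  obtain k :: nat where k: "real k \<le> log 2 ?y" "log 2 ?y \<le> real (k + 1)"
  proof
    show "real (nat \<lfloor>log 2 ?y\<rfloor>) \<le> log 2 ?y" "log 2 ?y \<le> real (nat \<lfloor>log 2 ?y\<rfloor> + 1)"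
      using l by linarith+
  qed
  have "2 powr real k \<le> ?y"
    using k(1) by (subst (asm) le_log_iff) auto
  moreover have "?y \<le> 2 powr real (k + 1)"
    using k(2) by (subst (asm) log_le_iff) auto
  ultimately show ?thesis
    using that[of k] by (simp only: powr_realpow zero_less_numeral)
qed

text \<open>Sort the points by the dyadic box \<open>2 ^ k j \<le> max 1 \<bar>N (B m)_j\<bar> \<le> 2 ^ (k j + 1)\<close> that contains them.
  Since the product of the coordinates is at least n, only boxes with |k| at least about log n occur; each
  of them has about \<open>2 ^ |k| / n\<close> points, and there are about \<open>|k| ^ (d - 1)\<close> of them for given |k|.\<close>

lemma frolov_sum_le:
  fixes B :: "real ^ 'n ^ 'n"
  assumes B: "frolov_matrix B" and r: "1 \<le> r"
  shows "\<exists>C>0. \<forall>n\<ge>2. \<forall>F. finite F \<and> F \<subseteq> int_points - {0} \<longrightarrow>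
    (\<Sum>m\<in>F. 1 / (\<Prod>j\<in>UNIV. max 1 (real n powr (1 / CARD('n)) * \<bar>(B *v m) $ j\<bar>)) ^ (2 * r))
      \<le> C * ln (real n) ^ (CARD('n) - 1) / real n ^ (2 * r)"
proof -
  define d where "d = CARD('n)"
  have d1: "1 \<le> d" unfolding d_def by (simp add: Suc_leI)
  define p where "p = d - 1"
  \<comment> \<open>The exponent that remains when one of the 2 r factors \<open>2 ^ s\<close> is
    spent on the number of lattice points in a dyadic box.\<close>
  define q where "q = 2 * r - 1"
  have q1: "1 \<le> q" "2 * r = q + 1" using r by (auto simp: q_def)
  \<comment> \<open>A dyadic box is enclosed in a symmetric one with sides
    \<open>4 / N * 2 ^ l j\<close>, whence \<open>4 ^ d\<close>. The factor 2 absorbs the additive 1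
    in the Frolov count.\<close>
  define C1 :: real where "C1 = 2 * 4 ^ d"
  define C2 where "C2 = (\<Sum>t. real (t + 1) ^ p / 2 ^ t)"
  \<comment> \<open>The factor \<open>(2 / ln 2) ^ p\<close> comes from comparing L + 1 with ln n,
    \<open>(2 ^ d) ^ q\<close> from comparing \<open>2 ^ L\<close> with n, and C2 from the geometric
    tail. The final 1 makes C positive.\<close>
  define C where "C = C1 * (2 / ln 2) ^ p * (2 ^ d) ^ q * C2 + 1"
  have C20: "0 \<le> C2"
    using sum_power_geometric_tail[of 1 "{}" 0 p] by (simp add: C2_def)
  have Cpos: "C > 0" using C20 by (auto simp: C_def C1_def intro!: add_nonneg_pos mult_nonneg_nonneg)
  show ?thesis
  proof (rule exI[of _ C], intro conjI Cpos allI impI)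
    fix n :: nat and F :: "(real ^ 'n) set"
    assume n: "2 \<le> n" and F: "finite F \<and> F \<subseteq> int_points - {0}"
    define N where "N = real n powr (1 / CARD('n))"
    have N0: "0 < N" using n by (simp add: N_def)
    have Nd: "N ^ d = real n"
      using n unfolding N_def d_def by (simp add: powr_powr flip: powr_realpow)
    define \<kappa> where "\<kappa> x = (SOME k :: nat. 2 ^ k \<le> max 1 x \<and> max 1 x \<le> 2 ^ (k + 1))" for x :: real
    have \<kappa>: "2 ^ \<kappa> x \<le> max 1 x" "max 1 x \<le> 2 ^ (\<kappa> x + 1)" for x
    proof -
      have "2 ^ \<kappa> x \<le> max 1 x \<and> max 1 x \<le> 2 ^ (\<kappa> x + 1)"
        unfolding \<kappa>_def by (rule someI_ex) (metis dyadic_exponent)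
      then show "2 ^ \<kappa> x \<le> max 1 x" "max 1 x \<le> 2 ^ (\<kappa> x + 1)" by auto
    qed
    define k where "k m = (\<lambda>j. \<kappa> (N * \<bar>(B *v m) $ j\<bar>))" for m
    define s where "s l = (\<Sum>j\<in>UNIV. l j)" for l :: "'n \<Rightarrow> nat"
    have term_le: "1 / (\<Prod>j\<in>UNIV. max 1 (N * \<bar>(B *v m) $ j\<bar>)) ^ (2 * r) \<le> 1 / 2 ^ (2 * r * s (k m))" for m
    proof -
      have "(2 :: real) ^ s (k m) = (\<Prod>j\<in>UNIV. 2 ^ k m j)" by (simp add: s_def power_sum)
      also have "\<dots> \<le> (\<Prod>j\<in>UNIV. max 1 (N * \<bar>(B *v m) $ j\<bar>))"
        unfolding k_def by (intro prod_mono) (use \<kappa> in auto)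
      finally have "(2 ^ s (k m)) ^ (2 * r) \<le> (\<Prod>j\<in>UNIV. max 1 (N * \<bar>(B *v m) $ j\<bar>)) ^ (2 * r)"
        by (intro power_mono) auto
      then have "2 ^ (2 * r * s (k m)) \<le> (\<Prod>j\<in>UNIV. max 1 (N * \<bar>(B *v m) $ j\<bar>)) ^ (2 * r)"
        by (simp add: power_mult[symmetric] mult.commute)
      then show ?thesis by (intro frac_le) auto
    qed
    have large: "real n \<le> 2 ^ (s (k m) + d)" if m: "m \<in> F" for m
    proof -
      have "1 \<le> \<bar>\<Prod>j\<in>UNIV. (B *v m) $ j\<bar>"
        using B m F by (auto simp: frolov_matrix_def)
      then have "real n \<le> real n * (\<Prod>j\<in>UNIV. \<bar>(B *v m) $ j\<bar>)"
        using n by (simp add: abs_prod)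
      also have "\<dots> = (\<Prod>j\<in>UNIV. N * \<bar>(B *v m) $ j\<bar>)"
        using Nd by (simp add: prod.distrib d_def)
      also have "\<dots> \<le> (\<Prod>j\<in>UNIV. 2 ^ (k m j + 1))"
      proof (intro prod_mono conjI)
        fix j show "0 \<le> N * \<bar>(B *v m) $ j\<bar>" using N0 by simp
        show "N * \<bar>(B *v m) $ j\<bar> \<le> 2 ^ (k m j + 1)"
          using \<kappa>(2)[of "N * \<bar>(B *v m) $ j\<bar>"] unfolding k_def by linarith
      qed
      also have "\<dots> = 2 ^ (\<Sum>j\<in>UNIV. k m j + 1)" by (simp add: power_sum)
      also have "(\<Sum>j\<in>UNIV. k m j + 1) = s (k m) + d"
        unfolding s_def sum.distrib by (simp add: d_def)
      finally show ?thesis .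
    qed
    have card_le: "real (card {m \<in> F. k m = l}) \<le> C1 * 2 ^ s l / n" if l: "l \<in> k ` F" for l
    proof -
      define x :: "real ^ 'n" where "x = (\<chi> j. 2 ^ (l j + 1) / N)"
      have "real (card {m \<in> F. k m = l}) \<le> (\<Prod>j\<in>UNIV. \<bar>(- x) $ j - x $ j\<bar>) + 1"
      proof (rule frolov_card_le(2)[OF B])
        show "{m \<in> F. k m = l} \<subseteq> int_points" using F by auto
        fix m assume m: "m \<in> {m \<in> F. k m = l}"
        have "\<bar>(B *v m) $ j\<bar> \<le> x $ j" for j
        proof -
          have "N * \<bar>(B *v m) $ j\<bar> \<le> 2 ^ (l j + 1)"
            using \<kappa>(2)[of "N * \<bar>(B *v m) $ j\<bar>"] m unfolding k_def by auto
          then show ?thesis using N0 by (simp add: x_def field_simps)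
        qed
        then show "B *v m \<in> coord_box (- x) x"
          by (auto simp: coord_box_def closed_segment_eq_real_ivl abs_le_iff) (smt (verit))+
      qed
      also have "(\<Prod>j\<in>UNIV. \<bar>(- x) $ j - x $ j\<bar>) = (\<Prod>j\<in>UNIV. (4 / N) * 2 ^ l j)"
        using N0 by (intro prod.cong) (auto simp: x_def abs_if)
      also have "\<dots> = 4 ^ d / real n * 2 ^ s l"
        by (simp only: prod.distrib prod_constant power_sum s_def power_divide Nd d_def[symmetric])
      finally have "real (card {m \<in> F. k m = l}) \<le> 4 ^ d / real n * 2 ^ s l + 1" .
      \<comment> \<open>An occupied box has \<open>2 ^ (s l + d)\<close> at least n, so the additive
        1 is dominated by the volume term.\<close>
      moreover have "1 \<le> 2 ^ d / real n * 2 ^ s l"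
        using large l n by (auto simp: field_simps power_add)
      moreover have "2 ^ d / real n * 2 ^ s l \<le> 4 ^ d / real n * 2 ^ s l"
        by (intro mult_right_mono divide_right_mono power_mono) auto
      moreover have "a \<le> 2 * x" if "a \<le> x + 1" "1 \<le> z" "z \<le> x" for a x z :: real
        using that by linarith
      ultimately have "real (card {m \<in> F. k m = l}) \<le> 2 * (4 ^ d / real n * 2 ^ s l)"
        by blast
      then show ?thesis by (simp add: C1_def)
    qed
    \<comment> \<open>The smallest level at which an occupied box is possible. Minimality gives L at
      most log n to base 2, and membership gives \<open>2 ^ L\<close> at least
      \<open>n / 2 ^ d\<close>; both directions are needed.\<close>
    define L where "L = (LEAST t. real n \<le> 2 ^ (t + d))"
    have exL: "\<exists>t. real n \<le> 2 ^ (t + d)"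
    proof -
      have "real n \<le> 2 ^ n" by (simp add: of_nat_less_two_power less_imp_le)
      also have "\<dots> \<le> 2 ^ (n + d)" by (intro power_increasing) auto
      finally show ?thesis by blast
    qed
    have L: "real n \<le> 2 ^ (L + d)" unfolding L_def by (rule LeastI_ex[OF exL])
    have Lle: "L \<le> s l" if "l \<in> k ` F" for l
      using that large unfolding L_def by (auto intro: Least_le)
    have lnn: "ln 2 \<le> ln (real n)" using n by simp
    have ln0: "0 \<le> ln (real n)" using n by simp
    have "real L \<le> ln (real n) / ln 2"
    proof (cases L)
      case 0 then show ?thesis using ln0 by simp
    next
      case (Suc L')
      then have "\<not> real n \<le> 2 ^ (L' + d)"
        unfolding L_def using not_less_Least[of L' "\<lambda>t. real n \<le> 2 ^ (t + d)"] by simp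
      then have "2 ^ (L' + d) \<le> real n" by simp
      moreover have "(2 :: real) ^ L \<le> 2 ^ (L' + d)" using Suc d1 by (intro power_increasing) auto
      ultimately have "2 ^ L \<le> real n" by (rule order_trans[rotated])
      then have "ln (2 ^ L) \<le> ln (real n)" by (rule ln_mono) simp
      then show ?thesis by (simp add: ln_realpow field_simps)
    qed
    moreover have "1 \<le> ln (real n) / ln 2" using lnn by (simp add: le_divide_eq)
    ultimately have L1: "real (L + 1) \<le> 2 / ln 2 * ln (real n)" by (simp add: field_simps)
    have nr: "real n ^ (2 * r) = real n * real n ^ q" by (simp only: q1(2)) simp
    have L2: "1 / 2 ^ (q * L) \<le> (2 ^ d) ^ q / real n ^ q"
    proof -
      have "1 / 2 ^ L \<le> 2 ^ d / real n" using L n by (simp add: field_simps power_add)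
      then have "(1 / 2 ^ L) ^ q \<le> (2 ^ d / real n) ^ q" by (intro power_mono) auto
      then show ?thesis by (simp add: power_divide power_mult[symmetric] mult.commute)
    qed
    have "(\<Sum>l\<in>k ` F. 1 / 2 ^ (q * s l)) = (\<Sum>t\<in>s ` k ` F. \<Sum>l\<in>{l \<in> k ` F. s l = t}. 1 / 2 ^ (q * s l))"
      using F by (intro sum.image_gen) auto
    also have "\<dots> = (\<Sum>t\<in>s ` k ` F. real (card {l \<in> k ` F. s l = t}) * (1 / 2 ^ (q * t)))"
      by (intro sum.cong) auto
    also have "\<dots> \<le> (\<Sum>t\<in>s ` k ` F. real ((t + 1) ^ p) * (1 / 2 ^ (q * t)))"
    proof (intro sum_mono mult_right_mono)
      fix t
      have "card {l \<in> k ` F. s l = t} \<le> (t + 1) ^ (CARD('n) - 1)"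
        by (rule card_sum_eq_le(2)) (auto simp: s_def)
      then show "real (card {l \<in> k ` F. s l = t}) \<le> real ((t + 1) ^ p)"
        unfolding of_nat_le_iff by (simp add: p_def d_def)
    qed simp
    also have "\<dots> = (\<Sum>t\<in>s ` k ` F. real (t + 1) ^ p / 2 ^ (q * t))"
      by (intro sum.cong) auto
    also have "\<dots> \<le> real (L + 1) ^ p / 2 ^ (q * L) * C2"
      unfolding C2_def by (rule sum_power_geometric_tail) (use F Lle q1 in auto)
    also have "\<dots> \<le> (2 / ln 2 * ln (real n)) ^ p * ((2 ^ d) ^ q / real n ^ q) * C2"
    proof -
      have "real (L + 1) ^ p \<le> (2 / ln 2 * ln (real n)) ^ p" using L1 by (intro power_mono) auto
      then have "real (L + 1) ^ p * (1 / 2 ^ (q * L)) \<le> (2 / ln 2 * ln (real n)) ^ p * ((2 ^ d) ^ q / real n ^ q)"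
        using L2 ln0 by (intro mult_mono) (auto intro!: zero_le_power mult_nonneg_nonneg)
      then show ?thesis using C20 by (intro mult_right_mono) auto
    qed
    finally have X: "(\<Sum>l\<in>k ` F. 1 / 2 ^ (q * s l))
      \<le> (2 / ln 2 * ln (real n)) ^ p * ((2 ^ d) ^ q / real n ^ q) * C2" .
    have "(\<Sum>m\<in>F. 1 / (\<Prod>j\<in>UNIV. max 1 (N * \<bar>(B *v m) $ j\<bar>)) ^ (2 * r)) \<le> (\<Sum>m\<in>F. 1 / 2 ^ (2 * r * s (k m)))"
      by (rule sum_mono[OF term_le])
    also have "\<dots> = (\<Sum>l\<in>k ` F. \<Sum>m\<in>{m \<in> F. k m = l}. 1 / 2 ^ (2 * r * s (k m)))"
      using F by (intro sum.image_gen) auto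
    also have "\<dots> = (\<Sum>l\<in>k ` F. real (card {m \<in> F. k m = l}) * (1 / 2 ^ (2 * r * s l)))"
      by (intro sum.cong) auto
    also have "\<dots> \<le> (\<Sum>l\<in>k ` F. C1 * 2 ^ s l / n * (1 / 2 ^ (2 * r * s l)))"
      by (intro sum_mono mult_right_mono card_le) auto
    also have "\<dots> = (\<Sum>l\<in>k ` F. C1 / n * (1 / 2 ^ (q * s l)))"
      by (intro sum.cong) (auto simp: q1(2) distrib_right power_add)
    also have "\<dots> = C1 / n * (\<Sum>l\<in>k ` F. 1 / 2 ^ (q * s l))"
      by (simp add: sum_distrib_left)
    also have "\<dots> \<le> C1 / n * ((2 / ln 2 * ln (real n)) ^ p * ((2 ^ d) ^ q / real n ^ q) * C2)"
      by (rule mult_left_mono[OF X]) (simp add: C1_def)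
    also have "C1 / n * ((2 / ln 2 * ln (real n)) ^ p * ((2 ^ d) ^ q / real n ^ q) * C2)
        = C1 * (2 / ln 2) ^ p * (2 ^ d) ^ q * C2 * ln (real n) ^ p / real n ^ (2 * r)"
      by (simp only: nr power_mult_distrib) (simp add: mult_ac)
    also have "\<dots> \<le> C * ln (real n) ^ p / real n ^ (2 * r)"
      using ln0 by (intro divide_right_mono mult_right_mono) (auto simp: C_def intro!: zero_le_power)
    finally show "(\<Sum>m\<in>F. 1 / (\<Prod>j\<in>UNIV. max 1 (real n powr (1 / CARD('n)) * \<bar>(B *v m) $ j\<bar>)) ^ (2 * r))
      \<le> C * ln (real n) ^ (CARD('n) - 1) / real n ^ (2 * r)"
      by (simp add: N_def p_def d_def)
  qed
qed

subsection \<open>The change of variables\<close>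

text \<open>A jet is a smooth function together with all its mixed partial derivatives, F \<alpha> being the
  derivative of multi-index \<alpha> of F 0.\<close>

definition jet :: "(('n \<Rightarrow> nat) \<Rightarrow> real ^ 'n \<Rightarrow> real) \<Rightarrow> bool" where
  "jet F \<longleftrightarrow> (\<forall>\<alpha>. continuous_on UNIV (F \<alpha>)) \<and>
    (\<forall>\<alpha> i x t. ((\<lambda>s. F \<alpha> (upd x i s)) has_real_derivative F (\<alpha>(i := Suc (\<alpha> i))) (upd x i t)) (at t))"

text \<open>The one-dimensional Sobolev embedding. The difference of \<phi>^2 at two points is an
  integral of 2 \<phi> \<phi>', which is bounded by the integral of \<phi>^2 + \<phi>'^2; averaging
  over the second point replaces its value by the L2 norm.\<close>

lemma sup_le_L2:
  assumes cont: "continuous_on UNIV \<phi>" "continuous_on UNIV \<phi>'"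
    and deriv: "\<And>t. (\<phi> has_real_derivative \<phi>' t) (at t)" and s: "s \<in> {0..1}"
  shows "(\<phi> s)\<^sup>2 \<le> 2 * integral {0..1} (\<lambda>t. (\<phi> t)\<^sup>2) + integral {0..1} (\<lambda>t. (\<phi>' t)\<^sup>2)"
proof -
  have c: "continuous_on S \<phi>" "continuous_on S \<phi>'" for S
    using cont continuous_on_subset by blast+
  let ?e = "\<lambda>t. (\<phi> t)\<^sup>2 + (\<phi>' t)\<^sup>2"
  have int: "?e integrable_on {a..b}" "(\<lambda>t. 2 * \<phi> t * \<phi>' t) integrable_on {a..b}" for a b
    by (intro integrable_continuous_real continuous_intros c)+
  have diff: "\<bar>(\<phi> b)\<^sup>2 - (\<phi> a)\<^sup>2\<bar> \<le> integral {0..1} ?e" if "0 \<le> a" "a \<le> b" "b \<le> 1" for a b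
  proof -
    have "((\<lambda>t. 2 * \<phi> t * \<phi>' t) has_integral (\<phi> b)\<^sup>2 - (\<phi> a)\<^sup>2) {a..b}"
      by (rule fundamental_theorem_of_calculus[OF that(2)])
         (auto intro!: derivative_eq_intros deriv simp: has_real_derivative_iff_has_vector_derivative[symmetric]
           intro: has_field_derivative_at_within)
    then have "\<bar>(\<phi> b)\<^sup>2 - (\<phi> a)\<^sup>2\<bar> = norm (integral {a..b} (\<lambda>t. 2 * \<phi> t * \<phi>' t))"
      by (simp add: integral_unique)
    also have "\<dots> \<le> integral {a..b} ?e"
    proof (rule integral_norm_bound_integral[OF int(2) int(1)])
      fix t
      have "0 \<le> (\<phi> t - \<phi>' t)\<^sup>2" "0 \<le> (\<phi> t + \<phi>' t)\<^sup>2" by auto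
      then show "norm (2 * \<phi> t * \<phi>' t) \<le> ?e t"
        by (simp add: power2_eq_square algebra_simps abs_le_iff)
    qed
    also have "\<dots> \<le> integral {0..1} ?e"
      by (rule integral_subset_le) (use that int in auto)
    finally show ?thesis .
  qed
  have le: "(\<phi> s)\<^sup>2 \<le> (\<phi> t)\<^sup>2 + integral {0..1} ?e" if "t \<in> {0..1}" for t
    using diff[of s t] diff[of t s] s that by (cases "s \<le> t") auto
  have "integral {0..1} (\<lambda>t :: real. (\<phi> s)\<^sup>2) \<le> integral {0..1} (\<lambda>t. (\<phi> t)\<^sup>2 + integral {0..1} ?e)"
    by (rule integral_le) (auto intro!: integrable_continuous_real continuous_intros c le)
  also have "\<dots> = integral {0..1} (\<lambda>t. (\<phi> t)\<^sup>2) + integral {0..1} ?e"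
    by (subst Henstock_Kurzweil_Integration.integral_add)
       (auto intro!: integrable_continuous_real continuous_intros c)
  also have "integral {0..1} ?e = integral {0..1} (\<lambda>t. (\<phi> t)\<^sup>2) + integral {0..1} (\<lambda>t. (\<phi>' t)\<^sup>2)"
    by (rule Henstock_Kurzweil_Integration.integral_add)
       (auto intro!: integrable_continuous_real continuous_intros c)
  finally show ?thesis by simp
qed

section \<open>The transformation \<psi> and its derivatives\<close>

context
  fixes \<psi> :: "real \<Rightarrow> real"
  assumes \<psi>: "transform_fun \<psi>"
begin

lemma DERIV_psi: "((deriv ^^ k) \<psi> has_real_derivative (deriv ^^ Suc k) \<psi> t) (at t)"
proof -
  have "(deriv ^^ k) \<psi> differentiable (at t)"
    using \<psi> by (auto simp: transform_fun_def smooth_fun_on_def)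
  then have "(deriv ^^ k) \<psi> field_differentiable (at t)"
    by (simp add: field_differentiable_def real_differentiable_def)
  then show ?thesis by (simp add: DERIV_deriv_iff_field_differentiable)
qed

lemma continuous_on_derivs_psi: "continuous_on S ((deriv ^^ k) \<psi>)"
  by (intro continuous_at_imp_continuous_on ballI DERIV_isCont[OF DERIV_psi])

lemma continuous_on_psi: "continuous_on S \<psi>"
  using continuous_on_derivs_psi[of S 0] by simp

lemma DERIV_psi': "(\<psi> has_real_derivative deriv \<psi> t) (at t)"
  using DERIV_psi[of 0] by simp

lemma continuous_on_deriv_psi: "continuous_on S (deriv \<psi>)"
  using continuous_on_derivs_psi[of S 1] by simp

text \<open>The values of \<psi> and of its derivatives are known on the open half-lines only;
  continuity extends them to the endpoints 0 and 1.\<close>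

lemma eq_on_closure_outside:
  fixes g :: "real \<Rightarrow> real"
  assumes "continuous_on UNIV g"
  shows "(\<And>t. t < 0 \<Longrightarrow> g t = c) \<Longrightarrow> t \<le> 0 \<Longrightarrow> g t = c"
    and "(\<And>t. 1 < t \<Longrightarrow> g t = c) \<Longrightarrow> 1 \<le> t \<Longrightarrow> g t = c"
proof -
  show "g t = c" if "\<And>t. t < 0 \<Longrightarrow> g t = c" "t \<le> 0"
  proof (rule continuous_constant_on_closure[of "{..<0}" g])
    show "t \<in> closure {..<0}" using that by simp
  qed (use that assms in \<open>auto intro: continuous_on_subset\<close>)
  show "g t = c" if "\<And>t. 1 < t \<Longrightarrow> g t = c" "1 \<le> t"
  proof (rule continuous_constant_on_closure[of "{1<..}" g])
    show "t \<in> closure {1<..}" using that by simp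
  qed (use that assms in \<open>auto intro: continuous_on_subset\<close>)
qed

lemma psi_le_0: "t \<le> 0 \<Longrightarrow> \<psi> t = 0"
  by (rule eq_on_closure_outside(1)[OF continuous_on_psi]) (use \<psi> in \<open>auto simp: transform_fun_def\<close>)

lemma psi_ge_1: "1 \<le> t \<Longrightarrow> \<psi> t = 1"
  by (rule eq_on_closure_outside(2)[OF continuous_on_psi]) (use \<psi> in \<open>auto simp: transform_fun_def\<close>)

lemma psi_inside: "0 < t \<Longrightarrow> t < 1 \<Longrightarrow> 0 < \<psi> t \<and> \<psi> t < 1"
  using \<psi> by (auto simp: transform_fun_def diffeomorphism_between_def bij_betw_def)

lemma psi_range: "0 \<le> \<psi> t" "\<psi> t \<le> 1"
proof -
  consider "t \<le> 0" | "1 \<le> t" | "0 < t" "t < 1" by linarith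
  then have "0 \<le> \<psi> t \<and> \<psi> t \<le> 1"
    by cases (use psi_le_0[of t] psi_ge_1[of t] psi_inside[of t] in auto)
  then show "0 \<le> \<psi> t" "\<psi> t \<le> 1" by auto
qed

lemma Psi_unit_cube: "Psi \<psi> x \<in> unit_cube"
  by (simp add: mem_unit_cube Psi_def psi_range)

text \<open>On either open half-line \<psi> is constant, so all its derivatives vanish there, and by
  continuity at 0 and 1 too. This flatness is what makes the transformed integrand vanish smoothly
  at the boundary of the cube.\<close>

lemma derivs_psi_outside:
  assumes "t \<notin> {0<..<1}"
  shows "(deriv ^^ Suc k) \<psi> t = 0"
proof -
  have const: "deriv g t = 0" if "open S" "t \<in> S" "\<And>s. s \<in> S \<Longrightarrow> g s = c" for g :: "real \<Rightarrow> real" and S t c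
  proof -
    have "((\<lambda>_. c) has_real_derivative 0) (at t)" by simp
    then have "(g has_real_derivative 0) (at t)"
      by (rule has_field_derivative_transform_within_open) (use that in auto)
    then show ?thesis by (rule DERIV_imp_deriv)
  qed
  have neg: "(deriv ^^ Suc k) \<psi> t = 0" if "t < 0" for t
    using that
  proof (induction k arbitrary: t)
    case 0
    then show ?case using const[of "{..<0}" t \<psi> 0] psi_le_0 by simp
  next
    case (Suc k)
    then show ?case using const[of "{..<0}" t "(deriv ^^ Suc k) \<psi>" 0] by simp
  qed
  have pos: "(deriv ^^ Suc k) \<psi> t = 0" if "1 < t" for t
    using that
  proof (induction k arbitrary: t)
    case 0
    then show ?case using const[of "{1<..}" t \<psi> 1] psi_ge_1 by simp
  next
    case (Suc k)
    then show ?case using const[of "{1<..}" t "(deriv ^^ Suc k) \<psi>" 0] by simp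
  qed
  have "t \<le> 0 \<or> 1 \<le> t" using assms by auto
  then show ?thesis
  proof
    assume "t \<le> 0"
    then show ?thesis
      using eq_on_closure_outside(1)[OF continuous_on_derivs_psi, of "Suc k" 0 t] neg by blast
  next
    assume "1 \<le> t"
    then show ?thesis
      using eq_on_closure_outside(2)[OF continuous_on_derivs_psi, of "Suc k" 0 t] pos by blast
  qed
qed

text \<open>A continuous injective function on an interval is monotone. Injectivity is extended from
  (0,1) to the endpoints because only they attain 0 and 1, and the value 1 at the right end fixes
  the orientation.\<close>

lemma psi_strict_mono:
  assumes "0 \<le> x" "x < y" "y \<le> 1"
  shows "\<psi> x < \<psi> y"
proof (cases "y = 1")
  case True
  then show ?thesis using assms psi_inside[of x] psi_le_0[of x] psi_ge_1[of y] by fastforce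
next
  case False
  have inj: "inj_on \<psi> {x..1}"
  proof (rule inj_onI)
    fix s t assume st: "s \<in> {x..1}" "t \<in> {x..1}" "\<psi> s = \<psi> t"
    have inj: "inj_on \<psi> {0<..<1}"
      using \<psi> by (auto simp: transform_fun_def diffeomorphism_between_def bij_betw_def)
    consider "s = 0" | "s = 1" | "0 < s" "s < 1" using st assms by fastforce
    then show "s = t"
    proof cases
      case 1
      then show ?thesis using st assms psi_inside[of t] psi_le_0[of s] psi_ge_1[of t] by fastforce
    next
      case 2
      then show ?thesis using st assms psi_inside[of t] psi_le_0[of t] psi_ge_1[of s] by fastforce
    next
      case 3
      have "0 < t" using st 3 psi_inside[of s] psi_le_0[of t] by fastforce
      moreover have "t < 1" using st 3 psi_inside[of s] psi_ge_1[of t] by fastforce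
      ultimately show ?thesis using inj st 3 by (auto simp: inj_on_def)
    qed
  qed
  have "x < y" "y < 1" using assms False by auto
  from continuous_inj_imp_mono[OF this continuous_on_psi inj] show ?thesis
    using psi_ge_1[of 1] psi_range[of y] by auto
qed

lemma deriv_psi_nonneg: "0 \<le> deriv \<psi> t"
proof (cases "t \<in> {0<..<1}")
  case True
  have "mono_on {0..1} \<psi>"
  proof (rule mono_onI)
    fix x y :: real assume "x \<in> {0..1}" "y \<in> {0..1}" "x \<le> y"
    then show "\<psi> x \<le> \<psi> y" using psi_strict_mono[of x y] by (cases "x = y") auto
  qed
  then show ?thesis
    by (rule mono_on_imp_deriv_nonneg[OF _ DERIV_psi']) (use True in auto)
next
  case False
  then show ?thesis using derivs_psi_outside[of t 0] by simp
qed

text \<open>The algebra generated by the derivatives of \<psi>. It is closed under differentiation, and its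
  elements vanish outside the open unit interval.\<close>

inductive psi_alg :: "(real \<Rightarrow> real) \<Rightarrow> bool" where
  zero: "psi_alg (\<lambda>_. 0)"
| base: "psi_alg ((deriv ^^ Suc k) \<psi>)"
| add: "psi_alg p \<Longrightarrow> psi_alg q \<Longrightarrow> psi_alg (\<lambda>t. p t + q t)"
| mult: "psi_alg p \<Longrightarrow> psi_alg q \<Longrightarrow> psi_alg (\<lambda>t. p t * q t)"

lemma psi_alg_DERIV:
  assumes "psi_alg p"
  shows "(p has_real_derivative deriv p t) (at t)" "psi_alg (deriv p)"
proof -
  have "\<exists>p'. psi_alg p' \<and> (\<forall>t. (p has_real_derivative p' t) (at t))"
    using assms
  proof induction
    case zero
    then show ?case by (intro exI[of _ "\<lambda>_. 0"]) (auto intro: psi_alg.zero)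
  next
    case (base k)
    then show ?case using psi_alg.base[of "Suc k"] DERIV_psi[of "Suc k"] by blast
  next
    case (add p q)
    then obtain p' q' where *: "psi_alg p'" "psi_alg q'"
      "\<And>t. (p has_real_derivative p' t) (at t)" "\<And>t. (q has_real_derivative q' t) (at t)" by blast
    show ?case
      by (intro exI[of _ "\<lambda>t. p' t + q' t"] conjI allI psi_alg.add DERIV_add *)
  next
    case (mult p q)
    then obtain p' q' where *: "psi_alg p'" "psi_alg q'"
      "\<And>t. (p has_real_derivative p' t) (at t)" "\<And>t. (q has_real_derivative q' t) (at t)" by blast
    have "psi_alg (\<lambda>t. p' t * q t + q' t * p t)"
      by (intro psi_alg.add psi_alg.mult * mult.hyps)
    moreover have "((\<lambda>t. p t * q t) has_real_derivative p' t * q t + q' t * p t) (at t)" for t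
      by (intro DERIV_mult *)
    ultimately show ?case by blast
  qed
  then obtain p' where p': "psi_alg p'" "\<And>t. (p has_real_derivative p' t) (at t)" by blast
  then have "deriv p = p'" by (auto intro: DERIV_imp_deriv)
  with p' show "(p has_real_derivative deriv p t) (at t)" "psi_alg (deriv p)" by auto
qed

lemma psi_alg_continuous: "psi_alg p \<Longrightarrow> continuous_on S p"
  by (intro continuous_at_imp_continuous_on ballI DERIV_isCont[OF psi_alg_DERIV(1)])

lemma psi_alg_outside:
  assumes "psi_alg p" and t: "t \<notin> {0<..<1}"
  shows "p t = 0"
  using assms(1)
proof induction
  case (base k)
  show ?case using t by (rule derivs_psi_outside)
qed auto

text \<open>\<open>((h \<circ> \<psi>) \<psi>')\<^sup>(\<^sup>k\<^sup>) = (\<Sum>j\<le>k. chain_coeff k j * (h\<^sup>(\<^sup>j\<^sup>) \<circ> \<psi>))\<close>\<close>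

fun chain_coeff :: "nat \<Rightarrow> nat \<Rightarrow> real \<Rightarrow> real" where
  "chain_coeff 0 0 = deriv \<psi>"
| "chain_coeff 0 (Suc j) = (\<lambda>_. 0)"
| "chain_coeff (Suc k) 0 = deriv (chain_coeff k 0)"
| "chain_coeff (Suc k) (Suc j) = (\<lambda>t. deriv (chain_coeff k (Suc j)) t + chain_coeff k j t * deriv \<psi> t)"

lemma psi_alg_chain_coeff: "psi_alg (chain_coeff k j)"
proof (induction k arbitrary: j)
  case 0
  then show ?case using psi_alg.base[of 0] by (cases j) (auto intro: psi_alg.zero)
next
  case (Suc k)
  have d: "psi_alg (deriv \<psi>)" using psi_alg.base[of 0] by simp
  show ?case
  proof (cases j)
    case 0
    then show ?thesis using psi_alg_DERIV(2)[OF Suc.IH] by simp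
  next
    case (Suc j')
    then show ?thesis
      using psi_alg.add[OF psi_alg_DERIV(2)[OF Suc.IH[of j]] psi_alg.mult[OF Suc.IH[of j'] d]] by simp
  qed
qed

lemma chain_coeff_eq_0: "k < j \<Longrightarrow> chain_coeff k j = (\<lambda>_. 0)"
proof (induction k arbitrary: j)
  case 0
  then show ?case by (cases j) auto
next
  case (Suc k)
  then obtain j' where "j = Suc j'" "k < j'" by (cases j) auto
  then show ?case using Suc.IH[of j] Suc.IH[of j'] by simp
qed

lemma chain_coeff_diag: "chain_coeff k k t = deriv \<psi> t ^ Suc k"
  by (induction k arbitrary: t) (auto simp: chain_coeff_eq_0 mult.commute)

text \<open>The left side is the product rule applied to the expansion of order k; X j stands for
  the j-th derivative at \<psi> t. Shifting the index in the second summand gives the recursion of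
  \<open>chain_coeff\<close>, since the coefficient with j = k + 1 is 0 at order k.\<close>

lemma sum_chain_coeff_step:
  "(\<Sum>j\<le>k. deriv (chain_coeff k j) t * X j + chain_coeff k j t * (X (Suc j) * deriv \<psi> t))
    = (\<Sum>j\<le>Suc k. chain_coeff (Suc k) j t * X j)"
proof -
  have "(\<Sum>j\<le>Suc k. chain_coeff (Suc k) j t * X j)
      = deriv (chain_coeff k 0) t * X 0 + (\<Sum>j\<le>k. (deriv (chain_coeff k (Suc j)) t + chain_coeff k j t * deriv \<psi> t) * X (Suc j))"
    by (subst sum.atMost_Suc_shift) simp
  also have "\<dots> = (deriv (chain_coeff k 0) t * X 0 + (\<Sum>j\<le>k. deriv (chain_coeff k (Suc j)) t * X (Suc j)))
      + (\<Sum>j\<le>k. chain_coeff k j t * (X (Suc j) * deriv \<psi> t))"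
    by (simp add: sum.distrib[symmetric] algebra_simps)
  also have "deriv (chain_coeff k 0) t * X 0 + (\<Sum>j\<le>k. deriv (chain_coeff k (Suc j)) t * X (Suc j))
      = (\<Sum>j\<le>Suc k. deriv (chain_coeff k j) t * X j)"
    by (subst sum.atMost_Suc_shift) simp
  also have "\<dots> = (\<Sum>j\<le>k. deriv (chain_coeff k j) t * X j)"
    by (simp add: chain_coeff_eq_0)
  finally show ?thesis by (simp add: sum.distrib)
qed

text \<open>The jet of \<open>\<psi>' (x $ i)\<close> times F 0 with coordinate i of its argument
  replaced by its image under \<psi>. Acting on whole jets, it can be composed over all coordinates,
  which yields the jet of (F 0 \<circ> Psi) times the Jacobian determinant.\<close>

definition coord_transform :: "'n \<Rightarrow> (('n \<Rightarrow> nat) \<Rightarrow> real ^ 'n \<Rightarrow> real) \<Rightarrow> ('n \<Rightarrow> nat) \<Rightarrow> real ^ 'n \<Rightarrow> real" where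
  "coord_transform i F \<alpha> x = (\<Sum>j\<le>\<alpha> i. chain_coeff (\<alpha> i) j (x $ i) * F (\<alpha>(i := j)) (upd x i (\<psi> (x $ i))))"

text \<open>In direction i the chain and product rules give the recursion of the coefficients. In
  any other direction the coefficients are constants, and the differentiation commutes with the
  substitution.\<close>

lemma jet_coord_transform:
  fixes F :: "('n :: finite \<Rightarrow> nat) \<Rightarrow> real ^ 'n \<Rightarrow> real"
  assumes F: "jet F"
  shows "jet (coord_transform i F)"
  unfolding jet_def
proof (intro conjI allI)
  have cF: "continuous_on UNIV (F \<alpha>)" for \<alpha> using F by (simp add: jet_def)
  have dF: "((\<lambda>s. F \<alpha> (upd x i s)) has_real_derivative F (\<alpha>(i := Suc (\<alpha> i))) (upd x i t)) (at t)" for \<alpha> i x t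
    using F by (simp add: jet_def)
  fix \<alpha>
  show "continuous_on UNIV (coord_transform i F \<alpha>)"
    unfolding coord_transform_def
    by (intro continuous_intros continuous_on_compose2[OF psi_alg_continuous[OF psi_alg_chain_coeff]]
        continuous_on_compose2[OF cF] continuous_on_compose2[OF continuous_on_psi]) auto
  fix l x t
  show "((\<lambda>s. coord_transform i F \<alpha> (upd x l s)) has_real_derivative
      coord_transform i F (\<alpha>(l := Suc (\<alpha> l))) (upd x l t)) (at t)"
  proof (cases "l = i")
    case True
    let ?k = "\<alpha> i"
    define X where "X j = F (\<alpha>(i := j)) (upd x i (\<psi> t))" for j
    have dX: "((\<lambda>s. F (\<alpha>(i := j)) (upd x i (\<psi> s))) has_real_derivative X (Suc j) * deriv \<psi> t) (at t)" for j
      using DERIV_chain2[OF dF[of "\<alpha>(i := j)" x i "\<psi> t"] DERIV_psi'] by (simp add: X_def)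
    have "((\<lambda>s. \<Sum>j\<le>?k. chain_coeff ?k j s * F (\<alpha>(i := j)) (upd x i (\<psi> s))) has_real_derivative
        (\<Sum>j\<le>?k. deriv (chain_coeff ?k j) t * X j + chain_coeff ?k j t * (X (Suc j) * deriv \<psi> t))) (at t)"
    proof (rule DERIV_sum)
      fix j
      show "((\<lambda>s. chain_coeff ?k j s * F (\<alpha>(i := j)) (upd x i (\<psi> s))) has_real_derivative
        deriv (chain_coeff ?k j) t * X j + chain_coeff ?k j t * (X (Suc j) * deriv \<psi> t)) (at t)"
        using DERIV_mult'[OF psi_alg_DERIV(1)[OF psi_alg_chain_coeff[of ?k j], of t] dX[of j]]
        by (simp add: X_def add.commute)
    qed
    then show ?thesis
      unfolding sum_chain_coeff_step by (simp add: True coord_transform_def X_def)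
  next
    case False
    have "((\<lambda>s. \<Sum>j\<le>\<alpha> i. chain_coeff (\<alpha> i) j (x $ i) * F (\<alpha>(i := j)) (upd (upd x i (\<psi> (x $ i))) l s)) has_real_derivative
        (\<Sum>j\<le>\<alpha> i. chain_coeff (\<alpha> i) j (x $ i) * F ((\<alpha>(i := j))(l := Suc ((\<alpha>(i := j)) l))) (upd (upd x i (\<psi> (x $ i))) l t))) (at t)"
      by (intro DERIV_sum DERIV_cmult dF)
    then show ?thesis
      using False unfolding coord_transform_def
      by (simp add: upd_commute[of l i] fun_upd_twist[of l i])
  qed
qed

section \<open>Substitution and L2 bounds for the transformed derivatives\<close>

lemma integral_psi_subst:
  assumes u: "continuous_on UNIV u"
  shows "integral {0..1} (\<lambda>t. deriv \<psi> t * u (\<psi> t)) = integral {0..1} (u :: real \<Rightarrow> real)"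
proof -
  have "((\<lambda>t. deriv \<psi> t *\<^sub>R u (\<psi> t)) has_integral integral {\<psi> 0..\<psi> 1} u) {0..1}"
    by (rule has_integral_substitution[where c = 0 and d = 1])
       (auto simp: psi_range psi_le_0 psi_ge_1 intro: continuous_on_subset[OF u] has_field_derivative_at_within DERIV_psi')
  then show ?thesis by (simp add: integral_unique psi_le_0 psi_ge_1)
qed

lemma integral_cube_psi_subst_coordinate:
  fixes h :: "real ^ 'n \<Rightarrow> real"
  assumes h: "continuous_on UNIV h"
  shows "(\<integral>x. deriv \<psi> (x $ i) * h (upd x i (\<psi> (x $ i))) \<partial>cube_measure) = (\<integral>x. h x \<partial>cube_measure)"
proof -
  have c: "continuous_on UNIV (\<lambda>x. deriv \<psi> (x $ i) * h (upd x i (\<psi> (x $ i))))"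
    by (intro continuous_intros continuous_on_compose2[OF h] continuous_on_compose2[OF continuous_on_psi]
        continuous_on_compose2[OF continuous_on_deriv_psi]) auto
  have "continuous_on UNIV (\<lambda>t. h (upd x i t))" for x
    by (intro continuous_on_compose2[OF h] continuous_intros) auto
  then have "integral {0..1} (\<lambda>t. deriv \<psi> t * h (upd x i (\<psi> t))) = integral {0..1} (\<lambda>t. h (upd x i t))" for x
    by (rule integral_psi_subst)
  then show ?thesis
    by (simp add: integral_cube_coordinate[OF c, of i] integral_cube_coordinate[OF h, of i])
qed

text \<open>\<open>W I\<close> transforms only the coordinates in I, so adding one coordinate to I
  is a one-dimensional substitution.\<close>

lemma integral_cube_psi_subst:
  fixes h :: "real ^ 'n \<Rightarrow> real"
  assumes h: "continuous_on UNIV h"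
  shows "(\<integral>x. h (Psi \<psi> x) * DPsi \<psi> x \<partial>cube_measure) = (\<integral>x. h x \<partial>cube_measure)"
proof -
  define W where "W I x = (\<Prod>i\<in>I. deriv \<psi> (x $ i)) * h (\<chi> i. if i \<in> I then \<psi> (x $ i) else x $ i)" for I x
  have cW: "continuous_on UNIV (W I)" for I
  proof -
    have "continuous_on UNIV (\<lambda>x :: real ^ 'n. if i \<in> I then \<psi> (x $ i) else x $ i)" for i
      by (cases "i \<in> I") (auto intro!: continuous_intros continuous_on_compose2[OF continuous_on_psi])
    then show ?thesis
      unfolding W_def
      by (intro continuous_intros continuous_on_compose2[OF h] continuous_on_vec_lambda
        continuous_on_compose2[OF continuous_on_deriv_psi]) auto
  qed
  have "finite I \<Longrightarrow> (\<integral>x. W I x \<partial>cube_measure) = (\<integral>x. h x \<partial>cube_measure)" for I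
  proof (induction rule: finite_induct)
    case empty
    then show ?case by (simp add: W_def)
  next
    case (insert i I)
    have "W (insert i I) x = deriv \<psi> (x $ i) * W I (upd x i (\<psi> (x $ i)))" for x
    proof -
      have "(\<chi> j. if j \<in> insert i I then \<psi> (x $ j) else x $ j)
          = (\<chi> j. if j \<in> I then \<psi> (upd x i (\<psi> (x $ i)) $ j) else upd x i (\<psi> (x $ i)) $ j)"
        using insert.hyps by (auto simp: vec_eq_iff)
      moreover have "(\<Prod>j\<in>I. deriv \<psi> (x $ j)) = (\<Prod>j\<in>I. deriv \<psi> (upd x i (\<psi> (x $ i)) $ j))"
        using insert.hyps by (intro prod.cong) auto
      moreover have "(\<Prod>j\<in>insert i I. deriv \<psi> (x $ j)) = deriv \<psi> (x $ i) * (\<Prod>j\<in>I. deriv \<psi> (x $ j))"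
        using insert.hyps by simp
      ultimately show ?thesis
        by (simp only: W_def mult.assoc)
    qed
    then show ?case using integral_cube_psi_subst_coordinate[OF cW] insert.IH by simp
  qed
  from this[of UNIV] show ?thesis
    by (simp add: W_def DPsi_eq_prod[OF \<psi>] Psi_def[abs_def] mult.commute)
qed

lemma chain_coeff_bound: "\<exists>P\<ge>0. \<forall>k\<le>r. \<forall>j\<le>r. \<forall>t\<in>{0..1}. \<bar>chain_coeff k j t\<bar> \<le> P"
proof -
  have "\<exists>P. \<forall>t\<in>{0..1}. \<bar>chain_coeff k j t\<bar> \<le> P" for k j
  proof -
    have "compact (chain_coeff k j ` {0..1})"
      by (intro compact_continuous_image psi_alg_continuous psi_alg_chain_coeff) auto
    then show ?thesis using compact_imp_bounded[of "chain_coeff k j ` {0..1}"] by (auto simp: bounded_iff)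
  qed
  then obtain P where P: "\<And>k j t. t \<in> {0..1} \<Longrightarrow> \<bar>chain_coeff k j t\<bar> \<le> P k j" by metis
  have P0: "0 \<le> P k j" for k j using P[of 0 k j] by auto
  have "P k j \<le> (\<Sum>k\<le>r. \<Sum>j\<le>r. P k j)" if "k \<le> r" "j \<le> r" for k j
  proof -
    have "P k j \<le> (\<Sum>j\<le>r. P k j)" using that P0 by (intro member_le_sum) auto
    also have "\<dots> \<le> (\<Sum>k\<le>r. \<Sum>j\<le>r. P k j)"
      using that P0 by (intro member_le_sum[of k "{..r}" "\<lambda>k. \<Sum>j\<le>r. P k j"] sum_nonneg) auto
    finally show ?thesis .
  qed
  then have "\<forall>k\<le>r. \<forall>j\<le>r. \<forall>t\<in>{0..1}. \<bar>chain_coeff k j t\<bar> \<le> (\<Sum>k\<le>r. \<Sum>j\<le>r. P k j)"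
    using P by (meson order_trans)
  moreover have "0 \<le> (\<Sum>k\<le>r. \<Sum>j\<le>r. P k j)" by (intro sum_nonneg P0)
  ultimately show ?thesis by blast
qed

text \<open>Derivatives of order below r are bounded in the supremum norm by the L2 norms of one more
  derivative. The derivative of order r occurs with the factor \<open>chain_coeff r r = \<psi>' ^ Suc r\<close>, of
  which one power of \<psi>' is absorbed by the substitution.\<close>

lemma integral_chain_coeff_le:
  "\<exists>C\<ge>0. \<forall>\<phi>. (\<forall>j. continuous_on UNIV (\<phi> j)) \<and> (\<forall>j t. (\<phi> j has_real_derivative \<phi> (Suc j) t) (at t)) \<longrightarrow>
    (\<forall>k\<le>r. integral {0..1} (\<lambda>t. (\<Sum>j\<le>k. chain_coeff k j t * \<phi> j (\<psi> t))\<^sup>2)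
      \<le> C * (\<Sum>j\<le>r. integral {0..1} (\<lambda>t. (\<phi> j t)\<^sup>2)))"
proof -
  obtain P where P0: "0 \<le> P" and P: "\<And>k j t. k \<le> r \<Longrightarrow> j \<le> r \<Longrightarrow> t \<in> {0..1} \<Longrightarrow> \<bar>chain_coeff k j t\<bar> \<le> P"
    using chain_coeff_bound[of r] by auto
  \<comment> \<open>The outer r + 1 is the Cauchy-Schwarz factor for at most r + 1 summands, the
    inner one counts them. A single summand contributes \<open>2 * P\<^sup>2\<close> if its order is
    below r, by the supremum bound, and \<open>P ^ (2 * r + 1)\<close> if its order is r.\<close>
  define C where "C = real (r + 1) * (real (r + 1) * (2 * P\<^sup>2 + P ^ (2 * r + 1)))"
  show ?thesis
  proof (rule exI[of _ C], intro conjI allI impI)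
    show "0 \<le> C" using P0 by (simp add: C_def)
    fix \<phi> :: "nat \<Rightarrow> real \<Rightarrow> real" and k
    assume cd: "(\<forall>j. continuous_on UNIV (\<phi> j)) \<and> (\<forall>j t. (\<phi> j has_real_derivative \<phi> (Suc j) t) (at t))"
      and k: "k \<le> r"
    from cd have c: "\<forall>j. continuous_on UNIV (\<phi> j)"
      and d: "\<forall>j t. (\<phi> j has_real_derivative \<phi> (Suc j) t) (at t)" by auto
    define E where "E = (\<Sum>j\<le>r. integral {0..1} (\<lambda>t. (\<phi> j t)\<^sup>2))"
    have cS: "continuous_on S (\<phi> j)" for S j using c continuous_on_subset by blast
    have c\<psi>: "continuous_on S (\<lambda>t. \<phi> j (\<psi> t))" for S j
      by (rule continuous_on_compose2[OF cS continuous_on_psi]) auto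
    have cc: "continuous_on S (chain_coeff k j)" for S j by (rule psi_alg_continuous[OF psi_alg_chain_coeff])
    have I0: "0 \<le> integral {0..1} (\<lambda>t. (\<phi> j t)\<^sup>2)" for j
      by (rule Henstock_Kurzweil_Integration.integral_nonneg) (auto intro!: integrable_continuous_real continuous_intros cS)
    have IE: "integral {0..1} (\<lambda>t. (\<phi> j t)\<^sup>2) \<le> E" if "j \<le> r" for j
      unfolding E_def using that I0 by (intro member_le_sum) auto
    have E0: "0 \<le> E" unfolding E_def by (intro sum_nonneg I0)
    have sup: "(\<phi> j s)\<^sup>2 \<le> 2 * E" if "j < r" "s \<in> {0..1}" for j s
    proof -
      have "(\<phi> j s)\<^sup>2 \<le> 2 * integral {0..1} (\<lambda>t. (\<phi> j t)\<^sup>2) + integral {0..1} (\<lambda>t. (\<phi> (Suc j) t)\<^sup>2)"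
        by (rule sup_le_L2) (use cS d that in auto)
      moreover have "(\<Sum>i\<in>{j, Suc j}. integral {0..1} (\<lambda>t. (\<phi> i t)\<^sup>2)) \<le> E"
        unfolding E_def using that I0 by (intro sum_mono2) auto
      ultimately show ?thesis using I0[of "Suc j"] by simp
    qed
    have part: "integral {0..1} (\<lambda>t. (chain_coeff k j t * \<phi> j (\<psi> t))\<^sup>2) \<le> (2 * P\<^sup>2 + P ^ (2 * r + 1)) * E"
      if j: "j \<le> k" for j
    proof (cases "j < r")
      case True
      have "integral {0..1} (\<lambda>t. (chain_coeff k j t * \<phi> j (\<psi> t))\<^sup>2) \<le> integral {0..1} (\<lambda>t :: real. P\<^sup>2 * (2 * E))"
      proof (rule integral_le)
        fix t :: real assume t: "t \<in> {0..1}"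
        have "(chain_coeff k j t)\<^sup>2 \<le> P\<^sup>2"
          using P[OF k _ t, of j] j k by (simp add: abs_le_square_iff[symmetric])
        moreover have "(\<phi> j (\<psi> t))\<^sup>2 \<le> 2 * E" using True psi_range by (intro sup) auto
        ultimately show "(chain_coeff k j t * \<phi> j (\<psi> t))\<^sup>2 \<le> P\<^sup>2 * (2 * E)"
          unfolding power_mult_distrib by (intro mult_mono) auto
      qed (auto intro!: integrable_continuous_real continuous_intros cc c\<psi>)
      also have "\<dots> = 2 * P\<^sup>2 * E" by simp
      also have "\<dots> \<le> (2 * P\<^sup>2 + P ^ (2 * r + 1)) * E"
        using P0 E0 by (intro mult_right_mono) auto
      finally show ?thesis .
    next
      case False
      then have jk: "j = r" "k = r" using j k by auto
      have "integral {0..1} (\<lambda>t. (chain_coeff k j t * \<phi> j (\<psi> t))\<^sup>2)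
          \<le> integral {0..1} (\<lambda>t. P ^ (2 * r + 1) * (deriv \<psi> t * (\<phi> r (\<psi> t))\<^sup>2))"
      proof (rule integral_le)
        fix t :: real assume t: "t \<in> {0..1}"
        have p: "0 \<le> deriv \<psi> t" "deriv \<psi> t \<le> P"
          using deriv_psi_nonneg[of t] P[of 0 0 t] t by auto
        \<comment> \<open>Of the 2 r + 2 factors, all but one are estimated by P; the remaining one
          is the Jacobian of the substitution.\<close>
        have "(deriv \<psi> t ^ Suc r)\<^sup>2 = deriv \<psi> t ^ (2 * r + 1) * deriv \<psi> t"
          by (simp add: power_mult[symmetric] mult.commute power_add[symmetric] power_Suc[symmetric] del: power_Suc)
        also have "\<dots> \<le> P ^ (2 * r + 1) * deriv \<psi> t"
          using p by (intro mult_right_mono power_mono) auto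
        finally have "(deriv \<psi> t ^ Suc r)\<^sup>2 * (\<phi> r (\<psi> t))\<^sup>2 \<le> P ^ (2 * r + 1) * deriv \<psi> t * (\<phi> r (\<psi> t))\<^sup>2"
          by (intro mult_right_mono) auto
        then show "(chain_coeff k j t * \<phi> j (\<psi> t))\<^sup>2 \<le> P ^ (2 * r + 1) * (deriv \<psi> t * (\<phi> r (\<psi> t))\<^sup>2)"
          unfolding jk chain_coeff_diag power_mult_distrib by (simp add: mult.assoc)
      qed (auto intro!: integrable_continuous_real continuous_intros cc c\<psi> continuous_on_deriv_psi)
      also have "\<dots> = P ^ (2 * r + 1) * integral {0..1} (\<lambda>t. (\<phi> r t)\<^sup>2)"
        by (simp add: integral_psi_subst[of "\<lambda>s. (\<phi> r s)\<^sup>2"] continuous_intros cS)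
      also have "\<dots> \<le> P ^ (2 * r + 1) * E"
        using IE[of r] P0 by (intro mult_left_mono) auto
      also have "\<dots> \<le> (2 * P\<^sup>2 + P ^ (2 * r + 1)) * E"
        using P0 E0 by (intro mult_right_mono) auto
      finally show ?thesis .
    qed
    have "integral {0..1} (\<lambda>t. (\<Sum>j\<le>k. chain_coeff k j t * \<phi> j (\<psi> t))\<^sup>2)
        \<le> integral {0..1} (\<lambda>t. real (r + 1) * (\<Sum>j\<le>k. (chain_coeff k j t * \<phi> j (\<psi> t))\<^sup>2))"
    proof (rule integral_le)
      fix t :: real
      have "(\<Sum>j\<le>k. chain_coeff k j t * \<phi> j (\<psi> t))\<^sup>2 \<le> real (k + 1) * (\<Sum>j\<le>k. (chain_coeff k j t * \<phi> j (\<psi> t))\<^sup>2)"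
        using Cauchy_Schwarz_ineq_sum[of "\<lambda>_. 1" "\<lambda>j. chain_coeff k j t * \<phi> j (\<psi> t)" "{..k}"] by simp
      also have "\<dots> \<le> real (r + 1) * (\<Sum>j\<le>k. (chain_coeff k j t * \<phi> j (\<psi> t))\<^sup>2)"
        using k by (intro mult_right_mono sum_nonneg) auto
      finally show "(\<Sum>j\<le>k. chain_coeff k j t * \<phi> j (\<psi> t))\<^sup>2
          \<le> real (r + 1) * (\<Sum>j\<le>k. (chain_coeff k j t * \<phi> j (\<psi> t))\<^sup>2)" .
    qed (auto intro!: integrable_continuous_real continuous_intros cc c\<psi>)
    also have "\<dots> = real (r + 1) * (\<Sum>j\<le>k. integral {0..1} (\<lambda>t. (chain_coeff k j t * \<phi> j (\<psi> t))\<^sup>2))"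
      by (subst Henstock_Kurzweil_Integration.integral_mult_right, subst Henstock_Kurzweil_Integration.integral_sum)
         (auto intro!: integrable_continuous_real continuous_intros cc c\<psi>)
    also have "\<dots> \<le> real (r + 1) * (\<Sum>j\<le>k. (2 * P\<^sup>2 + P ^ (2 * r + 1)) * E)"
      by (intro mult_left_mono sum_mono part) auto
    also have "\<dots> \<le> C * E"
    proof -
      have "real (k + 1) * ((2 * P\<^sup>2 + P ^ (2 * r + 1)) * E) \<le> real (r + 1) * ((2 * P\<^sup>2 + P ^ (2 * r + 1)) * E)"
        using k P0 E0 by (intro mult_right_mono mult_nonneg_nonneg) auto
      then have "real (r + 1) * (real (k + 1) * ((2 * P\<^sup>2 + P ^ (2 * r + 1)) * E))
          \<le> real (r + 1) * (real (r + 1) * ((2 * P\<^sup>2 + P ^ (2 * r + 1)) * E))"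
        by (intro mult_left_mono) auto
      then show ?thesis by (simp only: C_def sum_constant card_atMost mult.assoc) (simp add: add.commute)
    qed
    finally show "integral {0..1} (\<lambda>t. (\<Sum>j\<le>k. chain_coeff k j t * \<phi> j (\<psi> t))\<^sup>2)
      \<le> C * (\<Sum>j\<le>r. integral {0..1} (\<lambda>t. (\<phi> j t)\<^sup>2))" by (simp only: E_def)
  qed
qed

text \<open>On every line in direction i the functions \<open>F (\<alpha>(i := j))\<close> form a
  sequence of successive derivatives, to which the one-dimensional estimate applies. Integration
  over the remaining coordinates preserves it.\<close>

lemma integral_coord_transform_le:
  "\<exists>C\<ge>0. \<forall>F :: ('n :: finite \<Rightarrow> nat) \<Rightarrow> real ^ 'n \<Rightarrow> real. \<forall>i :: 'n. \<forall>\<alpha>. jet F \<and> \<alpha> i \<le> r \<longrightarrow>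
    (\<integral>x. (coord_transform i F \<alpha> x)\<^sup>2 \<partial>cube_measure) \<le> C * (\<Sum>j\<le>r. \<integral>x. (F (\<alpha>(i := j)) x)\<^sup>2 \<partial>cube_measure)"
proof -
  obtain C where C0: "0 \<le> C" and C': "\<forall>\<phi>. (\<forall>j. continuous_on UNIV (\<phi> j)) \<and>
      (\<forall>j t. (\<phi> j has_real_derivative \<phi> (Suc j) t) (at t)) \<longrightarrow>
      (\<forall>k\<le>r. integral {0..1} (\<lambda>t. (\<Sum>j\<le>k. chain_coeff k j t * \<phi> j (\<psi> t))\<^sup>2)
        \<le> C * (\<Sum>j\<le>r. integral {0..1} (\<lambda>t. (\<phi> j t)\<^sup>2)))"
    using integral_chain_coeff_le[of r] by (elim exE conjE) (rule that)
  have C: "integral {0..1} (\<lambda>t. (\<Sum>j\<le>k. chain_coeff k j t * \<phi> j (\<psi> t))\<^sup>2)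
        \<le> C * (\<Sum>j\<le>r. integral {0..1} (\<lambda>t. (\<phi> j t)\<^sup>2))"
    if "\<forall>j. continuous_on UNIV (\<phi> j)" "\<forall>j t. (\<phi> j has_real_derivative \<phi> (Suc j) t) (at t)" "k \<le> r" for \<phi> k
    using C' that by blast
  show ?thesis
  proof (rule exI[of _ C], intro conjI allI impI C0)
    fix F :: "('n \<Rightarrow> nat) \<Rightarrow> real ^ 'n \<Rightarrow> real" and i :: 'n and \<alpha>
    assume F\<alpha>: "jet F \<and> \<alpha> i \<le> r"
    then have F: "jet F" and \<alpha>: "\<alpha> i \<le> r" by auto
    have cF: "continuous_on UNIV (F \<beta>)" for \<beta> using F by (simp add: jet_def)
    have cT: "continuous_on UNIV (coord_transform i F \<alpha>)"
      using jet_coord_transform[OF F] by (simp add: jet_def)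
    have int: "continuous_on UNIV (\<lambda>x. integral {0..1} (\<lambda>t. h (upd x i t)))"
      if "continuous_on UNIV h" for h :: "real ^ 'n \<Rightarrow> real"
    proof -
      have "continuous_on (UNIV \<times> cbox 0 1) (\<lambda>(x, t). h (upd x i t))"
        unfolding case_prod_unfold by (intro continuous_on_compose2[OF that] continuous_intros) auto
      then show ?thesis using integral_continuous_on_param[of UNIV 0 1 "\<lambda>x t. h (upd x i t)"] by simp
    qed
    have "(\<integral>x. (coord_transform i F \<alpha> x)\<^sup>2 \<partial>cube_measure)
        = (\<integral>x. integral {0..1} (\<lambda>t. (coord_transform i F \<alpha> (upd x i t))\<^sup>2) \<partial>cube_measure)"
      by (rule integral_cube_coordinate) (intro continuous_intros cT)
    also have "\<dots> \<le> (\<integral>x. C * (\<Sum>j\<le>r. integral {0..1} (\<lambda>t. (F (\<alpha>(i := j)) (upd x i t))\<^sup>2)) \<partial>cube_measure)"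
    proof (rule Bochner_Integration.integral_mono)
      fix x :: "real ^ 'n"
      define \<phi> where "\<phi> j t = F (\<alpha>(i := j)) (upd x i t)" for j t
      have "integral {0..1} (\<lambda>t. (\<Sum>j\<le>\<alpha> i. chain_coeff (\<alpha> i) j t * \<phi> j (\<psi> t))\<^sup>2)
          \<le> C * (\<Sum>j\<le>r. integral {0..1} (\<lambda>t. (\<phi> j t)\<^sup>2))"
      proof (rule C)
        show "\<forall>j. continuous_on UNIV (\<phi> j)"
          unfolding \<phi>_def by (intro allI continuous_on_compose2[OF cF] continuous_intros) auto
        show "\<forall>j t. (\<phi> j has_real_derivative \<phi> (Suc j) t) (at t)"
        proof (intro allI)
          fix j t
          have "((\<lambda>s. F (\<alpha>(i := j)) (upd x i s)) has_real_derivative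
            F ((\<alpha>(i := j))(i := Suc ((\<alpha>(i := j)) i))) (upd x i t)) (at t)"
            using F unfolding jet_def by blast
          then show "(\<phi> j has_real_derivative \<phi> (Suc j) t) (at t)"
            by (simp add: \<phi>_def[abs_def])
        qed
      qed (rule \<alpha>)
      then show "integral {0..1} (\<lambda>t. (coord_transform i F \<alpha> (upd x i t))\<^sup>2)
          \<le> C * (\<Sum>j\<le>r. integral {0..1} (\<lambda>t. (F (\<alpha>(i := j)) (upd x i t))\<^sup>2))"
        by (simp add: coord_transform_def \<phi>_def)
    qed (intro integrable_cube_continuous continuous_intros int cT cF)+
    also have "\<dots> = C * (\<Sum>j\<le>r. \<integral>x. integral {0..1} (\<lambda>t. (F (\<alpha>(i := j)) (upd x i t))\<^sup>2) \<partial>cube_measure)"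
      by (subst integral_mult_right_zero, subst Bochner_Integration.integral_sum)
         (auto intro!: integrable_cube_continuous continuous_intros int cF)
    also have "\<dots> = C * (\<Sum>j\<le>r. \<integral>x. (F (\<alpha>(i := j)) x)\<^sup>2 \<partial>cube_measure)"
      by (intro arg_cong2[where f = "(*)"] refl sum.cong integral_cube_coordinate[symmetric] continuous_intros cF)
    finally show "(\<integral>x. (coord_transform i F \<alpha> x)\<^sup>2 \<partial>cube_measure)
        \<le> C * (\<Sum>j\<le>r. \<integral>x. (F (\<alpha>(i := j)) x)\<^sup>2 \<partial>cube_measure)" .
  qed
qed

lemma finite_multi_indices: "finite {\<alpha> :: 'n :: finite \<Rightarrow> nat. \<forall>i. \<alpha> i \<le> r}"
proof -
  have "{\<alpha> :: 'n \<Rightarrow> nat. \<forall>i. \<alpha> i \<le> r} = PiE UNIV (\<lambda>_. {..r})" by (auto simp: PiE_def)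
  then show ?thesis by (simp add: finite_PiE)
qed

text \<open>The coordinates are transformed one after another along a fixed enumeration. Since the
  bound for \<alpha> involves all \<open>\<alpha>(i := j)\<close> with j at most r, the quantity
  that propagates is the sum \<open>M\<close> over the full box of multi-indices: each coordinate
  multiplies it by at most D.\<close>

lemma transform_jet:
  "\<exists>C\<ge>0. \<forall>F :: ('n :: finite \<Rightarrow> nat) \<Rightarrow> real ^ 'n \<Rightarrow> real. jet F \<longrightarrow>
    (\<exists>G. jet G \<and> (\<forall>\<alpha> x. x \<notin> box 0 1 \<longrightarrow> G \<alpha> x = 0) \<and>
      (\<forall>x. G (\<lambda>_. 0) x = F (\<lambda>_. 0) (Psi \<psi> x) * DPsi \<psi> x) \<and>
      (\<forall>\<alpha>. (\<forall>i. \<alpha> i \<le> r) \<longrightarrow> (\<integral>x. (G \<alpha> x)\<^sup>2 \<partial>cube_measure)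
        \<le> C * (\<Sum>\<beta> | \<forall>i. \<beta> i \<le> r. \<integral>x. (F \<beta> x)\<^sup>2 \<partial>cube_measure)))"
proof -
  define I where "I = {\<alpha> :: 'n \<Rightarrow> nat. \<forall>i. \<alpha> i \<le> r}"
  have finI: "finite I" unfolding I_def by (rule finite_multi_indices)
  obtain C where C0: "0 \<le> C" and C': "\<forall>F :: ('n \<Rightarrow> nat) \<Rightarrow> real ^ 'n \<Rightarrow> real. \<forall>i :: 'n. \<forall>\<alpha>. jet F \<and> \<alpha> i \<le> r \<longrightarrow>
    (\<integral>x. (coord_transform i F \<alpha> x)\<^sup>2 \<partial>cube_measure) \<le> C * (\<Sum>j\<le>r. \<integral>x. (F (\<alpha>(i := j)) x)\<^sup>2 \<partial>cube_measure)"
    using integral_coord_transform_le[where 'n = 'n, of r] by (elim exE conjE) (rule that)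
  have C: "(\<integral>x. (coord_transform i F \<alpha> x)\<^sup>2 \<partial>cube_measure) \<le> C * (\<Sum>j\<le>r. \<integral>x. (F (\<alpha>(i := j)) x)\<^sup>2 \<partial>cube_measure)"
    if "jet F" "\<alpha> i \<le> r" for F :: "('n \<Rightarrow> nat) \<Rightarrow> real ^ 'n \<Rightarrow> real" and i :: 'n and \<alpha>
    using C' that by blast
  define M where "M F = (\<Sum>\<beta>\<in>I. \<integral>x. (F \<beta> x)\<^sup>2 \<partial>cube_measure)" for F :: "('n \<Rightarrow> nat) \<Rightarrow> real ^ 'n \<Rightarrow> real"
  have M0: "0 \<le> M F" for F unfolding M_def by (intro sum_nonneg Bochner_Integration.integral_nonneg) auto
  define D where "D = real (card I) * C"
  have D0: "0 \<le> D" using C0 by (simp add: D_def)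
  have step: "M (coord_transform i F) \<le> D * M F" if F: "jet F" for i F
  proof -
    have "(\<integral>x. (coord_transform i F \<alpha> x)\<^sup>2 \<partial>cube_measure) \<le> C * M F" if \<alpha>: "\<alpha> \<in> I" for \<alpha>
    proof -
      have inj: "inj_on (\<lambda>j. \<alpha>(i := j)) {..r}" by (rule inj_onI) (metis fun_upd_same)
      have "(\<Sum>j\<le>r. \<integral>x. (F (\<alpha>(i := j)) x)\<^sup>2 \<partial>cube_measure)
          = (\<Sum>\<beta>\<in>(\<lambda>j. \<alpha>(i := j)) ` {..r}. \<integral>x. (F \<beta> x)\<^sup>2 \<partial>cube_measure)"
        by (simp add: sum.reindex[OF inj])
      also have "\<dots> \<le> M F"
        unfolding M_def using finI \<alpha> by (intro sum_mono2 Bochner_Integration.integral_nonneg) (auto simp: I_def)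
      finally have "C * (\<Sum>j\<le>r. \<integral>x. (F (\<alpha>(i := j)) x)\<^sup>2 \<partial>cube_measure) \<le> C * M F"
        using C0 by (rule mult_left_mono)
      then show ?thesis using C[OF F, of \<alpha> i] \<alpha> by (auto simp: I_def)
    qed
    then have "M (coord_transform i F) \<le> (\<Sum>\<beta>\<in>I. C * M F)"
      unfolding M_def[of "coord_transform i F"] by (rule sum_mono)
    then show ?thesis by (simp add: D_def mult.assoc)
  qed
  have T: "jet (foldr coord_transform is F) \<and> M (foldr coord_transform is F) \<le> D ^ length is * M F \<and>
      (\<forall>\<alpha> x. (\<exists>i\<in>set is. x $ i \<notin> {0<..<1}) \<longrightarrow> foldr coord_transform is F \<alpha> x = 0) \<and>
      (\<forall>x. foldr coord_transform is F (\<lambda>_. 0) x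
        = (\<Prod>i\<in>set is. deriv \<psi> (x $ i)) * F (\<lambda>_. 0) (\<chi> i. if i \<in> set is then \<psi> (x $ i) else x $ i))"
    if "jet F" "distinct is" for F "is"
    using that(2)
  proof (induction "is")
    case Nil
    then show ?case using \<open>jet F\<close> by simp
  next
    case (Cons i "is")
    let ?G = "foldr coord_transform is F"
    have j: "jet ?G" and m: "M ?G \<le> D ^ length is * M F"
      and v: "\<And>\<alpha> x. (\<exists>i\<in>set is. x $ i \<notin> {0<..<1}) \<Longrightarrow> ?G \<alpha> x = 0"
      and z: "\<And>x. ?G (\<lambda>_. 0) x
        = (\<Prod>i\<in>set is. deriv \<psi> (x $ i)) * F (\<lambda>_. 0) (\<chi> i. if i \<in> set is then \<psi> (x $ i) else x $ i)"
      using Cons by auto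
    have i: "i \<notin> set is" using Cons.prems by simp
    have "M (coord_transform i ?G) \<le> D * M ?G" by (rule step[OF j])
    also have "\<dots> \<le> D * (D ^ length is * M F)" by (rule mult_left_mono[OF m D0])
    finally have m': "M (coord_transform i ?G) \<le> D ^ length (i # is) * M F" by (simp add: mult.assoc)
    have v': "coord_transform i ?G \<alpha> x = 0" if x: "\<exists>l\<in>set (i # is). x $ l \<notin> {0<..<1}" for \<alpha> x
    proof (cases "x $ i \<in> {0<..<1}")
      case False
      then show ?thesis
        unfolding coord_transform_def[of i ?G] by (intro sum.neutral) (simp add: psi_alg_outside[OF psi_alg_chain_coeff])
    next
      case True
      then obtain l where l: "l \<in> set is" "x $ l \<notin> {0<..<1}" using x by auto
      then have "\<exists>l\<in>set is. upd x i (\<psi> (x $ i)) $ l \<notin> {0<..<1}"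
        using i by (intro bexI[of _ l]) (auto split: if_splits)
      then show ?thesis unfolding coord_transform_def[of i ?G] by (intro sum.neutral) (simp add: v)
    qed
    have z': "coord_transform i ?G (\<lambda>_. 0) x
        = (\<Prod>i\<in>set (i # is). deriv \<psi> (x $ i)) * F (\<lambda>_. 0) (\<chi> l. if l \<in> set (i # is) then \<psi> (x $ l) else x $ l)" for x
    proof -
      have u: "(\<lambda>_. 0 :: nat)(i := 0) = (\<lambda>_. 0)" by auto
      have "coord_transform i ?G (\<lambda>_. 0) x = deriv \<psi> (x $ i) * ?G (\<lambda>_. 0) (upd x i (\<psi> (x $ i)))"
        unfolding coord_transform_def[of i ?G] by (simp add: u)
      also have "\<dots> = deriv \<psi> (x $ i) * ((\<Prod>l\<in>set is. deriv \<psi> (upd x i (\<psi> (x $ i)) $ l)) *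
          F (\<lambda>_. 0) (\<chi> l. if l \<in> set is then \<psi> (upd x i (\<psi> (x $ i)) $ l) else upd x i (\<psi> (x $ i)) $ l))"
        by (simp only: z)
      also have "(\<Prod>l\<in>set is. deriv \<psi> (upd x i (\<psi> (x $ i)) $ l)) = (\<Prod>l\<in>set is. deriv \<psi> (x $ l))"
        using i by (intro prod.cong) auto
      also have "(\<chi> l. if l \<in> set is then \<psi> (upd x i (\<psi> (x $ i)) $ l) else upd x i (\<psi> (x $ i)) $ l)
          = (\<chi> l. if l \<in> set (i # is) then \<psi> (x $ l) else x $ l)"
        using i by (auto simp: vec_eq_iff)
      finally show ?thesis using i by (simp add: mult.assoc)
    qed
    show ?case
      using jet_coord_transform[OF j] m' v' z' by simp
  qed
  obtain L :: "'n list" where L: "set L = UNIV" "distinct L"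
    using finite_distinct_list[of "UNIV :: 'n set"] by auto
  show ?thesis
  proof (rule exI[of _ "D ^ length L"], intro conjI allI impI)
    show "0 \<le> D ^ length L" using D0 by simp
    fix F :: "('n \<Rightarrow> nat) \<Rightarrow> real ^ 'n \<Rightarrow> real" assume F: "jet F"
    let ?G = "foldr coord_transform L F"
    have outside: "\<exists>i. x $ i \<notin> {0<..<1}" if "x \<notin> box 0 1" for x :: "real ^ 'n"
      using that by (auto simp: mem_box_cart)
    have "(\<integral>x. (?G \<alpha> x)\<^sup>2 \<partial>cube_measure) \<le> M ?G" if "\<alpha> \<in> I" for \<alpha>
      unfolding M_def by (rule member_le_sum[OF that _ finI]) (auto intro: Bochner_Integration.integral_nonneg)
    moreover have "M ?G \<le> D ^ length L * M F" using T[OF F L(2)] by blast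
    ultimately have norm: "(\<integral>x. (?G \<alpha> x)\<^sup>2 \<partial>cube_measure) \<le> D ^ length L * M F" if "\<alpha> \<in> I" for \<alpha>
      using that by (meson order_trans)
    show "\<exists>G. jet G \<and> (\<forall>\<alpha> x. x \<notin> box 0 1 \<longrightarrow> G \<alpha> x = 0) \<and>
      (\<forall>x. G (\<lambda>_. 0) x = F (\<lambda>_. 0) (Psi \<psi> x) * DPsi \<psi> x) \<and>
      (\<forall>\<alpha>. (\<forall>i. \<alpha> i \<le> r) \<longrightarrow> (\<integral>x. (G \<alpha> x)\<^sup>2 \<partial>cube_measure)
        \<le> D ^ length L * (\<Sum>\<beta> | \<forall>i. \<beta> i \<le> r. \<integral>x. (F \<beta> x)\<^sup>2 \<partial>cube_measure))"
    proof (intro exI[of _ ?G] conjI allI impI)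
      show "jet ?G" using T[OF F L(2)] by blast
      show "?G \<alpha> x = 0" if "x \<notin> box 0 1" for \<alpha> x
        using T[OF F L(2)] outside[OF that] L(1) by auto
      show "?G (\<lambda>_. 0) x = F (\<lambda>_. 0) (Psi \<psi> x) * DPsi \<psi> x" for x
        using T[OF F L(2)] L(1) by (simp add: DPsi_eq_prod[OF \<psi>] Psi_def mult.commute)
      show "(\<integral>x. (?G \<alpha> x)\<^sup>2 \<partial>cube_measure)
        \<le> D ^ length L * (\<Sum>\<beta> | \<forall>i. \<beta> i \<le> r. \<integral>x. (F \<beta> x)\<^sup>2 \<partial>cube_measure)" if "\<forall>i. \<alpha> i \<le> r" for \<alpha>
        using norm[of \<alpha>] that by (simp add: M_def I_def)
    qed
  qed
qed

end

subsection \<open>The error of a lattice rule\<close>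

lemma nn_integral_count_space_subset_le:
  fixes f :: "'a \<Rightarrow> ennreal"
  assumes "A \<subseteq> X"
  shows "(\<integral>\<^sup>+x. f x \<partial>count_space A) \<le> (\<integral>\<^sup>+x. f x \<partial>count_space X)"
proof -
  have "(\<integral>\<^sup>+x. f x \<partial>count_space A) = (\<integral>\<^sup>+x. f x * indicator A x \<partial>count_space UNIV)"
    by (rule nn_integral_count_space_indicator) simp
  also have "\<dots> \<le> (\<integral>\<^sup>+x. f x * indicator X x \<partial>count_space UNIV)"
    by (rule nn_integral_mono) (use assms in \<open>auto simp: indicator_def\<close>)
  also have "\<dots> = (\<integral>\<^sup>+x. f x \<partial>count_space X)"
    by (rule nn_integral_count_space_indicator[symmetric]) simp
  finally show ?thesis .
qed

text \<open>All derivatives vanish off the open box, so they vanish on the faces of the cube and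
  integration by parts has no boundary terms.\<close>

definition supported_jet :: "(('n \<Rightarrow> nat) \<Rightarrow> real ^ 'n \<Rightarrow> real) \<Rightarrow> bool" where
  "supported_jet G \<longleftrightarrow> jet G \<and> (\<forall>\<alpha> x. x \<notin> box 0 1 \<longrightarrow> G \<alpha> x = 0)"

lemma supported_jetD:
  assumes "supported_jet G"
  shows "continuous_on UNIV (G \<alpha>)" "x \<notin> box 0 1 \<Longrightarrow> G \<alpha> x = 0" "x \<notin> unit_cube \<Longrightarrow> G \<alpha> x = 0"
    "((\<lambda>s. G \<alpha> (upd x i s)) has_real_derivative G (\<alpha>(i := Suc (\<alpha> i))) (upd x i t)) (at t)"
proof -
  show "continuous_on UNIV (G \<alpha>)" "x \<notin> box 0 1 \<Longrightarrow> G \<alpha> x = 0"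
    "((\<lambda>s. G \<alpha> (upd x i s)) has_real_derivative G (\<alpha>(i := Suc (\<alpha> i))) (upd x i t)) (at t)"
    using assms by (auto simp: supported_jet_def jet_def)
  have "x \<notin> unit_cube \<Longrightarrow> x \<notin> box 0 1"
    unfolding unit_cube_def using box_subset_cbox by blast
  then show "x \<notin> unit_cube \<Longrightarrow> G \<alpha> x = 0"
    using assms unfolding supported_jet_def by blast
qed

text \<open>Integration by parts: the derivative of the product of \<open>G \<alpha>\<close> and the
  exponential has integral 0, because the product vanishes on the two faces orthogonal to i.\<close>

lemma fc_jet_Suc:
  assumes G: "supported_jet G"
  shows "fc (\<lambda>x. of_real (G (\<alpha>(i := Suc (\<alpha> i))) x)) \<xi> = (2 * pi * \<xi> $ i * \<i>) * fc (\<lambda>x. of_real (G \<alpha> x)) \<xi>"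
proof -
  let ?\<beta> = "\<alpha>(i := Suc (\<alpha> i))"
  let ?c = "complex_of_real (2 * pi * (- \<xi>) $ i) * \<i>"
  have cont: "continuous_on UNIV (G \<beta>)" for \<beta> using G by (rule supported_jetD)
  have int: "integrable cube_measure (\<lambda>x. complex_of_real (G \<beta> x) * ce (- \<xi>) x)" for \<beta>
    by (intro integrable_cube_continuous continuous_intros cont)
  have "(\<integral>x. of_real (G ?\<beta> x) * ce (- \<xi>) x + ?c * (of_real (G \<alpha> x) * ce (- \<xi>) x) \<partial>cube_measure) = 0"
  proof (rule integral_cube_partial_eq_0[where i = i and h = "\<lambda>x. of_real (G \<alpha> x) * ce (- \<xi>) x"])
    show "continuous_on UNIV (\<lambda>x. complex_of_real (G ?\<beta> x) * ce (- \<xi>) x + ?c * (of_real (G \<alpha> x) * ce (- \<xi>) x))"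
      by (intro continuous_intros cont)
    show "((\<lambda>s. complex_of_real (G \<alpha> (upd x i s)) * ce (- \<xi>) (upd x i s)) has_vector_derivative
        of_real (G ?\<beta> (upd x i t)) * ce (- \<xi>) (upd x i t) + ?c * (of_real (G \<alpha> (upd x i t)) * ce (- \<xi>) (upd x i t))) (at t)" for x t
    proof -
      have 1: "((\<lambda>s. complex_of_real (G \<alpha> (upd x i s))) has_vector_derivative of_real (G ?\<beta> (upd x i t))) (at t)"
        using supported_jetD(4)[OF G] by (intro has_vector_derivative_of_real) (simp add: has_real_derivative_iff_has_vector_derivative)
      show ?thesis
        using has_vector_derivative_mult[OF 1 ce_upd_deriv[of "- \<xi>" x i t]] by (simp add: algebra_simps)
    qed
    have "upd x i 0 \<notin> box 0 1" "upd x i 1 \<notin> box 0 1" for x :: "real ^ 'a"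
      by (auto simp: mem_box_cart intro!: exI[of _ i])
    then show "complex_of_real (G \<alpha> (upd x i 0)) * ce (- \<xi>) (upd x i 0) = of_real (G \<alpha> (upd x i 1)) * ce (- \<xi>) (upd x i 1)" for x
      using supported_jetD(2)[OF G] by simp
  qed
  then have "fc (\<lambda>x. of_real (G ?\<beta> x)) \<xi> + ?c * fc (\<lambda>x. of_real (G \<alpha> x)) \<xi> = 0"
    unfolding fc_def using int by (simp add: Bochner_Integration.integral_add)
  then show ?thesis by (simp add: add_eq_0_iff2)
qed

lemma norm_fc_jet:
  assumes G: "supported_jet G"
  shows "norm (fc (\<lambda>x. of_real (G \<alpha> x)) \<xi>)
    = (\<Prod>j\<in>UNIV. \<bar>2 * pi * \<xi> $ j\<bar> ^ \<alpha> j) * norm (fc (\<lambda>x. of_real (G (\<lambda>_. 0) x)) \<xi>)"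
proof (induction "\<Sum>j\<in>UNIV. \<alpha> j" arbitrary: \<alpha>)
  case 0
  then have "\<alpha> = (\<lambda>_. 0)" by auto
  then show ?case by simp
next
  case (Suc s)
  then obtain i where i: "\<alpha> i > 0" by (metis gr0I sum.neutral nat.distinct(1))
  define \<beta> where "\<beta> = \<alpha>(i := \<alpha> i - 1)"
  have \<alpha>: "\<alpha> = \<beta>(i := Suc (\<beta> i))" using i by (auto simp: \<beta>_def)
  have \<beta>: "(\<Sum>j\<in>UNIV-{i}. \<beta> j) = (\<Sum>j\<in>UNIV-{i}. \<alpha> j)" by (rule sum.cong) (auto simp: \<beta>_def)
  have "(\<Sum>j\<in>UNIV. \<alpha> j) = Suc (\<Sum>j\<in>UNIV. \<beta> j)"
    using \<beta> i by (simp add: sum.remove[of UNIV i] \<beta>_def)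
  then have IH: "norm (fc (\<lambda>x. of_real (G \<beta> x)) \<xi>)
    = (\<Prod>j\<in>UNIV. \<bar>2 * pi * \<xi> $ j\<bar> ^ \<beta> j) * norm (fc (\<lambda>x. of_real (G (\<lambda>_. 0) x)) \<xi>)"
    using Suc by auto
  have "(\<Prod>j\<in>UNIV. \<bar>2 * pi * \<xi> $ j\<bar> ^ \<alpha> j) = \<bar>2 * pi * \<xi> $ i\<bar> * (\<Prod>j\<in>UNIV. \<bar>2 * pi * \<xi> $ j\<bar> ^ \<beta> j)"
  proof -
    have "(\<Prod>j\<in>UNIV-{i}. \<bar>2 * pi * \<xi> $ j\<bar> ^ \<alpha> j) = (\<Prod>j\<in>UNIV-{i}. \<bar>2 * pi * \<xi> $ j\<bar> ^ \<beta> j)"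
      by (rule prod.cong) (auto simp: \<beta>_def)
    moreover have "\<bar>2 * pi * \<xi> $ i\<bar> ^ \<alpha> i = \<bar>2 * pi * \<xi> $ i\<bar> * \<bar>2 * pi * \<xi> $ i\<bar> ^ \<beta> i"
      by (subst \<alpha>) simp
    ultimately show ?thesis by (simp only: prod.remove[of UNIV i] finite UNIV_I mult.assoc)
  qed
  moreover have "norm (fc (\<lambda>x. of_real (G \<alpha> x)) \<xi>) = \<bar>2 * pi * \<xi> $ i\<bar> * norm (fc (\<lambda>x. of_real (G \<beta> x)) \<xi>)"
    by (subst \<alpha>, subst fc_jet_Suc[OF G]) (simp add: norm_mult abs_mult)
  ultimately show ?case using IH by simp
qed

text \<open>The corners of the box of multi-indices, one for each set of coordinates. They are the
  derivatives that occur when a product of terms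
  \<open>1 + \<bar>2 * pi * \<xi> $ j\<bar> ^ (2 * r)\<close> is multiplied out.\<close>

definition corner_index :: "nat \<Rightarrow> 'n set \<Rightarrow> 'n \<Rightarrow> nat" where
  "corner_index r A = (\<lambda>j. if j \<in> A then r else 0)"

text \<open>Each weight is at most \<open>\<bar>2 * pi * \<xi> $ j\<bar> ^ (2 * r) + 1\<close>.
  Multiplying out gives one term per set A, and it is the squared transform of the derivative with
  index \<open>corner_index r A\<close>.\<close>

lemma weighted_fc_jet_le:
  fixes G :: "('n :: finite \<Rightarrow> nat) \<Rightarrow> real ^ 'n \<Rightarrow> real"
  assumes G: "supported_jet G"
  shows "(\<Prod>j\<in>UNIV. max 1 \<bar>\<xi> $ j\<bar>) ^ (2 * r) * (norm (fc (\<lambda>x. of_real (G (\<lambda>_. 0) x)) \<xi>))\<^sup>2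
    \<le> (\<Sum>A\<in>Pow UNIV. (norm (fc (\<lambda>x. of_real (G (corner_index r A) x)) \<xi>))\<^sup>2)"
proof -
  let ?g = "(norm (fc (\<lambda>x. of_real (G (\<lambda>_. 0) x)) \<xi>))\<^sup>2"
  have "(norm (fc (\<lambda>x. of_real (G (corner_index r A) x)) \<xi>))\<^sup>2 = (\<Prod>j\<in>A. \<bar>2 * pi * \<xi> $ j\<bar> ^ (2 * r)) * ?g" for A
  proof -
    have "(\<Prod>j\<in>UNIV. \<bar>2 * pi * \<xi> $ j\<bar> ^ corner_index r A j) = (\<Prod>j\<in>A. \<bar>2 * pi * \<xi> $ j\<bar> ^ r)"
      by (rule prod.mono_neutral_cong_right) (auto simp: corner_index_def)
    moreover have "(\<Prod>j\<in>A. \<bar>2 * pi * \<xi> $ j\<bar> ^ r)\<^sup>2 = (\<Prod>j\<in>A. \<bar>2 * pi * \<xi> $ j\<bar> ^ (2 * r))"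
      by (simp only: prod_power_distrib power_mult[symmetric] mult.commute[of r 2])
    ultimately show ?thesis
      by (simp only: norm_fc_jet[OF G, of "corner_index r A"] power_mult_distrib)
  qed
  then have "(\<Sum>A\<in>Pow UNIV. (norm (fc (\<lambda>x. of_real (G (corner_index r A) x)) \<xi>))\<^sup>2)
      = (\<Prod>j\<in>UNIV. \<bar>2 * pi * \<xi> $ j\<bar> ^ (2 * r) + 1) * ?g"
    by (subst prod_add) (auto simp: sum_distrib_right)
  moreover have "(\<Prod>j\<in>UNIV. max 1 \<bar>\<xi> $ j\<bar>) ^ (2 * r) \<le> (\<Prod>j\<in>UNIV. \<bar>2 * pi * \<xi> $ j\<bar> ^ (2 * r) + 1)"
    unfolding prod_power_distrib
  proof (intro prod_mono conjI)
    fix j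
    show "max 1 \<bar>\<xi> $ j\<bar> ^ (2 * r) \<le> \<bar>2 * pi * \<xi> $ j\<bar> ^ (2 * r) + 1"
    proof (cases "\<bar>\<xi> $ j\<bar> \<le> 1")
      case True
      then show ?thesis by (simp add: max_def)
    next
      case False
      have "1 * \<bar>\<xi> $ j\<bar> \<le> (2 * pi) * \<bar>\<xi> $ j\<bar>" using pi_ge_two by (intro mult_right_mono) auto
      then have "\<bar>\<xi> $ j\<bar> ^ (2 * r) \<le> \<bar>2 * pi * \<xi> $ j\<bar> ^ (2 * r)"
        by (intro power_mono) (auto simp: abs_mult)
      then show ?thesis using False by (simp add: max_def)
    qed
  qed auto
  ultimately show ?thesis by (simp add: mult_right_mono)
qed

section \<open>Scaled Frolov matrices and the lattice error\<close>

lemma diag_matrix_mult_nth: "(diag_matrix w ** B) $ i $ j = w $ i * B $ i $ j"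
proof -
  have "(\<Sum>k\<in>UNIV. (if i = k then w $ i else 0) * B $ k $ j) = (\<Sum>k\<in>UNIV. if k = i then w $ i * B $ i $ j else 0)"
    by (rule sum.cong) auto
  then show ?thesis by (simp add: matrix_matrix_mult_def diag_matrix_def)
qed

lemma scaled_matrix_nth: "scaled_matrix n u B $ i $ j = real n powr (1 / CARD('n)) * u $ i * B $ i $ j"
  for u :: "real ^ 'n"
  by (simp add: scaled_matrix_def diag_matrix_mult_nth mult.assoc)

lemma scaled_matrix_eq: "scaled_matrix n u B = diag_matrix (real n powr (1 / CARD('n)) *\<^sub>R u) ** B"
  for u :: "real ^ 'n"
  by (simp add: vec_eq_iff scaled_matrix_nth diag_matrix_mult_nth mult.assoc)

lemma scaled_matrix_vector: "(scaled_matrix n u B *v m) $ j = real n powr (1 / CARD('n)) * u $ j * (B *v m) $ j"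
  for u :: "real ^ 'n"
  by (simp add: matrix_vector_mult_def scaled_matrix_nth sum_distrib_left mult.assoc)

lemma det_scaled_matrix:
  fixes u :: "real ^ 'n"
  assumes "n > 0"
  shows "det (scaled_matrix n u B) = real n * (\<Prod>i\<in>UNIV. u $ i) * det B"
proof -
  have "det (diag_matrix (real n powr (1 / CARD('n)) *\<^sub>R u)) = (\<Prod>i\<in>UNIV. real n powr (1 / CARD('n)) * u $ i)"
    by (subst det_diagonal) (auto simp: diag_matrix_def)
  also have "\<dots> = (real n powr (1 / CARD('n))) ^ CARD('n) * (\<Prod>i\<in>UNIV. u $ i)"
    by (simp add: prod.distrib)
  also have "(real n powr (1 / CARD('n))) ^ CARD('n) = real n"
    using assms by (simp add: powr_powr flip: powr_realpow)
  finally show ?thesis by (simp add: scaled_matrix_eq det_mul)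
qed

lemma dilation_cubeD:
  fixes u :: "real ^ 'n"
  assumes "u \<in> dilation_cube"
  shows "1 \<le> u $ i" "u $ i \<le> 2"
proof -
  have "1 \<le> u $ i" "u $ i \<le> 2 powr (1 / real CARD('n))"
    using assms by (auto simp: dilation_cube_def mem_box_cart)
  moreover have "(2 :: real) powr (1 / real CARD('n)) \<le> 2 powr 1"
    by (intro powr_mono) (auto simp: Suc_leI)
  ultimately show "1 \<le> u $ i" "u $ i \<le> 2" by auto
qed

definition matrix_sum :: "real ^ 'n ^ 'n \<Rightarrow> real" where
  "matrix_sum B = (\<Sum>j\<in>UNIV. \<Sum>i\<in>UNIV. \<bar>B $ j $ i\<bar>)"

lemma matrix_sum_nonneg: "0 \<le> matrix_sum B"
  by (simp add: matrix_sum_def sum_nonneg)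

lemma transpose_inv_mult:
  fixes S :: "real ^ 'n ^ 'n"
  assumes "invertible S"
  shows "transpose S *v (transpose (matrix_inv S) *v z) = z" "transpose (matrix_inv S) *v (transpose S *v z) = z"
  using assms
  by (simp_all add: matrix_vector_mul_assoc matrix_transpose_mul[symmetric] matrix_inv_mult del: transpose_matrix_vector)

text \<open>Here z is the image of a point of the unit cube under \<open>transpose S\<close>, so its
  coordinates are bounded by column sums of S.\<close>

lemma support_bound:
  fixes u :: "real ^ 'n" and B :: "real ^ 'n ^ 'n"
  assumes inv: "invertible (scaled_matrix n u B)" and u: "\<And>j. \<bar>u $ j\<bar> \<le> Y"
    and z: "transpose (matrix_inv (scaled_matrix n u B)) *v z \<in> unit_cube"
  shows "\<bar>z $ i\<bar> \<le> real n powr (1 / CARD('n)) * Y * matrix_sum B"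
proof -
  let ?S = "scaled_matrix n u B"
  let ?N = "real n powr (1 / CARD('n))"
  define x where "x = transpose (matrix_inv ?S) *v z"
  have zx: "z = transpose ?S *v x" by (simp only: x_def transpose_inv_mult[OF inv])
  have Y0: "0 \<le> Y" using u[of i] by linarith
  have "\<bar>z $ i\<bar> = \<bar>\<Sum>j\<in>UNIV. ?S $ j $ i * x $ j\<bar>"
    by (simp add: zx vector_matrix_mult_def mult.commute)
  also have "\<dots> \<le> (\<Sum>j\<in>UNIV. ?N * Y * (\<Sum>i\<in>UNIV. \<bar>B $ j $ i\<bar>))"
  proof (rule order_trans[OF sum_abs sum_mono])
    fix j
    have "\<bar>x $ j\<bar> \<le> 1" using z by (auto simp: x_def mem_unit_cube)
    then have "\<bar>?S $ j $ i * x $ j\<bar> \<le> \<bar>?S $ j $ i\<bar> * 1"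
      unfolding abs_mult by (intro mult_left_mono) auto
    also have "\<dots> = ?N * \<bar>u $ j\<bar> * \<bar>B $ j $ i\<bar>" by (simp add: scaled_matrix_nth abs_mult)
    also have "\<dots> \<le> ?N * Y * (\<Sum>i\<in>UNIV. \<bar>B $ j $ i\<bar>)"
      using u[of j] Y0 by (intro mult_mono member_le_sum) auto
    finally show "\<bar>?S $ j $ i * x $ j\<bar> \<le> ?N * Y * (\<Sum>i\<in>UNIV. \<bar>B $ j $ i\<bar>)" .
  qed
  also have "\<dots> = ?N * Y * matrix_sum B" by (simp add: matrix_sum_def sum_distrib_left)
  finally show ?thesis .
qed

text \<open>The error of the plain lattice rule on g, as a function of the shift v. The transformed
  rule is this rule applied to the transformed integrand.\<close>

definition lattice_error :: "real ^ 'n ^ 'n \<Rightarrow> (real ^ 'n \<Rightarrow> real) \<Rightarrow> real ^ 'n \<Rightarrow> real" where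
  "lattice_error S g v = 1 / \<bar>det S\<bar> * periodization (transpose (matrix_inv S)) g v - (\<integral>x. g x \<partial>cube_measure)"

context
  fixes B :: "real ^ 'n ^ 'n" and n :: nat and u :: "real ^ 'n"
  assumes B: "frolov_matrix B" and n: "2 \<le> n" and u: "u \<in> dilation_cube"
begin

lemma dilation_factor_ge_1: "1 \<le> real n powr (1 / CARD('n))"
  using n by (intro ge_one_powr_ge_zero) auto

lemma dilation_factor_power: "(real n powr (1 / CARD('n))) ^ CARD('n) = real n"
  using n by (simp add: powr_powr flip: powr_realpow)

lemma det_frolov_nonzero: "det B \<noteq> 0"
  using B invertible_det_nz by (auto simp: frolov_matrix_def)

lemma det_scaled_matrix_ge: "real n * \<bar>det B\<bar> \<le> \<bar>det (scaled_matrix n u B)\<bar>"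
proof -
  have "1 \<le> (\<Prod>i\<in>UNIV. \<bar>u $ i\<bar>)"
    by (rule prod_ge_1) (use dilation_cubeD[OF u] in \<open>auto intro: order_trans[OF _ abs_ge_self]\<close>)
  then have "real n * \<bar>det B\<bar> * 1 \<le> real n * \<bar>det B\<bar> * (\<Prod>i\<in>UNIV. \<bar>u $ i\<bar>)"
    by (intro mult_left_mono) auto
  then show ?thesis using n by (simp add: det_scaled_matrix abs_mult abs_prod mult_ac)
qed

lemma det_scaled_matrix_pos: "0 < \<bar>det (scaled_matrix n u B)\<bar>"
proof -
  have "0 < real n * \<bar>det B\<bar>" using det_frolov_nonzero n by simp
  then show ?thesis using det_scaled_matrix_ge by linarith
qed

lemma invertible_scaled_matrix: "invertible (scaled_matrix n u B)"
  using det_scaled_matrix_pos by (simp add: invertible_det_nz)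

lemma scaled_matrix_support: "transpose (matrix_inv (scaled_matrix n u B)) *v z \<in> unit_cube \<Longrightarrow> \<bar>z $ i\<bar> \<le> real n powr (1 / CARD('n)) * 2 * matrix_sum B"
proof (rule support_bound[OF invertible_scaled_matrix])
  show "\<bar>u $ j\<bar> \<le> 2" for j using dilation_cubeD[OF u, of j] by simp
qed

lemma continuous_lattice_error:
  assumes c: "continuous_on UNIV g" and supp: "\<And>x. x \<notin> unit_cube \<Longrightarrow> g x = 0"
  shows "continuous_on UNIV (lattice_error (scaled_matrix n u B) g)"
  unfolding lattice_error_def
  by (intro continuous_intros continuous_periodization[OF c supp scaled_matrix_support])

text \<open>The weight 1 / \<bar>det S\<bar> cancels the determinant from Poisson summation. The
  coefficient at 0 is the integral of g itself, which the error subtracts.\<close>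

lemma fc_lattice_error:
  assumes c: "continuous_on UNIV g" and supp: "\<And>x. x \<notin> unit_cube \<Longrightarrow> g x = 0"
    and m: "m \<in> int_points"
  shows "fc (\<lambda>y. of_real (lattice_error (scaled_matrix n u B) g y)) m = (if m = 0 then 0 else fc (\<lambda>x. of_real (g x)) (scaled_matrix n u B *v m))"
proof -
  let ?P = "\<lambda>y. complex_of_real (periodization (transpose (matrix_inv (scaled_matrix n u B))) g y)"
  let ?I = "\<integral>x. g x \<partial>cube_measure"
  have cP: "continuous_on UNIV ?P"
    by (intro continuous_intros continuous_periodization[OF c supp scaled_matrix_support])
  have "fc (\<lambda>y. of_real (lattice_error (scaled_matrix n u B) g y)) m
      = fc (\<lambda>y. of_real (1 / \<bar>det (scaled_matrix n u B)\<bar>) * ?P y - (\<Sum>k\<in>{0}. of_real ?I * ce k y)) m"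
    by (simp only: lattice_error_def of_real_diff of_real_mult sum.insert finite.emptyI empty_iff
        not_False_eq_True sum.empty ce_0 mult_1_right add_0_right)
  also have "\<dots> = fc (\<lambda>y. of_real (1 / \<bar>det (scaled_matrix n u B)\<bar>) * ?P y) m - (if m \<in> {0} then of_real ?I else 0)"
    by (rule fc_diff_trig[OF continuous_on_mult_left[OF cP]]) (auto simp: m)
  also have "fc (\<lambda>y. of_real (1 / \<bar>det (scaled_matrix n u B)\<bar>) * ?P y) m = of_real (1 / \<bar>det (scaled_matrix n u B)\<bar>) * fc ?P m"
    unfolding fc_def by (simp only: mult.assoc integral_mult_right_zero)
  also have "fc ?P m = of_real \<bar>det (scaled_matrix n u B)\<bar> * fc (\<lambda>x. of_real (g x)) (scaled_matrix n u B *v m)"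
    using fc_periodization[OF invertible_scaled_matrix refl c supp scaled_matrix_support m] by (simp add: scaleR_conv_of_real)
  also have "of_real (1 / \<bar>det (scaled_matrix n u B)\<bar>) * (of_real \<bar>det (scaled_matrix n u B)\<bar> * fc (\<lambda>x. of_real (g x)) (scaled_matrix n u B *v m)) = fc (\<lambda>x. of_real (g x)) (scaled_matrix n u B *v m)"
    using det_scaled_matrix_pos by (simp add: mult.assoc[symmetric] of_real_mult[symmetric] del: of_real_mult)
  finally show ?thesis by (simp add: fc_def)
qed

text \<open>Bessel's inequality for the periodization of h. The point is that the constant is free
  of n and u: the number of tiles is at most a constant times n, while \<bar>det S\<bar> is at least
  n \<bar>det B\<bar>.\<close>

lemma sum_fc_lattice_le:
  assumes c: "continuous_on UNIV h" and supp: "\<And>x. x \<notin> unit_cube \<Longrightarrow> h x = 0"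
    and F: "finite F" "F \<subseteq> int_points"
  shows "(\<Sum>m\<in>F. (norm (fc (\<lambda>x. of_real (h x)) (scaled_matrix n u B *v m)))\<^sup>2)
    \<le> (4 * matrix_sum B + 5) ^ CARD('n) / \<bar>det B\<bar> * (\<integral>x. (h x)\<^sup>2 \<partial>cube_measure)"
proof -
  let ?I = "\<integral>x. (h x)\<^sup>2 \<partial>cube_measure"
  let ?b = "matrix_sum B"
  have I0: "0 \<le> ?I" by (rule Bochner_Integration.integral_nonneg) simp
  define R where "R = nat \<lceil>real n powr (1 / CARD('n)) * 2 * ?b + 1\<rceil>"
  have NB: "0 \<le> real n powr (1 / CARD('n)) * 2 * ?b" using dilation_factor_ge_1 matrix_sum_nonneg[of B] by auto
  have R: "real n powr (1 / CARD('n)) * 2 * ?b + 1 \<le> real R" "real R \<le> real n powr (1 / CARD('n)) * 2 * ?b + 2"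
    unfolding R_def using NB by linarith+
  \<comment> \<open>The choice of R gives 2 R + 1 \<le> 4 b N + 5 with N =
    \<open>real n powr (1 / CARD('n))\<close>, and N \<ge> 1 allows N to be factored out. Its d-th
    power is n.\<close>
  have "real (2 * R + 1) \<le> (4 * ?b + 5) * (real n powr (1 / CARD('n)))"
    using R(2) dilation_factor_ge_1 by (simp add: algebra_simps)
  then have "real (2 * R + 1) ^ CARD('n) \<le> ((4 * ?b + 5) * (real n powr (1 / CARD('n)))) ^ CARD('n)"
    by (intro power_mono) auto
  then have card: "real ((2 * R + 1) ^ CARD('n)) \<le> (4 * ?b + 5) ^ CARD('n) * real n"
    by (simp only: power_mult_distrib dilation_factor_power of_nat_power)
  let ?P = "\<lambda>y. complex_of_real (periodization (transpose (matrix_inv (scaled_matrix n u B))) h y)"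
  have "\<bar>det (scaled_matrix n u B)\<bar>\<^sup>2 * (\<Sum>m\<in>F. (norm (fc (\<lambda>x. of_real (h x)) (scaled_matrix n u B *v m)))\<^sup>2) = (\<Sum>m\<in>F. (norm (fc ?P m))\<^sup>2)"
    unfolding sum_distrib_left
  proof (rule sum.cong[OF refl])
    fix m assume "m \<in> F"
    then have "fc ?P m = \<bar>det (scaled_matrix n u B)\<bar> *\<^sub>R fc (\<lambda>x. of_real (h x)) (scaled_matrix n u B *v m)"
      using F by (intro fc_periodization[OF invertible_scaled_matrix refl c supp scaled_matrix_support]) auto
    then show "\<bar>det (scaled_matrix n u B)\<bar>\<^sup>2 * (norm (fc (\<lambda>x. of_real (h x)) (scaled_matrix n u B *v m)))\<^sup>2 = (norm (fc ?P m))\<^sup>2"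
      by (simp add: power_mult_distrib)
  qed
  also have "\<dots> \<le> (\<integral>y. (norm (?P y))\<^sup>2 \<partial>cube_measure)"
    by (rule bessel[OF _ F]) (intro continuous_intros continuous_periodization[OF c supp scaled_matrix_support])
  also have "\<dots> = (\<integral>y. (periodization (transpose (matrix_inv (scaled_matrix n u B))) h y)\<^sup>2 \<partial>cube_measure)" by simp
  also have "\<dots> \<le> real ((2 * R + 1) ^ CARD('n)) * \<bar>det (scaled_matrix n u B)\<bar> * ?I"
    by (rule integral_periodization_squared_le[OF invertible_scaled_matrix refl c supp scaled_matrix_support R(1)])
  also have "\<dots> \<le> (4 * ?b + 5) ^ CARD('n) * real n * \<bar>det (scaled_matrix n u B)\<bar> * ?I"
    using card I0 by (intro mult_right_mono) auto
  finally have "\<bar>det (scaled_matrix n u B)\<bar> * (\<bar>det (scaled_matrix n u B)\<bar> * (\<Sum>m\<in>F. (norm (fc (\<lambda>x. of_real (h x)) (scaled_matrix n u B *v m)))\<^sup>2))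
      \<le> \<bar>det (scaled_matrix n u B)\<bar> * ((4 * ?b + 5) ^ CARD('n) * real n * ?I)"
    by (simp add: power2_eq_square mult_ac)
  then have "\<bar>det (scaled_matrix n u B)\<bar> * (\<Sum>m\<in>F. (norm (fc (\<lambda>x. of_real (h x)) (scaled_matrix n u B *v m)))\<^sup>2) \<le> (4 * ?b + 5) ^ CARD('n) * real n * ?I"
    using det_scaled_matrix_pos by (simp only: mult_le_cancel_left_pos)
  moreover have "real n * \<bar>det B\<bar> * (\<Sum>m\<in>F. (norm (fc (\<lambda>x. of_real (h x)) (scaled_matrix n u B *v m)))\<^sup>2)
      \<le> \<bar>det (scaled_matrix n u B)\<bar> * (\<Sum>m\<in>F. (norm (fc (\<lambda>x. of_real (h x)) (scaled_matrix n u B *v m)))\<^sup>2)"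
    by (intro mult_right_mono det_scaled_matrix_ge sum_nonneg) auto
  ultimately have "real n * (\<bar>det B\<bar> * (\<Sum>m\<in>F. (norm (fc (\<lambda>x. of_real (h x)) (scaled_matrix n u B *v m)))\<^sup>2))
      \<le> real n * ((4 * ?b + 5) ^ CARD('n) * ?I)"
    by (simp add: mult_ac)
  then have "\<bar>det B\<bar> * (\<Sum>m\<in>F. (norm (fc (\<lambda>x. of_real (h x)) (scaled_matrix n u B *v m)))\<^sup>2) \<le> (4 * ?b + 5) ^ CARD('n) * ?I"
    using n by simp
  then show ?thesis using det_frolov_nonzero by (simp add: field_simps)
qed

text \<open>The factor \<open>2 ^ CARD('n)\<close> counts the corner multi-indices. Since u has
  coordinates at least 1, dilation only increases the weights, so a bound W for the undilated
  lattice covers every u.\<close>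

lemma sum_norm_fc_lattice_error_le:
  fixes G :: "('n \<Rightarrow> nat) \<Rightarrow> real ^ 'n \<Rightarrow> real"
  assumes G: "supported_jet G"
    and E: "\<And>A. (\<integral>x. (G (corner_index r A) x)\<^sup>2 \<partial>cube_measure) \<le> E"
    and W: "\<And>F. finite F \<Longrightarrow> F \<subseteq> int_points - {0} \<Longrightarrow>
      (\<Sum>m\<in>F. 1 / (\<Prod>j\<in>UNIV. max 1 (real n powr (1 / CARD('n)) * \<bar>(B *v m) $ j\<bar>)) ^ (2 * r)) \<le> W"
    and F: "finite F" "F \<subseteq> int_points"
  shows "(\<Sum>m\<in>F. norm (fc (\<lambda>y. of_real (lattice_error (scaled_matrix n u B) (G (\<lambda>_. 0)) y)) m))
    \<le> sqrt (2 ^ CARD('n) * ((4 * matrix_sum B + 5) ^ CARD('n) / \<bar>det B\<bar> * E) * W)"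
proof -
  let ?g = "G (\<lambda>_. 0)"
  let ?C = "(4 * matrix_sum B + 5) ^ CARD('n) / \<bar>det B\<bar>"
  define F' where "F' = F - {0}"
  have F': "finite F'" "F' \<subseteq> int_points - {0}" "F' \<subseteq> int_points" using F by (auto simp: F'_def)
  define a where "a m = norm (fc (\<lambda>x. of_real (?g x)) (scaled_matrix n u B *v m))" for m
  define w where "w m = (\<Prod>j\<in>UNIV. max 1 \<bar>(scaled_matrix n u B *v m) $ j\<bar>) ^ r" for m
  have w2: "(w m)\<^sup>2 = (\<Prod>j\<in>UNIV. max 1 \<bar>(scaled_matrix n u B *v m) $ j\<bar>) ^ (2 * r)" for m
    by (simp only: w_def power_mult[symmetric] mult.commute[of r 2])
  have w1: "1 \<le> w m" for m unfolding w_def by (intro one_le_power prod_ge_1) auto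
  have w0: "w m \<noteq> 0" for m using w1[of m] by linarith
  have C0: "0 \<le> ?C" using matrix_sum_nonneg[of B] by auto
  have "(\<Sum>m\<in>F. norm (fc (\<lambda>y. of_real (lattice_error (scaled_matrix n u B) ?g y)) m)) = (\<Sum>m\<in>F'. a m)"
    unfolding F'_def a_def
    by (rule sum.mono_neutral_cong_right)
       (use F in \<open>auto simp: fc_lattice_error[OF supported_jetD(1,3)[OF G]] subset_iff\<close>)
  moreover have "(\<Sum>m\<in>F'. a m) \<le> sqrt (2 ^ CARD('n) * (?C * E) * W)"
  proof (rule real_le_rsqrt)
    have "(\<Sum>m\<in>F'. a m)\<^sup>2 = (\<Sum>m\<in>F'. (a m * w m) * (1 / w m))\<^sup>2"
      using w0 by (intro arg_cong[where f = "\<lambda>x. x\<^sup>2"] sum.cong) auto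
    also have "\<dots> \<le> (\<Sum>m\<in>F'. (a m * w m)\<^sup>2) * (\<Sum>m\<in>F'. (1 / w m)\<^sup>2)"
      by (rule Cauchy_Schwarz_ineq_sum)
    also have "\<dots> \<le> 2 ^ CARD('n) * (?C * E) * W"
    proof (rule mult_mono)
      have "(\<Sum>m\<in>F'. (a m * w m)\<^sup>2) \<le> (\<Sum>m\<in>F'. \<Sum>A\<in>Pow UNIV. (norm (fc (\<lambda>x. of_real (G (corner_index r A) x)) (scaled_matrix n u B *v m)))\<^sup>2)"
        using weighted_fc_jet_le[OF G, where r = r]
        by (intro sum_mono) (simp add: power_mult_distrib w2 a_def mult.commute)
      also have "\<dots> = (\<Sum>A\<in>Pow UNIV. \<Sum>m\<in>F'. (norm (fc (\<lambda>x. of_real (G (corner_index r A) x)) (scaled_matrix n u B *v m)))\<^sup>2)"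
        by (rule sum.swap)
      also have "\<dots> \<le> (\<Sum>A\<in>Pow (UNIV :: 'n set). ?C * E)"
      proof (rule sum_mono)
        fix A
        have "(\<Sum>m\<in>F'. (norm (fc (\<lambda>x. of_real (G (corner_index r A) x)) (scaled_matrix n u B *v m)))\<^sup>2)
            \<le> ?C * (\<integral>x. (G (corner_index r A) x)\<^sup>2 \<partial>cube_measure)"
          by (rule sum_fc_lattice_le[OF supported_jetD(1,3)[OF G] F'(1,3)])
        also have "\<dots> \<le> ?C * E" by (rule mult_left_mono[OF E C0])
        finally show "(\<Sum>m\<in>F'. (norm (fc (\<lambda>x. of_real (G (corner_index r A) x)) (scaled_matrix n u B *v m)))\<^sup>2) \<le> ?C * E" .
      qed
      also have "\<dots> = 2 ^ CARD('n) * (?C * E)" by (simp add: card_Pow)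
      finally show "(\<Sum>m\<in>F'. (a m * w m)\<^sup>2) \<le> 2 ^ CARD('n) * (?C * E)" .
      have "0 \<le> (\<integral>x. (G (corner_index r {}) x)\<^sup>2 \<partial>cube_measure)"
        by (rule Bochner_Integration.integral_nonneg) simp
      then have "0 \<le> E" using E[of "{}"] by linarith
      then show "0 \<le> 2 ^ CARD('n) * (?C * E)" using C0 by (intro mult_nonneg_nonneg) auto
      have "(\<Sum>m\<in>F'. (1 / w m)\<^sup>2)
          \<le> (\<Sum>m\<in>F'. 1 / (\<Prod>j\<in>UNIV. max 1 (real n powr (1 / CARD('n)) * \<bar>(B *v m) $ j\<bar>)) ^ (2 * r))"
      proof (rule sum_mono)
        fix m
        have "(\<Prod>j\<in>UNIV. max 1 (real n powr (1 / CARD('n)) * \<bar>(B *v m) $ j\<bar>)) ^ (2 * r) \<le> (w m)\<^sup>2"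
          unfolding w2
        proof (intro power_mono prod_mono prod_nonneg conjI)
          fix j
          have "real n powr (1 / CARD('n)) * \<bar>(B *v m) $ j\<bar> * 1 \<le> real n powr (1 / CARD('n)) * \<bar>(B *v m) $ j\<bar> * u $ j"
            using dilation_cubeD(1)[OF u, of j] by (intro mult_left_mono) auto
          also have "\<dots> = \<bar>(scaled_matrix n u B *v m) $ j\<bar>"
            using dilation_cubeD(1)[OF u, of j] by (simp add: scaled_matrix_vector abs_mult)
          finally show "max 1 (real n powr (1 / CARD('n)) * \<bar>(B *v m) $ j\<bar>) \<le> max 1 \<bar>(scaled_matrix n u B *v m) $ j\<bar>"
            by (simp add: max_def)
        qed auto
        moreover have "0 < (\<Prod>j\<in>UNIV. max 1 (real n powr (1 / CARD('n)) * \<bar>(B *v m) $ j\<bar>)) ^ (2 * r)"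
          by (intro zero_less_power prod_pos) auto
        ultimately show "(1 / w m)\<^sup>2 \<le> 1 / (\<Prod>j\<in>UNIV. max 1 (real n powr (1 / CARD('n)) * \<bar>(B *v m) $ j\<bar>)) ^ (2 * r)"
          unfolding power_one_over by (intro divide_left_mono mult_pos_pos) auto
      qed
      also have "\<dots> \<le> W" by (rule W[OF F'(1,2)])
      finally show "(\<Sum>m\<in>F'. (1 / w m)\<^sup>2) \<le> W" .
    qed (auto intro: sum_nonneg)
    finally show "(\<Sum>m\<in>F'. a m)\<^sup>2 \<le> 2 ^ CARD('n) * (?C * E) * W" .
  qed
  ultimately show ?thesis by simp
qed

lemma lattice_error_periodic: "k \<in> int_points \<Longrightarrow> lattice_error (scaled_matrix n u B) g (x + k) = lattice_error (scaled_matrix n u B) g x"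
  by (simp add: lattice_error_def periodization_periodic)

lemma abs_lattice_error_le:
  fixes G :: "('n \<Rightarrow> nat) \<Rightarrow> real ^ 'n \<Rightarrow> real"
  assumes G: "supported_jet G"
    and E: "\<And>A. (\<integral>x. (G (corner_index r A) x)\<^sup>2 \<partial>cube_measure) \<le> E"
    and W: "\<And>F. finite F \<Longrightarrow> F \<subseteq> int_points - {0} \<Longrightarrow>
      (\<Sum>m\<in>F. 1 / (\<Prod>j\<in>UNIV. max 1 (real n powr (1 / CARD('n)) * \<bar>(B *v m) $ j\<bar>)) ^ (2 * r)) \<le> W"
    and v: "v \<in> unit_cube"
  shows "\<bar>lattice_error (scaled_matrix n u B) (G (\<lambda>_. 0)) v\<bar>
    \<le> sqrt (2 ^ CARD('n) * ((4 * matrix_sum B + 5) ^ CARD('n) / \<bar>det B\<bar> * E) * W)"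
proof -
  have "norm (complex_of_real (lattice_error (scaled_matrix n u B) (G (\<lambda>_. 0)) v))
      \<le> sqrt (2 ^ CARD('n) * ((4 * matrix_sum B + 5) ^ CARD('n) / \<bar>det B\<bar> * E) * W)"
  proof (rule norm_le_sum_fc[OF _ _ _ v])
    show "continuous_on UNIV (\<lambda>y. complex_of_real (lattice_error (scaled_matrix n u B) (G (\<lambda>_. 0)) y))"
      by (intro continuous_intros continuous_lattice_error supported_jetD[OF G])
    show "complex_of_real (lattice_error (scaled_matrix n u B) (G (\<lambda>_. 0)) (x + k)) = complex_of_real (lattice_error (scaled_matrix n u B) (G (\<lambda>_. 0)) x)"
      if "k \<in> int_points" for x k using that by (simp add: lattice_error_periodic)
  qed (rule sum_norm_fc_lattice_error_le[OF G E W])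
  then show ?thesis by simp
qed

text \<open>The bound W enters through the absolute summability that \<open>parseval_le\<close> asks
  for; its size does not appear in the conclusion, and no logarithm survives the averaging.\<close>

lemma nn_integral_lattice_error_le:
  fixes G :: "('n \<Rightarrow> nat) \<Rightarrow> real ^ 'n \<Rightarrow> real"
  assumes G: "supported_jet G"
    and E: "\<And>A. (\<integral>x. (G (corner_index r A) x)\<^sup>2 \<partial>cube_measure) \<le> E"
    and W: "\<And>F. finite F \<Longrightarrow> F \<subseteq> int_points - {0} \<Longrightarrow>
      (\<Sum>m\<in>F. 1 / (\<Prod>j\<in>UNIV. max 1 (real n powr (1 / CARD('n)) * \<bar>(B *v m) $ j\<bar>)) ^ (2 * r)) \<le> W"
  shows "(\<integral>\<^sup>+v. ennreal ((lattice_error (scaled_matrix n u B) (G (\<lambda>_. 0)) v)\<^sup>2) \<partial>cube_measure)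
    \<le> (\<integral>\<^sup>+m. ennreal ((norm (fc (\<lambda>x. of_real (G (\<lambda>_. 0) x)) (scaled_matrix n u B *v m)))\<^sup>2) \<partial>count_space (int_points - {0}))"
proof (rule ennreal_le_epsilon)
  let ?g = "G (\<lambda>_. 0)"
  let ?\<phi> = "\<lambda>y. complex_of_real (lattice_error (scaled_matrix n u B) ?g y)"
  fix \<epsilon> :: real assume \<epsilon>: "0 < \<epsilon>"
  have c: "continuous_on UNIV (lattice_error (scaled_matrix n u B) ?g)"
    by (rule continuous_lattice_error[OF supported_jetD(1,3)[OF G]])
  have "\<exists>F. finite F \<and> F \<subseteq> int_points \<and>
    (\<integral>x. (norm (?\<phi> x))\<^sup>2 \<partial>cube_measure) \<le> (sqrt \<epsilon>)\<^sup>2 + (\<Sum>m\<in>F. (norm (fc ?\<phi> m))\<^sup>2)"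
  proof (rule parseval_le)
    show "continuous_on UNIV ?\<phi>" by (intro continuous_intros c)
    show "?\<phi> (x + k) = ?\<phi> x" if "k \<in> int_points" for x k using that by (simp add: lattice_error_periodic)
    show "0 < sqrt \<epsilon>" using \<epsilon> by simp
  qed (rule sum_norm_fc_lattice_error_le[OF G E W])
  then obtain F where F: "finite F" "F \<subseteq> int_points"
    "(\<integral>x. (norm (?\<phi> x))\<^sup>2 \<partial>cube_measure) \<le> (sqrt \<epsilon>)\<^sup>2 + (\<Sum>m\<in>F. (norm (fc ?\<phi> m))\<^sup>2)" by blast
  let ?a = "\<lambda>m. (norm (fc (\<lambda>x. of_real (?g x)) (scaled_matrix n u B *v m)))\<^sup>2"
  have s: "(\<Sum>m\<in>F. (norm (fc ?\<phi> m))\<^sup>2) = (\<Sum>m\<in>F-{0}. ?a m)"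
    by (rule sum.mono_neutral_cong_right)
       (use F in \<open>auto simp: fc_lattice_error[OF supported_jetD(1,3)[OF G]] subset_iff\<close>)
  have "(\<integral>\<^sup>+v. ennreal ((lattice_error (scaled_matrix n u B) ?g v)\<^sup>2) \<partial>cube_measure) = ennreal (\<integral>v. (lattice_error (scaled_matrix n u B) ?g v)\<^sup>2 \<partial>cube_measure)"
    by (rule nn_integral_eq_integral) (auto intro!: integrable_cube_continuous continuous_intros c)
  also have "\<dots> \<le> ennreal (\<epsilon> + (\<Sum>m\<in>F-{0}. ?a m))"
    using F(3) \<epsilon> by (intro ennreal_leI) (simp add: s)
  also have "\<dots> = (\<Sum>m\<in>F-{0}. ennreal (?a m)) + ennreal \<epsilon>"
    using \<epsilon> by (subst ennreal_plus) (auto simp: sum_nonneg sum_ennreal add.commute)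
  also have "(\<Sum>m\<in>F-{0}. ennreal (?a m)) = (\<integral>\<^sup>+m. ennreal (?a m) \<partial>count_space (F - {0}))"
    using F(1) by (simp add: nn_integral_count_space_finite)
  also have "\<dots> \<le> (\<integral>\<^sup>+m. ennreal (?a m) \<partial>count_space (int_points - {0}))"
    by (rule nn_integral_count_space_subset_le) (use F in auto)
  finally show "(\<integral>\<^sup>+v. ennreal ((lattice_error (scaled_matrix n u B) ?g v)\<^sup>2) \<partial>cube_measure)
      \<le> (\<integral>\<^sup>+m. ennreal (?a m) \<partial>count_space (int_points - {0})) + ennreal \<epsilon>"
    by (simp add: add_right_mono)
qed

end

subsection \<open>Averaging over the dilations\<close>

lemma nn_integral_count_space_le:
  fixes f :: "'a \<Rightarrow> ennreal"
  assumes X: "countable X" and b: "\<And>F. finite F \<Longrightarrow> F \<subseteq> X \<Longrightarrow> (\<Sum>x\<in>F. f x) \<le> b"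
  shows "(\<integral>\<^sup>+x. f x \<partial>count_space X) \<le> b"
proof (cases "finite X")
  case True
  then show ?thesis using b[of X] by (simp add: nn_integral_count_space_finite)
next
  case False
  let ?e = "from_nat_into X"
  have e: "bij_betw ?e UNIV X" using bij_betw_from_nat_into[OF X False] .
  have "(\<integral>\<^sup>+x. f x \<partial>count_space X) = (\<integral>\<^sup>+k. f (?e k) \<partial>count_space UNIV)"
    using nn_integral_bij_count_space[OF e, of f] by simp
  also have "\<dots> = (\<Sum>k. f (?e k))" by (rule nn_integral_count_space_nat)
  also have "\<dots> \<le> b"
  proof (rule suminf_le_const)
    fix K
    have "(\<Sum>k<K. f (?e k)) = (\<Sum>x\<in>?e ` {..<K}. f x)"
      by (subst sum.reindex) (use e in \<open>auto simp: bij_betw_def inj_on_def\<close>)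
    also have "\<dots> \<le> b" by (rule b) (use e in \<open>auto simp: bij_betw_def\<close>)
    finally show "(\<Sum>k<K. f (?e k)) \<le> b" .
  qed simp
  finally show ?thesis .
qed

lemma borel_measurable_fc:
  assumes h: "continuous_on UNIV h"
  shows "fc h \<in> borel_measurable borel"
proof -
  interpret prob_space "cube_measure :: (real ^ 'a) measure" by (rule prob_space_cube)
  have [measurable]: "h \<in> borel_measurable borel" using h by (rule borel_measurable_continuous_onI)
  show ?thesis
    unfolding fc_def by (rule borel_measurable_lebesgue_integral) measurable
qed

text \<open>Tiling the frequencies as k + t with k an integer point, the values at k + t are the
  Fourier coefficients of h modulated by \<open>ce (- t)\<close>. Modulation preserves the modulus,
  so Bessel's inequality gives the same bound for every t.\<close>

lemma plancherel_le:
  fixes h :: "real ^ 'n \<Rightarrow> real"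
  assumes h: "continuous_on UNIV h"
  shows "(\<integral>\<^sup>+\<xi>. ennreal ((norm (fc (\<lambda>x. of_real (h x)) \<xi>))\<^sup>2) \<partial>lborel) \<le> ennreal (\<integral>x. (h x)\<^sup>2 \<partial>cube_measure)"
proof -
  interpret prob_space "cube_measure :: (real ^ 'n) measure" by (rule prob_space_cube)
  let ?H = "\<lambda>x. complex_of_real (h x)"
  let ?I = "\<integral>x. (h x)\<^sup>2 \<partial>cube_measure"
  have cH: "continuous_on UNIV ?H" by (intro continuous_intros h)
  note [measurable] = borel_measurable_fc[OF cH]
  have "(\<integral>\<^sup>+\<xi>. ennreal ((norm (fc ?H \<xi>))\<^sup>2) \<partial>lborel)
      = (\<integral>\<^sup>+k. (\<integral>\<^sup>+t. ennreal ((norm (fc ?H (k + t)))\<^sup>2) \<partial>cube_measure) \<partial>count_space int_points)"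
    by (rule nn_integral_tiling) measurable
  also have "\<dots> = (\<integral>\<^sup>+t. (\<integral>\<^sup>+k. ennreal ((norm (fc ?H (k + t)))\<^sup>2) \<partial>count_space int_points) \<partial>cube_measure)"
    by (rule nn_integral_count_space_nn_integral[symmetric, OF countable_int_points]) measurable
  also have "\<dots> \<le> (\<integral>\<^sup>+t. ennreal ?I \<partial>(cube_measure :: (real ^ 'n) measure))"
  proof (intro nn_integral_mono nn_integral_count_space_le countable_int_points)
    fix t :: "real ^ 'n" and F :: "(real ^ 'n) set" assume F: "finite F" "F \<subseteq> int_points"
    let ?Ht = "\<lambda>x. ?H x * ce (- t) x"
    have "fc ?H (k + t) = fc ?Ht k" for k
      unfolding fc_def by (simp add: ce_add[symmetric] mult.assoc add.commute)
    then have "(\<Sum>k\<in>F. (norm (fc ?H (k + t)))\<^sup>2) = (\<Sum>k\<in>F. (norm (fc ?Ht k))\<^sup>2)" by simp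
    also have "\<dots> \<le> (\<integral>x. (norm (?Ht x))\<^sup>2 \<partial>cube_measure)"
      by (rule bessel[OF _ F]) (intro continuous_intros h)
    also have "\<dots> = ?I" by (simp add: norm_mult)
    finally show "(\<Sum>k\<in>F. ennreal ((norm (fc ?H (k + t)))\<^sup>2)) \<le> ennreal ?I"
      by (simp add: sum_ennreal ennreal_leI)
  qed
  also have "\<dots> = ennreal ?I" by (simp add: emeasure_space_1)
  finally show ?thesis .
qed

definition dilation_volume :: "'n itself \<Rightarrow> real" where
  "dilation_volume _ = (2 powr (1 / real CARD('n)) - 1) ^ CARD('n)"

lemma dilation_base: "1 < (2 :: real) powr (1 / real CARD('n :: finite))"
  by (rule gr_one_powr) auto

lemma emeasure_dilation_cube:
  "emeasure lborel (dilation_cube :: (real ^ 'n) set) = ennreal (dilation_volume TYPE('n))"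
  "0 < dilation_volume TYPE('n :: finite)"
proof -
  show "0 < dilation_volume TYPE('n)"
    using dilation_base[where 'n = 'n] by (simp add: dilation_volume_def)
  let ?b = "\<chi> i. 2 powr (1 / real CARD('n)) :: real ^ 'n"
  have ne: "cbox 1 ?b \<noteq> {}"
    using dilation_base[where 'n = 'n] by (simp add: interval_ne_empty_cart less_imp_le)
  have "emeasure lborel (cbox 1 ?b) = ennreal (measure lborel (cbox 1 ?b))"
    by (rule emeasure_eq_ennreal_measure) (use emeasure_lborel_cbox_finite[of 1 ?b] in auto)
  also have "measure lborel (cbox 1 ?b) = (\<Prod>i\<in>UNIV. ?b $ i - (1 :: real ^ 'n) $ i)"
    by (rule content_cbox_cart[OF ne])
  also have "\<dots> = dilation_volume TYPE('n)" by (simp add: dilation_volume_def)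
  finally show "emeasure lborel (dilation_cube :: (real ^ 'n) set) = ennreal (dilation_volume TYPE('n))"
    by (simp add: dilation_cube_def)
qed

lemma dilation_cube_measurable [measurable]: "dilation_cube \<in> sets borel"
  by (simp add: dilation_cube_def)

context
  fixes B :: "real ^ 'n ^ 'n" and n :: nat
  assumes B: "frolov_matrix B" and n: "2 \<le> n"
begin

lemma lattice_coords_nonzero:
  assumes "m \<in> int_points - {0}"
  shows "1 \<le> (\<Prod>j\<in>UNIV. \<bar>(B *v m) $ j\<bar>)" "(B *v m) $ j \<noteq> 0"
proof -
  show *: "1 \<le> (\<Prod>j\<in>UNIV. \<bar>(B *v m) $ j\<bar>)"
    using B assms by (auto simp: frolov_matrix_def abs_prod)
  show "(B *v m) $ j \<noteq> 0"
  proof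
    assume "(B *v m) $ j = 0"
    then have "(\<Prod>j\<in>UNIV. \<bar>(B *v m) $ j\<bar>) = 0" by (auto intro: prod_zero)
    with * show False by simp
  qed
qed

text \<open>The coordinates of the frequency before the random dilation: coordinate j of
  \<open>scaled_matrix n u B *v m\<close> is \<open>u $ j * dilated m j\<close>.\<close>

definition dilated :: "real ^ 'n \<Rightarrow> 'n \<Rightarrow> real" where
  "dilated m j = real n powr (1 / CARD('n)) * (B *v m) $ j"

lemma dilated_nonzero: "m \<in> int_points - {0} \<Longrightarrow> dilated m j \<noteq> 0"
  using lattice_coords_nonzero(2)[of m j] n by (simp add: dilated_def)

lemma prod_dilated: "(\<Prod>j\<in>UNIV. \<bar>dilated m j\<bar>) = real n * (\<Prod>j\<in>UNIV. \<bar>(B *v m) $ j\<bar>)"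
proof -
  have "(\<Prod>j\<in>UNIV. \<bar>dilated m j\<bar>) = (real n powr (1 / CARD('n))) ^ CARD('n) * (\<Prod>j\<in>UNIV. \<bar>(B *v m) $ j\<bar>)"
    by (simp add: dilated_def abs_mult prod.distrib)
  also have "(real n powr (1 / CARD('n))) ^ CARD('n) = real n"
    using n by (simp add: powr_powr flip: powr_realpow)
  finally show ?thesis .
qed

text \<open>All points counted here lie in one box of volume at most a constant times the product of the
  coordinates of \<xi>, so the Frolov property bounds their number.\<close>

lemma sum_dilation_indicator_le:
  fixes \<xi> :: "real ^ 'n"
  assumes F: "finite F" "F \<subseteq> int_points - {0}"
  shows "(\<Sum>m\<in>F. 1 / (\<Prod>j\<in>UNIV. \<bar>dilated m j\<bar>) * indicator dilation_cube (\<chi> j. \<xi> $ j / dilated m j))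
    \<le> 4 / real n * indicator {\<xi>. real n \<le> (\<Prod>j\<in>UNIV. \<bar>\<xi> $ j\<bar>)} \<xi>"
proof -
  let ?N = "real n powr (1 / CARD('n))"
  let ?t = "(2 :: real) powr (1 / real CARD('n))"
  define P where "P = (\<Prod>j\<in>UNIV. \<bar>\<xi> $ j\<bar>)"
  define M where "M = {m \<in> F. (\<chi> j. \<xi> $ j / dilated m j) \<in> dilation_cube}"
  have N0: "0 < ?N" using n by simp
  have Nd: "?N ^ CARD('n) = real n"
    using n by (simp add: powr_powr flip: powr_realpow)
  have td: "?t ^ CARD('n) = 2"
    by (simp add: powr_powr flip: powr_realpow)
  have t1: "1 < ?t" by (rule dilation_base)
  have ratio: "1 \<le> \<xi> $ j / dilated m j" "\<xi> $ j / dilated m j \<le> ?t" if "m \<in> M" for m j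
    using that by (auto simp: M_def dilation_cube_def mem_box_cart)
  have nz: "dilated m j \<noteq> 0" if "m \<in> M" for m j
    using that F by (intro dilated_nonzero) (auto simp: M_def)
  have abs_ratio: "\<bar>\<xi> $ j\<bar> = (\<xi> $ j / dilated m j) * \<bar>dilated m j\<bar>" if "m \<in> M" for m j
  proof -
    have 1: "\<bar>\<xi> $ j\<bar> = \<bar>\<xi> $ j / dilated m j\<bar> * \<bar>dilated m j\<bar>"
      using nz[OF that, of j] by (simp add: abs_divide)
    have 2: "\<bar>\<xi> $ j / dilated m j\<bar> = \<xi> $ j / dilated m j"
      using ratio(1)[OF that, of j] by linarith
    show ?thesis using 1 unfolding 2 .
  qed
  have low: "\<bar>dilated m j\<bar> \<le> \<bar>\<xi> $ j\<bar>" if "m \<in> M" for m j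
    using mult_right_mono[OF ratio(1)[OF that, of j], of "\<bar>dilated m j\<bar>"] abs_ratio[OF that, of j] by simp
  have up: "\<bar>\<xi> $ j\<bar> \<le> ?t * \<bar>dilated m j\<bar>" if "m \<in> M" for m j
    using mult_right_mono[OF ratio(2)[OF that, of j], of "\<bar>dilated m j\<bar>"] abs_ratio[OF that, of j] by simp
  have nP: "real n \<le> P" if "m \<in> M" for m
  proof -
    have "real n * 1 \<le> (\<Prod>j\<in>UNIV. \<bar>dilated m j\<bar>)"
      unfolding prod_dilated using that F by (intro mult_left_mono lattice_coords_nonzero(1)) (auto simp: M_def)
    also have "\<dots> \<le> P" unfolding P_def using low[OF that] by (intro prod_mono) auto
    finally show ?thesis by simp
  qed
  \<comment> \<open>Coordinatewise \<xi> exceeds \<open>dilated m\<close> by a factor at most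
    \<open>2 powr (1 / d)\<close>, so the two products differ at most by the factor 2.\<close>
  have inv: "1 / (\<Prod>j\<in>UNIV. \<bar>dilated m j\<bar>) \<le> 2 / P" if "m \<in> M" for m
  proof -
    have "P \<le> (\<Prod>j\<in>UNIV. ?t * \<bar>dilated m j\<bar>)"
      unfolding P_def using up[OF that] by (intro prod_mono) auto
    also have "\<dots> = 2 * (\<Prod>j\<in>UNIV. \<bar>dilated m j\<bar>)" by (simp add: prod.distrib td)
    finally have "P \<le> 2 * (\<Prod>j\<in>UNIV. \<bar>dilated m j\<bar>)" .
    moreover have "0 < (\<Prod>j\<in>UNIV. \<bar>dilated m j\<bar>)" using nz[OF that] by (intro prod_pos) auto
    moreover have "0 < P" using nP[OF that] n by linarith
    ultimately show ?thesis by (simp add: field_simps)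
  qed
  have sum_eq: "(\<Sum>m\<in>F. 1 / (\<Prod>j\<in>UNIV. \<bar>dilated m j\<bar>) * indicator dilation_cube (\<chi> j. \<xi> $ j / dilated m j))
      = (\<Sum>m\<in>M. 1 / (\<Prod>j\<in>UNIV. \<bar>dilated m j\<bar>))"
    using F(1) by (intro sum.mono_neutral_cong_right) (auto simp: M_def)
  show ?thesis
  proof (cases "M = {}")
    case True
    then show ?thesis unfolding sum_eq by simp
  next
    case False
    then obtain m0 where "m0 \<in> M" by blast
    then have nP': "real n \<le> P" by (rule nP)
    have P0: "0 < P" using nP' n by linarith
    \<comment> \<open>The ratio of \<open>\<xi> $ j\<close> to \<open>dilated m j\<close> lies
      between 1 and \<open>?t\<close>, so every coordinate of B m lies between those of x and y. The
      signs of the coordinates of \<xi> are arbitrary, hence the corners are not ordered.\<close>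
    define x y :: "real ^ 'n" where "x = (\<chi> j. \<xi> $ j / (?N * ?t))" and "y = (\<chi> j. \<xi> $ j / ?N)"
    have "real (card M) \<le> (\<Prod>j\<in>UNIV. \<bar>x $ j - y $ j\<bar>) + 1"
    proof (rule frolov_card_le(2)[OF B])
      show "M \<subseteq> int_points" using F by (auto simp: M_def)
      fix m assume m: "m \<in> M"
      show "B *v m \<in> coord_box x y"
        unfolding coord_box_def
      proof (safe)
        fix j
        define \<theta> where "\<theta> = \<xi> $ j / dilated m j"
        have \<theta>: "1 \<le> \<theta>" "\<theta> \<le> ?t" using ratio[OF m, of j] by (auto simp: \<theta>_def)
        have \<xi>: "\<xi> $ j = ?N * \<theta> * (B *v m) $ j"
          using nz[OF m, of j] by (simp add: \<theta>_def dilated_def)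
        have x: "x $ j = \<theta> / ?t * (B *v m) $ j" and y: "y $ j = \<theta> * (B *v m) $ j"
          using N0 t1 by (simp_all add: x_def y_def \<xi>)
        have 1: "\<theta> / ?t \<le> 1" using \<theta> t1 by (simp add: divide_le_eq)
        show "(B *v m) $ j \<in> closed_segment (x $ j) (y $ j)"
        proof (cases "0 \<le> (B *v m) $ j")
          case True
          have "x $ j \<le> 1 * (B *v m) $ j" "1 * (B *v m) $ j \<le> y $ j"
            unfolding x y using True 1 \<theta> by (intro mult_right_mono; simp)+
          then show ?thesis by (simp add: closed_segment_eq_real_ivl)
        next
          case False
          have "1 * (B *v m) $ j \<le> x $ j" "y $ j \<le> 1 * (B *v m) $ j"
            unfolding x y using False 1 \<theta> by (intro mult_right_mono_neg; simp)+
          then show ?thesis by (simp add: closed_segment_eq_real_ivl)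
        qed
      qed
    qed
    also have "(\<Prod>j\<in>UNIV. \<bar>x $ j - y $ j\<bar>) \<le> (\<Prod>j\<in>UNIV. \<bar>\<xi> $ j\<bar> / ?N)"
    proof (intro prod_mono conjI)
      fix j
      have "x $ j - y $ j = - ((1 - 1 / ?t) * (\<xi> $ j / ?N))"
        using N0 t1 by (simp add: x_def y_def field_simps)
      then have "\<bar>x $ j - y $ j\<bar> = \<bar>1 - 1 / ?t\<bar> * (\<bar>\<xi> $ j\<bar> / ?N)"
        using N0 by (simp only: abs_minus_cancel abs_mult abs_divide abs_of_pos)
      also have "\<dots> \<le> 1 * (\<bar>\<xi> $ j\<bar> / ?N)"
      proof (rule mult_right_mono)
        have "0 < 1 / ?t" "1 / ?t \<le> 1" using less_imp_le[OF t1] by (simp_all add: divide_le_eq)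
        then show "\<bar>1 - 1 / ?t\<bar> \<le> 1" by linarith
      qed (use N0 in auto)
      finally show "\<bar>x $ j - y $ j\<bar> \<le> \<bar>\<xi> $ j\<bar> / ?N" by simp
    qed auto
    also have "(\<Prod>j\<in>UNIV. \<bar>\<xi> $ j\<bar> / ?N) = P / real n"
      by (simp only: prod_dividef prod_constant Nd P_def)
    finally have card: "real (card M) \<le> P / real n + 1" by simp
    have "1 \<le> P / real n" using nP' n by (simp add: le_divide_eq)
    with card have card: "real (card M) \<le> 2 * (P / real n)" by linarith
    \<comment> \<open>At most 2 P / n points, each of weight at most 2 / P.\<close>
    have "(\<Sum>m\<in>M. 1 / (\<Prod>j\<in>UNIV. \<bar>dilated m j\<bar>)) \<le> (\<Sum>m\<in>M. 2 / P)" by (rule sum_mono[OF inv])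
    also have "\<dots> = real (card M) * (2 / P)" by simp
    also have "\<dots> \<le> 2 * (P / real n) * (2 / P)" using card P0 by (intro mult_right_mono) auto
    also have "\<dots> = 4 / real n" using P0 by simp
    finally show ?thesis unfolding sum_eq using nP' by (simp add: P_def)
  qed
qed

text \<open>For fixed m the map from u to the frequency is diagonal with entries
  \<open>dilated m j\<close>. Uniform dilations thus spread the frequency uniformly over a box,
  whose density contains the inverse product of these entries.\<close>

lemma nn_integral_dilation:
  assumes m: "m \<in> int_points - {0}" and [measurable]: "a \<in> borel_measurable borel"
  shows "(\<integral>\<^sup>+u. a (scaled_matrix n u B *v m) * indicator dilation_cube u \<partial>lborel)
    = (\<integral>\<^sup>+\<xi>. ennreal (1 / (\<Prod>j\<in>UNIV. \<bar>dilated m j\<bar>) * indicator dilation_cube (\<chi> j. \<xi> $ j / dilated m j)) * a \<xi> \<partial>lborel)"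
proof -
  let ?P = "\<Prod>j\<in>UNIV. \<bar>dilated m j\<bar>"
  have P: "0 < ?P" using dilated_nonzero[OF m] by (intro prod_pos) auto
  define f where "f \<xi> = ennreal (1 / ?P * indicator dilation_cube (\<chi> j. \<xi> $ j / dilated m j)) * a \<xi>" for \<xi>
  have [measurable]: "(\<lambda>\<xi> :: real ^ 'n. \<chi> j. \<xi> $ j / dilated m j) \<in> borel_measurable borel"
    unfolding measurable_vec_iff by simp
  have fm: "f \<in> borel_measurable borel"
    unfolding f_def by measurable
  have [measurable]: "(\<lambda>u :: real ^ 'n. \<chi> j. dilated m j * u $ j) \<in> borel_measurable borel"
    unfolding measurable_vec_iff by simp
  have "(\<integral>\<^sup>+\<xi>. f \<xi> \<partial>lborel) = ennreal ?P * (\<integral>\<^sup>+u. f (\<chi> j. dilated m j * u $ j) \<partial>lborel)"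
    by (rule nn_integral_scale_coordinates[OF fm]) (rule dilated_nonzero[OF m])
  also have "\<dots> = (\<integral>\<^sup>+u. ennreal ?P * f (\<chi> j. dilated m j * u $ j) \<partial>lborel)"
  proof -
    note [measurable] = fm
    have "(\<lambda>u :: real ^ 'n. f (\<chi> j. dilated m j * u $ j)) \<in> borel_measurable borel" by measurable
    then show ?thesis by (intro nn_integral_cmult[symmetric]) simp
  qed
  also have "\<dots> = (\<integral>\<^sup>+u. a (scaled_matrix n u B *v m) * indicator dilation_cube u \<partial>lborel)"
  proof (rule nn_integral_cong)
    fix u :: "real ^ 'n"
    have 1: "(\<chi> j. dilated m j * u $ j) = scaled_matrix n u B *v m"
      by (simp add: vec_eq_iff scaled_matrix_vector dilated_def mult_ac)
    have 2: "(\<chi> j. (scaled_matrix n u B *v m) $ j / dilated m j) = u"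
      using dilated_nonzero[OF m] by (simp add: vec_eq_iff 1[symmetric])
    have "ennreal p * ennreal (1 / p * indicator dilation_cube u) = indicator dilation_cube u" if "0 < p" for p
      using that by (cases "u \<in> dilation_cube") (simp_all add: ennreal_mult[symmetric])
    then have 3: "ennreal ?P * ennreal (1 / ?P * indicator dilation_cube u) = indicator dilation_cube u"
      using P by blast
    have "ennreal ?P * f (scaled_matrix n u B *v m) = indicator dilation_cube u * a (scaled_matrix n u B *v m)"
      by (simp only: f_def 2 mult.assoc[symmetric] 3)
    then show "ennreal ?P * f (\<chi> j. dilated m j * u $ j) = a (scaled_matrix n u B *v m) * indicator dilation_cube u"
      unfolding 1 by (simp only: mult.commute[of "a (scaled_matrix n u B *v m)"])
  qed
  finally show ?thesis by (simp only: f_def)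
qed

text \<open>Tonelli's theorem collects the contributions of all m into one integral over \<xi>; the
  weights sum to at most 4 / n. Applying Plancherel's inequality to the derivative of order (r, ...,
  r) gives the remaining power of n, and \<open>dilation_volume\<close> normalizes the distribution
  of u.\<close>

lemma nn_integral_random_dilation_le:
  fixes G :: "('n \<Rightarrow> nat) \<Rightarrow> real ^ 'n \<Rightarrow> real"
  assumes G: "supported_jet G"
    and E: "(\<integral>x. (G (corner_index r UNIV) x)\<^sup>2 \<partial>cube_measure) \<le> E"
  shows "(\<integral>\<^sup>+u. (\<integral>\<^sup>+m. ennreal ((norm (fc (\<lambda>x. of_real (G (\<lambda>_. 0) x)) (scaled_matrix n u B *v m)))\<^sup>2)
      \<partial>count_space (int_points - {0})) \<partial>uniform_measure lborel dilation_cube)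
    \<le> ennreal (4 / dilation_volume TYPE('n) * E / real n ^ (2 * r + 1))"
proof -
  let ?X = "int_points - {0} :: (real ^ 'n) set"
  let ?V = "dilation_volume TYPE('n)"
  let ?h = "G (corner_index r UNIV)"
  define a where "a \<xi> = ennreal ((norm (fc (\<lambda>x. of_real (G (\<lambda>_. 0) x)) \<xi>))\<^sup>2)" for \<xi> :: "real ^ 'n"
  define b where "b m \<xi> = 1 / (\<Prod>j\<in>UNIV. \<bar>dilated m j\<bar>) * indicator dilation_cube (\<chi> j. \<xi> $ j / dilated m j)" for m \<xi>
  have X: "countable ?X" using countable_int_points by (rule countable_subset[rotated]) auto
  have c0: "continuous_on UNIV (\<lambda>x. complex_of_real (G \<alpha> x))" for \<alpha>
    by (intro continuous_intros supported_jetD[OF G])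
  have am [measurable]: "a \<in> borel_measurable borel"
    unfolding a_def using borel_measurable_fc[OF c0] by measurable
  have [measurable]: "(\<lambda>u. scaled_matrix n u B *v m) \<in> borel_measurable borel" for m :: "real ^ 'n"
    unfolding measurable_vec_iff scaled_matrix_vector by simp
  have bm [measurable]: "b m \<in> borel_measurable borel" for m
  proof -
    have [measurable]: "(\<lambda>\<xi> :: real ^ 'n. \<chi> j. \<xi> $ j / dilated m j) \<in> borel_measurable borel"
      unfolding measurable_vec_iff by simp
    show ?thesis unfolding b_def by measurable
  qed
  have b0: "0 \<le> b m \<xi>" for m \<xi> unfolding b_def by (intro mult_nonneg_nonneg divide_nonneg_nonneg prod_nonneg) auto
  have V: "0 < ?V" "emeasure lborel (dilation_cube :: (real ^ 'n) set) = ennreal ?V"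
    by (rule emeasure_dilation_cube)+
  have "(\<integral>\<^sup>+u. (\<integral>\<^sup>+m. a (scaled_matrix n u B *v m) \<partial>count_space ?X) \<partial>uniform_measure lborel dilation_cube)
      = (\<integral>\<^sup>+m. (\<integral>\<^sup>+u. a (scaled_matrix n u B *v m) \<partial>uniform_measure lborel dilation_cube) \<partial>count_space ?X)"
    by (rule nn_integral_count_space_nn_integral[OF X]) measurable
  also have "\<dots> = (\<integral>\<^sup>+m. (\<integral>\<^sup>+\<xi>. ennreal (b m \<xi>) * a \<xi> \<partial>lborel) / ennreal ?V \<partial>count_space ?X)"
  proof (rule nn_integral_cong)
    fix m assume "m \<in> space (count_space ?X)"
    then have m: "m \<in> ?X" by simp
    show "(\<integral>\<^sup>+u. a (scaled_matrix n u B *v m) \<partial>uniform_measure lborel dilation_cube)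
        = (\<integral>\<^sup>+\<xi>. ennreal (b m \<xi>) * a \<xi> \<partial>lborel) / ennreal ?V"
      unfolding b_def nn_integral_dilation[OF m am, symmetric] V(2)[symmetric]
      by (rule nn_integral_uniform_measure) auto
  qed
  also have "\<dots> = (\<integral>\<^sup>+m. (\<integral>\<^sup>+\<xi>. ennreal (b m \<xi>) * a \<xi> \<partial>lborel) \<partial>count_space ?X) / ennreal ?V"
    by (rule nn_integral_divide) simp
  also have "(\<integral>\<^sup>+m. (\<integral>\<^sup>+\<xi>. ennreal (b m \<xi>) * a \<xi> \<partial>lborel) \<partial>count_space ?X)
      = (\<integral>\<^sup>+\<xi>. (\<integral>\<^sup>+m. ennreal (b m \<xi>) * a \<xi> \<partial>count_space ?X) \<partial>lborel)"
    by (rule nn_integral_count_space_nn_integral[symmetric, OF X]) measurable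
  also have "\<dots> / ennreal ?V \<le> ennreal (4 * E / real n ^ (2 * r + 1)) / ennreal ?V"
  proof (rule divide_right_mono_ennreal)
    have nn: "0 < real n" using n by simp
    have "(\<integral>\<^sup>+m. ennreal (b m \<xi>) * a \<xi> \<partial>count_space ?X)
        \<le> ennreal (4 / real n ^ (2 * r + 1)) * ennreal ((norm (fc (\<lambda>x. of_real (?h x)) \<xi>))\<^sup>2)" for \<xi>
    proof -
      have "(\<integral>\<^sup>+m. ennreal (b m \<xi>) * a \<xi> \<partial>count_space ?X) = (\<integral>\<^sup>+m. ennreal (b m \<xi>) \<partial>count_space ?X) * a \<xi>"
        by (rule nn_integral_multc) simp
      also have "(\<integral>\<^sup>+m. ennreal (b m \<xi>) \<partial>count_space ?X)
          \<le> ennreal (4 / real n * indicator {\<xi>. real n \<le> (\<Prod>j\<in>UNIV. \<bar>\<xi> $ j\<bar>)} \<xi>)"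
      proof (rule nn_integral_count_space_le[OF X])
        fix F assume F: "finite F" "F \<subseteq> ?X"
        show "(\<Sum>m\<in>F. ennreal (b m \<xi>)) \<le> ennreal (4 / real n * indicator {\<xi>. real n \<le> (\<Prod>j\<in>UNIV. \<bar>\<xi> $ j\<bar>)} \<xi>)"
          using sum_dilation_indicator_le[OF F, of \<xi>] b0
          by (subst sum_ennreal) (auto simp: b_def intro!: ennreal_leI)
      qed
      also have "ennreal (4 / real n * indicator {\<xi>. real n \<le> (\<Prod>j\<in>UNIV. \<bar>\<xi> $ j\<bar>)} \<xi>) * a \<xi>
          \<le> ennreal (4 / real n ^ (2 * r + 1)) * ennreal ((norm (fc (\<lambda>x. of_real (?h x)) \<xi>))\<^sup>2)"
      proof (cases "real n \<le> (\<Prod>j\<in>UNIV. \<bar>\<xi> $ j\<bar>)")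
        case True
        let ?g = "norm (fc (\<lambda>x. of_real (G (\<lambda>_. 0) x)) \<xi>)"
        have "(\<Prod>j\<in>UNIV. \<bar>\<xi> $ j\<bar>) \<le> (\<Prod>j\<in>UNIV. \<bar>2 * pi * \<xi> $ j\<bar>)"
        proof (intro prod_mono conjI)
          fix j
          have "1 * \<bar>\<xi> $ j\<bar> \<le> (2 * pi) * \<bar>\<xi> $ j\<bar>" using pi_ge_two by (intro mult_right_mono) auto
          then show "\<bar>\<xi> $ j\<bar> \<le> \<bar>2 * pi * \<xi> $ j\<bar>" by (simp add: abs_mult)
        qed auto
        with True have "real n ^ r \<le> (\<Prod>j\<in>UNIV. \<bar>2 * pi * \<xi> $ j\<bar>) ^ r"
          by (intro power_mono) auto
        then have "real n ^ r * ?g \<le> (\<Prod>j\<in>UNIV. \<bar>2 * pi * \<xi> $ j\<bar>) ^ r * ?g"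
          by (rule mult_right_mono) simp
        also have "\<dots> = norm (fc (\<lambda>x. of_real (?h x)) \<xi>)"
          by (subst norm_fc_jet[OF G, of "corner_index r UNIV"]) (simp add: corner_index_def prod_power_distrib)
        finally have "(real n ^ r * ?g)\<^sup>2 \<le> (norm (fc (\<lambda>x. of_real (?h x)) \<xi>))\<^sup>2"
          by (intro power_mono) auto
        then have "real n ^ (2 * r) * ?g\<^sup>2 \<le> (norm (fc (\<lambda>x. of_real (?h x)) \<xi>))\<^sup>2"
          by (simp only: power_mult_distrib power_mult[symmetric] mult.commute[of r 2])
        then have "4 / real n ^ (2 * r + 1) * (real n ^ (2 * r) * ?g\<^sup>2)
            \<le> 4 / real n ^ (2 * r + 1) * (norm (fc (\<lambda>x. of_real (?h x)) \<xi>))\<^sup>2"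
          by (intro mult_left_mono) auto
        moreover have "4 / real n ^ (2 * r + 1) * (real n ^ (2 * r) * ?g\<^sup>2) = 4 / real n * ?g\<^sup>2"
          using nn by (simp add: power_add)
        ultimately have "ennreal (4 / real n * ?g\<^sup>2) \<le> ennreal (4 / real n ^ (2 * r + 1) * (norm (fc (\<lambda>x. of_real (?h x)) \<xi>))\<^sup>2)"
          by (intro ennreal_leI) simp
        then show ?thesis using True by (simp add: a_def ennreal_mult[symmetric] del: power_Suc)
      qed simp
      finally show ?thesis by (simp add: mult_right_mono)
    qed
    then have "(\<integral>\<^sup>+\<xi>. (\<integral>\<^sup>+m. ennreal (b m \<xi>) * a \<xi> \<partial>count_space ?X) \<partial>lborel)
        \<le> (\<integral>\<^sup>+\<xi>. ennreal (4 / real n ^ (2 * r + 1)) * ennreal ((norm (fc (\<lambda>x. of_real (?h x)) \<xi>))\<^sup>2) \<partial>lborel)"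
      by (intro nn_integral_mono)
    also have "\<dots> = ennreal (4 / real n ^ (2 * r + 1)) * (\<integral>\<^sup>+\<xi>. ennreal ((norm (fc (\<lambda>x. of_real (?h x)) \<xi>))\<^sup>2) \<partial>lborel)"
    proof (rule nn_integral_cmult)
      have [measurable]: "fc (\<lambda>x. of_real (?h x)) \<in> borel_measurable borel" by (rule borel_measurable_fc[OF c0])
      show "(\<lambda>\<xi>. ennreal ((norm (fc (\<lambda>x. of_real (?h x)) \<xi>))\<^sup>2)) \<in> borel_measurable lborel" by measurable
    qed
    also have "\<dots> \<le> ennreal (4 / real n ^ (2 * r + 1)) * ennreal E"
      by (intro mult_left_mono order_trans[OF plancherel_le[OF supported_jetD(1)[OF G]]] ennreal_leI E) simp
    also have "\<dots> = ennreal (4 * E / real n ^ (2 * r + 1))"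
      by (simp add: ennreal_mult'[symmetric])
    finally show "(\<integral>\<^sup>+\<xi>. (\<integral>\<^sup>+m. ennreal (b m \<xi>) * a \<xi> \<partial>count_space ?X) \<partial>lborel)
        \<le> ennreal (4 * E / real n ^ (2 * r + 1))" .
  qed
  also have "\<dots> = ennreal (4 / ?V * E / real n ^ (2 * r + 1))"
  proof -
    have "0 \<le> (\<integral>x. (?h x)\<^sup>2 \<partial>cube_measure)" by (rule Bochner_Integration.integral_nonneg) simp
    then have "0 \<le> E" using E by linarith
    then show ?thesis using V(1) by (subst divide_ennreal) (auto simp: field_simps)
  qed
  finally show ?thesis by (simp only: a_def)
qed

end

subsection \<open>Mollification\<close>

lemma DPsi_nonneg: "transform_fun \<psi> \<Longrightarrow> 0 \<le> DPsi \<psi> x"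
  by (simp add: DPsi_eq_prod prod_nonneg deriv_psi_nonneg)

lemma continuous_on_DPsi:
  assumes \<psi>: "transform_fun \<psi>"
  shows "continuous_on S (DPsi \<psi>)"
  unfolding DPsi_eq_prod[OF \<psi>, abs_def]
  by (intro continuous_intros continuous_on_compose2[OF continuous_on_deriv_psi[OF \<psi>, of UNIV]]) auto

lemma DPsi_outside:
  assumes \<psi>: "transform_fun \<psi>" and z: "z \<notin> unit_cube"
  shows "DPsi \<psi> z = 0"
proof -
  obtain i where "\<not> (0 \<le> z $ i \<and> z $ i \<le> 1)" using z mem_unit_cube by blast
  then have "z $ i \<notin> {0<..<1}" by auto
  then have "deriv \<psi> (z $ i) = 0" using derivs_psi_outside[OF \<psi>, of "z $ i" 0] by simp
  then show ?thesis unfolding DPsi_eq_prod[OF \<psi>] by (intro prod_zero) auto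
qed

text \<open>Weak derivatives are Lebesgue measurable only, so a second measure on the cube is used
  next to the Borel measure \<open>cube_measure\<close>; the integrals of continuous functions
  agree.\<close>

abbreviation lebesgue_cube :: "(real ^ 'n) measure" where
  "lebesgue_cube \<equiv> lebesgue_on unit_cube"

lemma unit_cube_lmeasurable: "unit_cube \<in> lmeasurable" "unit_cube \<in> sets lebesgue"
  by (simp_all add: unit_cube_def)

lemma finite_measure_lebesgue_cube: "finite_measure (lebesgue_cube :: (real ^ 'n) measure)"
  by (rule finite_measure_lebesgue_on[OF unit_cube_lmeasurable(1)])

lemma measurable_lebesgue_cube [measurable (raw)]:
  "f \<in> borel_measurable borel \<Longrightarrow> f \<in> borel_measurable lebesgue_cube"
  by (intro measurable_restrict_space1 measurable_completion) simp

lemma integral_lebesgue_cube: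
  fixes f :: "real ^ 'n \<Rightarrow> real"
  assumes f: "continuous_on UNIV f"
  shows "integral\<^sup>L lebesgue_cube f = (\<integral>x. f x \<partial>cube_measure)"
proof -
  have [measurable]: "f \<in> borel_measurable borel" using f by (rule borel_measurable_continuous_onI)
  have "integral\<^sup>L lebesgue_cube f = (\<integral>x. indicator unit_cube x *\<^sub>R f x \<partial>lebesgue)"
    using unit_cube_lmeasurable by (intro integral_restrict_space) auto
  also have "\<dots> = (\<integral>x. indicator unit_cube x *\<^sub>R f x \<partial>lborel)"
    by (rule integral_completion) measurable
  finally show ?thesis by (simp add: integral_cube)
qed

lemma integrable_lebesgue_cube_mult_bounded:
  fixes g k :: "real ^ 'n \<Rightarrow> real"
  assumes g: "integrable lebesgue_cube g" and k: "continuous_on UNIV k"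
  shows "integrable lebesgue_cube (\<lambda>x. g x * k x)"
proof -
  have "compact (k ` unit_cube)"
    unfolding unit_cube_def by (rule compact_continuous_image[OF continuous_on_subset[OF k]]) auto
  then obtain M where M: "\<And>x. x \<in> unit_cube \<Longrightarrow> \<bar>k x\<bar> \<le> M"
    using compact_imp_bounded[of "k ` unit_cube"] by (auto simp: bounded_iff)
  have [measurable]: "k \<in> borel_measurable borel" using k by (rule borel_measurable_continuous_onI)
  have [measurable]: "g \<in> borel_measurable lebesgue_cube" using g by auto
  show ?thesis
  proof (rule Bochner_Integration.integrable_bound)
    show "integrable lebesgue_cube (\<lambda>x. M * g x)" using g by simp
    show "AE x in lebesgue_cube. norm (g x * k x) \<le> norm (M * g x)"
    proof (rule AE_I2)
      fix x :: "real ^ 'n" assume "x \<in> space lebesgue_cube"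
      then have "\<bar>k x\<bar> \<le> \<bar>M\<bar>" using M[of x] by simp
      then show "norm (g x * k x) \<le> norm (M * g x)"
        by (simp add: abs_mult mult.commute[of "\<bar>g x\<bar>"] mult_right_mono)
    qed
  qed measurable
qed

lemma L2_cube_integrable:
  assumes "g \<in> L2_cube"
  shows "integrable lebesgue_cube (\<lambda>x. (g x)\<^sup>2)" "integrable lebesgue_cube g"
proof -
  interpret finite_measure "lebesgue_cube :: (real ^ 'a) measure" by (rule finite_measure_lebesgue_cube)
  show 2: "integrable lebesgue_cube (\<lambda>x. (g x)\<^sup>2)" using assms by (simp add: L2_cube_def)
  have [measurable]: "g \<in> borel_measurable lebesgue_cube" using assms by (simp add: L2_cube_def)
  show "integrable lebesgue_cube g"
  proof (rule Bochner_Integration.integrable_bound)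
    show "integrable lebesgue_cube (\<lambda>x. 1 + (g x)\<^sup>2)" using 2 by simp
    have "\<bar>t\<bar> \<le> 1 + t\<^sup>2" for t :: real
    proof -
      have "0 \<le> (\<bar>t\<bar> - 1)\<^sup>2" "0 \<le> t\<^sup>2" by auto
      then show ?thesis by (simp add: power2_eq_square algebra_simps)
    qed
    then have "\<bar>t\<bar> \<le> \<bar>1 + t\<^sup>2\<bar>" for t :: real by (meson abs_ge_self order_trans)
    then show "AE x in lebesgue_cube. norm (g x) \<le> norm (1 + (g x)\<^sup>2)" by simp
  qed simp
qed

text \<open>Here \<open>h i k\<close> is the k-th derivative of the i-th factor. For such products
  an iterated partial derivative visibly depends only on how often each coordinate occurs in the
  list, as the definition of weak derivatives requires.\<close>

lemma partials_prod:
  fixes h :: "'n :: finite \<Rightarrow> nat \<Rightarrow> real \<Rightarrow> real"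
  assumes h: "\<And>i k t. (h i k has_real_derivative h i (Suc k) t) (at t)"
  shows "partials is (\<lambda>x. \<Prod>i\<in>UNIV. h i 0 (x $ i)) = (\<lambda>x. \<Prod>i\<in>UNIV. h i (count_list is i) (x $ i))"
proof (induction "is")
  case Nil
  then show ?case by (simp add: partials_def)
next
  case (Cons j "is")
  let ?c = "count_list is"
  have "partial j (\<lambda>x. \<Prod>i\<in>UNIV. h i (?c i) (x $ i)) x = (\<Prod>i\<in>UNIV. h i (count_list (j # is) i) (x $ i))" for x
  proof -
    let ?P = "\<Prod>i\<in>UNIV-{j}. h i (?c i) (x $ i)"
    have eq: "(\<Prod>i\<in>UNIV. h i (?c i) ((x + t *\<^sub>R axis j 1) $ i)) = h j (?c j) (x $ j + t) * ?P" for t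
    proof -
      have "(\<Prod>i\<in>UNIV-{j}. h i (?c i) ((x + t *\<^sub>R axis j 1) $ i)) = ?P"
        by (rule prod.cong) (auto simp: axis_def)
      then show ?thesis by (subst prod.remove[of UNIV j]) (auto simp: axis_def)
    qed
    have "((\<lambda>t. x $ j + t) has_real_derivative 1) (at 0)"
      by (auto intro!: derivative_eq_intros)
    then have "((\<lambda>t. h j (?c j) (x $ j + t)) has_real_derivative h j (Suc (?c j)) (x $ j + 0) * 1) (at 0)"
      by (rule DERIV_chain2[OF h])
    then have "((\<lambda>t. h j (?c j) (x $ j + t) * ?P) has_real_derivative h j (Suc (?c j)) (x $ j) * ?P) (at 0)"
      by (auto dest: DERIV_cmult_right)
    then have "partial j (\<lambda>x. \<Prod>i\<in>UNIV. h i (?c i) (x $ i)) x = h j (Suc (?c j)) (x $ j) * ?P"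
      unfolding partial_def eq by (rule DERIV_imp_deriv)
    also have "?P = (\<Prod>i\<in>UNIV-{j}. h i (count_list (j # is) i) (x $ i))"
      by (rule prod.cong) auto
    also have "h j (Suc (?c j)) (x $ j) = h j (count_list (j # is) j) (x $ j)" by simp
    finally show ?thesis by (simp only: prod.remove[of UNIV j] finite UNIV_I)
  qed
  then have "partial j (partials is (\<lambda>x. \<Prod>i\<in>UNIV. h i 0 (x $ i))) = (\<lambda>x. \<Prod>i\<in>UNIV. h i (count_list (j # is) i) (x $ i))"
    unfolding Cons.IH by (rule ext)
  then show ?case by (simp add: partials_def)
qed

lemma differentiable_prod_coordinates:
  fixes h :: "'n :: finite \<Rightarrow> real \<Rightarrow> real"
  assumes h: "\<And>i t. (h i has_real_derivative h' i t) (at t)"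
  shows "(\<lambda>x. \<Prod>i\<in>UNIV. h i (x $ i)) differentiable (at x)"
proof -
  have "((\<lambda>x. h i (x $ i)) has_derivative (\<lambda>y. h' i (x $ i) * y $ i)) (at x)" for i
    by (rule has_derivative_compose[OF bounded_linear_imp_has_derivative[OF bounded_linear_vec_nth]])
       (use h in \<open>simp add: has_field_derivative_def\<close>)
  note d = this
  show ?thesis unfolding differentiable_def by (rule exI, rule has_derivative_prod[OF d])
qed

lemma exists_list_with_counts:
  fixes \<alpha> :: "'n :: finite \<Rightarrow> nat"
  obtains "is" where "\<And>i. count_list is i = \<alpha> i"
proof -
  obtain "is" where "mset is = Abs_multiset \<alpha>" using ex_mset by blast
  then have "count (mset is) = \<alpha>" by (simp add: count_Abs_multiset)
  then show ?thesis using that by (metis count_mset)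
qed

context
  fixes \<psi> :: "real \<Rightarrow> real" and \<epsilon> :: real
  assumes \<psi>: "transform_fun \<psi>" and \<epsilon>: "0 < \<epsilon>" "\<epsilon> \<le> 1 / 6"
begin

text \<open>The value of the mollified function at y averages f over a box around the point
  \<open>(1 - 3 \<epsilon>) y + 3 \<epsilon> / 2\<close>. The contraction keeps this box inside the open cube, so that for y in the
  closed cube the kernel is a test function. Since \<psi>' is the bump, no further cut-off is needed.\<close>

definition kernel_arg :: "real ^ 'n \<Rightarrow> real ^ 'n \<Rightarrow> real ^ 'n" where
  "kernel_arg y w = (\<chi> i. (w $ i - (1 - 3 * \<epsilon>) * y $ i - \<epsilon>) / \<epsilon>)"

text \<open>The derivative of multi-index \<alpha> in y, the point at which the mollified function
  is evaluated; each differentiation contributes the inner derivative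
  \<open>- (1 - 3 * \<epsilon>) / \<epsilon>\<close>. At order 0 this is a rescaled
  \<open>DPsi\<close>.\<close>

definition kernel :: "('n \<Rightarrow> nat) \<Rightarrow> real ^ 'n \<Rightarrow> real ^ 'n \<Rightarrow> real" where
  "kernel \<alpha> y w = (\<Prod>i\<in>UNIV. 1 / \<epsilon> * (- (1 - 3 * \<epsilon>) / \<epsilon>) ^ \<alpha> i * (deriv ^^ Suc (\<alpha> i)) \<psi> (kernel_arg y w $ i))"

definition mollified :: "(real ^ 'n \<Rightarrow> real) \<Rightarrow> ('n \<Rightarrow> nat) \<Rightarrow> real ^ 'n \<Rightarrow> real" where
  "mollified f \<alpha> y = integral unit_cube (\<lambda>w. f w * kernel \<alpha> y w)"

lemma kernel_0: "kernel (\<lambda>_. 0) y w = DPsi \<psi> (kernel_arg y w) / \<epsilon> ^ CARD('n)" for y w :: "real ^ 'n"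
  by (simp add: kernel_def DPsi_eq_prod[OF \<psi>] prod_dividef)

lemma kernel_nonneg: "0 \<le> kernel (\<lambda>_. 0) y w"
  using \<epsilon> by (simp add: kernel_0 DPsi_eq_prod[OF \<psi>] prod_nonneg deriv_psi_nonneg[OF \<psi>])

lemma continuous_kernel: "continuous_on S (\<lambda>p. kernel \<alpha> (fst p) (snd p))"
  unfolding kernel_def kernel_arg_def vec_lambda_beta
  by (intro continuous_intros continuous_on_compose2[OF continuous_on_derivs_psi[OF \<psi>, of UNIV]]) (use \<epsilon> in auto)

lemma continuous_kernel': "continuous_on S (kernel \<alpha> y)" "continuous_on S (\<lambda>y. kernel \<alpha> y w)"
proof -
  have "continuous_on S (\<lambda>w. (y, w))" "continuous_on S (\<lambda>y. (y, w))" by (intro continuous_intros)+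
  from this[THEN continuous_on_compose2[OF continuous_kernel[of UNIV \<alpha>]]]
  show "continuous_on S (kernel \<alpha> y)" "continuous_on S (\<lambda>y. kernel \<alpha> y w)" by simp_all
qed

lemma kernel_deriv:
  "((\<lambda>s. kernel \<alpha> (upd y i s) w) has_real_derivative kernel (\<alpha>(i := Suc (\<alpha> i))) (upd y i t) w) (at t)"
proof -
  let ?a = "1 - 3 * \<epsilon>"
  define h where "h k s = 1 / \<epsilon> * (- ?a / \<epsilon>) ^ k * (deriv ^^ Suc k) \<psi> ((w $ i - ?a * s - \<epsilon>) / \<epsilon>)" for k s
  define P where "P = (\<Prod>j\<in>UNIV-{i}. 1 / \<epsilon> * (- ?a / \<epsilon>) ^ \<alpha> j * (deriv ^^ Suc (\<alpha> j)) \<psi> ((w $ j - ?a * y $ j - \<epsilon>) / \<epsilon>))"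
  have K: "kernel \<beta> (upd y i s) w = h (\<beta> i) s * P" if "\<And>j. j \<noteq> i \<Longrightarrow> \<beta> j = \<alpha> j" for \<beta> s
  proof -
    have "(\<Prod>j\<in>UNIV-{i}. 1 / \<epsilon> * (- ?a / \<epsilon>) ^ \<beta> j * (deriv ^^ Suc (\<beta> j)) \<psi> (kernel_arg (upd y i s) w $ j)) = P"
      unfolding P_def using that by (intro prod.cong) (auto simp: kernel_arg_def)
    then show ?thesis
      unfolding kernel_def by (subst prod.remove[of UNIV i]) (auto simp: h_def kernel_arg_def)
  qed
  have "((\<lambda>s. (w $ i - ?a * s - \<epsilon>) / \<epsilon>) has_real_derivative (- ?a / \<epsilon>)) (at t)"
    using \<epsilon> by (auto intro!: derivative_eq_intros)
  from DERIV_chain2[OF DERIV_psi[OF \<psi>] this]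
  have D: "((\<lambda>s. (deriv ^^ Suc k) \<psi> ((w $ i - ?a * s - \<epsilon>) / \<epsilon>)) has_real_derivative
      (deriv ^^ Suc (Suc k)) \<psi> ((w $ i - ?a * t - \<epsilon>) / \<epsilon>) * (- ?a / \<epsilon>)) (at t)" for k .
  have "(h k has_real_derivative h (Suc k) t) (at t)" for k
    using DERIV_cmult[OF D[of k], of "1 / \<epsilon> * (- ?a / \<epsilon>) ^ k"]
    unfolding h_def[abs_def] by (simp only: power_Suc2 mult_ac)
  from DERIV_cmult_right[OF this, of "\<alpha> i" P]
  show ?thesis by (simp add: K)
qed

text \<open>All differentiations fall on the kernel, under the integral sign, so continuity of f
  suffices.\<close>

lemma jet_mollified:
  fixes f :: "real ^ 'n \<Rightarrow> real"
  assumes f: "continuous_on unit_cube f"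
  shows "jet (mollified f)"
  unfolding jet_def
proof (intro conjI allI)
  have fs: "continuous_on (S \<times> unit_cube) (\<lambda>p. f (snd p))" for S :: "'b :: topological_space set"
    by (rule continuous_on_compose2[OF f]) (auto intro!: continuous_intros)
  fix \<alpha>
  have "continuous_on (UNIV \<times> cbox 0 1) (\<lambda>(y, w). f w * kernel \<alpha> y w)"
    unfolding case_prod_unfold by (intro continuous_intros continuous_kernel fs[unfolded unit_cube_def])
  then show "continuous_on UNIV (mollified f \<alpha>)"
    unfolding mollified_def[abs_def] unit_cube_def by (rule integral_continuous_on_param)
  fix i and y :: "real ^ 'n" and t
  let ?\<beta> = "\<alpha>(i := Suc (\<alpha> i))"
  have "((\<lambda>s. integral (cbox 0 1) (\<lambda>w. f w * kernel \<alpha> (upd y i s) w)) has_real_derivative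
      integral (cbox 0 1) (\<lambda>w. f w * kernel ?\<beta> (upd y i t) w)) (at t within UNIV)"
  proof (rule leibniz_rule_field_derivative)
    show "((\<lambda>s. f w * kernel \<alpha> (upd y i s) w) has_real_derivative f w * kernel ?\<beta> (upd y i s) w) (at s within UNIV)" for s w
      by (rule DERIV_cmult[OF kernel_deriv])
    show "(\<lambda>w. f w * kernel \<alpha> (upd y i s) w) integrable_on cbox 0 1" for s
      by (intro integrable_continuous continuous_intros f[unfolded unit_cube_def] continuous_kernel')
    show "continuous_on (UNIV \<times> cbox 0 1) (\<lambda>(s, w). f w * kernel ?\<beta> (upd y i s) w)"
      unfolding case_prod_unfold
      by (intro continuous_intros fs[unfolded unit_cube_def]
          continuous_on_compose2[OF continuous_kernel[of UNIV ?\<beta>], where f = "\<lambda>p. (upd y i (fst p), snd p)", simplified])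
  qed auto
  then show "((\<lambda>s. mollified f \<alpha> (upd y i s)) has_real_derivative mollified f ?\<beta> (upd y i t)) (at t)"
    by (simp add: mollified_def unit_cube_def)
qed

lemma kernel_support:
  assumes "kernel \<alpha> y w \<noteq> 0"
  shows "0 < kernel_arg y w $ i" "kernel_arg y w $ i < 1"
proof -
  have "(deriv ^^ Suc (\<alpha> i)) \<psi> (kernel_arg y w $ i) \<noteq> 0"
    using assms unfolding kernel_def by (auto simp: prod_zero_iff simp del: funpow.simps)
  then have "kernel_arg y w $ i \<in> {0<..<1}"
    using derivs_psi_outside[OF \<psi>] by blast
  then show "0 < kernel_arg y w $ i" "kernel_arg y w $ i < 1" by auto
qed

text \<open>The support lies strictly between
  \<open>(1 - 3 * \<epsilon>) * y $ i + \<epsilon>\<close> and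
  \<open>(1 - 3 * \<epsilon>) * y $ i + 2 * \<epsilon>\<close>, and y has coordinates in
  [0,1].\<close>

lemma kernel_support_bounds:
  assumes "kernel \<alpha> y w \<noteq> 0" "y \<in> unit_cube"
  shows "\<epsilon> \<le> w $ i" "w $ i \<le> 1 - \<epsilon>" "\<bar>w $ i - y $ i\<bar> \<le> 2 * \<epsilon>"
proof -
  let ?a = "1 - 3 * \<epsilon>"
  have w: "?a * y $ i + \<epsilon> < w $ i" "w $ i < ?a * y $ i + 2 * \<epsilon>"
    using kernel_support[OF assms(1), of i] \<epsilon> by (auto simp: kernel_arg_def field_simps)
  have y: "0 \<le> y $ i" "y $ i \<le> 1" using assms(2) by (auto simp: mem_unit_cube)
  have ay: "0 \<le> ?a * y $ i" "?a * y $ i \<le> ?a * 1" "0 \<le> \<epsilon> * y $ i" "\<epsilon> * y $ i \<le> \<epsilon> * 1"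
    using y \<epsilon> by (auto intro!: mult_left_mono)
  show "\<epsilon> \<le> w $ i" "w $ i \<le> 1 - \<epsilon>" using w ay by auto
  have "?a * y $ i = y $ i - 3 * (\<epsilon> * y $ i)" by (simp add: algebra_simps)
  moreover have "\<epsilon> * y $ i \<le> \<epsilon>" using mult_left_mono[OF y(2), of \<epsilon>] \<epsilon> by simp
  ultimately show "\<bar>w $ i - y $ i\<bar> \<le> 2 * \<epsilon>" using w ay(3) by linarith
qed

text \<open>The kernel depends on y and w through w - (1 - 3 \<epsilon>) y only. A derivative in y
  is therefore a derivative in w times - (1 - 3 \<epsilon>), and derivatives in w can be moved onto
  f by the definition of weak derivatives.\<close>

lemma test_function_kernel:
  assumes y: "y \<in> unit_cube"
  shows "test_function (kernel (\<lambda>_. 0) y)"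
    and "(\<And>i. count_list is i = \<alpha> i) \<Longrightarrow>
      kernel \<alpha> y w = (- (1 - 3 * \<epsilon>)) ^ (\<Sum>i\<in>UNIV. \<alpha> i) * partials is (kernel (\<lambda>_. 0) y) w"
proof -
  let ?a = "1 - 3 * \<epsilon>"
  define h where "h i k s = 1 / \<epsilon> * (1 / \<epsilon>) ^ k * (deriv ^^ Suc k) \<psi> ((s - ?a * y $ i - \<epsilon>) / \<epsilon>)" for i k s
  have h: "(h i k has_real_derivative h i (Suc k) t) (at t)" for i k t
  proof -
    have "((\<lambda>s. (s - ?a * y $ i - \<epsilon>) / \<epsilon>) has_real_derivative (1 / \<epsilon>)) (at t)"
      using \<epsilon> by (auto intro!: derivative_eq_intros)
    from DERIV_cmult[OF DERIV_chain2[OF DERIV_psi[OF \<psi>, of "Suc k"] this], of "1 / \<epsilon> * (1 / \<epsilon>) ^ k"]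
    show ?thesis
      unfolding h_def[abs_def] by (simp only: power_Suc2 mult_ac)
  qed
  have K0: "kernel (\<lambda>_. 0) y = (\<lambda>w. \<Prod>i\<in>UNIV. h i 0 (w $ i))"
    by (simp add: fun_eq_iff kernel_def h_def kernel_arg_def)
  have P: "partials is (kernel (\<lambda>_. 0) y) = (\<lambda>w. \<Prod>i\<in>UNIV. h i (count_list is i) (w $ i))" for "is"
    unfolding K0 by (rule partials_prod) (rule h)
  show "test_function (kernel (\<lambda>_. 0) y)"
    unfolding test_function_def
  proof (intro conjI allI)
    show "partials is (kernel (\<lambda>_. 0) y) differentiable (at x)" for "is" x
      unfolding P by (rule differentiable_prod_coordinates) (rule h)
    have "{w. kernel (\<lambda>_. 0) y w \<noteq> 0} \<subseteq> cbox (\<chi> i. \<epsilon>) (\<chi> i. 1 - \<epsilon>)"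
      using kernel_support_bounds(1,2)[OF _ y] by (auto simp: mem_box_cart)
    then have "closure {w. kernel (\<lambda>_. 0) y w \<noteq> 0} \<subseteq> cbox (\<chi> i. \<epsilon>) (\<chi> i. 1 - \<epsilon>)"
      by (rule closure_minimal) auto
    also have "\<dots> \<subseteq> box 0 1"
    proof
      fix w :: "real ^ 'a" assume w: "w \<in> cbox (\<chi> i. \<epsilon>) (\<chi> i. 1 - \<epsilon>)"
      have "0 < w $ i \<and> w $ i < 1" for i
      proof -
        have "\<epsilon> \<le> w $ i" "w $ i \<le> 1 - \<epsilon>" using w by (auto simp: mem_box_cart)
        then show ?thesis using \<epsilon>(1) by linarith
      qed
      then show "w \<in> box 0 1" by (simp add: mem_box_cart)
    qed
    finally show "closure {w. kernel (\<lambda>_. 0) y w \<noteq> 0} \<subseteq> box 0 1" .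
  qed
  show "kernel \<alpha> y w = (- ?a) ^ (\<Sum>i\<in>UNIV. \<alpha> i) * partials is (kernel (\<lambda>_. 0) y) w"
    if "\<And>i. count_list is i = \<alpha> i"
  proof -
    have "kernel \<alpha> y w = (\<Prod>i\<in>UNIV. (- ?a) ^ \<alpha> i * h i (\<alpha> i) (w $ i))"
      unfolding kernel_def
    proof (rule prod.cong[OF refl])
      fix i
      have "(- ?a / \<epsilon>) ^ \<alpha> i = (- ?a) ^ \<alpha> i * (1 / \<epsilon>) ^ \<alpha> i" by (simp add: power_divide)
      then show "1 / \<epsilon> * (- ?a / \<epsilon>) ^ \<alpha> i * (deriv ^^ Suc (\<alpha> i)) \<psi> (kernel_arg y w $ i)
          = (- ?a) ^ \<alpha> i * h i (\<alpha> i) (w $ i)"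
        by (simp only: h_def kernel_arg_def vec_lambda_beta mult_ac)
    qed
    then show ?thesis by (simp add: P that prod.distrib power_sum)
  qed
qed

lemma nn_integral_DPsi: "(\<integral>\<^sup>+z. ennreal (DPsi \<psi> (z :: real ^ 'n)) \<partial>lborel) = 1"
proof -
  interpret prob_space "cube_measure :: (real ^ 'n) measure" by (rule prob_space_cube)
  have i: "integrable lborel (\<lambda>z :: real ^ 'n. DPsi \<psi> z)"
    by (rule integrable_lborel_cube_support(1)[OF continuous_on_DPsi[OF \<psi>]]) (rule DPsi_outside[OF \<psi>])
  have i': "(\<integral>z. DPsi \<psi> (z :: real ^ 'n) \<partial>lborel) = (\<integral>z. DPsi \<psi> (z :: real ^ 'n) \<partial>cube_measure)"
    by (rule integrable_lborel_cube_support(2)[OF continuous_on_DPsi[OF \<psi>]]) (rule DPsi_outside[OF \<psi>])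
  have "(\<integral>\<^sup>+z. ennreal (DPsi \<psi> (z :: real ^ 'n)) \<partial>lborel) = ennreal (\<integral>z. DPsi \<psi> (z :: real ^ 'n) \<partial>lborel)"
    by (rule nn_integral_eq_integral[OF i])
       (simp add: DPsi_nonneg[OF \<psi>])
  also have "(\<integral>z. DPsi \<psi> (z :: real ^ 'n) \<partial>lborel) = 1"
    using integral_cube_psi_subst[OF \<psi>, of "\<lambda>_. 1"] prob_space
    by (simp add: i')
  finally show ?thesis by simp
qed

lemma nn_integral_affine:
  fixes f :: "real ^ 'n \<Rightarrow> ennreal"
  assumes [measurable]: "f \<in> borel_measurable borel" and c: "c \<noteq> 0"
  shows "(\<integral>\<^sup>+x. f x \<partial>lborel) = ennreal (\<bar>c\<bar> ^ CARD('n)) * (\<integral>\<^sup>+x. f (b + c *\<^sub>R x) \<partial>lborel)"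
proof -
  have "(\<integral>\<^sup>+x. f x \<partial>lborel) = (\<integral>\<^sup>+x. f (b + x) \<partial>lborel)" by (rule nn_integral_lborel_translate) measurable
  also have "\<dots> = ennreal (\<Prod>i\<in>(UNIV :: 'n set). \<bar>c\<bar>) * (\<integral>\<^sup>+x. f (b + (\<chi> i. c * x $ i)) \<partial>lborel)"
    by (rule nn_integral_scale_coordinates) (use c in auto)
  also have "(\<lambda>x :: real ^ 'n. \<chi> i. c * x $ i) = (\<lambda>x. c *\<^sub>R x)" by (simp add: fun_eq_iff vec_eq_iff)
  finally show ?thesis by (simp add: fun_eq_iff)
qed

lemma borel_measurable_DPsi [measurable]: "DPsi \<psi> \<in> borel_measurable borel"
  using continuous_on_DPsi[OF \<psi>] by (rule borel_measurable_continuous_onI)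

text \<open>In w the kernel is a rescaled \<open>DPsi\<close> of mass 1. In y the scaling is (1 - 3
  \<epsilon>) / \<epsilon> instead of 1 / \<epsilon>, which leaves the mass (1 - 3 \<epsilon>)^(-d);
  this is at most 2^d because \<epsilon> is at most 1 / 6.\<close>

lemma nn_integral_kernel:
  fixes y w :: "real ^ 'n"
  shows "(\<integral>\<^sup>+w. ennreal (kernel (\<lambda>_. 0) y w) \<partial>lborel) = 1"
    and "(\<integral>\<^sup>+y. ennreal (kernel (\<lambda>_. 0) y w) \<partial>lborel) \<le> ennreal (2 ^ CARD('n))"
proof -
  let ?a = "1 - 3 * \<epsilon>"
  have DP0: "0 \<le> DPsi \<psi> z" for z :: "real ^ 'n"
    by (simp add: DPsi_eq_prod[OF \<psi>] prod_nonneg deriv_psi_nonneg[OF \<psi>])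
  have c1: "(\<integral>\<^sup>+x. ennreal (DPsi \<psi> (b + c *\<^sub>R x) * (\<bar>c\<bar> ^ CARD('n))) \<partial>lborel) = 1" if "c \<noteq> 0" for b :: "real ^ 'n" and c
  proof -
    have "(\<integral>\<^sup>+x. ennreal (DPsi \<psi> (b + c *\<^sub>R x) * (\<bar>c\<bar> ^ CARD('n))) \<partial>lborel)
        = ennreal (\<bar>c\<bar> ^ CARD('n)) * (\<integral>\<^sup>+x. ennreal (DPsi \<psi> (b + c *\<^sub>R x)) \<partial>lborel)"
      by (subst nn_integral_cmult[symmetric]) (auto simp: ennreal_mult' mult.commute)
    also have "\<dots> = (\<integral>\<^sup>+x. ennreal (DPsi \<psi> (x :: real ^ 'n)) \<partial>lborel)"
      by (rule nn_integral_affine[symmetric]) (use that in auto)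
    finally show ?thesis by (simp add: nn_integral_DPsi)
  qed
  have "kernel (\<lambda>_. 0) y w = DPsi \<psi> ((\<chi> i. (- ?a * y $ i - \<epsilon>) / \<epsilon>) + (1 / \<epsilon>) *\<^sub>R w) * \<bar>1 / \<epsilon>\<bar> ^ CARD('n)" for w
  proof -
    have "kernel_arg y w = (\<chi> i. (- ?a * y $ i - \<epsilon>) / \<epsilon>) + (1 / \<epsilon>) *\<^sub>R w"
      using \<epsilon> by (simp add: kernel_arg_def vec_eq_iff field_simps)
    then show ?thesis using \<epsilon> by (simp add: kernel_0 power_one_over)
  qed
  then show "(\<integral>\<^sup>+w. ennreal (kernel (\<lambda>_. 0) y w) \<partial>lborel) = 1"
    using c1[of "1 / \<epsilon>"] \<epsilon> by simp
  have a: "1 / 2 \<le> ?a" using \<epsilon> by simp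
  have K: "kernel (\<lambda>_. 0) y w = (1 / ?a) ^ CARD('n) *
      (DPsi \<psi> ((\<chi> i. (w $ i - \<epsilon>) / \<epsilon>) + (- ?a / \<epsilon>) *\<^sub>R y) * \<bar>- ?a / \<epsilon>\<bar> ^ CARD('n))" for y
  proof -
    have 1: "kernel_arg y w = (\<chi> i. (w $ i - \<epsilon>) / \<epsilon>) + (- ?a / \<epsilon>) *\<^sub>R y"
      using \<epsilon> by (simp add: kernel_arg_def vec_eq_iff field_simps)
    have "(1 / ?a) * \<bar>- ?a / \<epsilon>\<bar> = 1 / \<epsilon>" using \<epsilon> a by (simp add: abs_divide)
    then have "((1 / ?a) * \<bar>- ?a / \<epsilon>\<bar>) ^ CARD('n) = (1 / \<epsilon>) ^ CARD('n)" by (simp only:)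
    then have 2: "(1 / ?a) ^ CARD('n) * \<bar>- ?a / \<epsilon>\<bar> ^ CARD('n) = 1 / \<epsilon> ^ CARD('n)"
      by (simp only: power_mult_distrib power_one_over)
    have "D / \<epsilon> ^ CARD('n) = (1 / ?a) ^ CARD('n) * (D * \<bar>- ?a / \<epsilon>\<bar> ^ CARD('n))" for D :: real
    proof -
      have "(1 / ?a) ^ CARD('n) * (D * \<bar>- ?a / \<epsilon>\<bar> ^ CARD('n)) = D * ((1 / ?a) ^ CARD('n) * \<bar>- ?a / \<epsilon>\<bar> ^ CARD('n))"
        by (simp only: mult_ac)
      then show ?thesis unfolding 2 by simp
    qed
    then show ?thesis unfolding kernel_0 1 by blast
  qed
  have "(\<integral>\<^sup>+y. ennreal (kernel (\<lambda>_. 0) y w) \<partial>lborel)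
      = (\<integral>\<^sup>+y. ennreal ((1 / ?a) ^ CARD('n)) *
        ennreal (DPsi \<psi> ((\<chi> i. (w $ i - \<epsilon>) / \<epsilon>) + (- ?a / \<epsilon>) *\<^sub>R y) * \<bar>- ?a / \<epsilon>\<bar> ^ CARD('n)) \<partial>lborel)"
  proof -
    have "0 \<le> (1 / ?a) ^ CARD('n)" using a by simp
    then show ?thesis by (simp only: K ennreal_mult')
  qed
  also have "\<dots> = ennreal ((1 / ?a) ^ CARD('n)) * 1"
    using c1[of "- ?a / \<epsilon>"] \<epsilon> a by (subst nn_integral_cmult) auto
  also have "\<dots> \<le> ennreal (2 ^ CARD('n))"
  proof -
    have "1 / ?a \<le> 2" using a by (simp add: divide_le_eq)
    then have "(1 / ?a) ^ CARD('n) \<le> 2 ^ CARD('n)" using a by (intro power_mono) auto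
    then show ?thesis by (simp add: ennreal_leI)
  qed
  finally show "(\<integral>\<^sup>+y. ennreal (kernel (\<lambda>_. 0) y w) \<partial>lborel) \<le> ennreal (2 ^ CARD('n))" .
qed

lemma integral_kernel:
  assumes y: "y \<in> unit_cube"
  shows "integral\<^sup>L lebesgue_cube (kernel (\<lambda>_. 0) y) = 1"
proof -
  have c: "continuous_on UNIV (kernel (\<lambda>_. 0) y)" by (rule continuous_kernel')
  have [measurable]: "kernel (\<lambda>_. 0) y \<in> borel_measurable borel" using c by (rule borel_measurable_continuous_onI)
  have s: "w \<in> unit_cube" if "kernel (\<lambda>_. 0) y w \<noteq> 0" for w
  proof -
    have "0 \<le> w $ i \<and> w $ i \<le> 1" for i
      using kernel_support_bounds(1,2)[OF that y, of i] \<epsilon>(1) by linarith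
    then show ?thesis by (simp add: mem_unit_cube)
  qed
  have "ennreal (\<integral>w. kernel (\<lambda>_. 0) y w \<partial>cube_measure) = (\<integral>\<^sup>+w. ennreal (kernel (\<lambda>_. 0) y w) \<partial>cube_measure)"
    by (rule nn_integral_eq_integral[symmetric]) (auto intro: integrable_cube_continuous c simp: kernel_nonneg)
  also have "\<dots> = (\<integral>\<^sup>+w. ennreal (kernel (\<lambda>_. 0) y w) * indicator unit_cube w \<partial>lborel)"
    by (rule nn_integral_cube) measurable
  also have "\<dots> = (\<integral>\<^sup>+w. ennreal (kernel (\<lambda>_. 0) y w) \<partial>lborel)"
  proof (rule nn_integral_cong)
    fix w
    show "ennreal (kernel (\<lambda>_. 0) y w) * indicator unit_cube w = ennreal (kernel (\<lambda>_. 0) y w)"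
      using s[of w] by (cases "kernel (\<lambda>_. 0) y w = 0") auto
  qed
  also have "\<dots> = 1" by (rule nn_integral_kernel(1))
  finally show ?thesis by (simp add: integral_lebesgue_cube[OF c])
qed

lemma mollified_eq_lebesgue:
  assumes f: "continuous_on unit_cube f"
  shows "mollified f \<alpha> y = (\<integral>w. f w * kernel \<alpha> y w \<partial>lebesgue_cube)"
  unfolding mollified_def unit_cube_def
  by (rule lebesgue_integral_eq_integral[symmetric])
     (auto intro!: continuous_imp_integrable continuous_intros f[unfolded unit_cube_def] continuous_kernel')

text \<open>The sign in the definition of weak derivatives cancels the sign from exchanging
  y-derivatives for w-derivatives. What remains is an average of g, damped by the
  contraction.\<close>

lemma mollified_weak_deriv:
  assumes f: "continuous_on unit_cube f" and g: "has_weak_deriv f \<alpha> g" and y: "y \<in> unit_cube"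
  shows "mollified f \<alpha> y = (1 - 3 * \<epsilon>) ^ (\<Sum>i\<in>UNIV. \<alpha> i) * (\<integral>w. g w * kernel (\<lambda>_. 0) y w \<partial>lebesgue_cube)"
proof -
  let ?a = "1 - 3 * \<epsilon>"
  let ?s = "\<Sum>i\<in>UNIV. \<alpha> i"
  obtain "is" where "is": "\<And>i. count_list is i = \<alpha> i" using exists_list_with_counts[of \<alpha>] by blast
  have "mollified f \<alpha> y = (\<integral>w. (- ?a) ^ ?s * (f w * partials is (kernel (\<lambda>_. 0) y) w) \<partial>lebesgue_cube)"
    unfolding mollified_eq_lebesgue[OF f] test_function_kernel(2)[OF y "is"] by (simp only: mult_ac)
  also have "\<dots> = (- ?a) ^ ?s * (\<integral>w. f w * partials is (kernel (\<lambda>_. 0) y) w \<partial>lebesgue_cube)"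
    by (rule integral_mult_right_zero)
  also have "(\<integral>w. f w * partials is (kernel (\<lambda>_. 0) y) w \<partial>lebesgue_cube)
      = (-1) ^ ?s * (\<integral>w. g w * kernel (\<lambda>_. 0) y w \<partial>lebesgue_cube)"
    using g test_function_kernel(1)[OF y] "is" unfolding has_weak_deriv_def by blast
  also have "(- ?a) ^ ?s * ((-1) ^ ?s * X) = ?a ^ ?s * X" for X :: real
  proof -
    have "(- ?a) ^ ?s * (-1) ^ ?s = (- ?a * -1) ^ ?s" by (rule power_mult_distrib[symmetric])
    then show ?thesis by (simp only: mult.assoc[symmetric]) simp
  qed
  finally show ?thesis .
qed

text \<open>Jensen's inequality for the probability density \<open>kernel\<close>, obtained by
  expanding the nonnegative integral of (g - c)^2 against it, c being the mean of g. The power of 1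
  - 3 \<epsilon> is at most 1.\<close>

lemma mollified_squared_le:
  assumes f: "continuous_on unit_cube f" and g: "has_weak_deriv f \<alpha> g" and y: "y \<in> unit_cube"
  shows "(mollified f \<alpha> y)\<^sup>2 \<le> (\<integral>w. (g w)\<^sup>2 * kernel (\<lambda>_. 0) y w \<partial>lebesgue_cube)"
proof -
  let ?k = "kernel (\<lambda>_. 0) y"
  let ?a = "1 - 3 * \<epsilon>"
  define c where "c = (\<integral>w. g w * ?k w \<partial>lebesgue_cube)"
  have ck: "continuous_on UNIV ?k" by (rule continuous_kernel')
  have gL: "g \<in> L2_cube" using g by (simp add: has_weak_deriv_def)
  interpret finite_measure "lebesgue_cube :: (real ^ 'a) measure" by (rule finite_measure_lebesgue_cube)
  have i2: "integrable lebesgue_cube (\<lambda>w. (g w)\<^sup>2 * ?k w)" and i1: "integrable lebesgue_cube (\<lambda>w. g w * ?k w)"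
    and i0: "integrable lebesgue_cube ?k"
    using integrable_lebesgue_cube_mult_bounded[OF L2_cube_integrable(1)[OF gL] ck]
      integrable_lebesgue_cube_mult_bounded[OF L2_cube_integrable(2)[OF gL] ck]
      integrable_lebesgue_cube_mult_bounded[OF integrable_const[of 1] ck] by simp_all
  have "0 \<le> (\<integral>w. (g w - c)\<^sup>2 * ?k w \<partial>lebesgue_cube)"
    by (rule Bochner_Integration.integral_nonneg) (simp add: kernel_nonneg)
  also have "\<dots> = (\<integral>w. (g w)\<^sup>2 * ?k w - (2 * c) * (g w * ?k w) + c\<^sup>2 * ?k w \<partial>lebesgue_cube)"
    by (rule Bochner_Integration.integral_cong) (auto simp: power2_eq_square algebra_simps)
  also have "\<dots> = (\<integral>w. (g w)\<^sup>2 * ?k w \<partial>lebesgue_cube) - 2 * c * c + c\<^sup>2 * 1"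
    using i2 i1 i0 by (simp add: c_def integral_kernel[OF y])
  finally have "c\<^sup>2 \<le> (\<integral>w. (g w)\<^sup>2 * ?k w \<partial>lebesgue_cube)"
    by (simp add: power2_eq_square)
  moreover have "(mollified f \<alpha> y)\<^sup>2 \<le> c\<^sup>2"
  proof -
    have "0 \<le> ?a" "?a \<le> 1" using \<epsilon> by auto
    then have a: "0 \<le> ?a ^ (\<Sum>i\<in>UNIV. \<alpha> i)" "?a ^ (\<Sum>i\<in>UNIV. \<alpha> i) \<le> 1"
      by (auto intro: power_le_one)
    have "(?a ^ (\<Sum>i\<in>UNIV. \<alpha> i))\<^sup>2 * c\<^sup>2 \<le> 1 * c\<^sup>2"
      by (rule mult_right_mono[OF power_le_one[OF a]]) simp
    then show ?thesis by (simp add: mollified_weak_deriv[OF f g y] c_def power_mult_distrib)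
  qed
  ultimately show ?thesis by linarith
qed

text \<open>After Jensen's inequality, Tonelli's theorem brings the integration over y inside, where
  the kernel has mass at most 2^d. The bound is uniform in \<epsilon>.\<close>

lemma integral_mollified_le:
  fixes f g :: "real ^ 'n \<Rightarrow> real"
  assumes f: "continuous_on unit_cube f" and g: "has_weak_deriv f \<alpha> g"
  shows "(\<integral>y. (mollified f \<alpha> y)\<^sup>2 \<partial>cube_measure) \<le> 2 ^ CARD('n) * (L2_norm_cube g)\<^sup>2"
proof -
  let ?k = "\<lambda>y w. kernel (\<lambda>_. 0) y w"
  interpret L: finite_measure "lebesgue_cube :: (real ^ 'n) measure" by (rule finite_measure_lebesgue_cube)
  interpret C: prob_space "cube_measure :: (real ^ 'n) measure" by (rule prob_space_cube)
  interpret LC: pair_sigma_finite "lebesgue_cube :: (real ^ 'n) measure" "cube_measure :: (real ^ 'n) measure" ..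
  have cm: "continuous_on UNIV (mollified f \<alpha>)" using jet_mollified[OF f] by (simp add: jet_def)
  have gL: "g \<in> L2_cube" using g by (simp add: has_weak_deriv_def)
  have gm [measurable]: "g \<in> borel_measurable lebesgue_cube" using gL by (simp add: L2_cube_def)
  have km: "(\<lambda>p. ?k (fst p) (snd p)) \<in> borel_measurable borel"
    using continuous_kernel by (rule borel_measurable_continuous_onI)
  have id: "(\<lambda>w. w) \<in> measurable lebesgue_cube (borel :: (real ^ 'n) measure)"
    by (rule measurable_lebesgue_cube) simp
  have km' [measurable]: "(\<lambda>(w, y). ?k y w) \<in> borel_measurable (lebesgue_cube \<Otimes>\<^sub>M (cube_measure :: (real ^ 'n) measure))"
  proof -
    have f1: "fst \<in> borel_measurable ((lebesgue_cube :: (real ^ 'n) measure) \<Otimes>\<^sub>M (cube_measure :: (real ^ 'n) measure))"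
      by (rule measurable_compose[OF measurable_fst id])
    have f2: "snd \<in> borel_measurable ((lebesgue_cube :: (real ^ 'n) measure) \<Otimes>\<^sub>M (cube_measure :: (real ^ 'n) measure))"
      using measurable_snd[of "lebesgue_cube :: (real ^ 'n) measure" "cube_measure :: (real ^ 'n) measure"]
      by (simp cong: measurable_cong_sets)
    have "(\<lambda>p. (snd p, fst p)) \<in> borel_measurable ((lebesgue_cube :: (real ^ 'n) measure) \<Otimes>\<^sub>M (cube_measure :: (real ^ 'n) measure))"
      by (rule borel_measurable_Pair[OF f2 f1])
    from measurable_compose[OF this km] show ?thesis by (simp add: case_prod_unfold)
  qed
  have kmw: "(\<lambda>w. ?k y w) \<in> borel_measurable lebesgue_cube" for y
    by (intro measurable_lebesgue_cube borel_measurable_continuous_onI continuous_kernel')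
  have kmy: "(\<lambda>y. ?k y w) \<in> borel_measurable borel" for w
    by (intro borel_measurable_continuous_onI continuous_kernel')
  have "ennreal (\<integral>y. (mollified f \<alpha> y)\<^sup>2 \<partial>cube_measure) = (\<integral>\<^sup>+y. ennreal ((mollified f \<alpha> y)\<^sup>2) \<partial>cube_measure)"
    by (rule nn_integral_eq_integral[symmetric]) (auto intro!: integrable_cube_continuous continuous_intros cm)
  also have "\<dots> \<le> (\<integral>\<^sup>+y. (\<integral>\<^sup>+w. ennreal ((g w)\<^sup>2 * ?k y w) \<partial>lebesgue_cube) \<partial>cube_measure)"
  proof (rule nn_integral_mono_AE)
    show "AE y in cube_measure. ennreal ((mollified f \<alpha> y)\<^sup>2) \<le> (\<integral>\<^sup>+w. ennreal ((g w)\<^sup>2 * ?k y w) \<partial>lebesgue_cube)"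
      using AE_cube
    proof eventually_elim
      case (elim y)
      have i: "integrable lebesgue_cube (\<lambda>w. (g w)\<^sup>2 * ?k y w)"
        by (rule integrable_lebesgue_cube_mult_bounded[OF L2_cube_integrable(1)[OF gL] continuous_kernel'(1)])
      have "ennreal ((mollified f \<alpha> y)\<^sup>2) \<le> ennreal (\<integral>w. (g w)\<^sup>2 * ?k y w \<partial>lebesgue_cube)"
        by (intro ennreal_leI mollified_squared_le[OF f g elim])
      also have "\<dots> = (\<integral>\<^sup>+w. ennreal ((g w)\<^sup>2 * ?k y w) \<partial>lebesgue_cube)"
        by (rule nn_integral_eq_integral[OF i, symmetric]) (simp add: kernel_nonneg)
      finally show ?case .
    qed
  qed
  also have "\<dots> = (\<integral>\<^sup>+w. (\<integral>\<^sup>+y. ennreal ((g w)\<^sup>2 * ?k y w) \<partial>cube_measure) \<partial>lebesgue_cube)"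
    using LC.Fubini'[of "\<lambda>w y. ennreal ((g w)\<^sup>2 * ?k y w)"] by simp
  also have "\<dots> \<le> (\<integral>\<^sup>+w. ennreal ((g w)\<^sup>2) * ennreal (2 ^ CARD('n)) \<partial>lebesgue_cube)"
  proof (rule nn_integral_mono)
    fix w :: "real ^ 'n"
    have "(\<integral>\<^sup>+y. ennreal ((g w)\<^sup>2 * ?k y w) \<partial>cube_measure) = ennreal ((g w)\<^sup>2) * (\<integral>\<^sup>+y. ennreal (?k y w) \<partial>cube_measure)"
    proof -
      have [measurable]: "(\<lambda>y. ?k y w) \<in> borel_measurable borel" by (rule kmy)
      have "(\<integral>\<^sup>+y. ennreal ((g w)\<^sup>2) * ennreal (?k y w) \<partial>cube_measure) = ennreal ((g w)\<^sup>2) * (\<integral>\<^sup>+y. ennreal (?k y w) \<partial>cube_measure)"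
        by (rule nn_integral_cmult) measurable
      then show ?thesis by (simp add: ennreal_mult')
    qed
    also have "(\<integral>\<^sup>+y. ennreal (?k y w) \<partial>cube_measure) \<le> (\<integral>\<^sup>+y. ennreal (?k y w) \<partial>lborel)"
    proof -
      have [measurable]: "(\<lambda>y. ?k y w) \<in> borel_measurable borel" by (rule kmy)
      have "(\<integral>\<^sup>+y. ennreal (?k y w) \<partial>cube_measure) = (\<integral>\<^sup>+y. ennreal (?k y w) * indicator unit_cube y \<partial>lborel)"
        by (rule nn_integral_cube) measurable
      also have "\<dots> \<le> (\<integral>\<^sup>+y. ennreal (?k y w) \<partial>lborel)"
        by (rule nn_integral_mono) (simp add: indicator_def)
      finally show ?thesis .
    qed
    also have "\<dots> \<le> ennreal (2 ^ CARD('n))" by (rule nn_integral_kernel(2))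
    finally show "(\<integral>\<^sup>+y. ennreal ((g w)\<^sup>2 * ?k y w) \<partial>cube_measure) \<le> ennreal ((g w)\<^sup>2) * ennreal (2 ^ CARD('n))"
      by (simp add: mult_left_mono)
  qed
  also have "\<dots> = (\<integral>\<^sup>+w. ennreal ((g w)\<^sup>2) \<partial>lebesgue_cube) * ennreal (2 ^ CARD('n))"
    by (rule nn_integral_multc) measurable
  also have "(\<integral>\<^sup>+w. ennreal ((g w)\<^sup>2) \<partial>lebesgue_cube) = ennreal (\<integral>w. (g w)\<^sup>2 \<partial>lebesgue_cube)"
    by (rule nn_integral_eq_integral[OF L2_cube_integrable(1)[OF gL]]) simp
  also have "(\<integral>w. (g w)\<^sup>2 \<partial>lebesgue_cube) = (L2_norm_cube g)\<^sup>2"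
    by (simp add: L2_norm_cube_def Bochner_Integration.integral_nonneg)
  also have "ennreal ((L2_norm_cube g)\<^sup>2) * ennreal (2 ^ CARD('n)) = ennreal (2 ^ CARD('n) * (L2_norm_cube g)\<^sup>2)"
    by (subst ennreal_mult[symmetric]) (auto simp: mult.commute)
  finally show ?thesis by (subst (asm) ennreal_le_iff) auto
qed

lemma mollified_close:
  fixes f :: "real ^ 'n \<Rightarrow> real"
  assumes f: "continuous_on unit_cube f" and y: "y \<in> unit_cube"
    and close: "\<And>w. w \<in> unit_cube \<Longrightarrow> (\<And>i. \<bar>w $ i - y $ i\<bar> \<le> 2 * \<epsilon>) \<Longrightarrow> \<bar>f w - f y\<bar> \<le> e"
  shows "\<bar>mollified f (\<lambda>_. 0) y - f y\<bar> \<le> e"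
proof -
  let ?k = "kernel (\<lambda>_. 0) y"
  have ck: "continuous_on S ?k" for S by (rule continuous_kernel')
  have i: "integrable lebesgue_cube (\<lambda>w. f w * ?k w)" "integrable lebesgue_cube ?k"
    "integrable lebesgue_cube (\<lambda>w. (f w - f y) * ?k w)"
    unfolding unit_cube_def
    by (intro continuous_imp_integrable continuous_intros f[unfolded unit_cube_def] ck)+
  have "mollified f (\<lambda>_. 0) y - f y = (\<integral>w. f w * ?k w \<partial>lebesgue_cube) - f y * (\<integral>w. ?k w \<partial>lebesgue_cube)"
    by (simp add: mollified_eq_lebesgue[OF f] integral_kernel[OF y])
  also have "\<dots> = (\<integral>w. (f w - f y) * ?k w \<partial>lebesgue_cube)"
    using i by (simp add: left_diff_distrib)
  finally have "\<bar>mollified f (\<lambda>_. 0) y - f y\<bar> \<le> (\<integral>w. \<bar>(f w - f y) * ?k w\<bar> \<partial>lebesgue_cube)"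
    using integral_abs_bound[of lebesgue_cube "\<lambda>w. (f w - f y) * ?k w"] by simp
  also have "\<dots> \<le> (\<integral>w. e * ?k w \<partial>lebesgue_cube)"
  proof (rule Bochner_Integration.integral_mono)
    show "integrable lebesgue_cube (\<lambda>w. \<bar>(f w - f y) * ?k w\<bar>)" using i(3) by (rule integrable_abs)
    show "integrable lebesgue_cube (\<lambda>w. e * ?k w)" using i(2) by simp
    fix w :: "real ^ 'n" assume "w \<in> space lebesgue_cube"
    then have w: "w \<in> unit_cube" by simp
    show "\<bar>(f w - f y) * ?k w\<bar> \<le> e * ?k w"
    proof (cases "?k w = 0")
      case False
      have "\<bar>f w - f y\<bar> \<le> e" by (rule close[OF w kernel_support_bounds(3)[OF False y]])
      then show ?thesis using kernel_nonneg[of y w] by (simp add: abs_mult mult_right_mono)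
    qed simp
  qed
  also have "\<dots> = e" by (simp add: integral_kernel[OF y])
  finally show ?thesis .
qed

end

lemma mollify:
  fixes f :: "real ^ 'n \<Rightarrow> real"
  assumes \<psi>: "transform_fun \<psi>" and f: "f \<in> H_mix r" and e: "0 < e"
  shows "\<exists>F. jet F \<and> (\<forall>y\<in>unit_cube. \<bar>F (\<lambda>_. 0) y - f y\<bar> \<le> e) \<and>
    (\<Sum>\<beta> | \<forall>i. \<beta> i \<le> r. \<integral>x. (F \<beta> x)\<^sup>2 \<partial>cube_measure) \<le> 2 ^ CARD('n) * (mix_norm r f)\<^sup>2"
proof -
  have c: "continuous_on unit_cube f" using f by (simp add: H_mix_def)
  have "uniformly_continuous_on unit_cube f"
    by (rule compact_uniformly_continuous[OF c]) (simp add: unit_cube_def)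
  then obtain \<delta> where \<delta>: "0 < \<delta>" "\<And>w y. w \<in> unit_cube \<Longrightarrow> y \<in> unit_cube \<Longrightarrow> dist w y < \<delta> \<Longrightarrow> dist (f w) (f y) < e"
    using e unfolding uniformly_continuous_on_def by metis
  \<comment> \<open>Points of the kernel's support differ from y by at most 2 \<epsilon> in each of
    d coordinates, hence by at most \<delta> / 2 in distance.\<close>
  define \<epsilon> where "\<epsilon> = min (1 / 6) (\<delta> / (4 * CARD('n)))"
  have \<epsilon>: "0 < \<epsilon>" "\<epsilon> \<le> 1 / 6" using \<delta>(1) by (auto simp: \<epsilon>_def)
  let ?F = "mollified \<psi> \<epsilon> f"
  have "\<bar>?F (\<lambda>_. 0) y - f y\<bar> \<le> e" if y: "y \<in> unit_cube" for y
  proof (rule mollified_close[OF \<psi> \<epsilon> c y])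
    fix w assume w: "w \<in> unit_cube" "\<And>i. \<bar>w $ i - y $ i\<bar> \<le> 2 * \<epsilon>"
    have "dist w y \<le> (\<Sum>i\<in>UNIV. \<bar>(w - y) $ i\<bar>)" unfolding dist_norm by (rule norm_le_l1_cart)
    also have "\<dots> \<le> (\<Sum>i\<in>(UNIV :: 'n set). 2 * \<epsilon>)" using w(2) by (intro sum_mono) simp
    also have "\<dots> = CARD('n) * (2 * \<epsilon>)" by simp
    also have "\<dots> \<le> CARD('n) * (2 * (\<delta> / (4 * CARD('n))))" by (intro mult_left_mono) (auto simp: \<epsilon>_def)
    also have "\<dots> < \<delta>" using \<delta>(1) by simp
    finally show "\<bar>f w - f y\<bar> \<le> e" using \<delta>(2)[OF w(1) y] by (simp add: dist_real_def)
  qed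
  moreover have "(\<Sum>\<beta> | \<forall>i. \<beta> i \<le> r. \<integral>x. (?F \<beta> x)\<^sup>2 \<partial>cube_measure) \<le> 2 ^ CARD('n) * (mix_norm r f)\<^sup>2"
  proof -
    have "(\<Sum>\<beta> | \<forall>i. \<beta> i \<le> r. \<integral>x. (?F \<beta> x)\<^sup>2 \<partial>cube_measure)
        \<le> (\<Sum>\<beta> | \<forall>i. \<beta> i \<le> r. 2 ^ CARD('n) * (L2_norm_cube (weak_deriv \<beta> f))\<^sup>2)"
    proof (rule sum_mono)
      fix \<beta> :: "'n \<Rightarrow> nat" assume "\<beta> \<in> {\<beta>. \<forall>i. \<beta> i \<le> r}"
      then have "\<exists>g. has_weak_deriv f \<beta> g" using f by (simp add: H_mix_def)
      then have "has_weak_deriv f \<beta> (weak_deriv \<beta> f)" unfolding weak_deriv_def by (rule someI_ex)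
      then show "(\<integral>x. (?F \<beta> x)\<^sup>2 \<partial>cube_measure) \<le> 2 ^ CARD('n) * (L2_norm_cube (weak_deriv \<beta> f))\<^sup>2"
        by (rule integral_mollified_le[OF \<psi> \<epsilon> c])
    qed
    also have "\<dots> = 2 ^ CARD('n) * (mix_norm r f)\<^sup>2"
      by (simp add: mix_norm_def sum_nonneg sum_distrib_left)
    finally show ?thesis .
  qed
  ultimately show ?thesis using jet_mollified[OF \<psi> \<epsilon> c] by blast
qed

subsection \<open>The transformed rule\<close>

definition transplant :: "(real \<Rightarrow> real) \<Rightarrow> (real ^ 'n \<Rightarrow> real) \<Rightarrow> real ^ 'n \<Rightarrow> real" where
  "transplant \<psi> f x = f (Psi \<psi> x) * DPsi \<psi> x"

lemma Q_tilde_eq_periodization: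
  "Q_tilde \<psi> S v f = 1 / \<bar>det S\<bar> * periodization (transpose (matrix_inv S)) (transplant \<psi> f) v"
  by (simp add: Q_tilde_def periodization_def transplant_def)

lemma transplant_outside: "transform_fun \<psi> \<Longrightarrow> x \<notin> unit_cube \<Longrightarrow> transplant \<psi> f x = 0"
  by (simp add: transplant_def DPsi_outside)

lemma continuous_on_transplant:
  fixes f :: "real ^ 'n \<Rightarrow> real"
  assumes \<psi>: "transform_fun \<psi>" and f: "continuous_on unit_cube f"
  shows "continuous_on UNIV (transplant \<psi> f)"
proof -
  have P: "continuous_on UNIV (Psi \<psi> :: real ^ 'n \<Rightarrow> real ^ 'n)"
    unfolding Psi_def
    by (intro continuous_on_vec_lambda continuous_on_compose2[OF continuous_on_psi[OF \<psi>, of UNIV]] continuous_intros) auto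
  show ?thesis
    unfolding transplant_def
    by (intro continuous_on_mult continuous_on_compose2[OF f P] continuous_on_DPsi[OF \<psi>])
       (auto simp: Psi_unit_cube[OF \<psi>])
qed

lemma integral_close_lebesgue_cube:
  fixes f g :: "real ^ 'n \<Rightarrow> real"
  assumes "continuous_on unit_cube f" "continuous_on unit_cube g"
    and e: "\<And>y. y \<in> unit_cube \<Longrightarrow> \<bar>g y - f y\<bar> \<le> e"
  shows "\<bar>(\<integral>y. g y \<partial>lebesgue_cube) - (\<integral>y. f y \<partial>lebesgue_cube)\<bar> \<le> e"
proof -
  interpret finite_measure "lebesgue_cube :: (real ^ 'n) measure" by (rule finite_measure_lebesgue_cube)
  interpret C: prob_space "cube_measure :: (real ^ 'n) measure" by (rule prob_space_cube)
  have i: "integrable lebesgue_cube f" "integrable lebesgue_cube g"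
    using assms(1,2) unfolding unit_cube_def by (auto intro: continuous_imp_integrable)
  have "(\<integral>y. g y \<partial>lebesgue_cube) - (\<integral>y. f y \<partial>lebesgue_cube) = (\<integral>y. g y - f y \<partial>lebesgue_cube)"
    using i by simp
  then have "\<bar>(\<integral>y. g y \<partial>lebesgue_cube) - (\<integral>y. f y \<partial>lebesgue_cube)\<bar> \<le> (\<integral>y. \<bar>g y - f y\<bar> \<partial>lebesgue_cube)"
    using integral_abs_bound[of lebesgue_cube "\<lambda>y. g y - f y"] by simp
  also have "\<dots> \<le> integral\<^sup>L (lebesgue_cube :: (real ^ 'n) measure) (\<lambda>_. e)"
    by (rule Bochner_Integration.integral_mono) (use i e in auto)
  also have "\<dots> = e"
    using C.prob_space by (simp only: integral_lebesgue_cube continuous_on_const) simp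
  finally show ?thesis .
qed

text \<open>Convergence is required at every point and not almost everywhere, because the rule
  evaluates the integrand at its nodes. The bound E on the corner derivatives does not depend on k,
  so the error estimates pass to the limit.\<close>

definition approximates ::
  "(real \<Rightarrow> real) \<Rightarrow> nat \<Rightarrow> (real ^ 'n \<Rightarrow> real) \<Rightarrow> real \<Rightarrow> (nat \<Rightarrow> ('n \<Rightarrow> nat) \<Rightarrow> real ^ 'n \<Rightarrow> real) \<Rightarrow> bool" where
  "approximates \<psi> r f E G \<longleftrightarrow> (\<forall>k. supported_jet (G k)) \<and>
    (\<forall>k A. (\<integral>x. (G k (corner_index r A) x)\<^sup>2 \<partial>cube_measure) \<le> E) \<and>
    (\<forall>x. (\<lambda>k. G k (\<lambda>_. 0) x) \<longlonglongrightarrow> transplant \<psi> f x) \<and>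
    (\<lambda>k. \<integral>x. G k (\<lambda>_. 0) x \<partial>cube_measure) \<longlonglongrightarrow> I_cube f"

text \<open>Mollification of f comes before the change of variables. The transformed mollifications
  inherit uniform closeness on the cube as pointwise convergence, and the substitution formula keeps
  their integrals equal to those of the mollified functions.\<close>

lemma jet_approximation:
  assumes \<psi>: "transform_fun \<psi>"
  shows "\<exists>C\<ge>0. \<forall>f :: real ^ 'n \<Rightarrow> real. f \<in> H_mix r \<longrightarrow>
    (\<exists>G. approximates \<psi> r f (C * (mix_norm r f)\<^sup>2) G)"
proof -
  obtain C where C0: "0 \<le> C" and C: "\<forall>F :: ('n \<Rightarrow> nat) \<Rightarrow> real ^ 'n \<Rightarrow> real. jet F \<longrightarrow>
    (\<exists>G. jet G \<and> (\<forall>\<alpha> x. x \<notin> box 0 1 \<longrightarrow> G \<alpha> x = 0) \<and>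
      (\<forall>x. G (\<lambda>_. 0) x = F (\<lambda>_. 0) (Psi \<psi> x) * DPsi \<psi> x) \<and>
      (\<forall>\<alpha>. (\<forall>i. \<alpha> i \<le> r) \<longrightarrow> (\<integral>x. (G \<alpha> x)\<^sup>2 \<partial>cube_measure)
        \<le> C * (\<Sum>\<beta> | \<forall>i. \<beta> i \<le> r. \<integral>x. (F \<beta> x)\<^sup>2 \<partial>cube_measure)))"
    using transform_jet[OF \<psi>, where 'n = 'n, of r] by (elim exE conjE) (rule that)
  show ?thesis
  proof (intro exI[of _ "C * 2 ^ CARD('n)"] conjI allI impI)
    show "0 \<le> C * 2 ^ CARD('n)" using C0 by simp
    fix f :: "real ^ 'n \<Rightarrow> real" assume f: "f \<in> H_mix r"
    have cf: "continuous_on unit_cube f" using f by (simp add: H_mix_def)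
    let ?e = "\<lambda>k. 1 / real (Suc k)"
    have e0: "?e \<longlonglongrightarrow> 0" using LIMSEQ_inverse_real_of_nat by (simp add: inverse_eq_divide)
    have "\<forall>k. \<exists>F. jet F \<and> (\<forall>y\<in>unit_cube. \<bar>F (\<lambda>_. 0) y - f y\<bar> \<le> ?e k) \<and>
      (\<Sum>\<beta> | \<forall>i. \<beta> i \<le> r. \<integral>x. (F \<beta> x)\<^sup>2 \<partial>cube_measure) \<le> 2 ^ CARD('n) * (mix_norm r f)\<^sup>2"
      using mollify[OF \<psi> f] by simp
    from choice[OF this] obtain F where "\<forall>k. jet (F k) \<and> (\<forall>y\<in>unit_cube. \<bar>F k (\<lambda>_. 0) y - f y\<bar> \<le> ?e k) \<and>
      (\<Sum>\<beta> | \<forall>i. \<beta> i \<le> r. \<integral>x. (F k \<beta> x)\<^sup>2 \<partial>cube_measure) \<le> 2 ^ CARD('n) * (mix_norm r f)\<^sup>2" ..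
    then have F: "\<And>k. jet (F k)" "\<And>k y. y \<in> unit_cube \<Longrightarrow> \<bar>F k (\<lambda>_. 0) y - f y\<bar> \<le> ?e k"
      "\<And>k. (\<Sum>\<beta> | \<forall>i. \<beta> i \<le> r. \<integral>x. (F k \<beta> x)\<^sup>2 \<partial>cube_measure) \<le> 2 ^ CARD('n) * (mix_norm r f)\<^sup>2"
      by blast+
    define T where "T k G \<longleftrightarrow> jet G \<and> (\<forall>\<alpha> x. x \<notin> box 0 1 \<longrightarrow> G \<alpha> x = 0) \<and>
      (\<forall>x. G (\<lambda>_. 0) x = F k (\<lambda>_. 0) (Psi \<psi> x) * DPsi \<psi> x) \<and>
      (\<forall>\<alpha>. (\<forall>i. \<alpha> i \<le> r) \<longrightarrow> (\<integral>x. (G \<alpha> x)\<^sup>2 \<partial>cube_measure)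
        \<le> C * (\<Sum>\<beta> | \<forall>i. \<beta> i \<le> r. \<integral>x. (F k \<beta> x)\<^sup>2 \<partial>cube_measure))" for k G
    have "\<forall>k. \<exists>G. T k G" unfolding T_def using C F(1) by blast
    from choice[OF this] obtain G where "\<forall>k. T k (G k)" ..
    then have G: "T k (G k)" for k by blast
    have G0: "G k (\<lambda>_. 0) x = F k (\<lambda>_. 0) (Psi \<psi> x) * DPsi \<psi> x" for k x using G[of k] by (simp add: T_def)
    have cF: "continuous_on UNIV (F k (\<lambda>_. 0))" for k using F(1)[of k] by (simp add: jet_def)
    have lim: "(\<lambda>k. F k (\<lambda>_. 0) y) \<longlonglongrightarrow> f y" if y: "y \<in> unit_cube" for y
      by (rule LIM_zero_cancel, rule Lim_null_comparison[OF _ e0]) (use F(2)[OF y] in simp)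
    show "\<exists>G. approximates \<psi> r f (C * 2 ^ CARD('n) * (mix_norm r f)\<^sup>2) G"
      unfolding approximates_def
    proof (intro exI[of _ G] conjI allI)
      fix k A
      show "supported_jet (G k)" using G[of k] by (simp add: T_def supported_jet_def)
      have "(\<integral>x. (G k (corner_index r A) x)\<^sup>2 \<partial>cube_measure)
          \<le> C * (\<Sum>\<beta> | \<forall>i. \<beta> i \<le> r. \<integral>x. (F k \<beta> x)\<^sup>2 \<partial>cube_measure)"
        using G[of k] by (simp add: T_def corner_index_def)
      also have "\<dots> \<le> C * (2 ^ CARD('n) * (mix_norm r f)\<^sup>2)" by (rule mult_left_mono[OF F(3) C0])
      finally show "(\<integral>x. (G k (corner_index r A) x)\<^sup>2 \<partial>cube_measure) \<le> C * 2 ^ CARD('n) * (mix_norm r f)\<^sup>2"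
        by (simp only: mult.assoc)
    next
      fix x
      show "(\<lambda>k. G k (\<lambda>_. 0) x) \<longlonglongrightarrow> transplant \<psi> f x"
        unfolding G0 transplant_def by (intro tendsto_intros lim Psi_unit_cube[OF \<psi>])
    next
      have "(\<integral>x. G k (\<lambda>_. 0) x \<partial>cube_measure) = (\<integral>x. F k (\<lambda>_. 0) x \<partial>lebesgue_cube)" for k
        using integral_cube_psi_subst[OF \<psi> cF[of k]] integral_lebesgue_cube[OF cF[of k]] by (simp add: G0)
      moreover have "\<bar>(\<integral>x. F k (\<lambda>_. 0) x \<partial>lebesgue_cube) - I_cube f\<bar> \<le> ?e k" for k
        unfolding I_cube_def
        by (rule integral_close_lebesgue_cube[OF cf continuous_on_subset[OF cF] F(2)]) auto
      ultimately have close: "\<bar>(\<integral>x. G k (\<lambda>_. 0) x \<partial>cube_measure) - I_cube f\<bar> \<le> ?e k" for k by simp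
      show "(\<lambda>k. \<integral>x. G k (\<lambda>_. 0) x \<partial>cube_measure) \<longlonglongrightarrow> I_cube f"
        by (rule LIM_zero_cancel, rule Lim_null_comparison[OF _ e0]) (use close in simp)
    qed
  qed
qed

text \<open>For fixed u and v the supports lie in the cube, so all the periodizations are sums over
  one and the same finite box and pointwise convergence is enough.\<close>

lemma lattice_error_tendsto:
  fixes B :: "real ^ 'n ^ 'n" and f :: "real ^ 'n \<Rightarrow> real"
  assumes \<psi>: "transform_fun \<psi>" and B: "frolov_matrix B" and n: "2 \<le> n" and u: "u \<in> dilation_cube"
    and G: "\<And>k. supported_jet (G k)"
    and lim: "\<And>x. (\<lambda>k. G k (\<lambda>_. 0) x) \<longlonglongrightarrow> transplant \<psi> f x"
      "(\<lambda>k. \<integral>x. G k (\<lambda>_. 0) x \<partial>cube_measure) \<longlonglongrightarrow> I_cube f"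
  shows "(\<lambda>k. lattice_error (scaled_matrix n u B) (G k (\<lambda>_. 0)) v)
    \<longlonglongrightarrow> Q_tilde \<psi> (scaled_matrix n u B) v f - I_cube f"
proof -
  let ?A = "transpose (matrix_inv (scaled_matrix n u B))"
  let ?\<rho> = "real n powr (1 / CARD('n)) * 2 * matrix_sum B"
  obtain R where R: "?\<rho> + norm v \<le> real R" using real_arch_simple by blast
  have eq: "periodization ?A g v = (\<Sum>k\<in>int_box R. g (?A *v (k + v)))"
    if g: "\<And>x. x \<notin> unit_cube \<Longrightarrow> g x = 0" for g :: "real ^ 'n \<Rightarrow> real"
    by (rule periodization_eq_sum[OF g scaled_matrix_support[OF B n u] component_le_norm_cart R])
  have eqG: "periodization ?A (G k (\<lambda>_. 0)) v = (\<Sum>l\<in>int_box R. G k (\<lambda>_. 0) (?A *v (l + v)))" for k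
    by (rule eq) (rule supported_jetD(3)[OF G])
  have eqT: "periodization ?A (transplant \<psi> f) v = (\<Sum>l\<in>int_box R. transplant \<psi> f (?A *v (l + v)))"
    by (rule eq) (rule transplant_outside[OF \<psi>])
  have "(\<lambda>k. periodization ?A (G k (\<lambda>_. 0)) v) \<longlonglongrightarrow> periodization ?A (transplant \<psi> f) v"
    unfolding eqG eqT by (intro tendsto_sum lim(1))
  then show ?thesis
    unfolding lattice_error_def Q_tilde_eq_periodization by (intro tendsto_intros lim(2))
qed

lemma sup_error_le:
  assumes \<psi>: "transform_fun \<psi>" and B: "frolov_matrix (B :: real ^ 'n ^ 'n)" and r: "1 \<le> r"
  shows "\<exists>c\<ge>0. \<forall>n\<ge>2. \<forall>f\<in>H_mix r. \<forall>u\<in>dilation_cube. \<forall>v\<in>unit_cube.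
    \<bar>Q_tilde \<psi> (scaled_matrix n u B) v f - I_cube f\<bar>
      \<le> c * real n powr (- real r) * ln (real n) powr ((real CARD('n) - 1) / 2) * mix_norm r f"
proof -
  let ?d = "CARD('n)"
  obtain C where C0: "0 \<le> C" and C: "\<forall>f :: real ^ 'n \<Rightarrow> real. f \<in> H_mix r \<longrightarrow>
    (\<exists>G. approximates \<psi> r f (C * (mix_norm r f)\<^sup>2) G)"
    using jet_approximation[OF \<psi>, where 'n = 'n, of r] by (elim exE conjE) (rule that)
  obtain D where D0: "0 < D" and D: "\<forall>n\<ge>2. \<forall>F. finite F \<and> F \<subseteq> int_points - {0} \<longrightarrow>
    (\<Sum>m\<in>F. 1 / (\<Prod>j\<in>UNIV. max 1 (real n powr (1 / ?d) * \<bar>(B *v m) $ j\<bar>)) ^ (2 * r))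
      \<le> D * ln (real n) ^ (?d - 1) / real n ^ (2 * r)"
    using frolov_sum_le[OF B r] by (elim exE conjE) (rule that)
  let ?K = "(4 * matrix_sum B + 5) ^ ?d / \<bar>det B\<bar>"
  have K0: "0 \<le> ?K" using matrix_sum_nonneg[of B] by simp
  \<comment> \<open>The factors are the number of corner multi-indices, the constant of
    \<open>sum_fc_lattice_le\<close>, the cost of mollification and transformation, and the constant
    of the Frolov sum.\<close>
  define c where "c = sqrt (2 ^ ?d * ?K * C * D)"
  show ?thesis
  proof (intro exI[of _ c] conjI allI impI ballI)
    show "0 \<le> c" unfolding c_def
      by (intro real_sqrt_ge_zero mult_nonneg_nonneg K0 C0 less_imp_le[OF D0]) auto
    fix n :: nat and f :: "real ^ 'n \<Rightarrow> real" and u v :: "real ^ 'n"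
    assume n: "2 \<le> n" and f: "f \<in> H_mix r" and u: "u \<in> dilation_cube" and v: "v \<in> unit_cube"
    obtain G :: "nat \<Rightarrow> ('n \<Rightarrow> nat) \<Rightarrow> real ^ 'n \<Rightarrow> real" where G: "\<And>k. supported_jet (G k)"
      and E: "\<And>k A. (\<integral>x. (G k (corner_index r A) x)\<^sup>2 \<partial>cube_measure) \<le> C * (mix_norm r f)\<^sup>2"
      and lim: "\<And>x. (\<lambda>k. G k (\<lambda>_. 0) x) \<longlonglongrightarrow> transplant \<psi> f x"
        "(\<lambda>k. \<integral>x. G k (\<lambda>_. 0) x \<partial>cube_measure) \<longlonglongrightarrow> I_cube f"
      using C f unfolding approximates_def by blast
    let ?W = "D * ln (real n) ^ (?d - 1) / real n ^ (2 * r)"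
    let ?M = "mix_norm r f"
    have W: "(\<Sum>m\<in>F. 1 / (\<Prod>j\<in>UNIV. max 1 (real n powr (1 / ?d) * \<bar>(B *v m) $ j\<bar>)) ^ (2 * r)) \<le> ?W"
      if "finite F" "F \<subseteq> int_points - {0}" for F
      using D n that by blast
    have "\<bar>Q_tilde \<psi> (scaled_matrix n u B) v f - I_cube f\<bar> \<le> sqrt (2 ^ ?d * (?K * (C * ?M\<^sup>2)) * ?W)"
      by (rule LIMSEQ_le_const2[OF tendsto_rabs[OF lattice_error_tendsto[OF \<psi> B n u G lim]]])
         (use abs_lattice_error_le[OF B n u G E W v] in auto)
    also have "2 ^ ?d * (?K * (C * ?M\<^sup>2)) * ?W
        = (2 ^ ?d * ?K * C * D) * (ln (real n) ^ (?d - 1)) * (?M / real n ^ r)\<^sup>2"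
      by (simp add: power_divide power_mult mult_ac)
    also have "sqrt \<dots> = c * sqrt (ln (real n) ^ (?d - 1)) * (?M / real n ^ r)"
    proof -
      have "0 \<le> ?M / real n ^ r" by (simp add: mix_norm_def sum_nonneg)
      then show ?thesis by (simp only: real_sqrt_mult real_sqrt_abs c_def abs_of_nonneg)
    qed
    \<comment> \<open>Since n \<ge> 2, the logarithm is positive, and the natural power can be
      rewritten as \<open>powr\<close>.\<close>
    also have "sqrt (ln (real n) ^ (?d - 1)) = ln (real n) powr ((real ?d - 1) / 2)"
    proof -
      have "0 < ln (real n)" using n by simp
      then have "ln (real n) ^ (?d - 1) = ln (real n) powr (real ?d - 1)"
        by (simp add: powr_realpow[symmetric] of_nat_diff)
      then show ?thesis by (simp add: powr_half_sqrt[symmetric] powr_powr)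
    qed
    also have "?M / real n ^ r = real n powr (- real r) * ?M"
      using n by (simp add: powr_minus powr_realpow divide_inverse)
    finally show "\<bar>Q_tilde \<psi> (scaled_matrix n u B) v f - I_cube f\<bar>
        \<le> c * real n powr (- real r) * ln (real n) powr ((real ?d - 1) / 2) * ?M"
      by (simp only: mult_ac)
  qed
qed

text \<open>Makes the dependence on u explicit, as division of each coordinate by a multiple of
  \<open>u $ j\<close>. Measurability in u can then be read off without treating the matrix inverse
  as a function of its entries.\<close>

lemma transpose_inv_scaled_matrix:
  fixes B :: "real ^ 'n ^ 'n"
  assumes B: "invertible B" and n: "0 < n" and u: "\<And>j. u $ j \<noteq> 0"
  shows "transpose (matrix_inv (scaled_matrix n u B)) *v z
    = (\<chi> j. (transpose (matrix_inv B) *v z) $ j / (real n powr (1 / CARD('n)) * u $ j))"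
proof -
  let ?S = "scaled_matrix n u B"
  let ?N = "real n powr (1 / CARD('n))"
  let ?b = "transpose (matrix_inv B) *v z"
  let ?w = "\<chi> j. ?b $ j / (?N * u $ j)"
  have N: "?N \<noteq> 0" using n by simp
  have "det ?S \<noteq> 0" using n u B by (simp add: det_scaled_matrix invertible_det_nz)
  then have S: "invertible ?S" by (simp add: invertible_det_nz)
  have "transpose ?S *v ?w = transpose B *v ?b"
    using N u by (simp add: vec_eq_iff matrix_vector_mult_def transpose_def scaled_matrix_nth del: transpose_matrix_vector)
  also have "\<dots> = z" by (rule transpose_inv_mult(1)[OF B])
  finally have "transpose (matrix_inv ?S) *v (transpose ?S *v ?w) = transpose (matrix_inv ?S) *v z"
    by (simp only:)
  then show ?thesis by (simp only: transpose_inv_mult(2)[OF S])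
qed

text \<open>Joint measurability in u and v. The lattice sum is the limit of sums over growing boxes;
  for each u with nonzero coordinates these are eventually constant, although no box works for all
  u.\<close>

lemma measurable_lattice_error:
  fixes B :: "real ^ 'n ^ 'n"
  assumes B: "invertible B" and n: "0 < n" and c: "continuous_on UNIV g"
    and supp: "\<And>x. x \<notin> unit_cube \<Longrightarrow> g x = 0"
  shows "(\<lambda>p. lattice_error (scaled_matrix n (fst p) B) g (snd p)) \<in> borel_measurable (borel \<Otimes>\<^sub>M borel)"
proof -
  let ?N = "real n powr (1 / CARD('n))"
  let ?A = "\<lambda>u. transpose (matrix_inv (scaled_matrix n u B))"
  have [measurable]: "g \<in> borel_measurable borel" using c by (rule borel_measurable_continuous_onI)
  define q where "q R p = (if \<forall>j. fst p $ j \<noteq> 0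
    then 1 / \<bar>det (scaled_matrix n (fst p) B)\<bar> * (\<Sum>k\<in>int_box R. g (\<chi> j. (transpose (matrix_inv B) *v (k + snd p)) $ j / (?N * fst p $ j)))
    else 0)" for R and p :: "(real ^ 'n) \<times> (real ^ 'n)"
  have "(\<lambda>p. 1 / \<bar>det (scaled_matrix n (fst p) B)\<bar> * periodization (?A (fst p)) g (snd p))
    \<in> borel_measurable (borel \<Otimes>\<^sub>M borel)"
  proof (rule borel_measurable_LIMSEQ_real)
    show "q R \<in> borel_measurable (borel \<Otimes>\<^sub>M borel)" for R
    proof -
      have [measurable]: "(\<lambda>p :: (real ^ 'n) \<times> (real ^ 'n). (transpose (matrix_inv B) *v (k + snd p)) $ j) \<in> borel_measurable (borel \<Otimes>\<^sub>M borel)" for k j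
        by (intro measurable_vec_nth measurable_compose[OF _ measurable_matrix_vector]) measurable
      have [measurable]: "(\<lambda>p :: (real ^ 'n) \<times> (real ^ 'n). fst p $ j) \<in> borel_measurable (borel \<Otimes>\<^sub>M borel)" for j
        by (intro measurable_vec_nth) measurable
      have [measurable]: "(\<lambda>p :: (real ^ 'n) \<times> (real ^ 'n). \<chi> j. (transpose (matrix_inv B) *v (k + snd p)) $ j / (?N * fst p $ j)) \<in> borel_measurable (borel \<Otimes>\<^sub>M borel)" for k
        by (subst measurable_vec_iff, simp only: vec_lambda_beta, intro allI) measurable
      show ?thesis unfolding q_def det_scaled_matrix[OF n] by measurable
    qed
    fix p :: "(real ^ 'n) \<times> (real ^ 'n)"
    show "(\<lambda>R. q R p) \<longlonglongrightarrow> 1 / \<bar>det (scaled_matrix n (fst p) B)\<bar> * periodization (?A (fst p)) g (snd p)"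
    proof (cases "\<forall>j. fst p $ j \<noteq> 0")
      case True
      then have u: "fst p $ j \<noteq> 0" for j by blast
      have "det (scaled_matrix n (fst p) B) \<noteq> 0" using n u B by (simp add: det_scaled_matrix invertible_det_nz)
      then have S: "invertible (scaled_matrix n (fst p) B)" by (simp add: invertible_det_nz)
      let ?\<rho> = "?N * norm (fst p) * matrix_sum B"
      have "\<forall>\<^sub>F R in sequentially. ?\<rho> + norm (snd p) \<le> real R"
        using filterlim_real_sequentially unfolding filterlim_at_top by blast
      then have "\<forall>\<^sub>F R in sequentially. q R p = 1 / \<bar>det (scaled_matrix n (fst p) B)\<bar> * periodization (?A (fst p)) g (snd p)"
      proof eventually_elim
        case (elim R)
        have "periodization (?A (fst p)) g (snd p) = (\<Sum>k\<in>int_box R. g (?A (fst p) *v (k + snd p)))"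
          by (rule periodization_eq_sum[OF supp support_bound[OF S component_le_norm_cart] component_le_norm_cart elim])
        then show ?case using True by (simp only: q_def if_True simp_thms transpose_inv_scaled_matrix[OF B n u])
      qed
      then show ?thesis by (rule tendsto_eventually)
    next
      case False
      \<comment> \<open>Division by zero yields 0, so for a singular matrix the limit agrees with
        the value 0 chosen for q.\<close>
      then have "det (scaled_matrix n (fst p) B) = 0" using n by (auto simp: det_scaled_matrix)
      moreover have "q R p = 0" for R using False by (simp only: q_def if_False)
      ultimately show ?thesis by simp
    qed
  qed
  then show ?thesis unfolding lattice_error_def by measurable
qed

lemma Q_tilde_eq_lattice_error:
  "Q_tilde \<psi> S v f = lattice_error S (transplant \<psi> f) v + (\<integral>x. transplant \<psi> f x \<partial>cube_measure)"
  by (simp add: Q_tilde_eq_periodization lattice_error_def)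

lemma AE_dilation_cube: "AE u in uniform_measure lborel (dilation_cube :: (real ^ 'n) set). u \<in> dilation_cube"
  by (rule AE_uniform_measureI) auto

text \<open>The Frolov sum D is used for absolute summability only; the constant c is built from the
  density bound 4, the volume of the dilation cube and the approximation constant C.\<close>

lemma random_error_le:
  assumes \<psi>: "transform_fun \<psi>" and B: "frolov_matrix (B :: real ^ 'n ^ 'n)" and r: "1 \<le> r"
  shows "\<exists>c\<ge>0. \<forall>n\<ge>2. \<forall>f\<in>H_mix r.
    (\<integral>\<^sup>+u. (\<integral>\<^sup>+v. ennreal ((Q_tilde \<psi> (scaled_matrix n u B) v f - I_cube f)\<^sup>2) \<partial>cube_measure)
      \<partial>uniform_measure lborel dilation_cube)
    \<le> ennreal ((c * real n powr (- real r - 1 / 2) * mix_norm r f)\<^sup>2)"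
proof -
  let ?d = "CARD('n)"
  obtain C where C0: "0 \<le> C" and C: "\<forall>f :: real ^ 'n \<Rightarrow> real. f \<in> H_mix r \<longrightarrow>
    (\<exists>G. approximates \<psi> r f (C * (mix_norm r f)\<^sup>2) G)"
    using jet_approximation[OF \<psi>, where 'n = 'n, of r] by (elim exE conjE) (rule that)
  obtain D where D: "\<forall>n\<ge>2. \<forall>F. finite F \<and> F \<subseteq> int_points - {0} \<longrightarrow>
    (\<Sum>m\<in>F. 1 / (\<Prod>j\<in>UNIV. max 1 (real n powr (1 / ?d) * \<bar>(B *v m) $ j\<bar>)) ^ (2 * r))
      \<le> D * ln (real n) ^ (?d - 1) / real n ^ (2 * r)"
    using frolov_sum_le[OF B r] by (elim exE conjE) (rule that)
  let ?V = "dilation_volume TYPE('n)"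
  define c where "c = sqrt (4 / ?V * C)"
  have V: "0 < ?V" by (rule emeasure_dilation_cube(2))
  show ?thesis
  proof (intro exI[of _ c] conjI allI impI ballI)
    show "0 \<le> c" using C0 V by (simp add: c_def)
    fix n :: nat and f :: "real ^ 'n \<Rightarrow> real"
    assume n: "2 \<le> n" and f: "f \<in> H_mix r"
    obtain G :: "nat \<Rightarrow> ('n \<Rightarrow> nat) \<Rightarrow> real ^ 'n \<Rightarrow> real" where G: "\<And>k. supported_jet (G k)"
      and E: "\<And>k A. (\<integral>x. (G k (corner_index r A) x)\<^sup>2 \<partial>cube_measure) \<le> C * (mix_norm r f)\<^sup>2"
      and lim: "\<And>x. (\<lambda>k. G k (\<lambda>_. 0) x) \<longlonglongrightarrow> transplant \<psi> f x"
        "(\<lambda>k. \<integral>x. G k (\<lambda>_. 0) x \<partial>cube_measure) \<longlonglongrightarrow> I_cube f"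
      using C f unfolding approximates_def by blast
    let ?W = "D * ln (real n) ^ (?d - 1) / real n ^ (2 * r)"
    let ?M = "mix_norm r f"
    let ?U = "uniform_measure lborel dilation_cube :: (real ^ 'n) measure"
    let ?S = "\<lambda>u. scaled_matrix n u B"
    have W: "(\<Sum>m\<in>F. 1 / (\<Prod>j\<in>UNIV. max 1 (real n powr (1 / ?d) * \<bar>(B *v m) $ j\<bar>)) ^ (2 * r)) \<le> ?W"
      if "finite F" "F \<subseteq> int_points - {0}" for F
      using D n that by blast
    define err where "err k u v = lattice_error (?S u) (G k (\<lambda>_. 0)) v" for k u v
    define J where "J k u = (\<integral>\<^sup>+v. ennreal ((err k u v)\<^sup>2) \<partial>cube_measure)" for k u
    let ?K = "ennreal (4 / ?V * (C * ?M\<^sup>2) / real n ^ (2 * r + 1))"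
    interpret prob_space "cube_measure :: (real ^ 'n) measure" by (rule prob_space_cube)
    have invB: "invertible B" using B by (simp add: frolov_matrix_def)
    have n0: "0 < n" using n by simp
    have errm [measurable]: "(\<lambda>p. err k (fst p) (snd p)) \<in> borel_measurable (borel \<Otimes>\<^sub>M borel)" for k
      unfolding err_def by (rule measurable_lattice_error[OF invB n0 supported_jetD(1,3)[OF G]])
    have errv [measurable]: "err k u \<in> borel_measurable borel" for k u
    proof -
      have "(\<lambda>v. (u, v)) \<in> borel \<rightarrow>\<^sub>M borel \<Otimes>\<^sub>M borel" by measurable
      from measurable_compose[OF this errm[of k]] show ?thesis by simp
    qed
    have "J k \<in> borel_measurable borel" for k
    proof -
      have "(\<lambda>p. ennreal ((err k (fst p) (snd p))\<^sup>2)) \<in> borel_measurable (borel \<Otimes>\<^sub>M cube_measure)"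
        using errm[of k] by (subst measurable_cong_sets[OF sets_pair_measure_cong refl]) auto
      from borel_measurable_nn_integral_fst[OF this] show ?thesis by (simp add: J_def[abs_def])
    qed
    then have Jm: "J k \<in> borel_measurable ?U" for k by simp
    \<comment> \<open>Fatou's lemma in v for fixed u; it is applied a second time below, in
      u.\<close>
    have "(\<integral>\<^sup>+v. ennreal ((Q_tilde \<psi> (?S u) v f - I_cube f)\<^sup>2) \<partial>cube_measure) \<le> liminf (\<lambda>k. J k u)"
      if u: "u \<in> dilation_cube" for u
    proof -
      have "(\<lambda>k. ennreal ((err k u v)\<^sup>2)) \<longlonglongrightarrow> ennreal ((Q_tilde \<psi> (?S u) v f - I_cube f)\<^sup>2)" for v
        unfolding err_def by (intro tendsto_ennrealI tendsto_power lattice_error_tendsto[OF \<psi> B n u G lim])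
      then have "liminf (\<lambda>k. ennreal ((err k u v)\<^sup>2)) = ennreal ((Q_tilde \<psi> (?S u) v f - I_cube f)\<^sup>2)" for v
        by (intro lim_imp_Liminf) auto
      moreover have "(\<integral>\<^sup>+v. liminf (\<lambda>k. ennreal ((err k u v)\<^sup>2)) \<partial>cube_measure) \<le> liminf (\<lambda>k. J k u)"
        unfolding J_def by (rule nn_integral_liminf) measurable
      ultimately show ?thesis by simp
    qed
    then have "(\<integral>\<^sup>+u. (\<integral>\<^sup>+v. ennreal ((Q_tilde \<psi> (?S u) v f - I_cube f)\<^sup>2) \<partial>cube_measure) \<partial>?U)
        \<le> (\<integral>\<^sup>+u. liminf (\<lambda>k. J k u) \<partial>?U)"
      using AE_dilation_cube by (intro nn_integral_mono_AE) (auto elim!: eventually_mono)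
    also have "\<dots> \<le> liminf (\<lambda>k. \<integral>\<^sup>+u. J k u \<partial>?U)" by (rule nn_integral_liminf[OF Jm])
    also have "\<dots> \<le> liminf (\<lambda>k. ?K)"
    proof (intro Liminf_mono always_eventually allI)
      fix k
      have "(\<integral>\<^sup>+u. J k u \<partial>?U) \<le> (\<integral>\<^sup>+u. (\<integral>\<^sup>+m. ennreal ((norm (fc (\<lambda>x. of_real (G k (\<lambda>_. 0) x)) (?S u *v m)))\<^sup>2)
          \<partial>count_space (int_points - {0})) \<partial>?U)"
      proof (rule nn_integral_mono_AE)
        show "AE u in ?U. J k u \<le> (\<integral>\<^sup>+m. ennreal ((norm (fc (\<lambda>x. of_real (G k (\<lambda>_. 0) x)) (?S u *v m)))\<^sup>2)
          \<partial>count_space (int_points - {0}))"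
          using AE_dilation_cube
        proof eventually_elim
          case (elim u)
          show ?case unfolding J_def err_def by (rule nn_integral_lattice_error_le[OF B n elim G E W])
        qed
      qed
      also have "\<dots> \<le> ?K" by (rule nn_integral_random_dilation_le[OF B n G E])
      finally show "(\<integral>\<^sup>+u. J k u \<partial>?U) \<le> ?K" .
    qed
    also have "\<dots> = ?K" by (rule lim_imp_Liminf) auto
    also have "4 / ?V * (C * ?M\<^sup>2) / real n ^ (2 * r + 1) = (c * real n powr (- real r - 1 / 2) * ?M)\<^sup>2"
    proof -
      have "(real n powr (- real r - 1 / 2))\<^sup>2 = real n powr (- real (2 * r + 1))"
      proof -
        have "(- real r - 1 / 2) + (- real r - 1 / 2) = - real (2 * r + 1)" by simp
        then show ?thesis by (simp only: power2_eq_square powr_add[symmetric])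
      qed
      also have "\<dots> = 1 / real n ^ (2 * r + 1)"
        using n by (simp only: powr_minus powr_realpow of_nat_0_less_iff n0 inverse_eq_divide)
      finally have *: "(real n powr (- real r - 1 / 2))\<^sup>2 = 1 / real n ^ (2 * r + 1)" .
      have c2: "c\<^sup>2 = 4 / ?V * C" using C0 V by (simp add: c_def)
      show ?thesis unfolding power_mult_distrib * c2 by simp
    qed
    finally show "(\<integral>\<^sup>+u. (\<integral>\<^sup>+v. ennreal ((Q_tilde \<psi> (?S u) v f - I_cube f)\<^sup>2) \<partial>cube_measure) \<partial>?U)
        \<le> ennreal ((c * real n powr (- real r - 1 / 2) * ?M)\<^sup>2)" .
  qed
qed

text \<open>Independence makes the joint law of U and V the product of the two uniform measures, and
  Tonelli's theorem gives the iterated integral. Integrability is part of the conclusion because the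
  Bochner integral of a non-integrable function is 0 by convention.\<close>

lemma expectation_transfer:
  fixes h :: "real ^ 'n \<Rightarrow> real ^ 'n \<Rightarrow> real"
  assumes "prob_space M" and ind: "prob_space.indep_var M borel U borel V"
    and U: "uniformly_distributed_in M U dilation_cube" and V: "uniformly_distributed_in M V unit_cube"
    and h: "(\<lambda>p. h (fst p) (snd p)) \<in> borel_measurable (borel \<Otimes>\<^sub>M borel)"
    and b: "(\<integral>\<^sup>+u. (\<integral>\<^sup>+v. ennreal ((h u v)\<^sup>2) \<partial>cube_measure) \<partial>uniform_measure lborel dilation_cube) \<le> ennreal (b\<^sup>2)"
    and b0: "0 \<le> b"
  shows "integrable M (\<lambda>\<omega>. (h (U \<omega>) (V \<omega>))\<^sup>2)" "sqrt (\<integral>\<omega>. (h (U \<omega>) (V \<omega>))\<^sup>2 \<partial>M) \<le> b"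
proof -
  interpret prob_space M by fact
  interpret C: prob_space "cube_measure :: (real ^ 'n) measure" by (rule prob_space_cube)
  let ?D = "uniform_measure lborel dilation_cube :: (real ^ 'n) measure"
  have m [measurable]: "U \<in> borel_measurable M" "V \<in> borel_measurable M"
    and dU: "distr M borel U = ?D" and dV: "distr M borel V = cube_measure"
    using U V by (auto simp: uniformly_distributed_in_def)
  have d: "distr M (borel \<Otimes>\<^sub>M borel) (\<lambda>\<omega>. (U \<omega>, V \<omega>)) = ?D \<Otimes>\<^sub>M cube_measure"
    using ind unfolding indep_var_distribution_eq by (simp add: dU dV)
  note [measurable] = h
  have hm: "(\<lambda>p. ennreal ((h (fst p) (snd p))\<^sup>2)) \<in> borel_measurable (?D \<Otimes>\<^sub>M cube_measure)"
    using h by (subst measurable_cong_sets[OF sets_pair_measure_cong refl]) auto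
  have "(\<integral>\<^sup>+\<omega>. ennreal ((h (U \<omega>) (V \<omega>))\<^sup>2) \<partial>M)
      = (\<integral>\<^sup>+p. ennreal ((h (fst p) (snd p))\<^sup>2) \<partial>distr M (borel \<Otimes>\<^sub>M borel) (\<lambda>\<omega>. (U \<omega>, V \<omega>)))"
    by (subst nn_integral_distr) auto
  also have "\<dots> = (\<integral>\<^sup>+u. (\<integral>\<^sup>+v. ennreal ((h u v)\<^sup>2) \<partial>cube_measure) \<partial>?D)"
    unfolding d using C.nn_integral_fst[OF hm] by simp
  finally have le: "(\<integral>\<^sup>+\<omega>. ennreal ((h (U \<omega>) (V \<omega>))\<^sup>2) \<partial>M) \<le> ennreal (b\<^sup>2)" using b by simp
  have hUV: "(\<lambda>\<omega>. h (U \<omega>) (V \<omega>)) \<in> borel_measurable M"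
    using measurable_compose[OF measurable_Pair[OF m] h] by simp
  show i: "integrable M (\<lambda>\<omega>. (h (U \<omega>) (V \<omega>))\<^sup>2)"
    by (rule integrableI_nonneg) (use hUV le in \<open>auto intro: le_less_trans\<close>)
  have "ennreal (\<integral>\<omega>. (h (U \<omega>) (V \<omega>))\<^sup>2 \<partial>M) \<le> ennreal (b\<^sup>2)"
    using le by (simp add: nn_integral_eq_integral[OF i])
  then have "(\<integral>\<omega>. (h (U \<omega>) (V \<omega>))\<^sup>2 \<partial>M) \<le> b\<^sup>2" by (simp add: ennreal_le_iff)
  then show "sqrt (\<integral>\<omega>. (h (U \<omega>) (V \<omega>))\<^sup>2 \<partial>M) \<le> b" using b0 by (rule real_le_lsqrt[rotated])
qed

theorem theorem11:
  fixes r :: nat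
    and B :: "real ^ 'n ^ 'n"
    and \<psi> :: "real \<Rightarrow> real"
  assumes "r \<ge> 1"
    and "frolov_matrix B"
    and "transform_fun \<psi>"
  shows "\<exists>c>0. \<forall>n\<ge>2. \<forall>f \<in> H_mix r.
    (\<forall>(M :: 'a measure) (U :: 'a \<Rightarrow> real ^ 'n) (V :: 'a \<Rightarrow> real ^ 'n).
       prob_space M \<and>
       prob_space.indep_var M borel U borel V \<and>
       uniformly_distributed_in M U dilation_cube \<and>
       uniformly_distributed_in M V unit_cube \<longrightarrow>
         integrable M (\<lambda>\<omega>. \<bar>Q_tilde \<psi> (scaled_matrix n (U \<omega>) B) (V \<omega>) f - I_cube f\<bar>\<^sup>2) \<and>
         sqrt (prob_space.expectation M
             (\<lambda>\<omega>. \<bar>Q_tilde \<psi> (scaled_matrix n (U \<omega>) B) (V \<omega>) f - I_cube f\<bar>\<^sup>2))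
           \<le> c * real n powr (- real r - 1 / 2) * mix_norm r f) \<and>
    (SUP (u, v) \<in> dilation_cube \<times> unit_cube.
        ereal \<bar>Q_tilde \<psi> (scaled_matrix n u B) v f - I_cube f\<bar>)
      \<le> ereal (c * real n powr (- real r)
                 * ln (real n) powr ((real CARD('n) - 1) / 2) * mix_norm r f)"
proof -
  note \<psi> = assms(3) and B = assms(2) and r = assms(1)
  obtain a where a0: "0 \<le> a" and a: "\<And>n f u v. 2 \<le> n \<Longrightarrow> f \<in> H_mix r \<Longrightarrow> u \<in> dilation_cube \<Longrightarrow> v \<in> unit_cube \<Longrightarrow>
    \<bar>Q_tilde \<psi> (scaled_matrix n u B) v f - I_cube f\<bar>
      \<le> a * real n powr (- real r) * ln (real n) powr ((real CARD('n) - 1) / 2) * mix_norm r f"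
    using sup_error_le[OF \<psi> B r] by blast
  obtain b where b0: "0 \<le> b" and b: "\<And>n f. 2 \<le> n \<Longrightarrow> f \<in> H_mix r \<Longrightarrow>
    (\<integral>\<^sup>+u. (\<integral>\<^sup>+v. ennreal ((Q_tilde \<psi> (scaled_matrix n u B) v f - I_cube f)\<^sup>2) \<partial>cube_measure)
      \<partial>uniform_measure lborel dilation_cube)
    \<le> ennreal ((b * real n powr (- real r - 1 / 2) * mix_norm r f)\<^sup>2)"
    using random_error_le[OF \<psi> B r] by blast
  \<comment> \<open>A single constant has to serve both estimates and be positive, while a and b are
    only known to be nonnegative.\<close>
  have c: "0 < a + b + 1" "a \<le> a + b + 1" "b \<le> a + b + 1" using a0 b0 by auto
  show ?thesis
  proof (intro exI[of _ "a + b + 1"] conjI allI ballI impI)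
    show "0 < a + b + 1" by fact
  next
    fix n :: nat and f :: "real ^ 'n \<Rightarrow> real" and M :: "'a measure" and U V :: "'a \<Rightarrow> real ^ 'n"
    assume n: "2 \<le> n" and f: "f \<in> H_mix r" and UV: "prob_space M \<and> prob_space.indep_var M borel U borel V \<and>
       uniformly_distributed_in M U dilation_cube \<and> uniformly_distributed_in M V unit_cube"
    have M0: "0 \<le> mix_norm r f" by (simp add: mix_norm_def sum_nonneg)
    have invB: "invertible B" using B by (simp add: frolov_matrix_def)
    have cf: "continuous_on unit_cube f" using f by (simp add: H_mix_def)
    have n0: "0 < n" using n by simp
    have m: "(\<lambda>p. Q_tilde \<psi> (scaled_matrix n (fst p) B) (snd p) f - I_cube f) \<in> borel_measurable (borel \<Otimes>\<^sub>M borel)"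
      unfolding Q_tilde_eq_lattice_error
      by (intro borel_measurable_diff borel_measurable_add borel_measurable_const
          measurable_lattice_error[OF invB n0 continuous_on_transplant[OF \<psi> cf] transplant_outside[OF \<psi>]])
    have p: "prob_space M" "prob_space.indep_var M borel U borel V"
      "uniformly_distributed_in M U dilation_cube" "uniformly_distributed_in M V unit_cube"
      using UV by auto
    note T = expectation_transfer[OF p m b[OF n f] mult_nonneg_nonneg[OF mult_nonneg_nonneg[OF b0 powr_ge_zero] M0]]
    show "integrable M (\<lambda>\<omega>. \<bar>Q_tilde \<psi> (scaled_matrix n (U \<omega>) B) (V \<omega>) f - I_cube f\<bar>\<^sup>2)"
      using T(1) by simp
    have "b * real n powr (- real r - 1 / 2) * mix_norm r f \<le> (a + b + 1) * real n powr (- real r - 1 / 2) * mix_norm r f"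
      by (intro mult_right_mono c M0) auto
    then show "sqrt (prob_space.expectation M (\<lambda>\<omega>. \<bar>Q_tilde \<psi> (scaled_matrix n (U \<omega>) B) (V \<omega>) f - I_cube f\<bar>\<^sup>2))
        \<le> (a + b + 1) * real n powr (- real r - 1 / 2) * mix_norm r f"
      using T(2) by simp
  next
    fix n :: nat and f :: "real ^ 'n \<Rightarrow> real"
    assume n: "2 \<le> n" and f: "f \<in> H_mix r"
    have M0: "0 \<le> mix_norm r f" by (simp add: mix_norm_def sum_nonneg)
    have "a * real n powr (- real r) * ln (real n) powr ((real CARD('n) - 1) / 2) * mix_norm r f
        \<le> (a + b + 1) * real n powr (- real r) * ln (real n) powr ((real CARD('n) - 1) / 2) * mix_norm r f"
      by (intro mult_right_mono c M0) auto
    then show "(SUP (u, v) \<in> dilation_cube \<times> unit_cube. ereal \<bar>Q_tilde \<psi> (scaled_matrix n u B) v f - I_cube f\<bar>)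
        \<le> ereal ((a + b + 1) * real n powr (- real r) * ln (real n) powr ((real CARD('n) - 1) / 2) * mix_norm r f)"
      by (intro SUP_least) (auto intro: order_trans[OF a[OF n f]])
  qed
qed

end
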